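(* Let $\sigma(\xi)=\xi^2\,\tau(\xi)$ satisfy the standing assumptions in the context, and let $$B=B(\alpha)=\alpha+i\left(\frac{\sigma_+}{\sigma_-}\right)'(0),$$ where the factors are chosen so that $\tau_-(0)=\tau_+(0)$. Then the operator $W_\alpha(\sigma)$ is invertible for sufficiently large $\alpha$ and $$W_\alpha(\sigma)^{-1}\equiv P_\alpha W(1/\sigma_+)W(1/\sigma_-)P_\alpha-Q_\alpha H(\widetilde{u_-})H(u_+)Q_\alpha$$ $$-B^{-1}\,\big[Q_\alpha H(\widetilde{u_-})1+P_\alpha W(1/\sigma_+)1\big]\otimes\big[Q_\alpha H(u_+)1+P_\alpha W(1/\widetilde{\sigma_-})1\big],$$ where $u_\pm$ are the regular parts of $\tau_\pm(0)/\sigma_\pm$ as defined in the context, and $\equiv$ means that the difference of the two sides is an integral operator on $L^2(0,\alpha)$ whose kernel is uniformly $O(e^{-\delta\alpha})$ as $\alpha\to\infty$ for some $\delta>0$.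
   Context: Conventions. The Fourier transform is $\hat k(\xi)=\int_{-\infty}^\infty e^{ix\xi}k(x)\,dx$. For a function $v$, $\tilde v(\xi)=v(-\xi)$. $\chi^\pm$ are the indicator functions of $\mathbb{R}^\pm$; $1$ denotes the constant function $1$ on $\mathbb{R}^+$. Standing assumptions. $\sigma=a+\hat k$ with $a$ constant and $e^{\delta|x|}k(x)\in L^1(\mathbb{R})$ for some $\delta>0$. $\sigma(\xi)=\xi^2\tau(\xi)$, where $\tau$ is nonzero on $\mathbb{R}$, has index zero (the total change of $\arg\tau$ over $\mathbb{R}$ is $0$), and its Wiener–Hopf factors $\tau_\pm$ are of the order $\xi^{-1}$ as $\xi\to\infty$. Here $\tau=\tau_-\tau_+$, where $\tau_+^{\pm1}$ (resp. $\tau_-^{\pm1}$) extend analytically to the upper (resp. lower) half-plane. The factors of $\sigma$ are $\sigma_-(\xi)=i\xi\,\tau_-(\xi)$ and $\sigma_+(\xi)=-i\xi\,\tau_+(\xi)$, so $\sigma=\sigma_-\sigma_+$. The quotient $\sigma_+/\sigma_-=-\tau_+/\tau_-$ is smooth near $0$. Distributional meaning of $1/\sigma_\pm$. Define $1/\sigma_\pm$ as distributions, and the functions $u_\pm$, by $$\frac{\tau_-(0)}{\sigma_-(\xi)}=\frac{1}{0+i\xi}+u_-(\xi),\qquad \frac{\tau_+(0)}{\sigma_+(\xi)}=\frac{1}{0-i\xi}+u_+(\xi),$$ where $u_\pm$ are bounded smooth functions; $u_+$ (resp. $u_-$) is a constant plus the Fourier transform of an exponentially decaying function supported on $\mathbb{R}^+$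 (resp. $\mathbb{R}^-$). The distribution $(0\mp i\xi)^{-1}$ is the Fourier transform of $\chi^\pm$. Operators. If $v=\hat V$, then $W(v)$ and $H(v)$ are the operators on functions on $(0,\infty)$ with kernels $V(x-y)$ and $V(x+y)$ respectively; an additive constant $c$ in $v$ contributes $cI$ to $W(v)$ and $0$ to $H(v)$. $W((0-i\xi)^{-1})f(x)=\int_0^x f(y)\,dy$, and $W((0+i\xi)^{-1})f(x)=\int_x^\infty f(y)\,dy$ for $f\in L^1(\mathbb{R}^+)$; this defines $W(1/\sigma_+)$ and $W(1/\widetilde{\sigma_-})$ on functions of at most polynomial growth and $W(1/\sigma_-)$ on $L^1(\mathbb{R}^+)$. $P_\alpha$ is multiplication by $\chi_{(0,\alpha)}$ or extension by zero from $(0,\alpha)$ to $(0,\infty)$, or restriction to $(0,\alpha)$, depending on context; $(Q_\alpha f)(x)=f(\alpha-x)$ for $0<x<\alpha$. $W_\alpha(v)=P_\alpha W(v)P_\alpha$ acting on $L^2(0,\alpha)$. Tensor products. $v\otimes w$ is the operator $f\mapsto v\,(w,f)$, with the bilinear pairing $(w,f)=\int wf$ (no complex conjugation).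
   Formalization: The printed formula fails under scaling of σ unless τ_±(0)=1 or the Hankel terms vanish; the formal version multiplies H(ũ_-)H(u_+) by 1/(τ_-(0)τ_+(0)), H(ũ_-)1 by 1/τ_-(0) and H(u_+)1 by 1/τ_+(0). It agrees with the printed one when τ_±(0)=1. *)

theory Defs
  imports "HOL-Complex_Analysis.Complex_Analysis" "HOL-Library.Landau_Symbols"
begin

text \<open>
  Functions on \<open>(0,\<infinity>)\<close> or \<open>(0,\<alpha>)\<close> are represented by total functions \<open>real \<Rightarrow> complex\<close> whose
  values outside the interval are ignored; elements of \<open>L\<^sup>2(0,\<alpha>)\<close> are Borel measurable
  representatives, compared almost everywhere.
\<close>

section \<open>Symbols\<close>

definition fourier :: "(real \<Rightarrow> complex) \<Rightarrow> real \<Rightarrow> complex" where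
  "fourier k \<xi> = (LBINT x. exp (\<i> * of_real (x * \<xi>)) * k x)"

definition has_total_arg_change :: "(real \<Rightarrow> complex) \<Rightarrow> real \<Rightarrow> bool" where
  "has_total_arg_change f d \<longleftrightarrow>
     (\<exists>\<theta> l r. continuous_on UNIV \<theta> \<and> (\<forall>\<xi>. f \<xi> = of_real (cmod (f \<xi>)) * cis (\<theta> \<xi>)) \<and>
        (\<theta> \<longlongrightarrow> l) at_bot \<and> (\<theta> \<longlongrightarrow> r) at_top \<and> d = r - l)"

text \<open>
  \<open>f\<close> and \<open>1/f\<close> extend analytically from the real line to the open half-plane \<open>H\<close>
  (continuously up to the real line), and \<open>f\<close> has exact order \<open>1/\<xi>\<close> as \<open>\<xi> \<rightarrow> \<plusminus>\<infinity>\<close>.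
\<close>

definition wh_factor :: "complex set \<Rightarrow> (complex \<Rightarrow> complex) \<Rightarrow> bool" where
  "wh_factor H f \<longleftrightarrow>
     f holomorphic_on H \<and> continuous_on (closure H) f \<and> (\<forall>z\<in>closure H. f z \<noteq> 0) \<and>
     (\<lambda>\<xi>::real. f (of_real \<xi>)) \<in> \<Theta>[at_infinity](\<lambda>\<xi>. 1 / of_real \<xi>)"

definition sigma_plus :: "(complex \<Rightarrow> complex) \<Rightarrow> real \<Rightarrow> complex" where
  "sigma_plus \<tau>p \<xi> = - \<i> * of_real \<xi> * \<tau>p (of_real \<xi>)"

definition sigma_minus :: "(complex \<Rightarrow> complex) \<Rightarrow> real \<Rightarrow> complex" where
  "sigma_minus \<tau>m \<xi> = \<i> * of_real \<xi> * \<tau>m (of_real \<xi>)"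

text \<open>
  The smooth quotient of \<open>sigma_plus\<close> by \<open>sigma_minus\<close>. The pointwise quotient of the two
  functions would be \<open>0 / 0 = 0\<close> at the origin, hence discontinuous there.
\<close>

definition sigma_quotient :: "(complex \<Rightarrow> complex) \<Rightarrow> (complex \<Rightarrow> complex) \<Rightarrow> real \<Rightarrow> complex" where
  "sigma_quotient \<tau>p \<tau>m \<xi> = - \<tau>p (of_real \<xi>) / \<tau>m (of_real \<xi>)"

definition exp_decaying :: "(real \<Rightarrow> complex) \<Rightarrow> bool" where
  "exp_decaying U \<longleftrightarrow>
     U \<in> borel_measurable borel \<and> (\<exists>C \<eta>. \<eta> > 0 \<and> (\<forall>x. cmod (U x) \<le> C * exp (- \<eta> * \<bar>x\<bar>)))"

definition const_plus_exp_decaying_on :: "real set \<Rightarrow> (real \<Rightarrow> complex) \<Rightarrow> bool" where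
  "const_plus_exp_decaying_on S u \<longleftrightarrow>
     (\<exists>c U. exp_decaying U \<and> (\<forall>x. x \<notin> S \<longrightarrow> U x = 0) \<and> (\<forall>\<xi>. u \<xi> = c + fourier U \<xi>))"


section \<open>Wiener-Hopf and Hankel operators\<close>

text \<open>
  A pair \<open>(c, V)\<close> with \<open>V\<close> in \<open>L\<^sup>1\<close> and \<open>v\<close> equal to \<open>c\<close> plus the Fourier transform of \<open>V\<close>.
  The constant is determined by \<open>v\<close>, and so is \<open>V\<close> up to a null set, which does not affect
  any of the integrals below.
\<close>

definition symbol_repr :: "(real \<Rightarrow> complex) \<Rightarrow> complex \<times> (real \<Rightarrow> complex)" where
  "symbol_repr v =
     (SOME (c, V). integrable lborel V \<and> (\<forall>\<xi>. v \<xi> = c + fourier V \<xi>))"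

definition wiener_hopf :: "(real \<Rightarrow> complex) \<Rightarrow> (real \<Rightarrow> complex) \<Rightarrow> real \<Rightarrow> complex" where
  "wiener_hopf v f x =
     (case symbol_repr v of (c, V) \<Rightarrow> c * f x + (LBINT y:{0<..}. V (x - y) * f y))"

definition hankel :: "(real \<Rightarrow> complex) \<Rightarrow> (real \<Rightarrow> complex) \<Rightarrow> real \<Rightarrow> complex" where
  "hankel v f x = (case symbol_repr v of (c, V) \<Rightarrow> (LBINT y:{0<..}. V (x + y) * f y))"

text \<open>The Wiener-Hopf operators with the distributional symbols \<open>1/(0 - i\<xi>)\<close> and \<open>1/(0 + i\<xi>)\<close>.\<close>

definition wh_sing_plus :: "(real \<Rightarrow> complex) \<Rightarrow> real \<Rightarrow> complex" where
  "wh_sing_plus f x = (LBINT y:{0<..<x}. f y)"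

definition wh_sing_minus :: "(real \<Rightarrow> complex) \<Rightarrow> real \<Rightarrow> complex" where
  "wh_sing_minus f x = (LBINT y:{x<..}. f y)"

text \<open>
  The operators with symbols \<open>t\<^sup>-\<^sup>1 (1/(0 - i\<xi>) + u(\<xi>))\<close> and \<open>t\<^sup>-\<^sup>1 (1/(0 + i\<xi>) + u(\<xi>))\<close>. Thus
  \<open>1/\<sigma>\<^sub>+\<close> is \<open>wh_plus (\<tau>\<^sub>+(0)) u\<^sub>+\<close>, and \<open>1/\<sigma>\<^sub>-\<close> is \<open>wh_minus (\<tau>\<^sub>-(0)) u\<^sub>-\<close>. The substitution of \<open>-\<xi>\<close> for
  \<open>\<xi>\<close> exchanges the two singular parts, so \<open>1/\<sigma>\<^sub>-(-\<xi>)\<close> gives \<open>wh_plus (\<tau>\<^sub>-(0)) (\<lambda>\<xi>. u\<^sub>-(-\<xi>))\<close>.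
\<close>

definition wh_plus :: "complex \<Rightarrow> (real \<Rightarrow> complex) \<Rightarrow> (real \<Rightarrow> complex) \<Rightarrow> real \<Rightarrow> complex" where
  "wh_plus t u f x = (wh_sing_plus f x + wiener_hopf u f x) / t"

definition wh_minus :: "complex \<Rightarrow> (real \<Rightarrow> complex) \<Rightarrow> (real \<Rightarrow> complex) \<Rightarrow> real \<Rightarrow> complex" where
  "wh_minus t u f x = (wh_sing_minus f x + wiener_hopf u f x) / t"

definition flip_arg :: "(real \<Rightarrow> complex) \<Rightarrow> real \<Rightarrow> complex" where
  "flip_arg v \<xi> = v (- \<xi>)"

definition P_cut :: "real \<Rightarrow> (real \<Rightarrow> complex) \<Rightarrow> real \<Rightarrow> complex" where
  "P_cut \<alpha> f x = (if 0 < x \<and> x < \<alpha> then f x else 0)"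

definition Q_rev :: "real \<Rightarrow> (real \<Rightarrow> complex) \<Rightarrow> real \<Rightarrow> complex" where
  "Q_rev \<alpha> f x = (if 0 < x \<and> x < \<alpha> then f (\<alpha> - x) else 0)"

definition wh_trunc :: "real \<Rightarrow> (real \<Rightarrow> complex) \<Rightarrow> (real \<Rightarrow> complex) \<Rightarrow> real \<Rightarrow> complex" where
  "wh_trunc \<alpha> v f = P_cut \<alpha> (wiener_hopf v (P_cut \<alpha> f))"

definition tensor :: "real \<Rightarrow> (real \<Rightarrow> complex) \<Rightarrow> (real \<Rightarrow> complex) \<Rightarrow> (real \<Rightarrow> complex) \<Rightarrow> real \<Rightarrow> complex"
  where "tensor \<alpha> v w f x = v x * (LBINT y:{0<..<\<alpha>}. w y * f y)"


section \<open>Operators on \<open>L\<^sup>2(0,\<alpha>)\<close>\<close>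

definition L2 :: "real \<Rightarrow> (real \<Rightarrow> complex) set" where
  "L2 \<alpha> = {f. set_borel_measurable lborel {0<..<\<alpha>} f \<and>
              set_integrable lborel {0<..<\<alpha>} (\<lambda>x. (cmod (f x))\<^sup>2)}"

definition L2_eq :: "real \<Rightarrow> (real \<Rightarrow> complex) \<Rightarrow> (real \<Rightarrow> complex) \<Rightarrow> bool" where
  "L2_eq \<alpha> f g \<longleftrightarrow> (AE x in lborel. x \<in> {0<..<\<alpha>} \<longrightarrow> f x = g x)"

definition L2_bounded_linear :: "real \<Rightarrow> ((real \<Rightarrow> complex) \<Rightarrow> real \<Rightarrow> complex) \<Rightarrow> bool" where
  "L2_bounded_linear \<alpha> T \<longleftrightarrow>
     (\<forall>f\<in>L2 \<alpha>. T f \<in> L2 \<alpha>) \<and>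
     (\<forall>f\<in>L2 \<alpha>. \<forall>g\<in>L2 \<alpha>. \<forall>c d.
        L2_eq \<alpha> (T (\<lambda>x. c * f x + d * g x)) (\<lambda>x. c * T f x + d * T g x)) \<and>
     (\<exists>M. \<forall>f\<in>L2 \<alpha>.
        (LBINT x:{0<..<\<alpha>}. (cmod (T f x))\<^sup>2) \<le> M * (LBINT x:{0<..<\<alpha>}. (cmod (f x))\<^sup>2))"

definition L2_inverse ::
  "real \<Rightarrow> ((real \<Rightarrow> complex) \<Rightarrow> real \<Rightarrow> complex) \<Rightarrow> ((real \<Rightarrow> complex) \<Rightarrow> real \<Rightarrow> complex) \<Rightarrow> bool"
  where
  "L2_inverse \<alpha> T R \<longleftrightarrow>
     L2_bounded_linear \<alpha> T \<and> L2_bounded_linear \<alpha> R \<and>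
     (\<forall>f\<in>L2 \<alpha>. L2_eq \<alpha> (T (R f)) f \<and> L2_eq \<alpha> (R (T f)) f)"

text \<open>
  Two families of operators on \<open>L\<^sup>2(0,\<alpha>)\<close> that differ by integral operators whose kernels are
  \<open>O(e\<^sup>-\<^sup>\<delta>\<^sup>\<alpha>)\<close>, uniformly on \<open>(0,\<alpha>) \<times> (0,\<alpha>)\<close>, for some \<open>\<delta> > 0\<close>.
\<close>

definition exp_equiv ::
  "(real \<Rightarrow> (real \<Rightarrow> complex) \<Rightarrow> real \<Rightarrow> complex) \<Rightarrow>
   (real \<Rightarrow> (real \<Rightarrow> complex) \<Rightarrow> real \<Rightarrow> complex) \<Rightarrow> bool" where
  "exp_equiv S T \<longleftrightarrow>
     (\<exists>\<delta>>0. \<exists>C. \<forall>\<^sub>F \<alpha> in at_top. \<exists>K.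
        case_prod K \<in> borel_measurable (lborel \<Otimes>\<^sub>M lborel) \<and>
        (\<forall>x\<in>{0<..<\<alpha>}. \<forall>y\<in>{0<..<\<alpha>}. cmod (K x y) \<le> C * exp (- \<delta> * \<alpha>)) \<and>
        (\<forall>f\<in>L2 \<alpha>. L2_eq \<alpha> (\<lambda>x. S \<alpha> f x - T \<alpha> f x)
                           (\<lambda>x. LBINT y:{0<..<\<alpha>}. K x y * f y)))"

end

theory Submission
  imports Defs "HOL-Probability.Probability" "HOL-Real_Asymp.Real_Asymp"
begin

text \<open>
  Normalise \<open>t = \<tau>\<^sub>+(0) = \<tau>\<^sub>-(0)\<close>. In the time domain \<open>t/\<sigma>\<^sub>+\<close> is a point mass plus \<open>p\<close>, the unit step on
  \<open>\<real>\<^sup>+\<close> plus an exponentially decaying function, and \<open>t/\<sigma>\<^sub>-\<close> is a point mass plus the mirror image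
  \<open>m\<close>. The products \<open>t \<sigma>/\<sigma>\<mp>\<close> are one-sided: this follows from Liouville's theorem once the factors
  are known to be bounded in their half-planes, which is a consequence of the Riemann-Lebesgue lemma
  applied to \<open>u\<plusminus>\<close> in the closed half-plane.

  For fixed \<open>y\<close>, a column of the claimed inverse is the restriction to \<open>(0,\<alpha>)\<close> of a function on the
  whole line which is annihilated by \<open>\<sigma>\<close> on \<open>(0,\<alpha>)\<close>, apart from the point mass at \<open>y\<close>. It consists of
  the half-line solution \<open>W(1/\<sigma>\<^sub>+) W(1/\<sigma>\<^sub>-)\<close>, the correction \<open>H H\<close> at the right end, and a multiple of
  the solution \<open>\<phi>\<close> of the homogeneous equation that vanishes, up to exponentially small terms, on the
  negative axis and equals \<open>B\<close> beyond \<open>\<alpha>\<close>. The first two parts differ beyond \<open>\<alpha>\<close> from a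
  constant \<open>\<psi>(y)\<close> only by an exponentially small term, so subtracting \<open>(\<psi>(y)/B) \<phi>\<close> makes the column
  exponentially small outside \<open>(0,\<alpha>)\<close>. Hence the truncated operator times the claimed inverse is the
  identity plus a small kernel, which a Neumann series removes. The reflection \<open>x \<mapsto> -x\<close> exchanges the
  two factors and gives the same for the transposed operator, so the right inverse is two-sided.
\<close>

section \<open>Fourier transforms in the upper half-plane\<close>

text \<open>The difficulty is the double zero of \<sigma> at the origin: the inverse factors have a
  pole there, so \<open>pfun\<close> and \<open>mfun\<close> tend to 1 at one end instead of
  decaying, and convolutions with them may grow linearly. The same zero makes the construction
  possible. It says that the integral of \<open>k\<close> is \<open>- a\<close> and that its first
  moment vanishes, so the operator with symbol \<sigma> annihilates all affine functions. Hence
  nondecaying steps cancel into decaying primitives (\<open>tail\<close>), and constants and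
  multiples of \<open>x\<close> can be added to a column without disturbing the equation; they are
  fitted so that the column becomes small outside (0,\<alpha>). The number \<open>B\<close> is the
  plateau \<alpha> + u_+(0) + u_-(0) of the homogeneous solution; it grows like \<alpha>, so
  dividing by it is harmless. Moreover \<open>k\<close> is only given in a weighted
  \<open>L^1\<close> sense while the operator estimates use bounded kernels; therefore
  \<open>k\<close> is replaced by a representative with pointwise exponential decay. Inside the
  square the approximate inverse grows at most linearly in \<alpha>, which the exponential smallness
  of the error absorbs.\<close>

lemmas bint_cong_AE = Bochner_Integration.integral_cong_AE
  and bint_cong = Bochner_Integration.integral_cong
  and bint_add = Bochner_Integration.integral_add
  and bint_diff = Bochner_Integration.integral_diff
  and bint_cmult = Bochner_Integration.integral_mult_right_zero
  and integrable_dominated = Bochner_Integration.integrable_bound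

definition fourier_laplace :: "(real \<Rightarrow> complex) \<Rightarrow> complex \<Rightarrow> complex" where
  "fourier_laplace g z = (LBINT x. exp (\<i> * z * of_real x) * g x)"

lemma fourier_eq_fourier_laplace: "fourier g \<xi> = fourier_laplace g (of_real \<xi>)"
  unfolding fourier_def fourier_laplace_def by (simp add: mult_ac)

lemma norm_exp_i_mult: "cmod (exp (\<i> * z * of_real x)) = exp (- (Im z * x))"
  by (simp add: norm_exp_eq_Re)

text \<open>The sign condition on the support serves two situations at once: real \<open>z\<close>
  with any integrable \<open>g\<close>, and \<open>z\<close> in a closed half-plane with
  \<open>g\<close> supported on the matching half-line. In both the exponential has modulus at most
  1.\<close>

lemma integrable_exp_mult:
  assumes "integrable lborel g" "\<And>x. g x \<noteq> 0 \<Longrightarrow> 0 \<le> Im z * x"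
  shows "integrable lborel (\<lambda>x. exp (\<i> * z * of_real x) * g x)"
proof (rule integrable_dominated[OF assms(1)])
  show "(\<lambda>x. exp (\<i> * z * of_real x) * g x) \<in> borel_measurable lborel"
    using assms(1) by measurable
  show "AE x in lborel. cmod (exp (\<i> * z * of_real x) * g x) \<le> cmod (g x)"
  proof (intro AE_I2)
    fix x show "cmod (exp (\<i> * z * of_real x) * g x) \<le> cmod (g x)"
      using assms(2)[of x] by (cases "g x = 0") (auto simp: norm_mult norm_exp_i_mult mult_left_le_one_le)
  qed
qed

lemma integrable_fourier_integrand:
  assumes "integrable lborel g"
  shows "integrable lborel (\<lambda>x. exp (\<i> * of_real (x * \<xi>)) * g x)"
  using integrable_exp_mult[OF assms, of "of_real \<xi>"] by (simp add: mult_ac)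

lemma norm_fourier_laplace_le:
  assumes "integrable lborel g" "\<And>x. g x \<noteq> 0 \<Longrightarrow> 0 \<le> Im z * x"
  shows "cmod (fourier_laplace g z) \<le> (LBINT x. cmod (g x))"
proof -
  have "cmod (fourier_laplace g z) \<le> (LBINT x. cmod (exp (\<i> * z * of_real x) * g x))"
    unfolding fourier_laplace_def by (rule integral_norm_bound)
  also have "\<dots> \<le> (LBINT x. cmod (g x))"
  proof (rule integral_mono)
    show "integrable lborel (\<lambda>x. cmod (exp (\<i> * z * of_real x) * g x))"
      using integrable_exp_mult[OF assms] by (rule integrable_norm)
    show "integrable lborel (\<lambda>x. cmod (g x))" using assms by simp
    fix x show "cmod (exp (\<i> * z * of_real x) * g x) \<le> cmod (g x)"
      using assms(2)[of x] by (cases "g x = 0") (auto simp: norm_mult norm_exp_i_mult mult_left_le_one_le)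
  qed
  finally show ?thesis .
qed

text \<open>\<open>cmod (g x)\<close> dominates the integrand for every \<open>z\<close> in
  \<open>S\<close>, so continuity reaches the real axis, where boundary values are compared
  later.\<close>

lemma continuous_on_fourier_laplace:
  assumes g: "integrable lborel g" and S: "\<And>x z. z \<in> S \<Longrightarrow> g x \<noteq> 0 \<Longrightarrow> 0 \<le> Im z * x"
  shows "continuous_on S (fourier_laplace g)"
  unfolding continuous_on_sequentially comp_def
proof (intro allI ballI impI, elim conjE)
  fix u :: "nat \<Rightarrow> complex" and a
  assume a: "a \<in> S" and u: "\<forall>n. u n \<in> S" and lim: "u \<longlonglongrightarrow> a"
  show "(\<lambda>n. fourier_laplace g (u n)) \<longlonglongrightarrow> fourier_laplace g a"
    unfolding fourier_laplace_def
  proof (rule integral_dominated_convergence[where w = "\<lambda>x. cmod (g x)"])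
    show "AE x in lborel. (\<lambda>i. exp (\<i> * u i * of_real x) * g x) \<longlonglongrightarrow> exp (\<i> * a * of_real x) * g x"
      by (intro AE_I2 tendsto_intros lim)
    fix i show "AE x in lborel. cmod (exp (\<i> * u i * of_real x) * g x) \<le> cmod (g x)"
    proof (intro AE_I2)
      fix x show "cmod (exp (\<i> * u i * of_real x) * g x) \<le> cmod (g x)"
        using S[of "u i" x] u by (cases "g x = 0") (auto simp: norm_mult norm_exp_i_mult mult_left_le_one_le)
    qed
  qed (use g in \<open>auto intro: integrable_norm\<close>)
qed

lemma continuous_on_fourier:
  assumes "integrable lborel g"
  shows "continuous_on S (fourier g)"
proof -
  have "continuous_on \<real> (fourier_laplace g)"
    by (rule continuous_on_fourier_laplace[OF assms]) (auto simp: complex_is_Real_iff)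
  then have "continuous_on UNIV (\<lambda>\<xi>::real. fourier_laplace g (of_real \<xi>))"
    by (rule continuous_on_compose2) (auto intro!: continuous_intros)
  then have "continuous_on UNIV (fourier g)"
    by (simp add: fourier_eq_fourier_laplace[abs_def])
  then show ?thesis by (rule continuous_on_subset) simp
qed

text \<open>On the real axis differentiation under the integral would call for a first moment of
  \<open>g\<close>. Staying above height \<open>b\<close> supplies it:
  \<open>x * exp (- b * x)\<close> is at most \<open>1 / b\<close> for \<open>x \<ge> 0\<close>, so
  the difference quotients are dominated by \<open>cmod (g x) / b\<close>.\<close>

lemma fourier_laplace_holomorphic_above:
  assumes g: "integrable lborel g" and supp: "\<And>x. x < 0 \<Longrightarrow> g x = 0" and b: "b > 0"
  shows "fourier_laplace g holomorphic_on {z. Im z > b}"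
  unfolding holomorphic_on_def
proof
  fix z assume z: "z \<in> {z. Im z > b}"
  have bd: "cmod ((exp (\<i> * w * of_real x) * g x - exp (\<i> * z * of_real x) * g x) / (w - z)) \<le> 1 / b * cmod (g x)"
    if w: "w \<in> {z. Im z > b} - {z}" for w x
  proof (cases "x < 0")
    case True then show ?thesis using supp b by simp
  next
    case False
    have "cmod (exp (\<i> * w * of_real x) - exp (\<i> * z * of_real x)) \<le> 1 / b * cmod (w - z)"
    proof (rule field_differentiable_bound[of "{z. Im z > b}" _ "\<lambda>z. \<i> * of_real x * exp (\<i> * z * of_real x)"])
      show "convex {z. Im z > b}" by (rule convex_halfspace_Im_gt)
      fix v assume v: "v \<in> {z. Im z > b}"
      show "((\<lambda>w. exp (\<i> * w * of_real x)) has_field_derivative \<i> * of_real x * exp (\<i> * v * of_real x)) (at v within {z. Im z > b})"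
        by (auto intro!: derivative_eq_intros)
      have "1 + b * x \<le> exp (b * x)" using exp_ge_add_one_self[of "b*x"] by simp
      then have "b * x * exp (- (b * x)) \<le> 1"
        using exp_ge_add_one_self[of "b*x"] by (simp add: exp_minus field_simps del: exp_ge_add_one_self)
      moreover have "exp (- (Im v * x)) \<le> exp (- (b * x))" using False v by (simp add: mult_right_mono)
      ultimately have "b * x * exp (- (Im v * x)) \<le> 1"
        using mult_left_mono[of "exp (- (Im v * x))" "exp (- (b * x))" "b * x"] mult_nonneg_nonneg[of b x] False b
        by linarith
      then show "cmod (\<i> * of_real x * exp (\<i> * v * of_real x)) \<le> 1 / b"
        using False b by (simp add: norm_mult norm_exp_i_mult field_simps)
    qed (use w z in auto)
    then have "cmod (exp (\<i> * w * of_real x) - exp (\<i> * z * of_real x)) * cmod (g x) \<le> 1 / b * cmod (w - z) * cmod (g x)"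
      by (rule mult_right_mono) simp
    moreover have "cmod (w - z) > 0" using w by simp
    moreover have "exp (\<i> * w * of_real x) * g x - exp (\<i> * z * of_real x) * g x = (exp (\<i> * w * of_real x) - exp (\<i> * z * of_real x)) * g x"
      by (simp add: left_diff_distrib)
    ultimately show ?thesis
      by (simp only: norm_divide norm_mult) (simp add: divide_le_eq mult_ac)
  qed
  have nn: "0 \<le> Im w * x" if "w \<in> {z. Im z > b}" "g x \<noteq> 0" for w x
    using that supp[of x] b by (cases "x < 0") auto
  have "((\<lambda>w. (fourier_laplace g w - fourier_laplace g z) / (w - z)) \<longlongrightarrow> (LBINT x. \<i> * of_real x * exp (\<i> * z * of_real x) * g x)) (at z within {z. Im z > b})"
    unfolding tendsto_at_iff_sequentially comp_def
  proof (intro allI impI)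
    fix X :: "nat \<Rightarrow> complex" assume X: "\<forall>i. X i \<in> {z. b < Im z} - {z}" and lim: "X \<longlonglongrightarrow> z"
    have "(\<lambda>i. LBINT x. (exp (\<i> * X i * of_real x) * g x - exp (\<i> * z * of_real x) * g x) / (X i - z))
       \<longlonglongrightarrow> (LBINT x. \<i> * of_real x * exp (\<i> * z * of_real x) * g x)"
    proof (rule integral_dominated_convergence[where w = "\<lambda>x. 1 / b * cmod (g x)"])
      show "AE x in lborel. (\<lambda>i. (exp (\<i> * X i * of_real x) * g x - exp (\<i> * z * of_real x) * g x) / (X i - z)) \<longlonglongrightarrow> \<i> * of_real x * exp (\<i> * z * of_real x) * g x"
      proof (intro AE_I2)
        fix x
        have "((\<lambda>w. exp (\<i> * w * of_real x) * g x) has_field_derivative \<i> * of_real x * exp (\<i> * z * of_real x) * g x) (at z)"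
          by (auto intro!: derivative_eq_intros)
        then have "((\<lambda>w. (exp (\<i> * w * of_real x) * g x - exp (\<i> * z * of_real x) * g x) / (w - z)) \<longlongrightarrow> \<i> * of_real x * exp (\<i> * z * of_real x) * g x) (at z)"
          by (simp add: has_field_derivative_iff)
        then show "(\<lambda>i. (exp (\<i> * X i * of_real x) * g x - exp (\<i> * z * of_real x) * g x) / (X i - z)) \<longlonglongrightarrow> \<i> * of_real x * exp (\<i> * z * of_real x) * g x"
          using X lim unfolding tendsto_at_iff_sequentially comp_def by auto
      qed
      fix i show "AE x in lborel. cmod ((exp (\<i> * X i * of_real x) * g x - exp (\<i> * z * of_real x) * g x) / (X i - z)) \<le> 1 / b * cmod (g x)"
        using bd X by (intro AE_I2) blast
    qed (use g in \<open>auto\<close>)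
    moreover have "(LBINT x. (exp (\<i> * X i * of_real x) * g x - exp (\<i> * z * of_real x) * g x) / (X i - z)) = (fourier_laplace g (X i) - fourier_laplace g z) / (X i - z)" for i
    proof -
      have "X i \<in> {z. Im z > b}" using X by auto
      then show ?thesis
        unfolding fourier_laplace_def integral_divide_zero using z nn
        by (subst bint_diff) (auto intro!: integrable_exp_mult[OF g])
    qed
    ultimately show "(\<lambda>i. (fourier_laplace g (X i) - fourier_laplace g z) / (X i - z)) \<longlonglongrightarrow> (LBINT x. \<i> * of_real x * exp (\<i> * z * of_real x) * g x)"
      by (simp only:)
  qed
  then show "fourier_laplace g field_differentiable at z within {z. Im z > b}"
    unfolding field_differentiable_def has_field_derivative_iff by blast
qed

lemma fourier_laplace_holomorphic:
  assumes g: "integrable lborel g" and supp: "\<And>x. x < 0 \<Longrightarrow> g x = 0"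
  shows "fourier_laplace g holomorphic_on {z. Im z > 0}"
proof -
  have "fourier_laplace g holomorphic_on (\<Union>b\<in>{0<..}. {z. Im z > b})"
    by (intro holomorphic_on_UN_open fourier_laplace_holomorphic_above assms) (auto simp: open_halfspace_Im_gt)
  also have "(\<Union>b\<in>{0<..}. {z. Im z > b}) = {z. Im z > 0}"
    by (auto dest: dense)
  finally show ?thesis .
qed

section \<open>Uniqueness of Fourier transforms of integrable functions, with an additive
  constant\<close>

lemma fourier_real_unique:
  fixes g :: "real \<Rightarrow> real"
  assumes g: "integrable lborel g" and z: "\<And>\<xi>. fourier (\<lambda>x. of_real (g x)) \<xi> = 0"
  shows "AE x in lborel. g x = 0"
proof -
  define gp where "gp = (\<lambda>x. max 0 (g x))"
  define gm where "gm = (\<lambda>x. max 0 (- g x))"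
  have ip: "integrable lborel gp" and im: "integrable lborel gm"
    unfolding gp_def gm_def using g by (auto intro!: integrable_max)
  have nnp: "gp x \<ge> 0" and nnm: "gm x \<ge> 0" and gd: "g x = gp x - gm x" for x
    unfolding gp_def gm_def by auto
  have tr: "(LBINT x. exp (\<i> * of_real (x * \<xi>)) * of_real (gp x)) = (LBINT x. exp (\<i> * of_real (x * \<xi>)) * of_real (gm x))" for \<xi>
  proof -
    have "(LBINT x. exp (\<i> * of_real (x * \<xi>)) * of_real (gp x)) - (LBINT x. exp (\<i> * of_real (x * \<xi>)) * of_real (gm x))
       = fourier (\<lambda>x. of_real (g x)) \<xi>"
      unfolding fourier_def
      using integrable_fourier_integrand[of "\<lambda>x. of_real (gp x)" \<xi>] integrable_fourier_integrand[of "\<lambda>x. of_real (gm x)" \<xi>] ip im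
      by (subst bint_diff[symmetric]) (auto simp: gd algebra_simps)
    then show ?thesis using z by simp
  qed
  \<comment> \<open>The transforms agree at frequency 0, so the positive and negative parts have the
    same mass \<open>c\<close>. Divided by it they become probability densities with equal
    characteristic functions.\<close>
  define c where "c = (LBINT x. gp x)"
  have c2: "c = (LBINT x. gm x)"
    using tr[of 0] unfolding c_def by simp
  have "c \<ge> 0" unfolding c_def using nnp by (simp add: integral_nonneg_AE)
  show ?thesis
  proof (cases "c = 0")
    case True
    have "AE x in lborel. gp x = 0"
      using integral_nonneg_eq_0_iff_AE[OF ip] nnp True c_def by simp
    moreover have "AE x in lborel. gm x = 0"
      using integral_nonneg_eq_0_iff_AE[OF im] nnm True c2 by simp
    ultimately show ?thesis by eventually_elim (simp add: gd)
  next
    case False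
    with \<open>c \<ge> 0\<close> have c: "c > 0" by simp
    have rd: "real_distribution (density lborel (\<lambda>x. ennreal (h x / c)))"
      if h: "integrable lborel h" "\<And>x. h x \<ge> 0" "(LBINT x. h x) = c" for h
    proof -
      have "prob_space (density lborel (\<lambda>x. ennreal (h x / c)))"
      proof (rule prob_spaceI)
        have "emeasure (density lborel (\<lambda>x. ennreal (h x / c))) UNIV = (\<integral>\<^sup>+x. ennreal (h x / c) \<partial>lborel)"
          using h(1) by (subst emeasure_density) auto
        also have "\<dots> = ennreal (LBINT x. h x / c)"
          using h c by (intro nn_integral_eq_integral) auto
        also have "\<dots> = 1" using h c by simp
        finally show "emeasure (density lborel (\<lambda>x. ennreal (h x / c))) (space (density lborel (\<lambda>x. ennreal (h x / c)))) = 1"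
          by simp
      qed
      then show ?thesis unfolding real_distribution_def real_distribution_axioms_def by simp
    qed
    have ch: "char (density lborel (\<lambda>x. ennreal (h x / c))) t = (LBINT x. exp (\<i> * of_real (x * t)) * of_real (h x)) / c"
      if h: "integrable lborel h" "\<And>x. h x \<ge> 0" "(LBINT x. h x) = c" for h t
      unfolding char_def using h c
      by (subst integral_density) (auto simp: scaleR_conv_of_real mult_ac integral_divide_zero[symmetric] simp del: integral_divide_zero)
    have "density lborel (\<lambda>x. ennreal (gp x / c)) = density lborel (\<lambda>x. ennreal (gm x / c))"
      by (rule Levy_uniqueness)
         (auto simp del: of_real_mult simp: fun_eq_iff ch[OF ip nnp c_def[symmetric]] ch[OF im nnm c2[symmetric]] tr intro!: rd ip im nnp nnm c_def[symmetric] c2[symmetric])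
    then have "AE x in lborel. ennreal (gp x / c) = ennreal (gm x / c)"
      using ip im by (subst (asm) sigma_finite_measure.density_unique_iff[OF sigma_finite_lborel]) auto
    then show ?thesis
      by eventually_elim (use nnp nnm c in \<open>simp add: gd divide_right_mono\<close>)
  qed
qed

lemma fourier_cnj: "fourier (\<lambda>x. cnj (h x)) \<xi> = cnj (fourier h (- \<xi>))"
  proof -
  have "cnj (fourier h (- \<xi>)) = (LBINT x. cnj (exp (\<i> * of_real (x * - \<xi>)) * h x))"
    unfolding fourier_def by (rule Bochner_Integration.integral_cnj[symmetric])
  also have "\<dots> = fourier (\<lambda>x. cnj (h x)) \<xi>"
    unfolding fourier_def by (simp add: exp_cnj del: integral_cnj Bochner_Integration.integral_cnj)
  finally show ?thesis by simp
qed

text \<open>The transform of \<open>cnj h\<close> is the conjugate of that of \<open>h\<close> at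
  the reflected frequency, so it vanishes too. Real and imaginary parts are combinations of
  \<open>h\<close> and \<open>cnj h\<close> and fall under the real case.\<close>

lemma fourier_eq_0_imp_AE_0:
  assumes h: "integrable lborel h" and z: "\<And>\<xi>. fourier h \<xi> = 0"
  shows "AE x in lborel. h x = 0"
proof -
  have hc: "integrable lborel (\<lambda>x. cnj (h x))" using h by simp
  have "fourier (\<lambda>x. of_real (Re (h x))) \<xi> = 0" for \<xi>
  proof -
    have "fourier (\<lambda>x. of_real (Re (h x))) \<xi> = (LBINT x. (exp (\<i> * of_real (x * \<xi>)) * h x + exp (\<i> * of_real (x * \<xi>)) * cnj (h x)) / 2)"
      unfolding fourier_def by (intro bint_cong) (auto simp: complex_add_cnj[symmetric] algebra_simps complex_eq_iff)
    also have "\<dots> = (fourier h \<xi> + fourier (\<lambda>x. cnj (h x)) \<xi>) / 2"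
      unfolding fourier_def using integrable_fourier_integrand[OF h] integrable_fourier_integrand[OF hc] by simp
    finally show ?thesis by (simp add: fourier_cnj z)
  qed
  moreover have "fourier (\<lambda>x. of_real (Im (h x))) \<xi> = 0" for \<xi>
  proof -
    have "fourier (\<lambda>x. of_real (Im (h x))) \<xi> = (LBINT x. (exp (\<i> * of_real (x * \<xi>)) * h x - exp (\<i> * of_real (x * \<xi>)) * cnj (h x)) / (2 * \<i>))"
      unfolding fourier_def
    proof (intro bint_cong refl)
      fix x :: real
      have "h x - cnj (h x) = 2 * \<i> * of_real (Im (h x))" by (simp add: complex_eq_iff)
      then show "exp (\<i> * of_real (x * \<xi>)) * of_real (Im (h x)) = (exp (\<i> * of_real (x * \<xi>)) * h x - exp (\<i> * of_real (x * \<xi>)) * cnj (h x)) / (2 * \<i>)"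
        by (metis (no_types, lifting) mult.left_commute nonzero_mult_div_cancel_left right_diff_distrib complex_i_not_zero mult_eq_0_iff zero_neq_numeral)
    qed
    also have "\<dots> = (fourier h \<xi> - fourier (\<lambda>x. cnj (h x)) \<xi>) / (2 * \<i>)"
      unfolding fourier_def using integrable_fourier_integrand[OF h] integrable_fourier_integrand[OF hc] by simp
    finally show ?thesis by (simp add: fourier_cnj z)
  qed
  ultimately have "AE x in lborel. Re (h x) = 0" "AE x in lborel. Im (h x) = 0"
    using h by (auto intro!: fourier_real_unique)
  then show ?thesis by eventually_elim (simp add: complex_eq_iff)
qed

text \<open>Frequency 0 is excluded in the hypothesis because callers divide by the frequency;
  continuity recovers it. The constant is eliminated by a difference of two frequencies, without any
  decay at infinity: a shift of the frequency by 1 multiplies the density by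
  \<open>exp (\<i> * x)\<close>, so \<open>(exp (\<i> * x) - 1) * h x\<close> has transform
  0.\<close>

lemma fourier_unique:
  assumes h: "integrable lborel h" and z: "\<And>\<xi>. \<xi> \<noteq> 0 \<Longrightarrow> c + fourier h \<xi> = 0"
  shows "c = 0" "AE x in lborel. h x = 0"
proof -
  have cont: "isCont (fourier h) 0"
    using continuous_on_fourier[OF h, of UNIV] by (simp add: continuous_on_eq_continuous_at)
  have "((\<lambda>\<xi>. c + fourier h \<xi>) \<longlongrightarrow> c + fourier h 0) (at 0)"
    using cont unfolding isCont_def by (intro tendsto_intros)
  moreover have "((\<lambda>\<xi>. c + fourier h \<xi>) \<longlongrightarrow> 0) (at 0)"
    by (rule tendsto_eventually) (auto simp: eventually_at_filter z)
  ultimately have "c + fourier h 0 = 0"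
    by (rule tendsto_unique[rotated]) simp
  with z have z: "c + fourier h \<xi> = 0" for \<xi> by (cases "\<xi> = 0") auto
  define d where "d = (\<lambda>x. (exp (\<i> * of_real x) - 1) * h x)"
  have e: "integrable lborel (\<lambda>x. exp (\<i> * of_real x) * h x)"
    using integrable_fourier_integrand[OF h, of 1] by simp
  have d: "integrable lborel d"
    unfolding d_def left_diff_distrib using e h by auto
  have "fourier d \<xi> = 0" for \<xi>
  proof -
    have "fourier d \<xi> = (LBINT x. exp (\<i> * of_real (x * (\<xi> + 1))) * h x - exp (\<i> * of_real (x * \<xi>)) * h x)"
      unfolding fourier_def d_def
      by (intro bint_cong) (auto simp: algebra_simps exp_add)
    also have "\<dots> = fourier h (\<xi> + 1) - fourier h \<xi>"
      unfolding fourier_def using integrable_fourier_integrand[OF h] by (intro bint_diff)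
    also have "\<dots> = 0" using z[of "\<xi>+1"] z[of \<xi>] by (metis add_left_cancel cancel_comm_monoid_add_class.diff_cancel)
    finally show ?thesis .
  qed
  then have "AE x in lborel. d x = 0" by (rule fourier_eq_0_imp_AE_0[OF d])
  \<comment> \<open>Off the countable set of multiples of 2 pi the factor
    \<open>exp (\<i> * x) - 1\<close> is nonzero and can be divided out.\<close>
  moreover have "AE x in lborel. x \<notin> range (\<lambda>n::int. of_int n * 2 * pi)"
    by (rule AE_not_in) (auto intro!: countable_imp_null_set_lborel)
  ultimately show h0: "AE x in lborel. h x = 0"
  proof eventually_elim
    case (elim x)
    have "exp (\<i> * of_real x) \<noteq> 1"
    proof
      assume "exp (\<i> * of_real x) = 1"
      then have "cos x = 1" by (simp add: cis_conv_exp[symmetric] complex_eq_iff)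
      then show False using elim by (auto simp: cos_one_2pi_int)
    qed
    then show ?case using elim by (simp add: d_def)
  qed
  have "fourier h 0 = (LBINT x::real. 0)"
    unfolding fourier_def
  proof (rule bint_cong_AE)
    show "AE x in lborel. exp (\<i> * of_real (x * 0)) * h x = 0" using h0 by eventually_elim simp
  qed (use h in auto)
  then show "c = 0" using z[of 0] by simp
qed

section \<open>The Riemann-Lebesgue lemma in the closed upper half-plane\<close>

definition half_plane_decay :: "(real \<Rightarrow> complex) \<Rightarrow> bool" where
  "half_plane_decay g \<longleftrightarrow> (\<forall>e>0. \<exists>R. \<forall>z. 0 \<le> Im z \<longrightarrow> R \<le> cmod z \<longrightarrow> cmod (fourier_laplace (\<lambda>x. indicator {0..} x *\<^sub>R g x) z) \<le> e)"

lemma integrable_half: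
  fixes g :: "real \<Rightarrow> complex"
  assumes "integrable lborel g"
  shows "integrable lborel (\<lambda>x. indicator {0..} x *\<^sub>R g x)"
  using assms by (intro integrable_mult_indicator) (auto intro: borel_closed)

lemma half_support:
  fixes g :: "real \<Rightarrow> complex"
  assumes "indicator {0..} x *\<^sub>R g x \<noteq> 0" "0 \<le> y"
  shows "0 \<le> y * x"
  using assms by (cases "x < 0") auto

lemma fourier_laplace_half_add:
  assumes "integrable lborel f" "integrable lborel g" "0 \<le> Im z"
  shows "fourier_laplace (\<lambda>x. indicator {0..} x *\<^sub>R (f x + g x)) z
       = fourier_laplace (\<lambda>x. indicator {0..} x *\<^sub>R f x) z + fourier_laplace (\<lambda>x. indicator {0..} x *\<^sub>R g x) z"
proof -
  have "integrable lborel (\<lambda>x. exp (\<i> * z * of_real x) * (indicator {0..} x *\<^sub>R f x))"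
       "integrable lborel (\<lambda>x. exp (\<i> * z * of_real x) * (indicator {0..} x *\<^sub>R g x))"
    by (rule integrable_exp_mult[OF integrable_half[OF assms(1)]], erule half_support[OF _ assms(3)],
        rule integrable_exp_mult[OF integrable_half[OF assms(2)]], erule half_support[OF _ assms(3)])
  then show ?thesis
    unfolding fourier_laplace_def by (subst bint_add[symmetric]) (auto simp: algebra_simps)
qed

lemma half_plane_decay_add:
  assumes "integrable lborel f" "integrable lborel g" "half_plane_decay f" "half_plane_decay g"
  shows "half_plane_decay (\<lambda>x. f x + g x)"
  unfolding half_plane_decay_def
proof (intro allI impI)
  fix e :: real assume "e > 0"
  then have "e / 2 > 0" by simp
  then obtain R1 R2 where R: "\<And>z. 0 \<le> Im z \<Longrightarrow> R1 \<le> cmod z \<Longrightarrow> cmod (fourier_laplace (\<lambda>x. indicator {0..} x *\<^sub>R f x) z) \<le> e/2"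
     "\<And>z. 0 \<le> Im z \<Longrightarrow> R2 \<le> cmod z \<Longrightarrow> cmod (fourier_laplace (\<lambda>x. indicator {0..} x *\<^sub>R g x) z) \<le> e/2"
    using assms(3,4) unfolding half_plane_decay_def by meson
  show "\<exists>R. \<forall>z. 0 \<le> Im z \<longrightarrow> R \<le> cmod z \<longrightarrow> cmod (fourier_laplace (\<lambda>x. indicator {0..} x *\<^sub>R (f x + g x)) z) \<le> e"
  proof (intro exI[of _ "max R1 R2"] allI impI)
    fix z :: complex assume z: "0 \<le> Im z" "max R1 R2 \<le> cmod z"
    show "cmod (fourier_laplace (\<lambda>x. indicator {0..} x *\<^sub>R (f x + g x)) z) \<le> e"
      unfolding fourier_laplace_half_add[OF assms(1,2) z(1)]
      using R(1)[of z] R(2)[of z] z norm_triangle_ineq[of "fourier_laplace (\<lambda>x. indicator {0..} x *\<^sub>R f x) z" "fourier_laplace (\<lambda>x. indicator {0..} x *\<^sub>R g x) z"]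
      by simp
  qed
qed

lemma half_plane_decay_uminus:
  assumes "half_plane_decay g" shows "half_plane_decay (\<lambda>x. - g x)"
proof -
  have "fourier_laplace (\<lambda>x. indicator {0..} x *\<^sub>R - g x) z = - fourier_laplace (\<lambda>x. indicator {0..} x *\<^sub>R g x) z" for z
    unfolding fourier_laplace_def by simp
  then show ?thesis using assms unfolding half_plane_decay_def by simp
qed

text \<open>The transform of a difference is bounded by its \<open>L^1\<close> norm uniformly over
  the closed half-plane, so decay passes to limits in \<open>L^1\<close>; dominated convergence
  turns the pointwise limit into such a limit.\<close>

lemma half_plane_decay_limit:
  fixes s :: "nat \<Rightarrow> real \<Rightarrow> complex"
  assumes s: "\<And>i. integrable lborel (s i)" "\<And>i. half_plane_decay (s i)" and lim: "\<And>x. (\<lambda>i. s i x) \<longlonglongrightarrow> f x"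
    and w: "integrable lborel w" "\<And>i x. cmod (s i x) \<le> w x" and f: "integrable lborel f"
  shows "half_plane_decay f"
  unfolding half_plane_decay_def
proof (intro allI impI)
  fix e :: real assume e: "e > 0"
  have "(\<lambda>i. LBINT x. cmod (f x - s i x)) \<longlonglongrightarrow> (LBINT x::real. 0)"
  proof (rule integral_dominated_convergence[where w = "\<lambda>x. cmod (f x) + w x"])
    show "AE x in lborel. (\<lambda>i. cmod (f x - s i x)) \<longlonglongrightarrow> 0"
    proof (intro AE_I2)
      fix x
      have "(\<lambda>i. cmod (f x - s i x)) \<longlonglongrightarrow> cmod (f x - f x)" by (intro tendsto_intros lim)
      then show "(\<lambda>i. cmod (f x - s i x)) \<longlonglongrightarrow> 0" by simp
    qed
    fix i show "AE x in lborel. norm (cmod (f x - s i x)) \<le> cmod (f x) + w x"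
    proof (intro AE_I2)
      fix x show "norm (cmod (f x - s i x)) \<le> cmod (f x) + w x"
        using w(2)[of i x] norm_triangle_ineq4[of "f x" "s i x"] by simp
    qed
  qed (use s f w in \<open>auto intro: borel_measurable_integrable\<close>)
  then have "\<forall>\<^sub>F i in sequentially. (LBINT x. cmod (f x - s i x)) < e / 2"
    using e by (intro order_tendstoD(2)[where y = 0]) auto
  then obtain i where i: "(LBINT x. cmod (f x - s i x)) < e / 2"
    by (auto simp: eventually_sequentially)
  obtain R where R: "\<And>z. 0 \<le> Im z \<Longrightarrow> R \<le> cmod z \<Longrightarrow> cmod (fourier_laplace (\<lambda>x. indicator {0..} x *\<^sub>R s i x) z) \<le> e/2"
    using s(2)[of i] e unfolding half_plane_decay_def by (meson half_gt_zero)
  show "\<exists>R. \<forall>z. 0 \<le> Im z \<longrightarrow> R \<le> cmod z \<longrightarrow> cmod (fourier_laplace (\<lambda>x. indicator {0..} x *\<^sub>R f x) z) \<le> e"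
  proof (intro exI[of _ R] allI impI)
    fix z :: complex assume z: "0 \<le> Im z" "R \<le> cmod z"
    have d: "integrable lborel (\<lambda>x. f x - s i x)" using f s by auto
    have "fourier_laplace (\<lambda>x. indicator {0..} x *\<^sub>R f x) z = fourier_laplace (\<lambda>x. indicator {0..} x *\<^sub>R s i x) z + fourier_laplace (\<lambda>x. indicator {0..} x *\<^sub>R (f x - s i x)) z"
      using fourier_laplace_half_add[OF s(1)[of i] d z(1)] by simp
    moreover have "cmod (fourier_laplace (\<lambda>x. indicator {0..} x *\<^sub>R (f x - s i x)) z) \<le> (LBINT x. cmod (indicator {0..} x *\<^sub>R (f x - s i x)))"
      by (rule norm_fourier_laplace_le[OF integrable_half[OF d]], erule half_support[OF _ z(1)])
    moreover have "(LBINT x. cmod (indicator {0..} x *\<^sub>R (f x - s i x))) \<le> (LBINT x. cmod (f x - s i x))"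
    proof (rule integral_mono)
      show "cmod (indicator {0..} x *\<^sub>R (f x - s i x)) \<le> cmod (f x - s i x)" for x
        by (simp add: indicator_def)
    qed (use integrable_norm[OF d] integrable_norm[OF integrable_half[OF d]] in auto)
    ultimately show "cmod (fourier_laplace (\<lambda>x. indicator {0..} x *\<^sub>R f x) z) \<le> e"
      using R[OF z] i norm_triangle_ineq[of "fourier_laplace (\<lambda>x. indicator {0..} x *\<^sub>R s i x) z" "fourier_laplace (\<lambda>x. indicator {0..} x *\<^sub>R (f x - s i x)) z"]
      by simp
  qed
qed

lemma half_plane_decay_interval: "half_plane_decay (\<lambda>x. indicator {a..b} x *\<^sub>R c)"
  unfolding half_plane_decay_def
proof (intro allI impI)
  fix e :: real assume e: "e > 0"
  show "\<exists>R. \<forall>z. 0 \<le> Im z \<longrightarrow> R \<le> cmod z \<longrightarrow> cmod (fourier_laplace (\<lambda>x. indicator {0..} x *\<^sub>R (indicator {a..b} x *\<^sub>R c)) z) \<le> e"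
  \<comment> \<open>The summand 1 keeps \<open>z\<close> away from 0, so that division by
    \<open>z\<close> is legitimate. The quotient makes the two boundary terms of the antiderivative,
    together at most \<open>2 * cmod c / cmod z\<close>, at most \<open>e\<close>.\<close>
  proof (intro exI[of _ "2 * cmod c / e + 1"] allI impI)
    fix z :: complex assume z: "0 \<le> Im z" "2 * cmod c / e + 1 \<le> cmod z"
    have "2 * cmod c / e \<ge> 0" using e by simp
    then have z0: "cmod z > 0" using z by linarith
    \<comment> \<open>Clipping at 0 merges the two indicators into one interval on which the
      exponential has modulus at most 1.\<close>
    define a' where "a' = max 0 a"
    have eq: "fourier_laplace (\<lambda>x. indicator {0..} x *\<^sub>R (indicator {a..b} x *\<^sub>R c)) z = (LBINT x. indicator {a'..b} x *\<^sub>R (exp (\<i> * z * of_real x) * c))"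
      unfolding fourier_laplace_def a'_def by (intro bint_cong) (auto split: split_indicator)
    show "cmod (fourier_laplace (\<lambda>x. indicator {0..} x *\<^sub>R (indicator {a..b} x *\<^sub>R c)) z) \<le> e"
    proof (cases "a' \<le> b")
      case True
      have "((\<lambda>x::real. exp (\<i> * z * of_real x) * c / (\<i> * z)) has_vector_derivative exp (\<i> * z * of_real x) * c) (at x within {a'..b})" for x
      proof -
        have "((\<lambda>w. exp (\<i> * z * w) * c / (\<i> * z)) has_field_derivative exp (\<i> * z * of_real x) * c) (at (of_real x))"
        proof -
          have "((\<lambda>w. exp (\<i> * z * w)) has_field_derivative exp (\<i> * z * of_real x) * (\<i> * z)) (at (of_real x))"
            by (auto intro!: derivative_eq_intros)
          from DERIV_cmult_right[OF this, of "c / (\<i> * z)"] show ?thesis using z0 by simp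
        qed
        from has_vector_derivative_real_field[OF this] show ?thesis .
      qed
      then have "(LBINT x. indicator {a'..b} x *\<^sub>R (exp (\<i> * z * of_real x) * c))
          = exp (\<i> * z * of_real b) * c / (\<i> * z) - exp (\<i> * z * of_real a') * c / (\<i> * z)"
        using True by (intro integral_FTC_Icc) (auto intro!: continuous_intros)
      also have "cmod \<dots> \<le> cmod (exp (\<i> * z * of_real b) * c / (\<i> * z)) + cmod (exp (\<i> * z * of_real a') * c / (\<i> * z))"
        by (rule norm_triangle_ineq4)
      also have "\<dots> \<le> cmod c / cmod z + cmod c / cmod z"
        using True z(1) a'_def
        by (intro add_mono) (auto simp: norm_mult norm_divide norm_exp_i_mult intro!: divide_right_mono mult_left_le_one_le)
      also have "\<dots> \<le> e"
      proof -
        have "2 * cmod c / e \<le> cmod z" using z by simp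
        then have "2 * cmod c \<le> e * cmod z" using e by (simp add: divide_le_eq mult_ac)
        then show ?thesis using z0 by (simp add: divide_simps)
      qed
      finally show ?thesis unfolding eq .
    next
      case False
      then show ?thesis unfolding eq using e by simp
    qed
  qed
qed

text \<open>A monotone-class argument from half-lines to all Borel sets. The window
  \<open>{-n..n}\<close> keeps complements integrable, so the family is closed under complements;
  countable disjoint unions follow from \<open>half_plane_decay_limit\<close>.\<close>

lemma half_plane_decay_borel_bounded:
  assumes "A \<in> sets borel"
  shows "half_plane_decay (\<lambda>x. indicator (A \<inter> {-n..n}) x *\<^sub>R c)"
proof -
  have int: "integrable lborel (\<lambda>x. indicator (A \<inter> {-n..n}) x *\<^sub>R c)" if "A \<in> sets borel" for A
  proof -
    have "emeasure lborel (A \<inter> {-n..n}) \<le> emeasure lborel {-n..n}" using that by (intro emeasure_mono) auto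
    also have "\<dots> < \<infinity>" by (cases "-n \<le> n") auto
    finally show ?thesis using that by (intro integrable_real_indicator[THEN integrable_scaleR_left]) auto
  qed
  have "Int_stable (range (\<lambda>a::real. {..a}))"
    by (auto simp: Int_stable_def intro!: image_eqI[where x = "min _ _"])
  moreover have "range (\<lambda>a::real. {..a}) \<subseteq> Pow UNIV" by simp
  moreover have "A \<in> sigma_sets UNIV (range (\<lambda>a::real. {..a}))"
    using assms unfolding borel_eq_atMost by simp
  ultimately show ?thesis
  proof (induction rule: sigma_sets_induct_disjoint)
    case (basic A)
    then obtain a where A: "A = {..a}" by auto
    have "A \<inter> {-n..n} = {-n..min a n}" unfolding A by auto
    then show ?case using half_plane_decay_interval by simp
  next
    case empty
    then show ?case using half_plane_decay_interval[of 1 0 c] by simp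
  next
    case (compl A)
    then have A: "A \<in> sets borel" by (simp add: borel_eq_atMost)
    have "half_plane_decay (\<lambda>x. indicator {-n..n} x *\<^sub>R c + - (indicator (A \<inter> {-n..n}) x *\<^sub>R c))"
      using int[OF A] int[of UNIV] compl by (intro half_plane_decay_add half_plane_decay_uminus half_plane_decay_interval) auto
    moreover have "(\<lambda>x. indicator {-n..n} x *\<^sub>R c + - (indicator (A \<inter> {-n..n}) x *\<^sub>R c)) = (\<lambda>x. indicator ((UNIV - A) \<inter> {-n..n}) x *\<^sub>R c)"
      by (auto simp: fun_eq_iff split: split_indicator)
    ultimately show ?case by simp
  next
    case (union A)
    then have A: "A i \<in> sets borel" for i by (auto simp: borel_eq_atMost)
    define s where "s = (\<lambda>i x. indicator ((\<Union>j<i. A j) \<inter> {-n..n}) x *\<^sub>R c)"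
    have U: "(\<Union>j<i. A j) \<in> sets borel" "(\<Union>j. A j) \<in> sets borel" for i :: nat using A by auto
    show ?case
    proof (rule half_plane_decay_limit[where s = s and w = "\<lambda>x. norm (indicator (UNIV \<inter> {-n..n}) x *\<^sub>R c)"])
      show "integrable lborel (s i)" for i unfolding s_def by (rule int[OF U(1)])
      show "half_plane_decay (s i)" for i
      proof (induction i)
        case 0 then show ?case using half_plane_decay_interval[of 1 0 c] by (simp add: s_def)
      next
        case (Suc i)
        have "s (Suc i) = (\<lambda>x. s i x + indicator (A i \<inter> {-n..n}) x *\<^sub>R c)"
        proof
          fix x
          have D: "x \<notin> (\<Union>j<i. A j)" if "x \<in> A i"
            using disjoint_family_onD[OF union(1), of i] that by fastforce
          have U: "(\<Union>j<Suc i. A j) = A i \<union> (\<Union>j<i. A j)" by (simp add: lessThan_Suc)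
          show "s (Suc i) x = s i x + indicator (A i \<inter> {-n..n}) x *\<^sub>R c"
          proof (cases "x \<in> A i")
            case True
            then show ?thesis using D[OF True] unfolding s_def U indicator_def by simp
          next
            case False
            then show ?thesis unfolding s_def U indicator_def by simp
          qed
        qed
        then show ?case using Suc union int[OF A] int[OF U(1)] by (auto intro!: half_plane_decay_add simp: s_def)
      qed
      show "(\<lambda>i. s i x) \<longlonglongrightarrow> indicator (\<Union> (range A) \<inter> {-n..n}) x *\<^sub>R c" for x
      proof (cases "x \<in> \<Union> (range A)")
        case True
        then obtain j where j: "x \<in> A j" by auto
        have "\<forall>\<^sub>F i in sequentially. s i x = indicator (\<Union> (range A) \<inter> {-n..n}) x *\<^sub>R c"
          using eventually_gt_at_top[of j]
        proof eventually_elim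
          case (elim i)
          then have "x \<in> (\<Union>j<i. A j)" "x \<in> \<Union> (range A)" using j by auto
          then show ?case unfolding s_def indicator_def by simp
        qed
        then show ?thesis by (rule tendsto_eventually)
      qed (auto simp: s_def)
      show "integrable lborel (\<lambda>x. norm (indicator (UNIV \<inter> {-n..n}) x *\<^sub>R c))" by (rule integrable_norm[OF int]) simp
      show "cmod (s i x) \<le> norm (indicator (UNIV \<inter> {-n..n}) x *\<^sub>R c)" for i x
        by (simp add: s_def indicator_def)
      show "integrable lborel (\<lambda>x. indicator (\<Union> (range A) \<inter> {-n..n}) x *\<^sub>R c)" by (rule int[OF U(2)])
    qed
  qed
qed

text \<open>Induction over integrable functions. The truncation to the half-line is built into
  \<open>half_plane_decay\<close>, so the approximating functions carry no support
  condition.\<close>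

lemma half_plane_decay_integrable:
  assumes "integrable lborel g" shows "half_plane_decay g"
  using assms
proof (induction rule: integrable_induct)
  case (base A c)
  have int: "integrable lborel (\<lambda>x. indicator B x *\<^sub>R c)" if "B \<in> sets borel" "B \<subseteq> A" for B
  proof -
    have "emeasure lborel B \<le> emeasure lborel A" using that base by (intro emeasure_mono) auto
    also have "\<dots> < \<infinity>" using base by simp
    finally show ?thesis using that by (intro integrable_real_indicator[THEN integrable_scaleR_left]) auto
  qed
  have A: "A \<in> sets borel" using base by simp
  show ?case
  proof (rule half_plane_decay_limit[where s = "\<lambda>i x. indicator (A \<inter> {-real i..real i}) x *\<^sub>R c" and w = "\<lambda>x. norm (indicator A x *\<^sub>R c)"])
    show "(\<lambda>i. indicator (A \<inter> {- real i..real i}) x *\<^sub>R c) \<longlonglongrightarrow> indicator A x *\<^sub>R c" for x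
    proof (rule tendsto_eventually)
      show "\<forall>\<^sub>F i in sequentially. indicator (A \<inter> {- real i..real i}) x *\<^sub>R c = indicator A x *\<^sub>R c"
        using eventually_ge_at_top[of "nat \<lceil>\<bar>x\<bar>\<rceil>"]
      proof eventually_elim
        case (elim i)
        then have "- real i \<le> x \<and> x \<le> real i" by linarith
        then show ?case by (auto split: split_indicator)
      qed
    qed
    show "integrable lborel (\<lambda>x. norm (indicator A x *\<^sub>R c))" by (rule integrable_norm[OF int[OF A]]) simp
    show "integrable lborel (\<lambda>x. indicator (A \<inter> {- real i..real i}) x *\<^sub>R c)" for i
      using A by (intro int) auto
    show "integrable lborel (\<lambda>x. indicator A x *\<^sub>R c)" by (rule int[OF A]) simp
  qed (auto intro!: half_plane_decay_borel_bounded A split: split_indicator)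
next
  case (add f g) then show ?case by (intro half_plane_decay_add)
next
  case (lim f s)
  show ?case
    by (rule half_plane_decay_limit[where s = s and w = "\<lambda>x. 2 * cmod (f x)"]) (use lim in \<open>auto intro: integrable_norm\<close>)
qed

lemma fourier_laplace_vanishes_at_infinity:
  assumes g: "integrable lborel g" and supp: "\<And>x. x < 0 \<Longrightarrow> g x = 0" and e: "e > 0"
  obtains R where "\<And>z. 0 \<le> Im z \<Longrightarrow> R \<le> cmod z \<Longrightarrow> cmod (fourier_laplace g z) \<le> e"
proof -
  have "(\<lambda>x. indicator {0..} x *\<^sub>R g x) = g" using supp by (auto simp: fun_eq_iff split: split_indicator)
  then show ?thesis using half_plane_decay_integrable[OF g] e that unfolding half_plane_decay_def by auto
qed

section \<open>Entire functions pasted together along the real axis\<close>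

lemma inner_i: "\<i> \<bullet> z = Im z"
  by (simp add: inner_complex_def)

text \<open>Continuity across a line suffices for holomorphy of the pasted function, so boundary
  values need only agree pointwise on the real axis. This feeds both the identity theorem and
  Liouville's theorem below.\<close>

lemma paste_half_planes:
  assumes f: "continuous_on {z. Im z \<ge> 0} f" "f holomorphic_on {z. Im z > 0}"
    and g: "continuous_on {z. Im z \<le> 0} g" "g holomorphic_on {z. Im z < 0}"
    and eq: "\<And>x::real. f (of_real x) = g (of_real x)"
  shows "(\<lambda>z. if Im z \<ge> 0 then f z else g z) holomorphic_on UNIV"
proof (rule holomorphic_on_paste_across_line[of UNIV \<i> _ 0])
  show "(\<lambda>z. if Im z \<ge> 0 then f z else g z) holomorphic_on UNIV \<inter> {z. \<i> \<bullet> z < 0}"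
    by (rule holomorphic_transform[of g]) (use g(2) in \<open>auto simp: inner_i\<close>)
  show "(\<lambda>z. if Im z \<ge> 0 then f z else g z) holomorphic_on UNIV \<inter> {z. 0 < \<i> \<bullet> z}"
    by (rule holomorphic_transform[of f]) (use f(2) in \<open>auto simp: inner_i\<close>)
  have "continuous_on ({z. Im z \<ge> 0} \<union> {z. Im z \<le> 0}) (\<lambda>z. if Im z \<ge> 0 then f z else g z)"
  proof (rule continuous_on_cases)
    show "\<forall>x. x \<in> {z. 0 \<le> Im z} \<and> \<not> 0 \<le> Im x \<or> x \<in> {z. Im z \<le> 0} \<and> 0 \<le> Im x \<longrightarrow> f x = g x"
    proof (intro allI impI)
      fix z assume "z \<in> {z. 0 \<le> Im z} \<and> \<not> 0 \<le> Im z \<or> z \<in> {z. Im z \<le> 0} \<and> 0 \<le> Im z"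
      then have "z = of_real (Re z)" by (auto simp: complex_eq_iff)
      then show "f z = g z" using eq by metis
    qed
  qed (use f g in \<open>auto intro: closed_halfspace_Im_ge closed_halfspace_Im_le\<close>)
  moreover have "{z. Im z \<ge> 0} \<union> {z. Im z \<le> 0} = UNIV" by auto
  ultimately show "continuous_on UNIV (\<lambda>z. if Im z \<ge> 0 then f z else g z)" by simp
qed auto

lemma fourier_laplace_cont_upper:
  assumes "integrable lborel g" "\<And>x. x < 0 \<Longrightarrow> g x = 0"
  shows "continuous_on {z. Im z \<ge> 0} (fourier_laplace g)"
proof (rule continuous_on_fourier_laplace[OF assms(1)])
  fix x z assume "z \<in> {z. 0 \<le> Im z}" "g x \<noteq> 0"
  then show "0 \<le> Im z * x" using assms(2)[of x] by (cases "x < 0") auto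
qed

lemma fourier_laplace_bound_upper:
  assumes "integrable lborel g" "\<And>x. x < 0 \<Longrightarrow> g x = 0" "Im z \<ge> 0"
  shows "cmod (fourier_laplace g z) \<le> (LBINT x. cmod (g x))"
proof (rule norm_fourier_laplace_le[OF assms(1)])
  fix x assume "g x \<noteq> 0"
  then show "0 \<le> Im z * x" using assms(2)[of x] assms(3) by (cases "x < 0") auto
qed

text \<open>
  The Riemann-Lebesgue lemma in the closed half-plane forces \<open>c \<noteq> 0\<close> and bounds the bracket from
  below near infinity. Continuity of the factor alone would not exclude \<open>T(z) = exp (- \<i> z)\<close>.
\<close>

lemma factor_bounded_in_half_plane:
  fixes T :: "complex \<Rightarrow> complex"
  assumes T: "continuous_on {z. Im z \<ge> 0} T" "T holomorphic_on {z. Im z > 0}"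
    and K: "\<And>x::real. cmod (of_real x * T (of_real x)) \<le> K" and t: "t \<noteq> 0"
    and U: "integrable lborel U" "\<And>x. x < 0 \<Longrightarrow> U x = 0"
    and eq: "\<And>\<xi>::real. T (of_real \<xi>) * (1 - \<i> * of_real \<xi> * (c + fourier U \<xi>)) = t"
  shows "c \<noteq> 0" "\<exists>K'. \<forall>z. Im z \<ge> 0 \<longrightarrow> cmod (z * T z) \<le> K'"
proof -
  have K0: "K \<ge> 0" using K[of 0] by simp
  define D where "D z = T z * (1 - \<i> * z * (c + fourier_laplace U z)) - t" for z
  have D1: "continuous_on {z. Im z \<ge> 0} D"
    unfolding D_def by (intro continuous_intros T fourier_laplace_cont_upper U)
  have D2: "D holomorphic_on {z. Im z > 0}"
    unfolding D_def by (intro holomorphic_intros T fourier_laplace_holomorphic U)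
  \<comment> \<open>\<open>D\<close> vanishes on the real axis, so its extension by 0 is entire.
    Being 0 below the axis it is 0 everywhere, and \<open>eq\<close> extends to the closed upper
    half-plane.\<close>
  have E: "(\<lambda>z. if Im z \<ge> 0 then D z else 0) holomorphic_on UNIV" (is "?E holomorphic_on _")
    by (rule paste_half_planes[OF D1 D2]) (use eq in \<open>auto simp: D_def fourier_eq_fourier_laplace\<close>)
  have E0: "?E z = 0" for z
  proof (rule analytic_continuation[of ?E UNIV "{z. Im z < 0}" "-\<i>"])
    have "-\<i> \<in> interior {z. Im z < 0}" by (simp add: open_halfspace_Im_lt interior_open)
    then show "-\<i> islimpt {z. Im z < 0}" by (rule interior_limit_point)
  qed (use E in auto)
  have eqU: "T z * (1 - \<i> * z * (c + fourier_laplace U z)) = t" if "Im z \<ge> 0" for z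
    using E0[of z] that by (simp add: D_def)
  show c: "c \<noteq> 0"
  proof
    assume c: "c = 0"
    \<comment> \<open>With \<open>c = 0\<close> the identity at a large real \<open>x\<close> bounds
      \<open>cmod t\<close> by \<open>K / x + K * e\<close>; the choices of \<open>e\<close> and
      \<open>x\<close> make each summand at most a quarter of \<open>cmod t\<close>.\<close>
    define e where "e = cmod t / (4 * (K + 1))"
    have e: "e > 0" using t K0 by (simp add: e_def)
    obtain R where R: "\<And>z. 0 \<le> Im z \<Longrightarrow> R \<le> cmod z \<Longrightarrow> cmod (fourier_laplace U z) \<le> e"
      using fourier_laplace_vanishes_at_infinity[OF U e] by blast
    define x where "x = max R (4 * K / cmod t) + 1"
    have "4 * K / cmod t \<ge> 0" using K0 by simp
    then have x: "x \<ge> R" "x > 4 * K / cmod t" "x > 0" unfolding x_def by auto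
    have F: "cmod (fourier_laplace U (of_real x)) \<le> e" using R[of "of_real x"] x by simp
    have "cmod t = cmod (T (of_real x) - \<i> * (of_real x * T (of_real x)) * fourier_laplace U (of_real x))"
      using arg_cong[OF eqU[of "of_real x"], of cmod] c by (simp add: algebra_simps)
    also have "\<dots> \<le> cmod (T (of_real x)) + cmod (of_real x * T (of_real x)) * cmod (fourier_laplace U (of_real x))"
      by (metis norm_triangle_ineq4 norm_mult norm_ii mult_1)
    also have "\<dots> \<le> K / x + K * e"
    proof (rule add_mono)
      show "cmod (T (of_real x)) \<le> K / x" using K[of x] x by (simp add: norm_mult field_simps)
      show "cmod (of_real x * T (of_real x)) * cmod (fourier_laplace U (of_real x)) \<le> K * e"
        by (intro mult_mono K F K0) simp
    qed
    also have "\<dots> \<le> cmod t / 4 + cmod t / 4"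
    proof (rule add_mono)
      show "K / x \<le> cmod t / 4" using x t by (simp add: field_simps)
      show "K * e \<le> cmod t / 4" unfolding e_def using K0 by (simp add: field_simps)
    qed
    finally show False using t by simp
  qed
  show "\<exists>K'. \<forall>z. Im z \<ge> 0 \<longrightarrow> cmod (z * T z) \<le> K'"
  proof -
    have e: "cmod c / 4 > 0" using c by simp
    obtain R where R: "\<And>z. 0 \<le> Im z \<Longrightarrow> R \<le> cmod z \<Longrightarrow> cmod (fourier_laplace U z) \<le> cmod c / 4"
      using fourier_laplace_vanishes_at_infinity[OF U e] by blast
    \<comment> \<open>Beyond \<open>R'\<close> the product \<open>cmod z * cmod c\<close> is at
      least 4, so the summand 1 and the transform of \<open>U\<close> each cost at most a quarter of
      it, and the bracket keeps at least half.\<close>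
    define R' where "R' = max R (4 / cmod c)"
    have far: "cmod (z * T z) \<le> 2 * cmod t / cmod c" if z: "Im z \<ge> 0" "cmod z \<ge> R'" for z
    proof -
      have z4: "cmod z \<ge> 4 / cmod c" using z R'_def by simp
      then have zc: "cmod z * cmod c \<ge> 4" using c by (simp add: field_simps)
      have F: "cmod (fourier_laplace U z) \<le> cmod c / 4" using R z R'_def by simp
      have "cmod z * cmod c = cmod (\<i> * z * c)" by (simp add: norm_mult)
      also have "\<dots> = cmod (1 - (1 - \<i> * z * (c + fourier_laplace U z)) - \<i> * z * fourier_laplace U z)" by (simp add: algebra_simps)
      also have "\<dots> \<le> cmod (1 - (1 - \<i> * z * (c + fourier_laplace U z))) + cmod (\<i> * z * fourier_laplace U z)" by (rule norm_triangle_ineq4)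
      also have "\<dots> \<le> cmod 1 + cmod (1 - \<i> * z * (c + fourier_laplace U z)) + cmod (\<i> * z * fourier_laplace U z)"
        by (intro add_right_mono norm_triangle_ineq4)
      also have "cmod (\<i> * z * fourier_laplace U z) \<le> cmod z * (cmod c / 4)"
        using F by (simp add: norm_mult mult_left_mono del: times_divide_eq_right)
      finally have "cmod z * cmod c / 2 \<le> cmod (1 - \<i> * z * (c + fourier_laplace U z))" using zc by simp
      then have "cmod (T z) * (cmod z * cmod c / 2) \<le> cmod t"
        using mult_left_mono[of _ _ "cmod (T z)"] eqU[OF z(1)] by (metis norm_ge_zero norm_mult)
      then show ?thesis using c by (simp add: norm_mult field_simps)
    qed
    have "compact ({z. Im z \<ge> 0} \<inter> cball 0 R')"
      by (intro closed_Int_compact compact_cball closed_halfspace_Im_ge)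
    then have "compact ((\<lambda>z. z * T z) ` ({z. Im z \<ge> 0} \<inter> cball 0 R'))"
      by (rule compact_continuous_image[rotated])
         (intro continuous_intros continuous_on_subset[OF T(1)], auto)
    then obtain K1 where "\<And>z. z \<in> {z. Im z \<ge> 0} \<inter> cball 0 R' \<Longrightarrow> cmod (z * T z) \<le> K1"
      using compact_imp_bounded bounded_iff by (metis (no_types, lifting) imageI)
    then have "cmod (z * T z) \<le> max K1 (2 * cmod t / cmod c)" if "Im z \<ge> 0" for z
      using far[of z] that by (cases "cmod z \<le> R'") (force simp: le_max_iff_disj)+
    then show ?thesis by blast
  qed
qed

lemma integral_reflect: "(LBINT x. f (- x)) = (LBINT x::real. (f x :: 'a::{banach,second_countable_topology}))"
  using lborel_integral_real_affine[of "-1" f 0] by simp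

lemma integrable_reflect_iff: "integrable lborel (\<lambda>x. f (- x)) \<longleftrightarrow> integrable lborel (f :: real \<Rightarrow> 'a::{banach,second_countable_topology})"
  using lborel_integrable_real_affine_iff[of "-1" f 0] by simp

lemma fourier_laplace_reflect: "fourier_laplace (\<lambda>x. g (- x)) z = fourier_laplace g (- z)"
proof -
  have "fourier_laplace (\<lambda>x. g (- x)) z = (LBINT x. (\<lambda>y. exp (\<i> * (- z) * of_real y) * g y) (- x))"
    unfolding fourier_laplace_def by simp
  also have "\<dots> = fourier_laplace g (- z)" unfolding fourier_laplace_def by (rule integral_reflect)
  finally show ?thesis .
qed

text \<open>Split \<open>G\<close> at 0. The right part is moved to the side of \<open>S\<close>,
  giving a function analytic above the axis; the left part has a transform analytic below. They
  agree on the real axis and form one bounded entire function, hence a constant, and uniqueness of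
  transforms kills the left part.\<close>

lemma vanish_on_negative_half_line:
  assumes S: "continuous_on {z. Im z \<ge> 0} S" "S holomorphic_on {z. Im z > 0}"
    and K: "\<And>z. Im z \<ge> 0 \<Longrightarrow> cmod (S z) \<le> K" and G: "integrable lborel G"
    and eq: "\<And>\<xi>. c + fourier G \<xi> = S (of_real \<xi>)"
  shows "AE x in lborel. x < 0 \<longrightarrow> G x = 0"
proof -
  define Gp where "Gp = (\<lambda>x. indicator {0..} x *\<^sub>R G x)"
  define Gm where "Gm = (\<lambda>x. indicator {0<..} x *\<^sub>R G (- x))"
  have iG: "integrable lborel (\<lambda>x. G (- x))" using G by (simp add: integrable_reflect_iff)
  have ip: "integrable lborel Gp" unfolding Gp_def by (rule integrable_half[OF G])
  have im: "integrable lborel Gm" unfolding Gm_def using iG by (intro integrable_mult_indicator) auto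
  have zp: "Gp x = 0" if "x < 0" for x using that by (simp add: Gp_def)
  have zm: "Gm x = 0" if "x < 0" for x using that by (simp add: Gm_def)
  have Gsum: "G x = Gp x + Gm (- x)" for x by (simp add: Gp_def Gm_def indicator_def)
  have im': "integrable lborel (\<lambda>x. Gm (- x))" using im by (simp add: integrable_reflect_iff)
  have FG: "fourier G \<xi> = fourier_laplace Gp (of_real \<xi>) + fourier_laplace Gm (- of_real \<xi>)" for \<xi>
  proof -
    have "fourier G \<xi> = fourier Gp \<xi> + fourier (\<lambda>x. Gm (- x)) \<xi>"
      unfolding fourier_def Gsum
      using integrable_fourier_integrand[OF ip, of \<xi>] integrable_fourier_integrand[OF im', of \<xi>]
      by (subst bint_add[symmetric]) (auto simp: algebra_simps)
    then show ?thesis by (simp add: fourier_eq_fourier_laplace fourier_laplace_reflect)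
  qed
  have holm: "(\<lambda>z. fourier_laplace Gm (- z)) holomorphic_on {z. Im z < 0}"
  proof -
    have "(fourier_laplace Gm \<circ> uminus) holomorphic_on {z. Im z < 0}"
      by (rule holomorphic_on_compose_gen[OF _ fourier_laplace_holomorphic[OF im zm]]) (auto intro!: holomorphic_intros)
    then show ?thesis by (simp add: o_def)
  qed
  have contm: "continuous_on {z. Im z \<le> 0} (\<lambda>z. fourier_laplace Gm (- z))"
    by (rule continuous_on_compose2[OF fourier_laplace_cont_upper[OF im zm]]) (auto intro!: continuous_intros)
  have "(\<lambda>z. if Im z \<ge> 0 then S z - c - fourier_laplace Gp z else fourier_laplace Gm (- z)) holomorphic_on UNIV" (is "?E holomorphic_on _")
  proof (rule paste_half_planes)
    show "continuous_on {z. Im z \<ge> 0} (\<lambda>z. S z - c - fourier_laplace Gp z)"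
      by (intro continuous_intros S fourier_laplace_cont_upper ip zp)
    show "(\<lambda>z. S z - c - fourier_laplace Gp z) holomorphic_on {z. Im z > 0}"
      by (intro holomorphic_intros S fourier_laplace_holomorphic ip zp)
    fix x :: real
    show "S (of_real x) - c - fourier_laplace Gp (of_real x) = fourier_laplace Gm (- of_real x)"
      using eq[of x] FG[of x] by (simp add: algebra_simps)
  qed (rule contm holm)+
  moreover have "bounded (range ?E)"
  proof -
    have "cmod (?E z) \<le> (K + cmod c + (LBINT x. cmod (Gp x))) + (LBINT x. cmod (Gm x))" for z
    proof (cases "Im z \<ge> 0")
      case True
      have "cmod (S z - c - fourier_laplace Gp z) \<le> cmod (S z) + cmod c + cmod (fourier_laplace Gp z)"
        using norm_triangle_ineq4[of "S z - c" "fourier_laplace Gp z"] norm_triangle_ineq4[of "S z" c] by simp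
      also have "\<dots> \<le> K + cmod c + (LBINT x. cmod (Gp x))"
        by (intro add_mono order_refl K True fourier_laplace_bound_upper ip zp)
      also have "\<dots> \<le> \<dots> + (LBINT x. cmod (Gm x))" by simp
      finally show ?thesis using True by simp
    next
      case False
      have "cmod (fourier_laplace Gm (-z)) \<le> (LBINT x. cmod (Gm x))"
        using False by (intro fourier_laplace_bound_upper im zm) auto
      moreover have "0 \<le> K" using order_trans[OF norm_ge_zero K[of 0]] by simp
      moreover have "0 \<le> (LBINT x. cmod (Gp x))" by simp
      moreover have "0 \<le> cmod c" by simp
      ultimately have "cmod (fourier_laplace Gm (-z)) \<le> (K + cmod c + (LBINT x. cmod (Gp x))) + (LBINT x. cmod (Gm x))" by linarith
      then show ?thesis using False by simp
    qed
    then show ?thesis unfolding bounded_iff by blast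
  qed
  ultimately have "?E constant_on UNIV" by (rule Liouville_theorem)
  then obtain b where b: "\<And>z. ?E z = b" unfolding constant_on_def by auto
  have "-b + fourier (\<lambda>x. Gm (- x)) \<xi> = 0" for \<xi>
    using b[of "of_real \<xi>"] eq[of \<xi>] FG[of \<xi>] by (simp add: fourier_eq_fourier_laplace fourier_laplace_reflect algebra_simps)
  then have "AE x in lborel. Gm (- x) = 0" using fourier_unique(2)[OF im', of "-b"] by blast
  then show ?thesis by eventually_elim (auto simp: Gm_def indicator_def split: if_splits)
qed

section \<open>Exponentially bounded functions and convolutions\<close>

lemma integral_sub: "(LBINT s. f (x - s)) = (LBINT s::real. (f s :: 'a::{banach,second_countable_topology}))"
  using lborel_integral_real_affine[of "-1" f x] by simp

lemma integral_shift: "(LBINT s. f (s + x)) = (LBINT s::real. (f s :: 'a::{banach,second_countable_topology}))"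
  using lborel_integral_real_affine[of 1 f x] by (simp add: add.commute)

lemma integrable_sub_iff: "integrable lborel (\<lambda>s. f (x - s)) \<longleftrightarrow> integrable lborel (f :: real \<Rightarrow> 'a::{banach,second_countable_topology})"
  using lborel_integrable_real_affine_iff[of "-1" f x] by simp

lemma integrable_shift_iff: "integrable lborel (\<lambda>s. f (s + x)) \<longleftrightarrow> integrable lborel (f :: real \<Rightarrow> 'a::{banach,second_countable_topology})"
  using lborel_integrable_real_affine_iff[of 1 f x] by (simp add: add.commute)

lemma integral_Ico_eq_Icc:
  fixes f :: "real \<Rightarrow> complex"
  assumes "f \<in> borel_measurable borel"
  shows "(LBINT x. indicator {a..<b} x *\<^sub>R f x) = (LBINT x. indicator {a..b} x *\<^sub>R f x)"
proof (rule bint_cong_AE)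
  have "AE x in lborel. x \<noteq> b" by (rule AE_lborel_singleton)
  then show "AE x in lborel. indicator {a..<b} x *\<^sub>R f x = indicator {a..b} x *\<^sub>R f x"
    by eventually_elim (auto simp: indicator_def)
qed (use assms in auto)

text \<open>Tonelli in a ready form: a majorant \<open>w\<close> for the inner \<open>L^1\<close>
  norms replaces the evaluation of an iterated integral of norms. The first argument of
  \<open>f\<close> is the variable in which the majorant is integrated.\<close>

lemma
  fixes f :: "real \<Rightarrow> real \<Rightarrow> complex" and w :: "real \<Rightarrow> real"
  assumes m: "case_prod f \<in> borel_measurable (lborel \<Otimes>\<^sub>M lborel)"
    and i: "\<And>s. integrable lborel (f s)"
    and w: "integrable lborel w" "\<And>s. (LBINT x. cmod (f s x)) \<le> w s"
  shows fubini_integrable: "integrable (lborel \<Otimes>\<^sub>M lborel) (case_prod f)"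
    and fubini_swap: "(LBINT x. LBINT s. f s x) = (LBINT s. LBINT x. f s x)"
    and fubini_integrable_snd: "integrable lborel (\<lambda>x. LBINT s. f s x)"
proof -
  show 1: "integrable (lborel \<Otimes>\<^sub>M lborel) (case_prod f)"
  proof (rule lborel_pair.Fubini_integrable[OF m])
    show "integrable lborel (\<lambda>s. LBINT x. norm (case (s, x) of (s, x) \<Rightarrow> f s x))"
    proof (rule integrable_dominated[OF w(1)])
      show "(\<lambda>s. LBINT x. norm (case (s, x) of (s, x) \<Rightarrow> f s x)) \<in> borel_measurable lborel"
        using m by measurable
      show "AE s in lborel. norm (LBINT x. norm (case (s, x) of (s, x) \<Rightarrow> f s x)) \<le> norm (w s)"
      proof (intro AE_I2)
        fix s
        have "0 \<le> (LBINT x. cmod (f s x))" by simp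
        then show "norm (LBINT x. norm (case (s, x) of (s, x) \<Rightarrow> f s x)) \<le> norm (w s)" using w(2)[of s] by simp
      qed
    qed
  qed (use i in simp)
  show "(LBINT x. LBINT s. f s x) = (LBINT s. LBINT x. f s x)"
    using lborel_pair.Fubini_integral[OF 1] .
  show "integrable lborel (\<lambda>x. LBINT s. f s x)"
    using lborel_pair.integrable_snd[OF 1] .
qed

definition conv :: "(real \<Rightarrow> complex) \<Rightarrow> (real \<Rightarrow> complex) \<Rightarrow> real \<Rightarrow> complex" where
  "conv f g x = (LBINT s. f (x - s) * g s)"

text \<open>The constants are carried explicitly because the kernel bounds below must be uniform in
  \<alpha>; functions sharing one pair \<open>C\<close>, \<open>\<eta>\<close> can then be estimated
  together.\<close>

definition exp_bounded :: "real \<Rightarrow> real \<Rightarrow> (real \<Rightarrow> complex) \<Rightarrow> bool" where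
  "exp_bounded C \<eta> U \<longleftrightarrow> U \<in> borel_measurable borel \<and> (\<forall>x. cmod (U x) \<le> C * exp (- \<eta> * \<bar>x\<bar>))"

definition weighted_L1 :: "real \<Rightarrow> (real \<Rightarrow> complex) \<Rightarrow> bool" where
  "weighted_L1 \<delta> k \<longleftrightarrow> k \<in> borel_measurable borel \<and> integrable lborel (\<lambda>x. exp (\<delta> * \<bar>x\<bar>) * cmod (k x))"

definition weighted_norm :: "real \<Rightarrow> (real \<Rightarrow> complex) \<Rightarrow> real" where
  "weighted_norm \<delta> k = (LBINT x. exp (\<delta> * \<bar>x\<bar>) * cmod (k x))"

text \<open>
  For \<open>x \<ge> 0\<close> this is the integral of \<open>k\<close> over \<open>{x<..}\<close>, for \<open>x < 0\<close> minus the integral over \<open>{..x}\<close>: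
  the primitive of \<open>-k\<close> that vanishes at both ends, up to a jump at \<open>0\<close>.
\<close>

definition tail :: "(real \<Rightarrow> complex) \<Rightarrow> real \<Rightarrow> complex" where
  "tail k x = (LBINT y. if x < y then k y else 0) - (if x < 0 then LBINT y. k y else 0)"

lemma conv_measurable [measurable]:
  assumes [measurable]: "f \<in> borel_measurable borel" "g \<in> borel_measurable borel"
  shows "conv f g \<in> borel_measurable borel"
  unfolding conv_def[abs_def] by measurable

lemma tail_measurable [measurable]:
  assumes [measurable]: "k \<in> borel_measurable borel"
  shows "tail k \<in> borel_measurable borel"
  unfolding tail_def[abs_def] by measurable

lemma integrable_exp_abs:
  assumes "\<eta> > 0" shows "integrable lborel (\<lambda>x::real. exp (- \<eta> * \<bar>x\<bar>))"
proof -
  have i: "integrable lborel (exponential_density \<eta>)"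
  proof (rule integrableI_nonneg)
    interpret prob_space "density lborel (exponential_density \<eta>)" by (rule prob_space_exponential_density[OF assms])
    show "(\<integral>\<^sup>+ x. ennreal (exponential_density \<eta> x) \<partial>lborel) < \<infinity>"
      using emeasure_space_1 by (subst (asm) emeasure_density) auto
  qed (use assms in \<open>auto simp: erlang_density_def\<close>)
  then have i2: "integrable lborel (\<lambda>x. exponential_density \<eta> (- x))"
    using integrable_reflect_iff[of "exponential_density \<eta>"] by simp
  have "integrable lborel (\<lambda>x. (exponential_density \<eta> x + exponential_density \<eta> (- x)) / \<eta>)"
    using i i2 by auto
  then show ?thesis
    by (rule integrable_dominated) (use assms in \<open>auto simp: exponential_density_def mult.commute\<close>)
qed

lemma exp_bounded_nonneg: "exp_bounded C \<eta> U \<Longrightarrow> 0 \<le> C"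
proof -
  assume "exp_bounded C \<eta> U"
  then have "cmod (U 0) \<le> C * exp (- \<eta> * \<bar>0\<bar>)" unfolding exp_bounded_def by blast
  then have "cmod (U 0) \<le> C" by simp
  with norm_ge_zero show ?thesis by (rule order_trans)
qed

lemma exp_bounded_mono:
  assumes "exp_bounded C \<eta> U" "C \<le> C'" "\<eta>' \<le> \<eta>" shows "exp_bounded C' \<eta>' U"
  unfolding exp_bounded_def
proof (intro conjI allI)
  show "U \<in> borel_measurable borel" using assms unfolding exp_bounded_def by simp
  fix x
  have "cmod (U x) \<le> C * exp (- \<eta> * \<bar>x\<bar>)" using assms unfolding exp_bounded_def by simp
  also have "\<dots> \<le> C' * exp (- \<eta>' * \<bar>x\<bar>)"
  proof (rule mult_mono)
    show "exp (- \<eta> * \<bar>x\<bar>) \<le> exp (- \<eta>' * \<bar>x\<bar>)" using mult_right_mono[OF assms(3), of "\<bar>x\<bar>"] by simp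
  qed (use exp_bounded_nonneg[OF assms(1)] assms(2) in auto)
  finally show "cmod (U x) \<le> C' * exp (- \<eta>' * \<bar>x\<bar>)" .
qed

lemma exp_bounded_le:
  assumes "exp_bounded C \<eta> U" "0 \<le> \<eta>" shows "cmod (U x) \<le> C"
proof -
  have "cmod (U x) \<le> C * exp (- \<eta> * \<bar>x\<bar>)" using assms unfolding exp_bounded_def by blast
  also have "\<dots> \<le> C * 1" using exp_bounded_nonneg[OF assms(1)] assms(2) by (intro mult_left_mono) auto
  finally show ?thesis by simp
qed

lemma exp_bounded_integrable:
  assumes "exp_bounded C \<eta> U" "\<eta> > 0" shows "integrable lborel U"
proof (rule integrable_dominated[where f = "\<lambda>x. C * exp (- \<eta> * \<bar>x\<bar>)"])
  show "integrable lborel (\<lambda>x. C * exp (- \<eta> * \<bar>x\<bar>))" using integrable_exp_abs[OF assms(2)] by simp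
  show "AE x in lborel. cmod (U x) \<le> norm (C * exp (- \<eta> * \<bar>x\<bar>))"
    using assms(1) exp_bounded_nonneg[OF assms(1)] by (auto simp: exp_bounded_def)
qed (use assms in \<open>auto simp: exp_bounded_def\<close>)

text \<open>Half of the decay rate is spent on integrability; this is one of the places where the
  final exponent shrinks to a fraction of the given one.\<close>

lemma exp_bounded_weighted_L1:
  assumes "exp_bounded C \<eta> U" "\<eta> > 0" shows "weighted_L1 (\<eta>/2) U"
  unfolding weighted_L1_def
proof
  show "integrable lborel (\<lambda>x. exp (\<eta>/2 * \<bar>x\<bar>) * cmod (U x))"
  proof (rule integrable_dominated[where f = "\<lambda>x. C * exp (- (\<eta>/2) * \<bar>x\<bar>)"])
    show "integrable lborel (\<lambda>x. C * exp (- (\<eta>/2) * \<bar>x\<bar>))" using integrable_exp_abs[of "\<eta>/2"] assms by simp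
    show "AE x in lborel. norm (exp (\<eta>/2 * \<bar>x\<bar>) * cmod (U x)) \<le> norm (C * exp (- (\<eta>/2) * \<bar>x\<bar>))"
    proof (intro AE_I2)
      fix x
      have "exp (\<eta>/2 * \<bar>x\<bar>) * cmod (U x) \<le> exp (\<eta>/2 * \<bar>x\<bar>) * (C * exp (- \<eta> * \<bar>x\<bar>))"
        using assms(1) by (intro mult_left_mono) (auto simp: exp_bounded_def)
      also have "\<dots> = C * exp (- (\<eta>/2) * \<bar>x\<bar>)" by (simp add: mult_ac exp_add[symmetric])
      finally show "norm (exp (\<eta>/2 * \<bar>x\<bar>) * cmod (U x)) \<le> norm (C * exp (- (\<eta>/2) * \<bar>x\<bar>))"
        using exp_bounded_nonneg[OF assms(1)] by (simp add: abs_mult)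
    qed
  qed (use assms in \<open>auto simp: exp_bounded_def\<close>)
qed (use assms in \<open>auto simp: exp_bounded_def\<close>)

lemma weighted_L1_mono:
  assumes "weighted_L1 \<delta> k" "\<delta>' \<le> \<delta>" shows "weighted_L1 \<delta>' k"
  unfolding weighted_L1_def
proof
  show "integrable lborel (\<lambda>x. exp (\<delta>' * \<bar>x\<bar>) * cmod (k x))"
    by (rule integrable_dominated[where f = "\<lambda>x. exp (\<delta> * \<bar>x\<bar>) * cmod (k x)"])
       (use assms in \<open>auto simp: weighted_L1_def abs_mult intro!: mult_right_mono\<close>)
qed (use assms in \<open>auto simp: weighted_L1_def\<close>)

lemma weighted_L1_integrable:
  assumes "weighted_L1 \<delta> k" "0 \<le> \<delta>" shows "integrable lborel k"
  using weighted_L1_mono[OF assms] unfolding weighted_L1_def by (auto simp: integrable_norm_iff)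

lemma weighted_L1_moment:
  assumes "weighted_L1 \<delta> k" "0 < \<delta>" shows "integrable lborel (\<lambda>x. of_real x * k x)"
proof (rule integrable_dominated[where f = "\<lambda>x. (exp (\<delta> * \<bar>x\<bar>) * cmod (k x)) / \<delta>"])
  show "AE x in lborel. cmod (of_real x * k x) \<le> norm ((exp (\<delta> * \<bar>x\<bar>) * cmod (k x)) / \<delta>)"
  proof (intro AE_I2)
    fix x
    have "\<delta> * \<bar>x\<bar> \<le> exp (\<delta> * \<bar>x\<bar>)" using exp_ge_add_one_self[of "\<delta> * \<bar>x\<bar>"] by linarith
    then have "\<delta> * \<bar>x\<bar> * cmod (k x) \<le> exp (\<delta> * \<bar>x\<bar>) * cmod (k x)" by (rule mult_right_mono) simp
    then show "cmod (of_real x * k x) \<le> norm ((exp (\<delta> * \<bar>x\<bar>) * cmod (k x)) / \<delta>)"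
      using assms(2) by (simp add: norm_mult field_simps)
  qed
qed (use assms in \<open>auto simp: weighted_L1_def\<close>)

text \<open>By \<open>\<bar>x\<bar> \<le> \<bar>x - s\<bar> + \<bar>s\<bar>\<close> the decay of
  \<open>U\<close> in \<open>s\<close> becomes decay in \<open>x\<close> at the price of a weight on
  \<open>k (x - s)\<close>. The rate is not diminished.\<close>

lemma conv_exp_bounded:
  assumes k: "weighted_L1 \<eta> k" and U: "exp_bounded C \<eta> U" and \<eta>: "\<eta> \<ge> 0"
  shows "exp_bounded (C * weighted_norm \<eta> k) \<eta> (conv k U)"
  unfolding exp_bounded_def
proof (intro conjI allI)
  show "conv k U \<in> borel_measurable borel" using k U by (auto simp: weighted_L1_def exp_bounded_def)
  fix x
  have i: "integrable lborel (\<lambda>s. exp (\<eta> * \<bar>x - s\<bar>) * cmod (k (x - s)))"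
    using k integrable_sub_iff[of "\<lambda>s. exp (\<eta> * \<bar>s\<bar>) * cmod (k s)" x] by (simp add: weighted_L1_def)
  have "cmod (conv k U x) \<le> (LBINT s. cmod (k (x - s) * U s))" unfolding conv_def by (rule integral_norm_bound)
  also have "\<dots> \<le> (LBINT s. C * exp (- \<eta> * \<bar>x\<bar>) * (exp (\<eta> * \<bar>x - s\<bar>) * cmod (k (x - s))))"
  proof (rule integral_mono')
    show "integrable lborel (\<lambda>s. C * exp (- \<eta> * \<bar>x\<bar>) * (exp (\<eta> * \<bar>x - s\<bar>) * cmod (k (x - s))))" using i by simp
    fix s
    have "- \<eta> * \<bar>s\<bar> \<le> - \<eta> * \<bar>x\<bar> + \<eta> * \<bar>x - s\<bar>"
      using mult_left_mono[of "\<bar>x\<bar>" "\<bar>x - s\<bar> + \<bar>s\<bar>" \<eta>] \<eta> by (simp add: algebra_simps)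
    then have "exp (- \<eta> * \<bar>s\<bar>) \<le> exp (- \<eta> * \<bar>x\<bar>) * exp (\<eta> * \<bar>x - s\<bar>)" by (simp add: exp_add[symmetric])
    then have "C * exp (- \<eta> * \<bar>s\<bar>) \<le> C * (exp (- \<eta> * \<bar>x\<bar>) * exp (\<eta> * \<bar>x - s\<bar>))"
      using exp_bounded_nonneg[OF U] by (rule mult_left_mono)
    moreover have "cmod (U s) \<le> C * exp (- \<eta> * \<bar>s\<bar>)" using U unfolding exp_bounded_def by simp
    ultimately have "cmod (U s) \<le> C * (exp (- \<eta> * \<bar>x\<bar>) * exp (\<eta> * \<bar>x - s\<bar>))" by linarith
    then have "cmod (k (x - s)) * cmod (U s) \<le> cmod (k (x - s)) * (C * (exp (- \<eta> * \<bar>x\<bar>) * exp (\<eta> * \<bar>x - s\<bar>)))"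
      by (rule mult_left_mono) simp
    then show "cmod (k (x - s) * U s) \<le> C * exp (- \<eta> * \<bar>x\<bar>) * (exp (\<eta> * \<bar>x - s\<bar>) * cmod (k (x - s)))"
      by (simp add: norm_mult mult_ac)
    show "0 \<le> C * exp (- \<eta> * \<bar>x\<bar>) * (exp (\<eta> * \<bar>x - s\<bar>) * cmod (k (x - s)))"
      using exp_bounded_nonneg[OF U] by simp
  qed
  also have "\<dots> = C * weighted_norm \<eta> k * exp (- \<eta> * \<bar>x\<bar>)"
    unfolding weighted_norm_def using integral_sub[of "\<lambda>s. exp (\<eta> * \<bar>s\<bar>) * cmod (k s)" x] by simp
  finally show "cmod (conv k U x) \<le> C * weighted_norm \<eta> k * exp (- \<eta> * \<bar>x\<bar>)" .
qed

lemma tail_eq_neg: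
  assumes "integrable lborel k" "x < 0"
  shows "tail k x = - (LBINT y. if x < y then 0 else k y)"
proof -
  have m: "k \<in> borel_measurable borel" using assms(1) borel_measurable_integrable by force
  have "(LBINT y. k y) = (LBINT y. (if x < y then k y else 0) + (if x < y then 0 else k y))"
    by (intro bint_cong) auto
  also have "\<dots> = (LBINT y. if x < y then k y else 0) + (LBINT y. if x < y then 0 else k y)"
    by (intro bint_add; rule integrable_dominated[OF assms(1)]) (use m in auto)
  finally show ?thesis using assms(2) unfolding tail_def by simp
qed

text \<open>On either side of 0 only values \<open>k y\<close> with
  \<open>\<bar>y\<bar> \<ge> \<bar>x\<bar>\<close> contribute, so the weight moves from
  \<open>y\<close> to \<open>x\<close>. For \<open>x < 0\<close> this relies on the form given by
  \<open>tail_eq_neg\<close>.\<close>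

lemma tail_exp_bounded:
  assumes k: "weighted_L1 \<delta> k" and \<delta>: "\<delta> \<ge> 0"
  shows "exp_bounded (weighted_norm \<delta> k) \<delta> (tail k)"
  unfolding exp_bounded_def
proof (intro conjI allI)
  have m[measurable]: "k \<in> borel_measurable borel" using k by (simp add: weighted_L1_def)
  show "tail k \<in> borel_measurable borel" by measurable
  fix x
  define h where "h y = (if x \<ge> 0 then (if x < y then k y else 0) else - (if x < y then 0 else k y))" for y
  have t: "tail k x = (LBINT y. h y)"
  proof (cases "x \<ge> 0")
    case True then show ?thesis by (simp add: tail_def h_def)
  next
    case False
    then show ?thesis using tail_eq_neg[OF weighted_L1_integrable[OF k \<delta>], of x] unfolding h_def by simp
  qed
  have "cmod (tail k x) \<le> (LBINT y. cmod (h y))" unfolding t by (rule integral_norm_bound)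
  also have "\<dots> \<le> (LBINT y. exp (- \<delta> * \<bar>x\<bar>) * (exp (\<delta> * \<bar>y\<bar>) * cmod (k y)))"
  proof (rule integral_mono')
    show "integrable lborel (\<lambda>y. exp (- \<delta> * \<bar>x\<bar>) * (exp (\<delta> * \<bar>y\<bar>) * cmod (k y)))" using k by (simp add: weighted_L1_def)
    fix y
    show "cmod (h y) \<le> exp (- \<delta> * \<bar>x\<bar>) * (exp (\<delta> * \<bar>y\<bar>) * cmod (k y))"
    proof (cases "\<bar>x\<bar> \<le> \<bar>y\<bar>")
      case True
      then have "1 \<le> exp (- \<delta> * \<bar>x\<bar>) * exp (\<delta> * \<bar>y\<bar>)"
        using mult_left_mono[of "\<bar>x\<bar>" "\<bar>y\<bar>" \<delta>] \<delta> by (simp add: exp_add[symmetric])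
      then have "1 * cmod (k y) \<le> exp (- \<delta> * \<bar>x\<bar>) * exp (\<delta> * \<bar>y\<bar>) * cmod (k y)"
        by (rule mult_right_mono) simp
      moreover have "cmod (h y) \<le> cmod (k y)" by (simp add: h_def)
      ultimately show ?thesis by (simp add: mult.assoc)
    next
      case False
      then have "h y = 0" unfolding h_def by auto
      then show ?thesis by simp
    qed
  qed simp
  also have "\<dots> = weighted_norm \<delta> k * exp (- \<delta> * \<bar>x\<bar>)" unfolding weighted_norm_def by simp
  finally show "cmod (tail k x) \<le> weighted_norm \<delta> k * exp (- \<delta> * \<bar>x\<bar>)" .
qed

lemma
  assumes k: "integrable lborel k" and U: "integrable lborel U"
  shows fourier_conv: "fourier (conv k U) \<xi> = fourier k \<xi> * fourier U \<xi>"
    and conv_integrable: "integrable lborel (conv k U)"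
proof -
  have mk[measurable]: "k \<in> borel_measurable borel" using k borel_measurable_integrable by force
  have mU[measurable]: "U \<in> borel_measurable borel" using U borel_measurable_integrable by force
  have ik: "integrable lborel (\<lambda>x. k (x - s))" for s
    using integrable_shift_iff[of k "-s"] k by simp
  have main: "(LBINT x. LBINT s. exp (\<i> * of_real (x * \<xi>)) * k (x - s) * U s) = (LBINT s. LBINT x. exp (\<i> * of_real (x * \<xi>)) * k (x - s) * U s)
      \<and> integrable lborel (\<lambda>x. LBINT s. exp (\<i> * of_real (x * \<xi>)) * k (x - s) * U s)" for \<xi>
  proof -
    have m: "(\<lambda>(s, x). exp (\<i> * of_real (x * \<xi>)) * k (x - s) * U s) \<in> borel_measurable (lborel \<Otimes>\<^sub>M lborel)" by measurable
    have i: "integrable lborel (\<lambda>x. exp (\<i> * of_real (x * \<xi>)) * k (x - s) * U s)" for s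
      using integrable_fourier_integrand[OF ik, of \<xi> s] by simp
    have w: "(LBINT x. cmod (exp (\<i> * of_real (x * \<xi>)) * k (x - s) * U s)) \<le> (LBINT x. cmod (k x)) * cmod (U s)" for s
      using integral_shift[of "\<lambda>x. cmod (k x)" "-s"] by (simp add: norm_mult)
    have wi: "integrable lborel (\<lambda>s. (LBINT x. cmod (k x)) * cmod (U s))" using U by simp
    show ?thesis using fubini_swap[OF m i wi w] fubini_integrable_snd[OF m i wi w] by blast
  qed
  show "integrable lborel (conv k U)"
    using main[of 0] by (simp add: conv_def[abs_def])
  have "fourier (conv k U) \<xi> = (LBINT x. LBINT s. exp (\<i> * of_real (x * \<xi>)) * k (x - s) * U s)"
    unfolding fourier_def conv_def by (simp add: mult.assoc del: of_real_mult)
  also have "\<dots> = (LBINT s. LBINT x. exp (\<i> * of_real (x * \<xi>)) * k (x - s) * U s)" using main by blast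
  also have "\<dots> = (LBINT s. fourier k \<xi> * (exp (\<i> * of_real (s * \<xi>)) * U s))"
  proof (rule bint_cong[OF refl])
    fix s
    have "(LBINT x. exp (\<i> * of_real (x * \<xi>)) * k (x - s) * U s) = (LBINT x. (\<lambda>x. exp (\<i> * of_real ((x + s) * \<xi>)) * k x * U s) (x + - s))"
      by simp
    also have "\<dots> = (LBINT x. exp (\<i> * of_real ((x + s) * \<xi>)) * k x * U s)" by (rule integral_shift)
    also have "\<dots> = (LBINT x. exp (\<i> * of_real (x * \<xi>)) * k x * (exp (\<i> * of_real (s * \<xi>)) * U s))"
      by (intro bint_cong) (auto simp: algebra_simps exp_add)
    also have "\<dots> = fourier k \<xi> * (exp (\<i> * of_real (s * \<xi>)) * U s)" unfolding fourier_def by simp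
    finally show "(LBINT x. exp (\<i> * of_real (x * \<xi>)) * k (x - s) * U s) = fourier k \<xi> * (exp (\<i> * of_real (s * \<xi>)) * U s)" .
  qed
  also have "\<dots> = fourier k \<xi> * fourier U \<xi>" unfolding fourier_def by simp
  finally show "fourier (conv k U) \<xi> = fourier k \<xi> * fourier U \<xi>" .
qed

text \<open>\<open>tail k\<close> is a superposition over \<open>y\<close>, with weight
  \<open>k y\<close>, of signed indicators of the interval between 0 and \<open>y\<close>. Each of
  them has \<open>L^1\<close> norm \<open>\<bar>y\<bar>\<close>, whence the moment condition, and
  transform \<open>(exp (\<i> * y * \<xi>) - 1) / (\<i> * \<xi>)\<close>, whence the division by the
  frequency.\<close>

lemma
  assumes k: "integrable lborel k" and mo: "integrable lborel (\<lambda>x. of_real x * k x)"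
  shows fourier_tail: "\<xi> \<noteq> 0 \<Longrightarrow> \<i> * of_real \<xi> * fourier (tail k) \<xi> = fourier k \<xi> - fourier k 0"
    and fourier_tail_0: "fourier (tail k) 0 = (LBINT x. of_real x * k x)"
    and tail_integrable: "integrable lborel (tail k)"
proof -
  have mk[measurable]: "k \<in> borel_measurable borel" using k borel_measurable_integrable by force
  \<comment> \<open>\<open>\<kappa> y\<close> is 1 on \<open>{0..<y}\<close> for positive
    \<open>y\<close> and -1 on \<open>{y..<0}\<close> for negative \<open>y\<close>; the half-open
    form matches the strict inequality in \<open>tail\<close>.\<close>
  define \<kappa> :: "real \<Rightarrow> real \<Rightarrow> real" where "\<kappa> y x = indicator {0..<y} x - indicator {y..<0} x" for y x
  have m\<kappa>[measurable]: "(\<lambda>(y, x). \<kappa> y x) \<in> borel_measurable (lborel \<Otimes>\<^sub>M lborel)"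
  proof -
    have "\<kappa> y x = (if 0 \<le> x \<and> x < y then 1 else 0) - (if y \<le> x \<and> x < 0 then 1 else 0)" for y x
      by (simp add: \<kappa>_def indicator_def)
    then show ?thesis by (simp only:) measurable
  qed
  have tk: "tail k x = (LBINT y. \<kappa> y x *\<^sub>R k y)" for x
  proof (cases "x < 0")
    case True
    show ?thesis unfolding tail_eq_neg[OF k True] \<kappa>_def using True
      by (subst Bochner_Integration.integral_minus[symmetric]) (intro bint_cong, auto simp: indicator_def)
  next
    case False
    then show ?thesis unfolding tail_def \<kappa>_def
      by simp (intro bint_cong, auto simp: indicator_def)
  qed
  have \<kappa>abs: "\<bar>\<kappa> y x\<bar> = indicator {min 0 y..<max 0 y} x" for y x
    by (auto simp: \<kappa>_def indicator_def)
  have i\<kappa>: "integrable lborel (\<kappa> y)" for y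
  proof -
    have e: "emeasure lborel {a..<b} < \<infinity>" for a b :: real by (cases "a \<le> b") auto
    show ?thesis
      unfolding \<kappa>_def[abs_def] by (intro Bochner_Integration.integrable_diff integrable_real_indicator e) auto
  qed
  have int\<kappa>: "(LBINT x. \<bar>\<kappa> y x\<bar>) = \<bar>y\<bar>" for y
    unfolding \<kappa>abs by (auto simp: min_def max_def)
  have main: "(LBINT x. LBINT y. exp (\<i> * of_real (x * \<xi>)) * (\<kappa> y x *\<^sub>R k y)) = (LBINT y. LBINT x. exp (\<i> * of_real (x * \<xi>)) * (\<kappa> y x *\<^sub>R k y))
      \<and> integrable lborel (\<lambda>x. LBINT y. exp (\<i> * of_real (x * \<xi>)) * (\<kappa> y x *\<^sub>R k y))" for \<xi>
  proof -
    have m: "(\<lambda>(y, x). exp (\<i> * of_real (x * \<xi>)) * (\<kappa> y x *\<^sub>R k y)) \<in> borel_measurable (lborel \<Otimes>\<^sub>M lborel)" by measurable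
    have i: "integrable lborel (\<lambda>x. exp (\<i> * of_real (x * \<xi>)) * (\<kappa> y x *\<^sub>R k y))" for y
      using integrable_fourier_integrand[of "\<lambda>x. \<kappa> y x *\<^sub>R k y" \<xi>] i\<kappa>[of y] by simp
    have w: "(LBINT x. cmod (exp (\<i> * of_real (x * \<xi>)) * (\<kappa> y x *\<^sub>R k y))) \<le> cmod (of_real y * k y)" for y
      by (simp add: norm_mult int\<kappa>)
    have wi: "integrable lborel (\<lambda>y. cmod (of_real y * k y))" using mo by (rule integrable_norm)
    show ?thesis using fubini_swap[OF m i wi w] fubini_integrable_snd[OF m i wi w] by blast
  qed
  show "integrable lborel (tail k)"
    using main[of 0] by (simp add: tk[abs_def])
  have F: "fourier (tail k) \<xi> = (LBINT y. k y * (LBINT x. \<kappa> y x *\<^sub>R exp (\<i> * of_real (x * \<xi>))))" for \<xi>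
  proof -
    have "fourier (tail k) \<xi> = (LBINT x. LBINT y. exp (\<i> * of_real (x * \<xi>)) * (\<kappa> y x *\<^sub>R k y))"
      unfolding fourier_def tk
      by (intro bint_cong refl) (rule bint_cmult[symmetric])
    also have "\<dots> = (LBINT y. LBINT x. exp (\<i> * of_real (x * \<xi>)) * (\<kappa> y x *\<^sub>R k y))" using main by blast
    also have "\<dots> = (LBINT y. LBINT x. k y * (\<kappa> y x *\<^sub>R exp (\<i> * of_real (x * \<xi>))))"
      by (simp add: mult_ac)
    finally show ?thesis unfolding bint_cmult .
  qed
  have e\<kappa>: "(LBINT x. \<kappa> y x *\<^sub>R f x) = (if y \<ge> 0 then (LBINT x. indicator {0..y} x *\<^sub>R f x) else - (LBINT x. indicator {y..0} x *\<^sub>R f x))"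
    if "f \<in> borel_measurable borel" for y and f :: "real \<Rightarrow> complex"
    using integral_Ico_eq_Icc[OF that, of 0 y] integral_Ico_eq_Icc[OF that, of y 0] unfolding \<kappa>_def by auto
  show "fourier (tail k) 0 = (LBINT x. of_real x * k x)"
    unfolding F using e\<kappa>[of "\<lambda>_. 1"]
    by (intro bint_cong) (auto simp: scaleR_conv_of_real[symmetric])
  show "\<i> * of_real \<xi> * fourier (tail k) \<xi> = fourier k \<xi> - fourier k 0" if "\<xi> \<noteq> 0"
  proof -
    have d: "((\<lambda>x::real. exp (\<i> * of_real (x * \<xi>)) / (\<i> * of_real \<xi>)) has_vector_derivative exp (\<i> * of_real (x * \<xi>))) (at x within S)" for x S
    proof -
      have "((\<lambda>w. exp (\<i> * of_real \<xi> * w)) has_field_derivative exp (\<i> * of_real \<xi> * of_real x) * (\<i> * of_real \<xi>)) (at (of_real x))"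
        by (auto intro!: derivative_eq_intros)
      from DERIV_cmult_right[OF this, of "1 / (\<i> * of_real \<xi>)"]
      have "((\<lambda>w. exp (\<i> * of_real \<xi> * w) * (1 / (\<i> * of_real \<xi>))) has_field_derivative exp (\<i> * of_real \<xi> * of_real x)) (at (of_real x))"
        using that by simp
      from has_vector_derivative_real_field[OF this] show ?thesis by (simp add: mult_ac)
    qed
    have I: "(LBINT x. \<kappa> y x *\<^sub>R exp (\<i> * of_real (x * \<xi>))) = (exp (\<i> * of_real (y * \<xi>)) - 1) / (\<i> * of_real \<xi>)" for y
    proof (cases "y \<ge> 0")
      case True
      have "(LBINT x. indicator {0..y} x *\<^sub>R exp (\<i> * of_real (x * \<xi>))) = exp (\<i> * of_real (y * \<xi>)) / (\<i> * of_real \<xi>) - exp (\<i> * of_real (0 * \<xi>)) / (\<i> * of_real \<xi>)"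
        by (rule integral_FTC_Icc[OF True d]) (intro continuous_intros)
      then show ?thesis using True by (simp add: e\<kappa> diff_divide_distrib)
    next
      case False
      then have "(LBINT x. indicator {y..0} x *\<^sub>R exp (\<i> * of_real (x * \<xi>))) = exp (\<i> * of_real (0 * \<xi>)) / (\<i> * of_real \<xi>) - exp (\<i> * of_real (y * \<xi>)) / (\<i> * of_real \<xi>)"
        by (intro integral_FTC_Icc[OF _ d]) (auto intro!: continuous_intros)
      then show ?thesis using False by (simp add: e\<kappa> diff_divide_distrib)
    qed
    have "\<i> * of_real \<xi> * fourier (tail k) \<xi> = (LBINT y. \<i> * of_real \<xi> * (k y * ((exp (\<i> * of_real (y * \<xi>)) - 1) / (\<i> * of_real \<xi>))))"
      unfolding F I by simp
    also have "\<dots> = (LBINT y. exp (\<i> * of_real (y * \<xi>)) * k y - exp (\<i> * of_real (y * 0)) * k y)"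
      using that by (intro bint_cong) (auto simp: field_simps)
    also have "\<dots> = fourier k \<xi> - fourier k 0"
      unfolding fourier_def using integrable_fourier_integrand[OF k] by (intro bint_diff)
    finally show ?thesis .
  qed
qed

section \<open>The Wiener-Hopf factors in the time domain\<close>

definition pfun :: "(real \<Rightarrow> complex) \<Rightarrow> real \<Rightarrow> complex" where
  "pfun U x = (if 0 < x then 1 else 0) + U x"

definition mfun :: "(real \<Rightarrow> complex) \<Rightarrow> real \<Rightarrow> complex" where
  "mfun U x = (if x < 0 then 1 else 0) + U x"

text \<open>
  If \<open>a + k^ = \<sigma>\<close> and \<open>c + U^ = u\<^sub>-\<close>, then \<open>a * c\<close> plus the Fourier transform of \<open>Splus a k c U\<close> is
  \<open>\<tau>\<^sub>-(0) \<sigma>/\<sigma>\<^sub>- = \<tau>\<^sub>-(0) \<sigma>\<^sub>+\<close>; likewise \<open>Sminus\<close> belongs to \<open>\<sigma>\<^sub>-\<close>.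
\<close>

definition Splus :: "complex \<Rightarrow> (real \<Rightarrow> complex) \<Rightarrow> complex \<Rightarrow> (real \<Rightarrow> complex) \<Rightarrow> real \<Rightarrow> complex" where
  "Splus a k c U x = a * mfun U x + c * k x + conv k (mfun U) x"

definition Sminus :: "complex \<Rightarrow> (real \<Rightarrow> complex) \<Rightarrow> complex \<Rightarrow> (real \<Rightarrow> complex) \<Rightarrow> real \<Rightarrow> complex" where
  "Sminus a k c U x = a * pfun U x + c * k x + conv k (pfun U) x"

lemma pfun_measurable [measurable]: "U \<in> borel_measurable borel \<Longrightarrow> pfun U \<in> borel_measurable borel"
  unfolding pfun_def[abs_def] by measurable

lemma mfun_measurable [measurable]: "U \<in> borel_measurable borel \<Longrightarrow> mfun U \<in> borel_measurable borel"
  unfolding mfun_def[abs_def] by measurable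

lemma conv_reflect: "conv (\<lambda>x. f (- x)) (\<lambda>x. g (- x)) x = conv f g (- x)"
proof -
  have "conv (\<lambda>x. f (- x)) (\<lambda>x. g (- x)) x = (LBINT s. (\<lambda>s. f (- x - s) * g s) (- s))"
    unfolding conv_def by simp
  also have "\<dots> = conv f g (- x)" unfolding conv_def by (rule integral_reflect)
  finally show ?thesis .
qed

lemma mfun_reflect: "mfun (\<lambda>x. U (- x)) x = pfun U (- x)"
  by (simp add: mfun_def pfun_def)

lemma pfun_reflect: "pfun (\<lambda>x. U (- x)) x = mfun U (- x)"
  by (simp add: mfun_def pfun_def)

lemma Splus_reflect: "Splus a (\<lambda>x. k (- x)) c (\<lambda>x. U (- x)) x = Sminus a k c U (- x)"
  unfolding Splus_def Sminus_def
  using conv_reflect[of k "pfun U" x] by (simp add: mfun_reflect[abs_def])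

lemma Sminus_reflect: "Sminus a (\<lambda>x. k (- x)) c (\<lambda>x. U (- x)) x = Splus a k c U (- x)"
  unfolding Splus_def Sminus_def
  using conv_reflect[of k "mfun U" x] by (simp add: pfun_reflect[abs_def])

lemma integrable_conv_integrand:
  fixes k U :: "real \<Rightarrow> complex"
  assumes "integrable lborel k" "U \<in> borel_measurable borel" "\<And>x. cmod (U x) \<le> C"
  shows "integrable lborel (\<lambda>s. k (x - s) * U s)"
proof (rule integrable_dominated[where f = "\<lambda>s. C * cmod (k (x - s))"])
  have m[measurable]: "k \<in> borel_measurable borel" using assms(1) borel_measurable_integrable by force
  show "integrable lborel (\<lambda>s. C * cmod (k (x - s)))"
    using integrable_sub_iff[of "\<lambda>s. C * cmod (k s)" x] assms(1) by simp
  show "(\<lambda>s. k (x - s) * U s) \<in> borel_measurable lborel" using assms(2) by measurable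
  have C: "C \<ge> 0" using order_trans[OF norm_ge_zero assms(3)] .
  show "AE s in lborel. cmod (k (x - s) * U s) \<le> norm (C * cmod (k (x - s)))"
  proof (intro AE_I2)
    fix s
    have "cmod (k (x - s)) * cmod (U s) \<le> cmod (k (x - s)) * C" by (intro mult_left_mono assms) simp
    then show "cmod (k (x - s) * U s) \<le> norm (C * cmod (k (x - s)))"
      using C by (simp add: norm_mult mult.commute)
  qed
qed

lemma i_mult_neg_i: "\<i> * x * (- \<i> * y) = x * y"
  by (simp add: complex_eq_iff)

lemma integrable_if:
  fixes k :: "real \<Rightarrow> complex"
  assumes "integrable lborel k" "Measurable.pred borel P"
  shows "integrable lborel (\<lambda>y. if P y then k y else (0::complex))"
proof (rule integrable_dominated[OF assms(1)])
  have m[measurable]: "k \<in> borel_measurable borel" using assms(1) borel_measurable_integrable by force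
  show "(\<lambda>y. if P y then k y else (0::complex)) \<in> borel_measurable lborel" using assms(2) by measurable
qed auto

text \<open>The step in \<open>mfun\<close> turns the convolution into a one-sided integral of
  \<open>k\<close>, which is the first term of \<open>tail\<close>.\<close>

lemma conv_mfun:
  assumes k: "integrable lborel k" and U: "U \<in> borel_measurable borel" "\<And>x. cmod (U x) \<le> C"
  shows "conv k (mfun U) x = (LBINT y. if x < y then k y else 0) + conv k U x"
proof -
  have i1: "integrable lborel (\<lambda>s. k (x - s) * (if s < 0 then 1 else 0))"
    by (rule integrable_conv_integrand[OF k, of _ 1]) auto
  have "conv k (mfun U) x = (LBINT s. k (x - s) * (if s < 0 then 1 else 0) + k (x - s) * U s)"
    unfolding conv_def mfun_def by (simp add: algebra_simps)
  also have "\<dots> = (LBINT s. k (x - s) * (if s < 0 then 1 else 0)) + conv k U x"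
    unfolding conv_def by (rule bint_add[OF i1 integrable_conv_integrand[OF k U]])
  also have "(LBINT s. k (x - s) * (if s < 0 then 1 else 0)) = (LBINT s. (\<lambda>y. if x < y then k y else 0) (x - s))"
    by (intro bint_cong) auto
  also have "\<dots> = (LBINT y. if x < y then k y else 0)" by (rule integral_sub)
  finally show ?thesis .
qed

lemma conv_pfun:
  assumes k: "integrable lborel k" and U: "U \<in> borel_measurable borel" "\<And>x. cmod (U x) \<le> C"
  shows "conv k (pfun U) x = (LBINT y. if y < x then k y else 0) + conv k U x"
proof -
  have i1: "integrable lborel (\<lambda>s. k (x - s) * (if 0 < s then 1 else 0))"
    by (rule integrable_conv_integrand[OF k, of _ 1]) auto
  have "conv k (pfun U) x = (LBINT s. k (x - s) * (if 0 < s then 1 else 0) + k (x - s) * U s)"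
    unfolding conv_def pfun_def by (simp add: algebra_simps)
  also have "\<dots> = (LBINT s. k (x - s) * (if 0 < s then 1 else 0)) + conv k U x"
    unfolding conv_def by (rule bint_add[OF i1 integrable_conv_integrand[OF k U]])
  also have "(LBINT s. k (x - s) * (if 0 < s then 1 else 0)) = (LBINT s. (\<lambda>y. if y < x then k y else 0) (x - s))"
    by (intro bint_cong) auto
  also have "\<dots> = (LBINT y. if y < x then k y else 0)" by (rule integral_sub)
  finally show ?thesis .
qed

lemma fourier_add:
  assumes "integrable lborel f" "integrable lborel g"
  shows "fourier (\<lambda>x. f x + g x) \<xi> = fourier f \<xi> + fourier g \<xi>"
  unfolding fourier_def ring_distribs
  by (intro bint_add integrable_fourier_integrand assms)

lemma fourier_cmult: "fourier (\<lambda>x. c * f x) \<xi> = c * fourier f \<xi>"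
proof -
  have "fourier (\<lambda>x. c * f x) \<xi> = (LBINT x. c * (exp (\<i> * of_real (x * \<xi>)) * f x))"
    unfolding fourier_def by (intro bint_cong) (auto simp: mult_ac)
  then show ?thesis unfolding fourier_def by simp
qed

lemma fourier_0: "fourier f 0 = (LBINT x. f x)"
  unfolding fourier_def by simp

lemma fourier_reflect: "fourier (\<lambda>x. f (- x)) \<xi> = fourier f (- \<xi>)"
  unfolding fourier_eq_fourier_laplace fourier_laplace_reflect by simp

lemma continuous_eq_at_0:
  fixes f g :: "real \<Rightarrow> complex"
  assumes "continuous_on UNIV f" "continuous_on UNIV g" "\<And>x. x \<noteq> 0 \<Longrightarrow> f x = g x"
  shows "f 0 = g 0"
proof -
  have "(f \<longlongrightarrow> f 0) (at 0)" "(g \<longlongrightarrow> g 0) (at 0)"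
    using assms by (auto simp: continuous_on_eq_continuous_at isCont_def)
  moreover have "(f \<longlongrightarrow> f 0) (at 0) \<longleftrightarrow> (g \<longlongrightarrow> f 0) (at 0)"
    by (rule tendsto_cong) (auto simp: eventually_at_filter assms(3))
  ultimately have "(g \<longlongrightarrow> f 0) (at 0)" by simp
  then show ?thesis using \<open>(g \<longlongrightarrow> g 0) (at 0)\<close> by (rule tendsto_unique[rotated]) simp
qed

lemma exp_bounded_reflect:
  assumes "exp_bounded C \<eta> U" shows "exp_bounded C \<eta> (\<lambda>x. U (- x))"
  unfolding exp_bounded_def
proof (intro conjI allI)
  have [measurable]: "U \<in> borel_measurable borel" using assms by (simp add: exp_bounded_def)
  show "(\<lambda>x. U (- x)) \<in> borel_measurable borel" by measurable
  fix x
  have "cmod (U (- x)) \<le> C * exp (- \<eta> * \<bar>- x\<bar>)" using assms unfolding exp_bounded_def by blast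
  then show "cmod (U (- x)) \<le> C * exp (- \<eta> * \<bar>x\<bar>)" by simp
qed

text \<open>\<open>eqp\<close> and \<open>eqm\<close> are the definitions of u_+ and u_- cleared of
  denominators, a form that stays valid at frequency 0, where it says that \<open>t\<close> is the
  common value of both factors. The list of assumptions is arranged to be symmetric under reflection
  of the line.\<close>

locale wh_fourier =
  fixes a cp cm t :: complex and k Up Um :: "real \<Rightarrow> complex" and Tp Tm :: "complex \<Rightarrow> complex"
    and \<delta> \<eta> C K :: real
  assumes eta: "0 < \<eta>" and eta_le: "\<eta> \<le> \<delta>" and k: "weighted_L1 \<delta> k"
    and symbol: "\<And>\<xi>::real. a + fourier k \<xi> = (of_real \<xi>)\<^sup>2 * (Tm (of_real \<xi>) * Tp (of_real \<xi>))"
    and Tp: "continuous_on {z. Im z \<ge> 0} Tp" "Tp holomorphic_on {z. Im z > 0}"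
    and Tm: "continuous_on {z. Im z \<le> 0} Tm" "Tm holomorphic_on {z. Im z < 0}"
    and K: "\<And>x::real. cmod (of_real x * Tp (of_real x)) \<le> K" "\<And>x::real. cmod (of_real x * Tm (of_real x)) \<le> K"
    and t: "t \<noteq> 0"
    and eqp: "\<And>\<xi>::real. Tp (of_real \<xi>) * (1 - \<i> * of_real \<xi> * (cp + fourier Up \<xi>)) = t"
    and eqm: "\<And>\<xi>::real. Tm (of_real \<xi>) * (1 + \<i> * of_real \<xi> * (cm + fourier Um \<xi>)) = t"
    and Up: "exp_bounded C \<eta> Up" "\<And>x. x < 0 \<Longrightarrow> Up x = 0"
    and Um: "exp_bounded C \<eta> Um" "\<And>x. 0 < x \<Longrightarrow> Um x = 0"
begin

lemma delta: "0 < \<delta>" using eta eta_le by simp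

lemma reflected: "wh_fourier a cm cp t (\<lambda>x. k (- x)) (\<lambda>x. Um (- x)) (\<lambda>x. Up (- x)) (\<lambda>z. Tm (- z)) (\<lambda>z. Tp (- z)) \<delta> \<eta> C K"
proof
  show "0 < \<eta>" "\<eta> \<le> \<delta>" "t \<noteq> 0" by (fact eta eta_le t)+
  show "weighted_L1 \<delta> (\<lambda>x. k (- x))"
    using k integrable_reflect_iff[of "\<lambda>x. exp (\<delta> * \<bar>x\<bar>) * cmod (k x)"]
      measurable_compose[OF borel_measurable_uminus[OF measurable_ident_sets[OF refl]], of k borel]
    by (simp add: weighted_L1_def)
  show "a + fourier (\<lambda>x. k (- x)) \<xi> = (of_real \<xi>)\<^sup>2 * (Tp (- of_real \<xi>) * Tm (- of_real \<xi>))" for \<xi>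
    using symbol[of "- \<xi>"] by (simp add: fourier_reflect mult.commute)
  show "continuous_on {z. Im z \<ge> 0} (\<lambda>z. Tm (- z))"
    by (rule continuous_on_compose2[OF Tm(1)]) (auto intro!: continuous_intros)
  show "continuous_on {z. Im z \<le> 0} (\<lambda>z. Tp (- z))"
    by (rule continuous_on_compose2[OF Tp(1)]) (auto intro!: continuous_intros)
  have "(Tm \<circ> uminus) holomorphic_on {z. Im z > 0}"
    by (rule holomorphic_on_compose_gen[OF _ Tm(2)]) (auto intro!: holomorphic_intros)
  then show "(\<lambda>z. Tm (- z)) holomorphic_on {z. Im z > 0}" by (simp add: o_def)
  have "(Tp \<circ> uminus) holomorphic_on {z. Im z < 0}"
    by (rule holomorphic_on_compose_gen[OF _ Tp(2)]) (auto intro!: holomorphic_intros)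
  then show "(\<lambda>z. Tp (- z)) holomorphic_on {z. Im z < 0}" by (simp add: o_def)
  show "cmod (of_real x * Tm (- of_real x)) \<le> K" "cmod (of_real x * Tp (- of_real x)) \<le> K" for x
    using K[of "- x"] by (simp_all add: norm_mult)
  show "Tm (- of_real \<xi>) * (1 - \<i> * of_real \<xi> * (cm + fourier (\<lambda>x. Um (- x)) \<xi>)) = t" for \<xi>
    using eqm[of "- \<xi>"] by (simp add: fourier_reflect)
  show "Tp (- of_real \<xi>) * (1 + \<i> * of_real \<xi> * (cp + fourier (\<lambda>x. Up (- x)) \<xi>)) = t" for \<xi>
    using eqp[of "- \<xi>"] by (simp add: fourier_reflect)
  show "exp_bounded C \<eta> (\<lambda>x. Um (- x))" "exp_bounded C \<eta> (\<lambda>x. Up (- x))"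
    using Um(1) Up(1) by (auto intro: exp_bounded_reflect)
qed (use Um Up in auto)

section \<open>Vanishing moments of \<open>k\<close>, and the one-sided density of the plus
  factor\<close>

lemma k_int: "integrable lborel k" using weighted_L1_integrable[OF k] delta by simp
lemma k_moment: "integrable lborel (\<lambda>x. of_real x * k x)" using weighted_L1_moment[OF k delta] .
lemma k_meas [measurable]: "k \<in> borel_measurable borel" using k by (simp add: weighted_L1_def)
lemma k_eta: "weighted_L1 \<eta> k" using weighted_L1_mono[OF k eta_le] .
lemma Up_int: "integrable lborel Up" using exp_bounded_integrable[OF Up(1) eta] .
lemma Um_int: "integrable lborel Um" using exp_bounded_integrable[OF Um(1) eta] .
lemma Up_meas [measurable]: "Up \<in> borel_measurable borel" using Up(1) by (simp add: exp_bounded_def)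
lemma Um_meas [measurable]: "Um \<in> borel_measurable borel" using Um(1) by (simp add: exp_bounded_def)
lemma Up_le: "cmod (Up x) \<le> C" using exp_bounded_le[OF Up(1)] eta by simp
lemma Um_le: "cmod (Um x) \<le> C" using exp_bounded_le[OF Um(1)] eta by simp

lemma int_k: "(LBINT x. k x) = - a"
  using symbol[of 0] by (simp add: fourier_0 eq_neg_iff_add_eq_0 add.commute)

lemma factors_continuous:
  "continuous_on UNIV (\<lambda>\<xi>::real. Tp (of_real \<xi>))" "continuous_on UNIV (\<lambda>\<xi>::real. Tm (of_real \<xi>))"
  by (rule continuous_on_compose2[OF Tp(1)] continuous_on_compose2[OF Tm(1)]; auto intro!: continuous_intros)+

text \<open>This is the second order of the zero of \<sigma>: away from 0 the transform of
  \<open>tail k\<close> is \<sigma> divided by \<open>\<i> * \<xi>\<close>, which tends to 0 at the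
  origin, and by continuity its value there is the first moment.\<close>

lemma moment_k: "(LBINT x. of_real x * k x) = 0"
proof -
  have "fourier (tail k) 0 = (- \<i> * of_real (0::real) * (Tm (of_real 0) * Tp (of_real 0)))"
  proof (rule continuous_eq_at_0)
    show "continuous_on UNIV (fourier (tail k))"
      by (rule continuous_on_fourier[OF tail_integrable[OF k_int k_moment]])
    show "continuous_on UNIV (\<lambda>\<xi>::real. - \<i> * of_real \<xi> * (Tm (of_real \<xi>) * Tp (of_real \<xi>)))"
      by (intro continuous_intros factors_continuous)
    fix \<xi> :: real assume \<xi>: "\<xi> \<noteq> 0"
    have "\<i> * of_real \<xi> * fourier (tail k) \<xi> = (of_real \<xi>)\<^sup>2 * (Tm (of_real \<xi>) * Tp (of_real \<xi>))"
      using fourier_tail[OF k_int k_moment \<xi>] symbol[of \<xi>] int_k by (simp add: fourier_0 add.commute)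
    also have "\<dots> = \<i> * of_real \<xi> * (- \<i> * (of_real \<xi> * (Tm (of_real \<xi>) * Tp (of_real \<xi>))))"
      unfolding i_mult_neg_i by (simp add: power2_eq_square mult.assoc)
    finally show "fourier (tail k) \<xi> = - \<i> * of_real \<xi> * (Tm (of_real \<xi>) * Tp (of_real \<xi>))"
      using \<xi> by (subst (asm) mult_left_cancel) (auto simp: mult.assoc)
  qed
  then show ?thesis using fourier_tail_0[OF k_int k_moment] by simp
qed

lemma cp_nz: "cp \<noteq> 0"
  by (rule factor_bounded_in_half_plane(1)[OF Tp K(1) t Up_int Up(2) eqp])

lemma cm_nz: "cm \<noteq> 0"
  using wh_fourier.cp_nz[OF reflected] .

text \<open>The steps contributed by \<open>a * mfun Um\<close> and by
  \<open>conv k (mfun Um)\<close> do not decay separately. Since \<open>k\<close> has integral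
  \<open>- a\<close>, they combine into \<open>tail k\<close>, and only the term
  \<open>cm * k\<close> is left without a pointwise bound.\<close>

lemma Splus_eq: "Splus a k cm Um x = cm * k x + (conv k Um x + a * Um x + tail k x)"
  unfolding Splus_def conv_mfun[OF k_int Um_meas Um_le] tail_def int_k
  by (simp add: mfun_def algebra_simps)

lemma rest_exp_bounded: "\<exists>C'. exp_bounded C' \<eta> (\<lambda>x. conv k Um x + a * Um x + tail k x)"
proof -
  have 1: "exp_bounded (C * weighted_norm \<eta> k) \<eta> (conv k Um)" by (rule conv_exp_bounded[OF k_eta Um(1)]) (use eta in simp)
  have 2: "exp_bounded (weighted_norm \<eta> k) \<eta> (tail k)" by (rule tail_exp_bounded[OF k_eta]) (use eta in simp)
  have "exp_bounded (C * weighted_norm \<eta> k + cmod a * C + weighted_norm \<eta> k) \<eta> (\<lambda>x. conv k Um x + a * Um x + tail k x)"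
    unfolding exp_bounded_def
  proof (intro conjI allI)
    show "(\<lambda>x. conv k Um x + a * Um x + tail k x) \<in> borel_measurable borel" by measurable
    fix x
    have "cmod (conv k Um x + a * Um x + tail k x) \<le> cmod (conv k Um x) + cmod a * cmod (Um x) + cmod (tail k x)"
      using norm_triangle_ineq[of "conv k Um x + a * Um x" "tail k x"] norm_triangle_ineq[of "conv k Um x" "a * Um x"]
      by (simp add: norm_mult)
    also have "\<dots> \<le> C * weighted_norm \<eta> k * exp (- \<eta> * \<bar>x\<bar>) + cmod a * (C * exp (- \<eta> * \<bar>x\<bar>)) + weighted_norm \<eta> k * exp (- \<eta> * \<bar>x\<bar>)"
      using 1 2 Um(1) by (intro add_mono mult_left_mono) (auto simp: exp_bounded_def)
    finally show "cmod (conv k Um x + a * Um x + tail k x) \<le> (C * weighted_norm \<eta> k + cmod a * C + weighted_norm \<eta> k) * exp (- \<eta> * \<bar>x\<bar>)"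
      by (simp add: algebra_simps)
  qed
  then show ?thesis by blast
qed

lemma Splus_integrable: "integrable lborel (Splus a k cm Um)"
proof -
  obtain C' where "exp_bounded C' \<eta> (\<lambda>x. conv k Um x + a * Um x + tail k x)" using rest_exp_bounded by blast
  then have "integrable lborel (\<lambda>x. conv k Um x + a * Um x + tail k x)" using eta by (rule exp_bounded_integrable)
  then have "integrable lborel (\<lambda>x. cm * k x + (conv k Um x + a * Um x + tail k x))"
    using k_int by (intro Bochner_Integration.integrable_add[OF integrable_mult_right])
  then show ?thesis by (simp add: Splus_eq[abs_def])
qed

text \<open>Away from 0 both sides are multiplied by \<open>\<i> * \<xi>\<close>, which removes the
  pole of the step and leaves an algebraic identity settled by \<open>symbol\<close> and
  \<open>eqm\<close>. At 0 the two moment conditions on \<open>k\<close> make the left side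
  vanish.\<close>

lemma fourier_Splus: "a * cm + fourier (Splus a k cm Um) \<xi> = - \<i> * of_real \<xi> * t * Tp (of_real \<xi>)"
proof -
  note ti = tail_integrable[OF k_int k_moment]
  note ci = conv_integrable[OF k_int Um_int]
  have F: "fourier (Splus a k cm Um) \<xi> = cm * fourier k \<xi> + (fourier k \<xi> * fourier Um \<xi> + a * fourier Um \<xi> + fourier (tail k) \<xi>)"
    unfolding Splus_eq[abs_def] using ti ci k_int Um_int
    by (simp add: fourier_add fourier_cmult fourier_conv)
  show ?thesis
  proof (cases "\<xi> = 0")
    case True
    then show ?thesis unfolding F using int_k
      by (simp add: fourier_0 fourier_tail_0[OF k_int k_moment, unfolded fourier_0] moment_k)
  next
    case False
    have T: "\<i> * of_real \<xi> * fourier (tail k) \<xi> = a + fourier k \<xi>"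
      using fourier_tail[OF k_int k_moment False] int_k by (simp add: fourier_0 add.commute)
    have "\<i> * of_real \<xi> * (a * cm + fourier (Splus a k cm Um) \<xi>)
        = (a + fourier k \<xi>) * (\<i> * of_real \<xi> * (cm + fourier Um \<xi>)) + \<i> * of_real \<xi> * fourier (tail k) \<xi>"
      unfolding F by (simp add: algebra_simps)
    also have "\<dots> = (a + fourier k \<xi>) * (1 + \<i> * of_real \<xi> * (cm + fourier Um \<xi>))"
      unfolding T by (simp add: algebra_simps)
    also have "\<dots> = (of_real \<xi>)\<^sup>2 * Tp (of_real \<xi>) * t"
      unfolding symbol eqm[of \<xi>, symmetric] by (simp add: mult_ac)
    also have "\<dots> = \<i> * of_real \<xi> * (- \<i> * (of_real \<xi> * t * Tp (of_real \<xi>)))"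
      unfolding i_mult_neg_i by (simp add: power2_eq_square mult_ac)
    finally have "a * cm + fourier (Splus a k cm Um) \<xi> = - \<i> * (of_real \<xi> * t * Tp (of_real \<xi>))"
      using False by (subst (asm) mult_left_cancel) auto
    then show ?thesis by (simp add: mult.assoc)
  qed
qed

lemma Splus_zero: "AE x in lborel. x < 0 \<longrightarrow> Splus a k cm Um x = 0"
proof -
  obtain K' where K': "\<And>z. Im z \<ge> 0 \<Longrightarrow> cmod (z * Tp z) \<le> K'"
    using factor_bounded_in_half_plane(2)[OF Tp K(1) t Up_int Up(2) eqp] by blast
  show ?thesis
  proof (rule vanish_on_negative_half_line[where S = "\<lambda>z. - \<i> * z * t * Tp z" and c = "a * cm" and K = "cmod t * K'"])
    show "continuous_on {z. Im z \<ge> 0} (\<lambda>z. - \<i> * z * t * Tp z)" by (intro continuous_intros Tp)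
    show "(\<lambda>z. - \<i> * z * t * Tp z) holomorphic_on {z. Im z > 0}" by (intro holomorphic_intros Tp)
    show "cmod (- \<i> * z * t * Tp z) \<le> cmod t * K'" if "Im z \<ge> 0" for z
      using mult_left_mono[OF K'[OF that], of "cmod t"] by (simp add: norm_mult mult_ac)
  qed (rule Splus_integrable fourier_Splus)+
qed

lemma int_Splus: "(LBINT x. Splus a k cm Um x) = - a * cm"
  using fourier_Splus[of 0] by (simp add: fourier_0 eq_neg_iff_add_eq_0 add.commute)

text \<open>The product of \<open>t * sigma_+\<close> with \<open>t / sigma_+\<close> is the
  constant \<open>t\<^sup>2\<close>. By uniqueness of transforms the point mass of the product is
  \<open>t\<^sup>2\<close> and its density vanishes almost everywhere.\<close>

lemma product_identity:
  assumes mo: "integrable lborel (\<lambda>x. of_real x * Splus a k cm Um x)"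
  shows "a * cm * cp = t\<^sup>2"
    "AE x in lborel. a * cm * pfun Up x + cp * Splus a k cm Um x + conv (Splus a k cm Um) (pfun Up) x = 0"
proof -
  define G where "G = Splus a k cm Um"
  have Gi: "integrable lborel G" unfolding G_def by (rule Splus_integrable)
  have mo: "integrable lborel (\<lambda>x. of_real x * G x)" using mo G_def by simp
  have intG: "(LBINT x. G x) = - a * cm" unfolding G_def by (rule int_Splus)
  \<comment> \<open>\<open>h\<close> below is the density of the product once its nondecaying steps
    are combined into \<open>- tail G\<close>, which makes it integrable. Keeping -1 opaque lets
    \<open>fourier_cmult\<close> match that term.\<close>
  define n :: complex where "n = -1"
  define h where "h = (\<lambda>x. cp * G x + a * cm * Up x + conv G Up x + n * tail G x)"
  note ti = tail_integrable[OF Gi mo]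
  note ci = conv_integrable[OF Gi Up_int]
  have hi: "integrable lborel h" unfolding h_def using ti ci Gi Up_int by auto
  have F: "fourier h \<xi> = cp * fourier G \<xi> + a * cm * fourier Up \<xi> + fourier G \<xi> * fourier Up \<xi> + n * fourier (tail G) \<xi>" for \<xi>
    unfolding h_def using ti ci Gi Up_int
    by (simp add: fourier_add fourier_cmult fourier_conv)
  have z: "(a * cm * cp - t\<^sup>2) + fourier h \<xi> = 0" if "\<xi> \<noteq> 0" for \<xi>
  proof -
    have T: "\<i> * of_real \<xi> * fourier (tail G) \<xi> = a * cm + fourier G \<xi>"
      using fourier_tail[OF Gi mo that] intG by (simp add: fourier_0 add.commute)
    have S: "a * cm + fourier G \<xi> = - \<i> * of_real \<xi> * t * Tp (of_real \<xi>)"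
      unfolding G_def by (rule fourier_Splus)
    have "\<i> * of_real \<xi> * ((a * cm * cp - t\<^sup>2) + fourier h \<xi>)
       = (a * cm + fourier G \<xi>) * (\<i> * of_real \<xi> * (cp + fourier Up \<xi>)) - \<i> * of_real \<xi> * t\<^sup>2 - \<i> * of_real \<xi> * fourier (tail G) \<xi>"
      unfolding F n_def by (simp add: algebra_simps)
    also have "\<dots> = - (a * cm + fourier G \<xi>) * (1 - \<i> * of_real \<xi> * (cp + fourier Up \<xi>)) - \<i> * of_real \<xi> * t\<^sup>2"
      unfolding T by (simp add: algebra_simps)
    also have "\<dots> = \<i> * of_real \<xi> * t * (Tp (of_real \<xi>) * (1 - \<i> * of_real \<xi> * (cp + fourier Up \<xi>))) - \<i> * of_real \<xi> * t\<^sup>2"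
      unfolding S by (simp add: mult_ac)
    also have "\<dots> = 0" unfolding eqp by (simp add: power2_eq_square)
    finally show ?thesis using that by simp
  qed
  show "a * cm * cp = t\<^sup>2" using fourier_unique(1)[OF hi z] by simp
  have "AE x in lborel. h x = 0" using fourier_unique(2)[OF hi z] by simp
  \<comment> \<open>At 0 the step in \<open>pfun\<close> and the jump of \<open>tail\<close> follow
    different conventions, so this single point is discarded.\<close>
  moreover have "AE x in lborel. x \<noteq> (0::real)" by (rule AE_lborel_singleton)
  ultimately show "AE x in lborel. a * cm * pfun Up x + cp * Splus a k cm Um x + conv (Splus a k cm Um) (pfun Up) x = 0"
  proof eventually_elim
    case (elim x)
    have "(LBINT y. if x < y then G y else 0) + (LBINT y. if y < x then G y else 0) = (LBINT y. (if x < y then G y else 0) + (if y < x then G y else 0))"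
      by (rule bint_add[symmetric]) (auto intro!: integrable_if Gi)
    also have "\<dots> = (LBINT y. G y)"
    proof (rule bint_cong_AE)
      have [measurable]: "G \<in> borel_measurable borel" using Gi borel_measurable_integrable by force
      show "(\<lambda>y. (if x < y then G y else 0) + (if y < x then G y else 0)) \<in> borel_measurable lborel" by measurable
      show "G \<in> borel_measurable lborel" by measurable
      have "AE y in lborel. y \<noteq> x" by (rule AE_lborel_singleton)
      then show "AE y in lborel. (if x < y then G y else 0) + (if y < x then G y else 0) = G y" by eventually_elim auto
    qed
    finally have PQ: "(LBINT y. if y < x then G y else 0) = - a * cm - (LBINT y. if x < y then G y else 0)"
      unfolding intG by (simp add: algebra_simps)
    have E: "(if 0 < x then a * cm else 0) + (LBINT y. if y < x then G y else 0) = - tail G x"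
      unfolding tail_def intG PQ using elim by (cases "x < 0") simp_all
    have H: "cp * G x + a * cm * Up x + conv G Up x = tail G x" using elim unfolding h_def n_def by simp
    have "a * cm * pfun Up x + cp * G x + conv G (pfun Up) x
        = (cp * G x + a * cm * Up x + conv G Up x) + ((if 0 < x then a * cm else 0) + (LBINT y. if y < x then G y else 0))"
      unfolding conv_pfun[OF Gi Up_meas Up_le, of x] pfun_def[of Up x] by (simp add: algebra_simps)
    then show ?case unfolding G_def[symmetric] E H by simp
  qed
qed

end

section \<open>From transforms to almost-everywhere identities in the time domain\<close>

lemma AE_reflect:
  assumes "Measurable.pred borel P" "AE x::real in lborel. P x"
  shows "AE x in lborel. P (- x)"
  using AE_borel_affine[of "-1" P 0] assms by simp

lemma fourier_cong_AE:
  assumes "AE x in lborel. f x = g x" "f \<in> borel_measurable borel" "g \<in> borel_measurable borel"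
  shows "fourier f \<xi> = fourier g \<xi>"
  unfolding fourier_def
proof (rule bint_cong_AE)
  show "AE x in lborel. exp (\<i> * of_real (x * \<xi>)) * f x = exp (\<i> * of_real (x * \<xi>)) * g x"
    using assms(1) by eventually_elim simp
  show "(\<lambda>x. exp (\<i> * of_real (x * \<xi>)) * f x) \<in> borel_measurable lborel" using assms(2) by measurable
  show "(\<lambda>x. exp (\<i> * of_real (x * \<xi>)) * g x) \<in> borel_measurable lborel" using assms(3) by measurable
qed

text \<open>
  What the Fourier side provides, stated without transforms. The last two almost-everywhere
  identities express \<open>\<sigma>\<plusminus> \<cdot> (1/\<sigma>\<plusminus>) = 1\<close>, and \<open>s\<close> stands for \<open>\<tau>\<^sub>-(0) \<tau>\<^sub>+(0)\<close>.
\<close>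

locale wh_time =
  fixes a cp cm s :: complex and k Up Um :: "real \<Rightarrow> complex" and C \<eta> :: real
  assumes eta: "0 < \<eta>" and k: "exp_bounded C \<eta> k"
    and Up: "exp_bounded C \<eta> Up" "\<And>x. x < 0 \<Longrightarrow> Up x = 0"
    and Um: "exp_bounded C \<eta> Um" "\<And>x. 0 < x \<Longrightarrow> Um x = 0"
    and int_k: "(LBINT x. k x) = - a" and moment_k: "(LBINT x. of_real x * k x) = 0"
    and Sp: "exp_bounded C \<eta> (Splus a k cm Um)" "AE x in lborel. x < 0 \<longrightarrow> Splus a k cm Um x = 0"
      "(LBINT x. Splus a k cm Um x) = - a * cm"
      "AE x in lborel. a * cm * pfun Up x + cp * Splus a k cm Um x + conv (Splus a k cm Um) (pfun Up) x = 0"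
    and Sm: "exp_bounded C \<eta> (Sminus a k cp Up)" "AE x in lborel. 0 < x \<longrightarrow> Sminus a k cp Up x = 0"
      "(LBINT x. Sminus a k cp Up x) = - a * cp"
      "AE x in lborel. a * cp * mfun Um x + cm * Sminus a k cp Up x + conv (Sminus a k cp Up) (mfun Um) x = 0"
    and s: "a * cp * cm = s" "s \<noteq> 0"

lemma exp_bounded_lincomb:
  assumes "exp_bounded C1 \<eta> f" "exp_bounded C2 \<eta> g"
  shows "exp_bounded (cmod b * C1 + C2) \<eta> (\<lambda>x. b * f x + g x)"
  unfolding exp_bounded_def
proof (intro conjI allI)
  show "(\<lambda>x. b * f x + g x) \<in> borel_measurable borel" using assms by (auto simp: exp_bounded_def)
  fix x
  have "cmod (b * f x + g x) \<le> cmod b * cmod (f x) + cmod (g x)"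
    using norm_triangle_ineq[of "b * f x" "g x"] by (simp add: norm_mult)
  also have "\<dots> \<le> cmod b * (C1 * exp (- \<eta> * \<bar>x\<bar>)) + C2 * exp (- \<eta> * \<bar>x\<bar>)"
    using assms by (intro add_mono mult_left_mono) (auto simp: exp_bounded_def)
  finally show "cmod (b * f x + g x) \<le> (cmod b * C1 + C2) * exp (- \<eta> * \<bar>x\<bar>)" by (simp add: algebra_simps)
qed

context wh_fourier
begin

text \<open>
  On each half-line the vanishing of one of the two factor densities expresses \<open>k\<close> by functions
  that decay exponentially pointwise.
\<close>

lemma exp_bounded_representative: "\<exists>k' C'. exp_bounded C' \<eta> k' \<and> (AE x in lborel. k' x = k x)"
proof -
  interpret R: wh_fourier a cm cp t "\<lambda>x. k (- x)" "\<lambda>x. Um (- x)" "\<lambda>x. Up (- x)" "\<lambda>z. Tm (- z)" "\<lambda>z. Tp (- z)" \<delta> \<eta> C K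
    by (rule reflected)
  define r where "r = (\<lambda>x. conv k Um x + a * Um x + tail k x)"
  define r' where "r' = (\<lambda>x. conv (\<lambda>x. k (- x)) (\<lambda>x. Up (- x)) x + a * Up (- x) + tail (\<lambda>x. k (- x)) x)"
  obtain C1 where C1: "exp_bounded C1 \<eta> r" using rest_exp_bounded unfolding r_def by blast
  obtain C2 where C2: "exp_bounded C2 \<eta> r'" using R.rest_exp_bounded unfolding r'_def by blast
  define k' where "k' x = (if x < 0 then - r x / cm else - r' (- x) / cp)" for x
  have "exp_bounded (C1 / cmod cm + C2 / cmod cp) \<eta> k'"
    unfolding exp_bounded_def
  proof (intro conjI allI)
    have [measurable]: "r \<in> borel_measurable borel" "r' \<in> borel_measurable borel"
      using C1 C2 by (auto simp: exp_bounded_def)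
    show "k' \<in> borel_measurable borel" unfolding k'_def[abs_def] by measurable
    fix x
    have nn: "0 \<le> C1 / cmod cm * exp (- \<eta> * \<bar>x\<bar>)" "0 \<le> C2 / cmod cp * exp (- \<eta> * \<bar>x\<bar>)"
      using exp_bounded_nonneg[OF C1] exp_bounded_nonneg[OF C2] by auto
    have "cmod (r x) \<le> C1 * exp (- \<eta> * \<bar>x\<bar>)" using C1 unfolding exp_bounded_def by blast
    then have 1: "cmod (r x) / cmod cm \<le> C1 / cmod cm * exp (- \<eta> * \<bar>x\<bar>)"
      using divide_right_mono[of "cmod (r x)" _ "cmod cm"] by simp
    have "cmod (r' (- x)) \<le> C2 * exp (- \<eta> * \<bar>- x\<bar>)" using C2 unfolding exp_bounded_def by blast
    then have 2: "cmod (r' (- x)) / cmod cp \<le> C2 / cmod cp * exp (- \<eta> * \<bar>x\<bar>)"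
      using divide_right_mono[of "cmod (r' (- x))" _ "cmod cp"] by simp
    show "cmod (k' x) \<le> (C1 / cmod cm + C2 / cmod cp) * exp (- \<eta> * \<bar>x\<bar>)"
    proof (cases "x < 0")
      case True
      then have "cmod (k' x) = cmod (r x) / cmod cm" by (simp add: k'_def norm_divide)
      then show ?thesis using nn 1 unfolding distrib_right by linarith
    next
      case False
      then have "cmod (k' x) = cmod (r' (- x)) / cmod cp" by (simp add: k'_def norm_divide)
      then show ?thesis using nn 2 unfolding distrib_right by linarith
    qed
  qed
  moreover have "AE x in lborel. k' x = k x"
  proof -
    have m: "Measurable.pred borel (\<lambda>x. x < 0 \<longrightarrow> Splus a (\<lambda>x. k (- x)) cp (\<lambda>x. Up (- x)) x = 0)"
    proof -
      have [measurable]: "Splus a (\<lambda>x. k (- x)) cp (\<lambda>x. Up (- x)) \<in> borel_measurable borel"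
        using borel_measurable_integrable[OF R.Splus_integrable] by simp
      show ?thesis by measurable
    qed
    have "AE x in lborel. x \<noteq> (0::real)" by (rule AE_lborel_singleton)
    with Splus_zero AE_reflect[OF m R.Splus_zero] show ?thesis
    proof eventually_elim
      case (elim x)
      show ?case
      proof (cases "x < 0")
        case True
        then have "cm * k x + r x = 0" using elim(1) Splus_eq[of x] by (simp add: r_def)
        then have "cm * k x = - r x" by (simp only: eq_neg_iff_add_eq_0)
        then have "- r x / cm = k x" using cm_nz by (metis nonzero_mult_div_cancel_left)
        then show ?thesis using True by (simp add: k'_def)
      next
        case False
        then have "- x < 0" using elim by simp
        then have "cp * k x + r' (- x) = 0" using elim(2) R.Splus_eq[of "- x"] by (simp add: r'_def)
        then have "cp * k x = - r' (- x)" by (simp only: eq_neg_iff_add_eq_0)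
        then have "- r' (- x) / cp = k x" using cp_nz by (metis nonzero_mult_div_cancel_left)
        then show ?thesis using False by (simp add: k'_def)
      qed
    qed
  qed
  ultimately show ?thesis by blast
qed

lemma Splus_exp_bounded:
  assumes "exp_bounded C1 \<eta> k"
  shows "\<exists>C'. exp_bounded C' \<eta> (Splus a k cm Um)"
proof -
  obtain C' where "exp_bounded C' \<eta> (\<lambda>x. conv k Um x + a * Um x + tail k x)" using rest_exp_bounded by blast
  from exp_bounded_lincomb[OF assms this, of cm] show ?thesis by (auto simp: Splus_eq[abs_def])
qed

lemma product_identity_exp_bounded:
  assumes "exp_bounded C1 \<eta> k"
  shows "a * cm * cp = t\<^sup>2"
    "AE x in lborel. a * cm * pfun Up x + cp * Splus a k cm Um x + conv (Splus a k cm Um) (pfun Up) x = 0"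
proof -
  obtain C' where C': "exp_bounded C' \<eta> (Splus a k cm Um)" using Splus_exp_bounded[OF assms] by blast
  have "integrable lborel (\<lambda>x. of_real x * Splus a k cm Um x)"
    using weighted_L1_moment[OF exp_bounded_weighted_L1[OF C' eta]] eta by simp
  from product_identity[OF this] show "a * cm * cp = t\<^sup>2"
    "AE x in lborel. a * cm * pfun Up x + cp * Splus a k cm Um x + conv (Splus a k cm Um) (pfun Up) x = 0" .
qed

text \<open>The representative \<open>k'\<close> has the same transform as \<open>k\<close>, so the
  whole Fourier-side context is interpreted again for it, at rate \<open>\<eta>/2\<close> because a
  pointwise bound gives weighted integrability only at a smaller rate. The facts on the minus factor
  come from the reflected context.\<close>

lemma time_data: "\<exists>k' C' \<eta>'. (AE x in lborel. k' x = k x) \<and> wh_time a cp cm (t\<^sup>2) k' Up Um C' \<eta>'"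
proof -
  obtain k' C1 where k': "exp_bounded C1 \<eta> k'" and ae: "AE x in lborel. k' x = k x" using exp_bounded_representative by blast
  have [measurable]: "k' \<in> borel_measurable borel" using k' by (simp add: exp_bounded_def)
  have Fk: "fourier k' \<xi> = fourier k \<xi>" for \<xi> by (rule fourier_cong_AE[OF ae]) measurable
  have half: "exp_bounded c (\<eta>/2) f" if "exp_bounded c \<eta> f" for c f
    by (rule exp_bounded_mono[OF that]) (use eta in auto)
  interpret F: wh_fourier a cp cm t k' Up Um Tp Tm "\<eta>/2" "\<eta>/2" C K
  proof
    show "0 < \<eta>/2" "\<eta>/2 \<le> \<eta>/2" "weighted_L1 (\<eta>/2) k'" using eta exp_bounded_weighted_L1[OF k' eta] by auto
    show "a + fourier k' \<xi> = (of_real \<xi>)\<^sup>2 * (Tm (of_real \<xi>) * Tp (of_real \<xi>))" for \<xi>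
      unfolding Fk by (rule symbol)
  qed (fact Tp Tm K t eqp eqm half[OF Up(1)] Up(2) half[OF Um(1)] Um(2))+
  interpret R: wh_fourier a cm cp t "\<lambda>x. k' (- x)" "\<lambda>x. Um (- x)" "\<lambda>x. Up (- x)" "\<lambda>z. Tm (- z)" "\<lambda>z. Tp (- z)" "\<eta>/2" "\<eta>/2" C K
    by (rule F.reflected)
  have k2: "exp_bounded C1 (\<eta>/2) k'" by (rule half[OF k'])
  obtain C2 where C2: "exp_bounded C2 (\<eta>/2) (Splus a k' cm Um)" using F.Splus_exp_bounded[OF k2] by blast
  obtain C3 where C3': "exp_bounded C3 (\<eta>/2) (Splus a (\<lambda>x. k' (- x)) cp (\<lambda>x. Up (- x)))"
    using R.Splus_exp_bounded[OF exp_bounded_reflect[OF k2]] by blast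
  then have C3: "exp_bounded C3 (\<eta>/2) (Sminus a k' cp Up)"
    using exp_bounded_reflect[OF C3'] by (simp add: Splus_reflect)
  have [measurable]: "Sminus a k' cp Up \<in> borel_measurable borel" using C3 by (simp add: exp_bounded_def)
  define D where "D = Max {C, C1, C2, C3}"
  have D: "C \<le> D" "C1 \<le> D" "C2 \<le> D" "C3 \<le> D" unfolding D_def by auto
  have "wh_time a cp cm (t\<^sup>2) k' Up Um D (\<eta>/2)"
  proof
    show "0 < \<eta>/2" using eta by simp
    show "exp_bounded D (\<eta>/2) k'" "exp_bounded D (\<eta>/2) Up" "exp_bounded D (\<eta>/2) Um" "exp_bounded D (\<eta>/2) (Splus a k' cm Um)" "exp_bounded D (\<eta>/2) (Sminus a k' cp Up)"
      using exp_bounded_mono[OF k2 D(2)] exp_bounded_mono[OF F.Up(1) D(1)] exp_bounded_mono[OF F.Um(1) D(1)] exp_bounded_mono[OF C2 D(3)] exp_bounded_mono[OF C3 D(4)] by auto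
    show "(LBINT x. k' x) = - a" "(LBINT x. of_real x * k' x) = 0" by (fact F.int_k F.moment_k)+
    show "AE x in lborel. x < 0 \<longrightarrow> Splus a k' cm Um x = 0" by (fact F.Splus_zero)
    show "(LBINT x. Splus a k' cm Um x) = - a * cm" by (fact F.int_Splus)
    show "AE x in lborel. a * cm * pfun Up x + cp * Splus a k' cm Um x + conv (Splus a k' cm Um) (pfun Up) x = 0"
      by (fact F.product_identity_exp_bounded(2)[OF k2])
    show "a * cp * cm = t\<^sup>2" using F.product_identity_exp_bounded(1)[OF k2] by (simp add: mult_ac)
    show "t\<^sup>2 \<noteq> 0" using t by simp
    have "AE x in lborel. x < 0 \<longrightarrow> Sminus a k' cp Up (- x) = 0" using R.Splus_zero by (simp add: Splus_reflect)
    from AE_reflect[OF _ this] show "AE x in lborel. 0 < x \<longrightarrow> Sminus a k' cp Up x = 0" by simp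
    show "(LBINT x. Sminus a k' cp Up x) = - a * cp"
      using R.int_Splus integral_reflect[of "Sminus a k' cp Up"] by (simp add: Splus_reflect)
    have "AE x in lborel. a * cp * mfun Um (- x) + cm * Sminus a k' cp Up (- x) + conv (Sminus a k' cp Up) (mfun Um) (- x) = 0"
      using R.product_identity_exp_bounded(2)[OF exp_bounded_reflect[OF k2]]
      by (simp add: Splus_reflect[abs_def] pfun_reflect[abs_def] conv_reflect)
    from AE_reflect[OF _ this] show "AE x in lborel. a * cp * mfun Um x + cm * Sminus a k' cp Up x + conv (Sminus a k' cp Up) (mfun Um) x = 0"
      by simp
  qed (use Up Um in auto)
  with ae show ?thesis by blast
qed

end

section \<open>Integral operators with bounded kernels\<close>

text \<open>Kernels are bounded everywhere and vanish off the square, so that all integrals can be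
  taken over the whole line and the length \<alpha> enters only through the support.\<close>

definition bounded_kernel :: "real \<Rightarrow> real \<Rightarrow> (real \<Rightarrow> real \<Rightarrow> complex) \<Rightarrow> bool" where
  "bounded_kernel \<alpha> b K \<longleftrightarrow> case_prod K \<in> borel_measurable (lborel \<Otimes>\<^sub>M lborel) \<and> (\<forall>x y. cmod (K x y) \<le> b) \<and>
     (\<forall>x y. K x y \<noteq> 0 \<longrightarrow> x \<in> {0<..<\<alpha>} \<and> y \<in> {0<..<\<alpha>})"

definition cutL1 :: "real \<Rightarrow> (real \<Rightarrow> complex) \<Rightarrow> bool" where
  "cutL1 \<alpha> f \<longleftrightarrow> integrable lborel f \<and> (\<forall>x. f x \<noteq> 0 \<longrightarrow> x \<in> {0<..<\<alpha>})"

definition cutL2 :: "real \<Rightarrow> (real \<Rightarrow> complex) \<Rightarrow> bool" where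
  "cutL2 \<alpha> f \<longleftrightarrow> f \<in> borel_measurable borel \<and> integrable lborel (\<lambda>x. (cmod (f x))\<^sup>2) \<and> (\<forall>x. f x \<noteq> 0 \<longrightarrow> x \<in> {0<..<\<alpha>})"

text \<open>The multiple of the identity is kept apart from the integral part, since the truncated
  operator and its inverse both have this shape.\<close>

definition kernel_op :: "complex \<Rightarrow> (real \<Rightarrow> real \<Rightarrow> complex) \<Rightarrow> (real \<Rightarrow> complex) \<Rightarrow> real \<Rightarrow> complex" where
  "kernel_op c K f x = c * f x + (LBINT y. K x y * f y)"

definition kernel_comp :: "(real \<Rightarrow> real \<Rightarrow> complex) \<Rightarrow> (real \<Rightarrow> real \<Rightarrow> complex) \<Rightarrow> real \<Rightarrow> real \<Rightarrow> complex" where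
  "kernel_comp K L x y = (LBINT s. K x s * L s y)"

lemma bounded_kernel_nonneg: "bounded_kernel \<alpha> b K \<Longrightarrow> 0 \<le> b"
  unfolding bounded_kernel_def by (meson norm_ge_zero order_trans)

lemma bounded_kernel_flip: "bounded_kernel \<alpha> b K \<Longrightarrow> bounded_kernel \<alpha> b (\<lambda>x y. K y x)"
proof -
  assume K: "bounded_kernel \<alpha> b K"
  define Kp where "Kp = case_prod K"
  have [measurable]: "Kp \<in> borel_measurable (lborel \<Otimes>\<^sub>M lborel)" using K by (simp add: Kp_def bounded_kernel_def)
  have "(\<lambda>q. Kp (snd q, fst q)) \<in> borel_measurable (lborel \<Otimes>\<^sub>M lborel)" by measurable
  then have "(\<lambda>(x, y). K y x) \<in> borel_measurable (lborel \<Otimes>\<^sub>M lborel)" by (simp add: Kp_def case_prod_beta)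
  then show ?thesis using K unfolding bounded_kernel_def by auto
qed

lemma integrable_box:
  assumes "f \<in> borel_measurable borel" "\<And>x. cmod (f x) \<le> b" "\<And>x. f x \<noteq> 0 \<Longrightarrow> x \<in> {0<..<\<alpha>}"
  shows "integrable lborel f" "0 < \<alpha> \<Longrightarrow> (LBINT x. cmod (f x)) \<le> b * \<alpha>"
proof -
  have i: "integrable lborel (\<lambda>x. b * indicator {0<..<\<alpha>} x :: real)"
  proof -
    have "emeasure lborel {0<..<\<alpha>} < \<infinity>" by (cases "0 \<le> \<alpha>") auto
    then show ?thesis by (intro integrable_mult_right integrable_real_indicator) auto
  qed
  have b: "0 \<le> b" using order_trans[OF norm_ge_zero assms(2)] .
  have le: "cmod (f x) \<le> b * indicator {0<..<\<alpha>} x" for x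
    using assms(2)[of x] assms(3)[of x] b by (cases "f x = 0") auto
  show fi: "integrable lborel f"
    by (rule integrable_dominated[OF i]) (use assms(1) le b in auto)
  assume "0 < \<alpha>"
  have "(LBINT x. cmod (f x)) \<le> (LBINT x. b * indicator {0<..<\<alpha>} x)"
    by (rule integral_mono) (use fi i le in auto)
  also have "\<dots> = b * \<alpha>" using \<open>0 < \<alpha>\<close> by simp
  finally show "(LBINT x. cmod (f x)) \<le> b * \<alpha>" .
qed

lemma bounded_kernel_row:
  assumes "bounded_kernel \<alpha> b K"
  shows "(\<lambda>y. K x y) \<in> borel_measurable borel" "(\<lambda>x. K x y) \<in> borel_measurable borel"
proof -
  define Kp where "Kp = case_prod K"
  have [measurable]: "Kp \<in> borel_measurable (lborel \<Otimes>\<^sub>M lborel)" using assms by (simp add: Kp_def bounded_kernel_def)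
  have "(\<lambda>y. Kp (x, y)) \<in> borel_measurable lborel" "(\<lambda>x. Kp (x, y)) \<in> borel_measurable lborel" by measurable
  then show "(\<lambda>y. K x y) \<in> borel_measurable borel" "(\<lambda>x. K x y) \<in> borel_measurable borel" by (simp_all add: Kp_def)
qed

lemma integrable_bounded_mult:
  fixes f g :: "real \<Rightarrow> complex"
  assumes "integrable lborel f" "g \<in> borel_measurable borel" "\<And>x. cmod (g x) \<le> b"
  shows "integrable lborel (\<lambda>x. g x * f x)" "(LBINT x. cmod (g x * f x)) \<le> b * (LBINT x. cmod (f x))"
proof -
  have i: "integrable lborel (\<lambda>x. b * cmod (f x))" using assms(1) by simp
  have b: "0 \<le> b" using order_trans[OF norm_ge_zero assms(3)] .
  have le: "cmod (g x * f x) \<le> b * cmod (f x)" for x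
    using assms(3)[of x] by (simp add: norm_mult mult_right_mono)
  show gi: "integrable lborel (\<lambda>x. g x * f x)"
    by (rule integrable_dominated[OF i]) (use assms(1,2) le b in auto)
  have "(LBINT x. cmod (g x * f x)) \<le> (LBINT x. b * cmod (f x))"
    by (rule integral_mono) (use gi i le in auto)
  then show "(LBINT x. cmod (g x * f x)) \<le> b * (LBINT x. cmod (f x))" by simp
qed

lemma kernel_op_integral_bound:
  assumes "bounded_kernel \<alpha> b K" "integrable lborel f"
  shows "cmod (LBINT y. K x y * f y) \<le> b * (LBINT y. cmod (f y))"
proof -
  have "cmod (LBINT y. K x y * f y) \<le> (LBINT y. cmod (K x y * f y))" by (rule integral_norm_bound)
  also have "\<dots> \<le> b * (LBINT y. cmod (f y))"
    using assms by (intro integrable_bounded_mult(2) bounded_kernel_row) (auto simp: bounded_kernel_def)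
  finally show ?thesis .
qed

lemma kernel_op_integrand_integrable:
  assumes "bounded_kernel \<alpha> b K" "integrable lborel f"
  shows "integrable lborel (\<lambda>y. K x y * f y)"
  using assms by (intro integrable_bounded_mult(1)[where b = b] bounded_kernel_row) (auto simp: bounded_kernel_def)

lemma kernel_op_int_measurable:
  assumes K: "bounded_kernel \<alpha> b K" and f: "f \<in> borel_measurable borel"
  shows "(\<lambda>x. LBINT y. K x y * f y) \<in> borel_measurable borel"
proof -
  define Kp where "Kp = case_prod K"
  have [measurable]: "Kp \<in> borel_measurable (lborel \<Otimes>\<^sub>M lborel)" using K by (simp add: Kp_def bounded_kernel_def)
  note f[measurable]
  have "(\<lambda>x. LBINT y. Kp (x, y) * f y) \<in> borel_measurable lborel" by measurable
  then show ?thesis by (simp add: Kp_def)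
qed

lemma cutL2_imp_cutL1:
  assumes "cutL2 \<alpha> f" shows "cutL1 \<alpha> f"
  unfolding cutL1_def
proof
  have "emeasure lborel {0<..<\<alpha>} < \<infinity>" by (cases "0 \<le> \<alpha>") auto
  then have i: "integrable lborel (\<lambda>x. indicator {0<..<\<alpha>} x + (cmod (f x))\<^sup>2 :: real)"
    using assms unfolding cutL2_def by (intro Bochner_Integration.integrable_add integrable_real_indicator) auto
  show "integrable lborel f"
  proof (rule integrable_dominated[OF i])
    show "AE x in lborel. cmod (f x) \<le> norm (indicator {0<..<\<alpha>} x + (cmod (f x))\<^sup>2 :: real)"
    proof (intro AE_I2)
      fix x
      have "0 \<le> (cmod (f x) - 1)\<^sup>2" "0 \<le> (cmod (f x))\<^sup>2" "0 \<le> cmod (f x)" by simp_all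
      then have "cmod (f x) \<le> 1 + (cmod (f x))\<^sup>2" unfolding power2_diff power_one mult_1_right by linarith
      then show "cmod (f x) \<le> norm (indicator {0<..<\<alpha>} x + (cmod (f x))\<^sup>2 :: real)"
        using assms unfolding cutL2_def by (cases "f x = 0") auto
    qed
  qed (use assms in \<open>auto simp: cutL2_def\<close>)
qed (use assms in \<open>auto simp: cutL2_def\<close>)

lemma kernel_op_cutL1:
  assumes K: "bounded_kernel \<alpha> b K" and f: "cutL1 \<alpha> f"
  shows "cutL1 \<alpha> (kernel_op c K f)"
  unfolding cutL1_def
proof
  have fi: "integrable lborel f" using f by (simp add: cutL1_def)
  have fm: "f \<in> borel_measurable borel" using fi borel_measurable_integrable by force
  have supp: "(LBINT y. K x y * f y) \<noteq> 0 \<Longrightarrow> x \<in> {0<..<\<alpha>}" for x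
  proof (rule ccontr)
    assume nz: "(LBINT y. K x y * f y) \<noteq> 0" and x: "x \<notin> {0<..<\<alpha>}"
    then have "(\<lambda>y. K x y * f y) = (\<lambda>y. 0)" using K by (fastforce simp: bounded_kernel_def)
    with nz show False by simp
  qed
  have "integrable lborel (\<lambda>x. LBINT y. K x y * f y)"
    by (rule integrable_box(1)[OF kernel_op_int_measurable[OF K fm] kernel_op_integral_bound[OF K fi] supp])
  then show "integrable lborel (kernel_op c K f)" unfolding kernel_op_def[abs_def] using fi by auto
  show "\<forall>x. kernel_op c K f x \<noteq> 0 \<longrightarrow> x \<in> {0<..<\<alpha>}"
    using f supp unfolding kernel_op_def cutL1_def by (metis add.right_neutral mult_zero_right)
qed

text \<open>One integration over an interval of length \<alpha> costs the factor \<alpha> in the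
  bound.\<close>

lemma kernel_comp_bounded_kernel:
  assumes K: "bounded_kernel \<alpha> b K" and L: "bounded_kernel \<alpha> d L" and \<alpha>: "0 < \<alpha>"
  shows "bounded_kernel \<alpha> (b * (d * \<alpha>)) (kernel_comp K L)"
  unfolding bounded_kernel_def
proof (intro conjI allI impI)
  define Kp where "Kp = case_prod K"
  define Lp where "Lp = case_prod L"
  have [measurable]: "Kp \<in> borel_measurable (lborel \<Otimes>\<^sub>M lborel)" "Lp \<in> borel_measurable (lborel \<Otimes>\<^sub>M lborel)"
    using K L by (simp_all add: Kp_def Lp_def bounded_kernel_def)
  have "(\<lambda>q. LBINT s. Kp (fst q, s) * Lp (s, snd q)) \<in> borel_measurable (lborel \<Otimes>\<^sub>M lborel)" by measurable
  then show "case_prod (kernel_comp K L) \<in> borel_measurable (lborel \<Otimes>\<^sub>M lborel)"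
    by (simp add: Kp_def Lp_def kernel_comp_def case_prod_unfold)
  fix x y
  have Li: "integrable lborel (\<lambda>s. L s y)" "(LBINT s. cmod (L s y)) \<le> d * \<alpha>"
    using integrable_box[OF bounded_kernel_row(2)[OF L, of y], of d \<alpha>] L \<alpha> by (auto simp: bounded_kernel_def)
  have "cmod (kernel_comp K L x y) \<le> b * (LBINT s. cmod (L s y))"
    unfolding kernel_comp_def by (rule kernel_op_integral_bound[OF K Li(1)])
  also have "\<dots> \<le> b * (d * \<alpha>)" by (intro mult_left_mono Li bounded_kernel_nonneg[OF K])
  finally show "cmod (kernel_comp K L x y) \<le> b * (d * \<alpha>)" .
  assume nz: "kernel_comp K L x y \<noteq> 0"
  show "x \<in> {0<..<\<alpha>}"
  proof (rule ccontr)
    assume "x \<notin> {0<..<\<alpha>}"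
    then have "(\<lambda>s. K x s * L s y) = (\<lambda>s. 0)" using K by (fastforce simp: bounded_kernel_def)
    with nz show False by (simp add: kernel_comp_def)
  qed
  show "y \<in> {0<..<\<alpha>}"
  proof (rule ccontr)
    assume "y \<notin> {0<..<\<alpha>}"
    then have "(\<lambda>s. K x s * L s y) = (\<lambda>s. 0)" using L by (fastforce simp: bounded_kernel_def)
    with nz show False by (simp add: kernel_comp_def)
  qed
qed

lemma bounded_kernel_lincomb:
  assumes K: "bounded_kernel \<alpha> b K" and L: "bounded_kernel \<alpha> d L"
  shows "bounded_kernel \<alpha> (cmod c1 * b + cmod c2 * d) (\<lambda>x y. c1 * K x y + c2 * L x y)"
  unfolding bounded_kernel_def
proof (intro conjI allI impI)
  have [measurable]: "case_prod K \<in> borel_measurable (lborel \<Otimes>\<^sub>M lborel)" "case_prod L \<in> borel_measurable (lborel \<Otimes>\<^sub>M lborel)"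
    using K L by (simp_all add: bounded_kernel_def)
  have "(\<lambda>q. c1 * case_prod K q + c2 * case_prod L q) \<in> borel_measurable (lborel \<Otimes>\<^sub>M lborel)" by measurable
  then show "(\<lambda>(x, y). c1 * K x y + c2 * L x y) \<in> borel_measurable (lborel \<Otimes>\<^sub>M lborel)" by (simp add: case_prod_beta)
  fix x y
  have "cmod (c1 * K x y + c2 * L x y) \<le> cmod c1 * cmod (K x y) + cmod c2 * cmod (L x y)"
    using norm_triangle_ineq[of "c1 * K x y" "c2 * L x y"] by (simp add: norm_mult)
  also have "\<dots> \<le> cmod c1 * b + cmod c2 * d"
    using K L by (intro add_mono mult_left_mono) (auto simp: bounded_kernel_def)
  finally show "cmod (c1 * K x y + c2 * L x y) \<le> cmod c1 * b + cmod c2 * d" .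
  assume "c1 * K x y + c2 * L x y \<noteq> 0"
  then have "K x y \<noteq> 0 \<or> L x y \<noteq> 0" by auto
  then show "x \<in> {0<..<\<alpha>}" "y \<in> {0<..<\<alpha>}" using K L unfolding bounded_kernel_def by blast+
qed

lemma kernel_fubini:
  assumes K: "bounded_kernel \<alpha> b K" and L: "bounded_kernel \<alpha> d L" and f: "integrable lborel f"
  shows "(LBINT s. K x s * (LBINT y. L s y * f y)) = (LBINT y. kernel_comp K L x y * f y)"
proof -
  define Kp where "Kp = case_prod K"
  define Lp where "Lp = case_prod L"
  have [measurable]: "Kp \<in> borel_measurable (lborel \<Otimes>\<^sub>M lborel)" "Lp \<in> borel_measurable (lborel \<Otimes>\<^sub>M lborel)"
    using K L by (simp_all add: Kp_def Lp_def bounded_kernel_def)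
  have fm[measurable]: "f \<in> borel_measurable borel" using f borel_measurable_integrable by force
  have Ki: "integrable lborel (\<lambda>s. K x s)"
    by (rule integrable_box(1)[OF bounded_kernel_row(1)[OF K]]) (use K in \<open>auto simp: bounded_kernel_def\<close>)
  have Lb: "cmod (L s y) \<le> d" for s y using L by (simp add: bounded_kernel_def)
  have m: "(\<lambda>(y, s). K x s * L s y * f y) \<in> borel_measurable (lborel \<Otimes>\<^sub>M lborel)"
  proof -
    have "(\<lambda>q. Kp (x, snd q) * Lp (snd q, fst q) * f (fst q)) \<in> borel_measurable (lborel \<Otimes>\<^sub>M lborel)" by measurable
    then show ?thesis by (simp add: Kp_def Lp_def case_prod_beta)
  qed
  have KL: "integrable lborel (\<lambda>s. K x s * L s y)" for y
    using integrable_bounded_mult(1)[OF Ki bounded_kernel_row(2)[OF L] Lb, of y] by (simp add: mult.commute)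
  have i: "integrable lborel (\<lambda>s. K x s * L s y * f y)" for y using KL by simp
  have w: "(LBINT s. cmod (K x s * L s y * f y)) \<le> d * (LBINT s. cmod (K x s)) * cmod (f y)" for y
    using mult_left_mono[OF integrable_bounded_mult(2)[OF Ki bounded_kernel_row(2)[OF L] Lb, of y], of "cmod (f y)"]
    by (simp add: norm_mult mult_ac)
  have wi: "integrable lborel (\<lambda>y. d * (LBINT s. cmod (K x s)) * cmod (f y))" using f by simp
  have "(LBINT s. K x s * (LBINT y. L s y * f y)) = (LBINT s. LBINT y. K x s * L s y * f y)"
    by (simp add: mult.assoc)
  also have "\<dots> = (LBINT y. LBINT s. K x s * L s y * f y)" by (rule fubini_swap[OF m i wi w])
  also have "\<dots> = (LBINT y. kernel_comp K L x y * f y)" unfolding kernel_comp_def by simp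
  finally show ?thesis .
qed

lemma kernel_op_comp:
  assumes K: "bounded_kernel \<alpha> b K" and L: "bounded_kernel \<alpha> d L" and f: "cutL1 \<alpha> f"
  shows "kernel_op c1 K (kernel_op c2 L f) x = c1 * c2 * f x + (LBINT y. (c1 * L x y + c2 * K x y + kernel_comp K L x y) * f y)"
proof -
  have fi: "integrable lborel f" using f by (simp add: cutL1_def)
  have gi: "integrable lborel (kernel_op c2 L f)" using kernel_op_cutL1[OF L f] by (simp add: cutL1_def)
  have Lfi: "integrable lborel (\<lambda>s. LBINT y. L s y * f y)"
    using Bochner_Integration.integrable_diff[OF gi, of "\<lambda>x. c2 * f x"] fi by (simp add: kernel_op_def)
  have "(LBINT s. K x s * kernel_op c2 L f s) = (LBINT s. c2 * (K x s * f s) + K x s * (LBINT y. L s y * f y))"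
    unfolding kernel_op_def by (simp add: algebra_simps)
  also have "\<dots> = c2 * (LBINT s. K x s * f s) + (LBINT y. kernel_comp K L x y * f y)"
    unfolding kernel_fubini[OF K L fi, symmetric]
    by (subst bint_add) (use kernel_op_integrand_integrable[OF K fi] kernel_op_integrand_integrable[OF K Lfi] in auto)
  finally have 1: "(LBINT s. K x s * kernel_op c2 L f s) = c2 * (LBINT s. K x s * f s) + (LBINT y. kernel_comp K L x y * f y)" .
  have kc: "integrable lborel (\<lambda>y. kernel_comp K L x y * f y)"
  proof (cases "0 < \<alpha>")
    case True
    then show ?thesis using kernel_op_integrand_integrable[OF kernel_comp_bounded_kernel[OF K L] fi] by blast
  next
    case False
    then have "f y = 0" for y using f by (auto simp: cutL1_def)
    then show ?thesis by simp
  qed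
  have "(LBINT y. (c1 * L x y + c2 * K x y + kernel_comp K L x y) * f y) = (LBINT y. (c1 * (L x y * f y) + c2 * (K x y * f y)) + kernel_comp K L x y * f y)"
    by (simp add: algebra_simps)
  also have "\<dots> = c1 * (LBINT y. L x y * f y) + c2 * (LBINT y. K x y * f y) + (LBINT y. kernel_comp K L x y * f y)"
    using kernel_op_integrand_integrable[OF K fi] kernel_op_integrand_integrable[OF L fi] kc by simp
  finally show ?thesis unfolding kernel_op_def[of c1 K] 1 unfolding kernel_op_def by (simp add: algebra_simps)
qed

text \<open>Transposition with respect to the bilinear pairing, without conjugation. Square
  integrability handles the product of the identity parts; boundedness of the kernel and
  \<open>L^1\<close> norms handle the rest by Fubini.\<close>

lemma kernel_op_pairing:
  assumes K: "bounded_kernel \<alpha> b K" and f: "cutL2 \<alpha> f" and g: "cutL2 \<alpha> g"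
  shows "(LBINT x. kernel_op c K f x * g x) = (LBINT y. f y * kernel_op c (\<lambda>x y. K y x) g y)"
proof -
  have fi: "integrable lborel f" and gi: "integrable lborel g"
    using cutL2_imp_cutL1[OF f] cutL2_imp_cutL1[OF g] by (auto simp: cutL1_def)
  have fm[measurable]: "f \<in> borel_measurable borel" and gm[measurable]: "g \<in> borel_measurable borel"
    using f g by (auto simp: cutL2_def)
  define Kp where "Kp = case_prod K"
  have [measurable]: "Kp \<in> borel_measurable (lborel \<Otimes>\<^sub>M lborel)" using K by (simp add: Kp_def bounded_kernel_def)
  have fg: "integrable lborel (\<lambda>x. f x * g x)"
  proof (rule integrable_dominated[where f = "\<lambda>x. (cmod (f x))\<^sup>2 + (cmod (g x))\<^sup>2"])
    show "integrable lborel (\<lambda>x. (cmod (f x))\<^sup>2 + (cmod (g x))\<^sup>2)" using f g by (auto simp: cutL2_def)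
    show "AE x in lborel. cmod (f x * g x) \<le> norm ((cmod (f x))\<^sup>2 + (cmod (g x))\<^sup>2)"
    proof (intro AE_I2)
      fix x
      have "0 \<le> (cmod (f x) - cmod (g x))\<^sup>2" "0 \<le> cmod (f x) * cmod (g x)" by simp_all
      then show "cmod (f x * g x) \<le> norm ((cmod (f x))\<^sup>2 + (cmod (g x))\<^sup>2)"
        unfolding power2_diff norm_mult real_norm_def by linarith
    qed
  qed simp
  have Kt: "bounded_kernel \<alpha> b (\<lambda>x y. K y x)" by (rule bounded_kernel_flip[OF K])
  have m: "(\<lambda>(y, x). K x y * f y * g x) \<in> borel_measurable (lborel \<Otimes>\<^sub>M lborel)"
  proof -
    have "(\<lambda>q. Kp (snd q, fst q) * f (fst q) * g (snd q)) \<in> borel_measurable (lborel \<Otimes>\<^sub>M lborel)" by measurable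
    then show ?thesis by (simp add: Kp_def case_prod_beta)
  qed
  have i: "integrable lborel (\<lambda>x. K x y * f y * g x)" for y
    using integrable_mult_right[OF kernel_op_integrand_integrable[OF Kt gi], of "f y" y] by (simp add: mult_ac)
  have w: "(LBINT x. cmod (K x y * f y * g x)) \<le> b * (LBINT x. cmod (g x)) * cmod (f y)" for y
  proof -
    have "(LBINT x. cmod (K x y * g x)) \<le> b * (LBINT x. cmod (g x))"
      using K by (intro integrable_bounded_mult(2)[OF gi bounded_kernel_row(2)[OF K]]) (auto simp: bounded_kernel_def)
    then have "cmod (f y) * (LBINT x. cmod (K x y * g x)) \<le> cmod (f y) * (b * (LBINT x. cmod (g x)))"
      by (rule mult_left_mono) simp
    moreover have "(LBINT x. cmod (K x y * f y * g x)) = cmod (f y) * (LBINT x. cmod (K x y * g x))"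
      by (subst bint_cmult[symmetric]) (simp add: norm_mult mult_ac)
    ultimately show ?thesis by (simp add: mult_ac)
  qed
  have wi: "integrable lborel (\<lambda>y. b * (LBINT x. cmod (g x)) * cmod (f y))" using fi by simp
  have sw: "(LBINT x. LBINT y. K x y * f y * g x) = (LBINT y. LBINT x. K x y * f y * g x)"
    by (rule fubini_swap[OF m i wi w])
  have i1: "integrable lborel (\<lambda>x. (LBINT y. K x y * f y) * g x)"
    using fubini_integrable_snd[OF m i wi w] by simp
  have i2: "integrable lborel (\<lambda>y. f y * (LBINT x. K x y * g x))"
  proof -
    have "(LBINT x. K x y * f y * g x) = f y * (LBINT x. K x y * g x)" for y
      by (subst bint_cmult[symmetric]) (simp add: mult_ac)
    then show ?thesis
      using lborel_pair.integrable_fst[OF fubini_integrable[OF m i wi w]] by simp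
  qed
  have "(LBINT x. kernel_op c K f x * g x) = (LBINT x. c * (f x * g x) + (LBINT y. K x y * f y) * g x)"
    unfolding kernel_op_def by (simp add: algebra_simps)
  also have "\<dots> = c * (LBINT x. f x * g x) + (LBINT x. (LBINT y. K x y * f y) * g x)"
    using fg i1 by simp
  also have "(LBINT x. (LBINT y. K x y * f y) * g x) = (LBINT x. LBINT y. K x y * f y * g x)" by simp
  also have "\<dots> = (LBINT y. LBINT x. K x y * f y * g x)" by (rule sw)
  also have "\<dots> = (LBINT y. f y * (LBINT x. K x y * g x))"
    by (subst bint_cmult[symmetric]) (simp add: mult_ac)
  also have "c * (LBINT x. f x * g x) + (LBINT y. f y * (LBINT x. K x y * g x)) = (LBINT y. c * (f y * g y) + f y * (LBINT x. K x y * g x))"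
    using fg i2 by simp
  also have "\<dots> = (LBINT y. f y * kernel_op c (\<lambda>x y. K y x) g y)"
    unfolding kernel_op_def by (simp add: algebra_simps)
  finally show ?thesis .
qed

section \<open>Neumann series and two-sided inverses\<close>

lemma neumann_kernel:
  assumes E: "bounded_kernel \<alpha> \<epsilon> E" and \<alpha>: "0 < \<alpha>" and small: "\<epsilon> * \<alpha> \<le> 1 / 2"
  obtains N where "bounded_kernel \<alpha> (2 * \<epsilon>) N" "\<And>x y. N x y + E x y + kernel_comp E N x y = 0"
proof -
  \<comment> \<open>\<open>P n\<close> is the composition power of order \<open>n + 1\<close> of
    \<open>E\<close>, so \<open>T n\<close> below is the corresponding signed term of the Neumann
    series and \<open>1 + N\<close> is a right inverse of \<open>1 + E\<close>. Each composition
    costs the factor \<open>\<epsilon> * \<alpha>\<close>, at most 1/2, hence the geometric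
    bounds.\<close>
  define P where "P = rec_nat E (\<lambda>_. kernel_comp E)"
  have P0: "P 0 = E" and PS: "P (Suc n) = kernel_comp E (P n)" for n by (simp_all add: P_def)
  have e0: "0 \<le> \<epsilon>" by (rule bounded_kernel_nonneg[OF E])
  have P: "bounded_kernel \<alpha> (\<epsilon> * (1/2)^n) (P n)" for n
  proof (induction n)
    case 0 then show ?case using E by (simp add: P0)
  next
    case (Suc n)
    have "bounded_kernel \<alpha> (\<epsilon> * (\<epsilon> * (1/2)^n * \<alpha>)) (P (Suc n))" unfolding PS by (rule kernel_comp_bounded_kernel[OF E Suc \<alpha>])
    moreover have "\<epsilon> * (\<epsilon> * (1/2)^n * \<alpha>) \<le> \<epsilon> * (1/2)^Suc n"
    proof -
      have "\<epsilon> * (1/2)^n * (\<epsilon> * \<alpha>) \<le> \<epsilon> * (1/2)^n * (1/2)" using e0 by (intro mult_left_mono small) simp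
      then show ?thesis by (simp add: mult_ac)
    qed
    ultimately show ?case unfolding bounded_kernel_def by (meson order_trans)
  qed
  define T where "T n x y = (-1) ^ Suc n * P n x y" for n x y
  have Tb: "cmod (T n x y) \<le> \<epsilon> * (1/2)^n" for n x y
    using P[of n] unfolding T_def bounded_kernel_def by (simp add: norm_mult norm_power)
  have geo: "summable (\<lambda>n. \<epsilon> * (1/2)^n)" "(\<Sum>n. \<epsilon> * (1/2)^n) = 2 * \<epsilon>"
    by (auto simp: suminf_mult summable_mult suminf_geometric)
  have Tsum: "summable (\<lambda>n. T n x y)" "summable (\<lambda>n. cmod (T n x y))" for x y
    by (rule summable_comparison_test'[OF geo(1)], use Tb in simp)+
  define N where "N x y = (\<Sum>n. T n x y)" for x y
  have NB: "bounded_kernel \<alpha> (2 * \<epsilon>) N"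
    unfolding bounded_kernel_def
  proof (intro conjI allI impI)
    have mT: "(\<lambda>q. T n (fst q) (snd q)) \<in> borel_measurable (lborel \<Otimes>\<^sub>M lborel)" for n
    proof -
      have [measurable]: "case_prod (P n) \<in> borel_measurable (lborel \<Otimes>\<^sub>M lborel)" using P[of n] by (simp add: bounded_kernel_def)
      have "(\<lambda>q. (-1) ^ Suc n * case_prod (P n) q) \<in> borel_measurable (lborel \<Otimes>\<^sub>M lborel)" by measurable
      then show ?thesis by (simp add: T_def case_prod_unfold)
    qed
    have "(\<lambda>q. \<Sum>n. T n (fst q) (snd q)) \<in> borel_measurable (lborel \<Otimes>\<^sub>M lborel)"
    proof (rule borel_measurable_LIMSEQ_metric)
      show "(\<lambda>q. \<Sum>n<i. T n (fst q) (snd q)) \<in> borel_measurable (lborel \<Otimes>\<^sub>M lborel)" for i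
        using mT by (intro borel_measurable_sum)
      show "(\<lambda>i. \<Sum>n<i. T n (fst q) (snd q)) \<longlonglongrightarrow> (\<Sum>n. T n (fst q) (snd q))" for q
        by (rule summable_LIMSEQ[OF Tsum(1)])
    qed
    then show "case_prod N \<in> borel_measurable (lborel \<Otimes>\<^sub>M lborel)" by (simp add: N_def case_prod_unfold)
    fix x y
    have "cmod (N x y) \<le> (\<Sum>n. cmod (T n x y))" unfolding N_def by (rule summable_norm[OF Tsum(2)])
    also have "\<dots> \<le> (\<Sum>n. \<epsilon> * (1/2)^n)" by (rule suminf_le[OF Tb Tsum(2) geo(1)])
    finally show "cmod (N x y) \<le> 2 * \<epsilon>" using geo(2) by simp
    assume nz: "N x y \<noteq> 0"
    have "\<exists>n. T n x y \<noteq> 0"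
    proof (rule ccontr)
      assume "\<not> ?thesis"
      then show False using nz by (simp add: N_def)
    qed
    then obtain n where "P n x y \<noteq> 0" by (auto simp: T_def)
    then show "x \<in> {0<..<\<alpha>}" "y \<in> {0<..<\<alpha>}" using P[of n] unfolding bounded_kernel_def by blast+
  qed
  moreover have "N x y + E x y + kernel_comp E N x y = 0" for x y
  proof -
    have Ei: "integrable lborel (\<lambda>s. E x s)"
      by (rule integrable_box(1)[OF bounded_kernel_row(1)[OF E]]) (use E in \<open>auto simp: bounded_kernel_def\<close>)
    have Tm: "(\<lambda>s. T n s y) \<in> borel_measurable borel" for n
      unfolding T_def using bounded_kernel_row(2)[OF P] by measurable
    have i: "integrable lborel (\<lambda>s. E x s * T n s y)" for n
      using integrable_bounded_mult(1)[OF Ei Tm Tb] by (simp add: mult.commute)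
    have ib: "(LBINT s. cmod (E x s * T n s y)) \<le> \<epsilon> * (1/2)^n * (LBINT s. cmod (E x s))" for n
      using integrable_bounded_mult(2)[OF Ei Tm Tb] by (simp add: mult.commute)
    have "kernel_comp E N x y = (LBINT s. (\<Sum>n. E x s * T n s y))"
      unfolding kernel_comp_def N_def by (intro bint_cong refl suminf_mult[symmetric] Tsum)
    also have "\<dots> = (\<Sum>n. LBINT s. E x s * T n s y)"
    proof (rule integral_suminf[OF i])
      show "AE s in lborel. summable (\<lambda>n. cmod (E x s * T n s y))"
        by (intro AE_I2) (simp add: norm_mult summable_mult Tsum)
      show "summable (\<lambda>n. LBINT s. cmod (E x s * T n s y))"
        by (rule summable_comparison_test'[OF summable_mult2[OF geo(1), of "LBINT s. cmod (E x s)"]])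
           (use ib in simp)
    qed
    also have "\<dots> = (\<Sum>n. - T (Suc n) x y)"
    proof -
      have "(LBINT s. E x s * T n s y) = - T (Suc n) x y" for n
      proof -
        have "(LBINT s. E x s * T n s y) = (LBINT s. (-1) ^ Suc n * (E x s * P n s y))"
          unfolding T_def by (simp add: mult_ac)
        also have "\<dots> = (-1) ^ Suc n * P (Suc n) x y"
          unfolding bint_cmult PS kernel_comp_def ..
        finally show ?thesis by (simp add: T_def)
      qed
      then show ?thesis by simp
    qed
    also have "\<dots> = - (\<Sum>n. T (Suc n) x y)"
      by (rule suminf_minus) (use Tsum(1)[of x y] summable_Suc_iff[of "\<lambda>n. T n x y"] in simp)
    also have "(\<Sum>n. T (Suc n) x y) = N x y - T 0 x y"
      unfolding N_def by (rule suminf_split_head[OF Tsum(1)])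
    finally show ?thesis by (simp add: T_def P0)
  qed
  ultimately show thesis by (rule that)
qed

lemma kernel_op_cutL2:
  assumes K: "bounded_kernel \<alpha> b K" and f: "cutL2 \<alpha> f" and \<alpha>: "0 < \<alpha>"
  shows "cutL2 \<alpha> (kernel_op c K f)"
    "(LBINT x. (cmod (kernel_op c K f x))\<^sup>2) \<le> 2 * ((cmod c)\<^sup>2 + (b * \<alpha>)\<^sup>2) * (LBINT x. (cmod (f x))\<^sup>2)"
proof -
  have f1: "cutL1 \<alpha> f" by (rule cutL2_imp_cutL1[OF f])
  then have fi: "integrable lborel f" by (simp add: cutL1_def)
  have fm[measurable]: "f \<in> borel_measurable borel" using f by (simp add: cutL2_def)
  have f2: "integrable lborel (\<lambda>x. (cmod (f x))\<^sup>2)" using f by (simp add: cutL2_def)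
  have f0: "f x = 0" if "x \<notin> {0<..<\<alpha>}" for x using f that unfolding cutL2_def by blast
  define m where "m = (LBINT x. cmod (f x))"
  have m0: "0 \<le> m" by (simp add: m_def)
  have ii: "integrable lborel (\<lambda>x. indicator {0<..<\<alpha>} x :: real)"
    using \<alpha> by (intro integrable_real_indicator) auto
  \<comment> \<open>Cauchy-Schwarz in the form of a variance: the integral of
    \<open>(cmod (f x) - m / \<alpha>)\<^sup>2\<close> over the interval is nonnegative.\<close>
  have CS: "m\<^sup>2 \<le> \<alpha> * (LBINT x. (cmod (f x))\<^sup>2)"
  proof -
    have eq: "(m / \<alpha>)\<^sup>2 * indicator {0<..<\<alpha>} x + (cmod (f x))\<^sup>2 - 2 * (m / \<alpha>) * cmod (f x) = indicator {0<..<\<alpha>} x * (cmod (f x) - m / \<alpha>)\<^sup>2" for x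
      using f0[of x] by (cases "x \<in> {0<..<\<alpha>}") (auto simp: power2_diff algebra_simps)
    have "0 \<le> (LBINT x. (m / \<alpha>)\<^sup>2 * indicator {0<..<\<alpha>} x + (cmod (f x))\<^sup>2 - 2 * (m / \<alpha>) * cmod (f x))"
      unfolding eq by (intro integral_nonneg_AE AE_I2) simp
    also have "\<dots> = (m / \<alpha>)\<^sup>2 * \<alpha> + (LBINT x. (cmod (f x))\<^sup>2) - 2 * (m / \<alpha>) * m"
      using fi f2 ii \<alpha> by (simp add: m_def)
    also have "\<dots> = (LBINT x. (cmod (f x))\<^sup>2) - m\<^sup>2 / \<alpha>" using \<alpha> by (simp add: power2_eq_square field_simps)
    finally show ?thesis using \<alpha> by (simp add: field_simps)
  qed
  have supp: "kernel_op c K f x = 0" if "x \<notin> {0<..<\<alpha>}" for x using kernel_op_cutL1[OF K f1] that unfolding cutL1_def by blast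
  have km[measurable]: "kernel_op c K f \<in> borel_measurable borel"
    using kernel_op_int_measurable[OF K fm] unfolding kernel_op_def[abs_def] by measurable
  have bd: "(cmod (kernel_op c K f x))\<^sup>2 \<le> 2 * (cmod c)\<^sup>2 * (cmod (f x))\<^sup>2 + 2 * (b * m)\<^sup>2 * indicator {0<..<\<alpha>} x" for x
  proof (cases "x \<in> {0<..<\<alpha>}")
    case True
    have "cmod (kernel_op c K f x) \<le> cmod c * cmod (f x) + cmod (LBINT y. K x y * f y)"
      unfolding kernel_op_def using norm_triangle_ineq[of "c * f x" "LBINT y. K x y * f y"] by (simp add: norm_mult)
    also have "\<dots> \<le> cmod c * cmod (f x) + b * m" using kernel_op_integral_bound[OF K fi] by (simp add: m_def)
    finally have "(cmod (kernel_op c K f x))\<^sup>2 \<le> (cmod c * cmod (f x) + b * m)\<^sup>2" by (rule power_mono) simp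
    also have "\<dots> \<le> 2 * (cmod c * cmod (f x))\<^sup>2 + 2 * (b * m)\<^sup>2"
    proof -
      have "0 \<le> (cmod c * cmod (f x) - b * m)\<^sup>2" by simp
      then show ?thesis unfolding power2_diff power2_sum by linarith
    qed
    finally show ?thesis using True by (simp add: power_mult_distrib)
  next
    case False then show ?thesis using supp by simp
  qed
  have bi: "integrable lborel (\<lambda>x. 2 * (cmod c)\<^sup>2 * (cmod (f x))\<^sup>2 + 2 * (b * m)\<^sup>2 * indicator {0<..<\<alpha>} x)"
    using f2 ii by auto
  have ki: "integrable lborel (\<lambda>x. (cmod (kernel_op c K f x))\<^sup>2)"
    by (rule integrable_dominated[OF bi]) (use bd in auto)
  then show "cutL2 \<alpha> (kernel_op c K f)" using supp unfolding cutL2_def by auto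
  have "(LBINT x. (cmod (kernel_op c K f x))\<^sup>2) \<le> (LBINT x. 2 * (cmod c)\<^sup>2 * (cmod (f x))\<^sup>2 + 2 * (b * m)\<^sup>2 * indicator {0<..<\<alpha>} x)"
    by (rule integral_mono[OF ki bi bd])
  also have "\<dots> = 2 * (cmod c)\<^sup>2 * (LBINT x. (cmod (f x))\<^sup>2) + 2 * b\<^sup>2 * \<alpha> * m\<^sup>2"
    using f2 ii \<alpha> by (simp add: power_mult_distrib mult_ac)
  also have "\<dots> \<le> 2 * (cmod c)\<^sup>2 * (LBINT x. (cmod (f x))\<^sup>2) + 2 * b\<^sup>2 * \<alpha> * (\<alpha> * (LBINT x. (cmod (f x))\<^sup>2))"
    using CS \<alpha> by (intro add_left_mono mult_left_mono) auto
  also have "\<dots> = 2 * ((cmod c)\<^sup>2 + (b * \<alpha>)\<^sup>2) * (LBINT x. (cmod (f x))\<^sup>2)"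
    by (simp add: algebra_simps power_mult_distrib power2_eq_square)
  finally show "(LBINT x. (cmod (kernel_op c K f x))\<^sup>2) \<le> 2 * ((cmod c)\<^sup>2 + (b * \<alpha>)\<^sup>2) * (LBINT x. (cmod (f x))\<^sup>2)" .
qed

text \<open>The hypotheses say that \<open>a + W\<close> times \<open>c + R0\<close> equals
  \<open>1 + E\<close>. Multiplying on the right by \<open>1 + N\<close> from the Neumann series
  gives an exact right inverse. It differs from \<open>c + R0\<close> by \<open>c N + R0 N\<close>,
  which is the kernel \<open>D\<close>.\<close>

lemma right_inverse_kernel:
  assumes W: "bounded_kernel \<alpha> w W" and R0: "bounded_kernel \<alpha> b R0" and E: "bounded_kernel \<alpha> \<epsilon> E" and \<alpha>: "0 < \<alpha>" and small: "\<epsilon> * \<alpha> \<le> 1 / 2"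
    and ac: "a * c = 1"
    and id: "\<And>y. y \<in> {0<..<\<alpha>} \<Longrightarrow> AE x in lborel. x \<in> {0<..<\<alpha>} \<longrightarrow> a * R0 x y + c * W x y + kernel_comp W R0 x y = E x y"
  obtains D where "bounded_kernel \<alpha> ((cmod c + b * \<alpha>) * (2 * \<epsilon>)) D"
    "\<And>f. cutL2 \<alpha> f \<Longrightarrow> AE x in lborel. kernel_op a W (kernel_op c (\<lambda>x y. R0 x y + D x y) f) x = f x"
proof -
  obtain N where N: "bounded_kernel \<alpha> (2 * \<epsilon>) N" "\<And>x y. N x y + E x y + kernel_comp E N x y = 0"
    using neumann_kernel[OF E \<alpha> small] by blast
  define D where "D x y = c * N x y + 1 * kernel_comp R0 N x y" for x y
  have RN: "bounded_kernel \<alpha> (b * (2 * \<epsilon> * \<alpha>)) (kernel_comp R0 N)" by (rule kernel_comp_bounded_kernel[OF R0 N(1) \<alpha>])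
  have D: "bounded_kernel \<alpha> ((cmod c + b * \<alpha>) * (2 * \<epsilon>)) D"
    using bounded_kernel_lincomb[OF N(1) RN, of c 1] unfolding D_def[abs_def] by (simp add: algebra_simps)
  have WR: "bounded_kernel \<alpha> (w * (b * \<alpha>)) (kernel_comp W R0)" by (rule kernel_comp_bounded_kernel[OF W R0 \<alpha>])
  have zero: "W x y = 0" "R0 x y = 0" "E x y = 0" "kernel_comp W R0 x y = 0" if "x \<notin> {0<..<\<alpha>} \<or> y \<notin> {0<..<\<alpha>}" for x y
    using that W R0 E WR unfolding bounded_kernel_def by blast+
  have id1: "AE x in lborel. a * R0 x y + c * W x y + kernel_comp W R0 x y = E x y" for y
  proof (cases "y \<in> {0<..<\<alpha>}")
    case True
    from id[OF True] show ?thesis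
    proof eventually_elim
      case (elim x)
      then show ?case by (cases "x \<in> {0<..<\<alpha>}") (auto simp: zero)
    qed
  qed (simp add: zero)
  \<comment> \<open>The identity is known for each \<open>y\<close> and almost every
    \<open>x\<close>, but is applied under an integral over \<open>y\<close> for fixed
    \<open>x\<close>. Measurability of the set where it holds allows the exchange.\<close>
  have id2: "AE x in lborel. AE y in lborel. a * R0 x y + c * W x y + kernel_comp W R0 x y = E x y"
  proof -
    have [measurable]: "case_prod R0 \<in> borel_measurable (lborel \<Otimes>\<^sub>M lborel)" "case_prod W \<in> borel_measurable (lborel \<Otimes>\<^sub>M lborel)"
      "case_prod (kernel_comp W R0) \<in> borel_measurable (lborel \<Otimes>\<^sub>M lborel)" "case_prod E \<in> borel_measurable (lborel \<Otimes>\<^sub>M lborel)"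
      using R0 W WR E by (simp_all add: bounded_kernel_def)
    have "Measurable.pred (lborel \<Otimes>\<^sub>M lborel) (\<lambda>q. a * case_prod R0 q + c * case_prod W q + case_prod (kernel_comp W R0) q = case_prod E q)"
      by measurable
    then have "{q \<in> space (lborel \<Otimes>\<^sub>M lborel). a * R0 (fst q) (snd q) + c * W (fst q) (snd q) + kernel_comp W R0 (fst q) (snd q) = E (fst q) (snd q)} \<in> sets (lborel \<Otimes>\<^sub>M lborel)"
      by (simp add: pred_def case_prod_unfold)
    from lborel_pair.AE_commute[OF this] id1 show ?thesis by simp
  qed
  have "AE x in lborel. kernel_op a W (kernel_op c (\<lambda>x y. R0 x y + D x y) f) x = f x" if f: "cutL2 \<alpha> f" for f
  proof -
    have f1: "cutL1 \<alpha> f" by (rule cutL2_imp_cutL1[OF f])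
    define g where "g = kernel_op 1 N f"
    have g: "cutL1 \<alpha> g" unfolding g_def by (rule kernel_op_cutL1[OF N(1) f1])
    then have gm: "g \<in> borel_measurable borel" using borel_measurable_integrable by (force simp: cutL1_def)
    have 1: "kernel_op c (\<lambda>x y. R0 x y + D x y) f = kernel_op c R0 g"
    proof
      fix x
      show "kernel_op c (\<lambda>x y. R0 x y + D x y) f x = kernel_op c R0 g x"
        unfolding g_def kernel_op_comp[OF R0 N(1) f1]
        by (subst kernel_op_def) (simp add: D_def algebra_simps)
    qed
    have 2: "kernel_op 1 E g x = f x" for x
      unfolding g_def kernel_op_comp[OF E N(1) f1] using N(2) by (simp add: add.commute)
    have "AE x in lborel. kernel_op a W (kernel_op c R0 g) x = kernel_op 1 E g x"
      using id2
    proof eventually_elim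
      case (elim x)
      have "(LBINT y. (a * R0 x y + c * W x y + kernel_comp W R0 x y) * g y) = (LBINT y. E x y * g y)"
      proof (rule bint_cong_AE)
        show "AE y in lborel. (a * R0 x y + c * W x y + kernel_comp W R0 x y) * g y = E x y * g y"
          using elim by eventually_elim simp
        show "(\<lambda>y. (a * R0 x y + c * W x y + kernel_comp W R0 x y) * g y) \<in> borel_measurable lborel"
          "(\<lambda>y. E x y * g y) \<in> borel_measurable lborel"
          using bounded_kernel_row(1)[OF R0, of x] bounded_kernel_row(1)[OF W, of x] bounded_kernel_row(1)[OF WR, of x] bounded_kernel_row(1)[OF E, of x] gm by auto
      qed
      then show ?case unfolding kernel_op_comp[OF W R0 g] by (simp add: kernel_op_def ac)
    qed
    then show ?thesis unfolding 1 2 .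
  qed
  with D show thesis by (rule that)
qed

text \<open>A right inverse of the transposed operator makes the operator itself injective. The
  defect \<open>d\<close>, which is \<open>R W f - f\<close>, is annihilated by the operator.
  Writing \<open>cnj d\<close> as a value of the transposed operator and moving that operator across
  the pairing shows that \<open>d\<close> has norm 0.\<close>

lemma two_sided_inverse:
  assumes W: "bounded_kernel \<alpha> w W" and \<alpha>: "0 < \<alpha>" and R: "bounded_kernel \<alpha> b R" and R': "bounded_kernel \<alpha> b' R'"
    and right: "\<And>f. cutL2 \<alpha> f \<Longrightarrow> AE x in lborel. kernel_op a W (kernel_op c R f) x = f x"
    and right': "\<And>f. cutL2 \<alpha> f \<Longrightarrow> AE x in lborel. kernel_op a (\<lambda>x y. W y x) (kernel_op c' R' f) x = f x"
    and f: "cutL2 \<alpha> f"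
  shows "AE x in lborel. kernel_op c R (kernel_op a W f) x = f x"
proof -
  have Wf: "cutL2 \<alpha> (kernel_op a W f)" by (rule kernel_op_cutL2(1)[OF W f \<alpha>])
  have RWf: "cutL2 \<alpha> (kernel_op c R (kernel_op a W f))" by (rule kernel_op_cutL2(1)[OF R Wf \<alpha>])
  define d where "d = (\<lambda>x. kernel_op c R (kernel_op a W f) x - f x)"
  have dm: "d \<in> borel_measurable borel" using RWf f unfolding d_def cutL2_def by auto
  have d: "cutL2 \<alpha> d"
    unfolding cutL2_def
  proof (intro conjI allI impI dm)
    have i: "integrable lborel (\<lambda>x. 2 * (cmod (kernel_op c R (kernel_op a W f) x))\<^sup>2 + 2 * (cmod (f x))\<^sup>2)"
      using RWf f unfolding cutL2_def by auto
    show "integrable lborel (\<lambda>x. (cmod (d x))\<^sup>2)"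
    proof (rule integrable_dominated[OF i])
      show "AE x in lborel. norm ((cmod (d x))\<^sup>2) \<le> norm (2 * (cmod (kernel_op c R (kernel_op a W f) x))\<^sup>2 + 2 * (cmod (f x))\<^sup>2)"
      proof (intro AE_I2)
        fix x
        define u v where "u = cmod (kernel_op c R (kernel_op a W f) x)" and "v = cmod (f x)"
        have "cmod (d x) \<le> u + v" unfolding d_def u_def v_def by (rule norm_triangle_ineq4)
        then have "(cmod (d x))\<^sup>2 \<le> (u + v)\<^sup>2" by (rule power_mono) simp
        also have "\<dots> \<le> 2 * u\<^sup>2 + 2 * v\<^sup>2"
          using zero_le_power2[of "u - v"] unfolding power2_diff power2_sum by linarith
        finally show "norm ((cmod (d x))\<^sup>2) \<le> norm (2 * (cmod (kernel_op c R (kernel_op a W f) x))\<^sup>2 + 2 * (cmod (f x))\<^sup>2)"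
          by (simp add: u_def v_def)
      qed
    qed (use dm in auto)
    fix x assume "d x \<noteq> 0"
    then have "kernel_op c R (kernel_op a W f) x \<noteq> 0 \<or> f x \<noteq> 0" by (auto simp: d_def)
    then show "x \<in> {0<..<\<alpha>}" using RWf f unfolding cutL2_def by blast
  qed
  have Wd: "AE x in lborel. kernel_op a W d x = 0"
    using right[OF Wf]
  proof eventually_elim
    case (elim x)
    have i1: "integrable lborel (\<lambda>y. W x y * kernel_op c R (kernel_op a W f) y)" and i2: "integrable lborel (\<lambda>y. W x y * f y)"
      using kernel_op_integrand_integrable[OF W] cutL2_imp_cutL1[OF RWf] cutL2_imp_cutL1[OF f] by (auto simp: cutL1_def)
    have A: "(LBINT y. W x y * d y) = (LBINT y. W x y * kernel_op c R (kernel_op a W f) y) - (LBINT y. W x y * f y)"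
      unfolding d_def right_diff_distrib by (rule bint_diff[OF i1 i2])
    have B: "a * d x = a * kernel_op c R (kernel_op a W f) x - a * f x" by (simp add: d_def algebra_simps)
    have "kernel_op a W d x = kernel_op a W (kernel_op c R (kernel_op a W f)) x - kernel_op a W f x"
      unfolding kernel_op_def[of a W d x] A B kernel_op_def[of a W "kernel_op c R (kernel_op a W f)" x] kernel_op_def[of a W f x] by simp
    then show ?case using elim by simp
  qed
  \<comment> \<open>The pairing is bilinear, so the squared norm of \<open>d\<close> is the pairing
    of \<open>d\<close> with its conjugate.\<close>
  have cm: "(\<lambda>x. cnj (d x)) \<in> borel_measurable borel"
    by (rule borel_measurable_continuous_on[OF _ dm]) (intro continuous_intros)
  have dc: "cutL2 \<alpha> (\<lambda>x. cnj (d x))" using d cm unfolding cutL2_def by auto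
  have Rd: "cutL2 \<alpha> (kernel_op c' R' (\<lambda>x. cnj (d x)))" by (rule kernel_op_cutL2(1)[OF R' dc \<alpha>])
  have d2: "integrable lborel (\<lambda>x. (cmod (d x))\<^sup>2)" using d by (simp add: cutL2_def)
  have "(LBINT x. (cmod (d x))\<^sup>2) = 0"
  proof -
    have "of_real (LBINT x. (cmod (d x))\<^sup>2) = (LBINT y. d y * cnj (d y))"
      by (simp add: complex_norm_square[symmetric] flip: of_real_power)
    also have "\<dots> = (LBINT y. d y * kernel_op a (\<lambda>x y. W y x) (kernel_op c' R' (\<lambda>x. cnj (d x))) y)"
    proof (rule bint_cong_AE)
      show "AE y in lborel. d y * cnj (d y) = d y * kernel_op a (\<lambda>x y. W y x) (kernel_op c' R' (\<lambda>x. cnj (d x))) y"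
        using right'[OF dc] by eventually_elim simp
      show "(\<lambda>y. d y * kernel_op a (\<lambda>x y. W y x) (kernel_op c' R' (\<lambda>x. cnj (d x))) y) \<in> borel_measurable lborel"
        using kernel_op_cutL2(1)[OF bounded_kernel_flip[OF W] Rd \<alpha>, of a] dm by (auto simp: cutL2_def)
    qed (use dm cm in auto)
    also have "\<dots> = (LBINT x. kernel_op a W d x * kernel_op c' R' (\<lambda>x. cnj (d x)) x)"
      by (rule kernel_op_pairing[OF W d Rd, symmetric])
    also have "\<dots> = (LBINT x::real. 0)"
    proof (rule bint_cong_AE)
      show "AE x in lborel. kernel_op a W d x * kernel_op c' R' (\<lambda>x. cnj (d x)) x = 0" using Wd by eventually_elim simp
      show "(\<lambda>x. kernel_op a W d x * kernel_op c' R' (\<lambda>x. cnj (d x)) x) \<in> borel_measurable lborel"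
        using kernel_op_cutL2(1)[OF W d \<alpha>, of a] Rd by (auto simp: cutL2_def)
    qed auto
    finally have "complex_of_real (LBINT x. (cmod (d x))\<^sup>2) = 0" by simp
    then show ?thesis by (simp only: of_real_eq_0_iff)
  qed
  then have "AE x in lborel. (cmod (d x))\<^sup>2 = 0" using integral_nonneg_eq_0_iff_AE[OF d2] by simp
  then show ?thesis by eventually_elim (simp add: d_def)
qed

section \<open>Solutions of the truncated equation\<close>

text \<open>The inner convolution need not be bounded: the majorant \<open>w\<close> may grow as
  long as \<open>k\<close> integrates it. The two applications below use a constant \<open>w\<close>
  and a linearly growing one.\<close>

lemma
  assumes m[measurable]: "k \<in> borel_measurable borel" "p \<in> borel_measurable borel" "h \<in> borel_measurable borel"
    and i: "\<And>s. integrable lborel (\<lambda>z. p (s - z) * h z)"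
    and w: "\<And>s. (LBINT z. cmod (p (s - z) * h z)) \<le> w s"
    and kw: "integrable lborel (\<lambda>s. cmod (k (x - s)) * w s)"
  shows conv_assoc: "conv k (conv p h) x = conv (conv k p) h x"
    and conv_assoc_integrable: "integrable lborel (\<lambda>s. k (x - s) * conv p h s)"
    and conv_assoc_integrable': "integrable lborel (\<lambda>z. conv k p (x - z) * h z)"
proof -
  have fm: "(\<lambda>(s, z). k (x - s) * (p (s - z) * h z)) \<in> borel_measurable (lborel \<Otimes>\<^sub>M lborel)" by measurable
  have fi: "integrable lborel (\<lambda>z. k (x - s) * (p (s - z) * h z))" for s using i[of s] by simp
  have fw: "(LBINT z. cmod (k (x - s) * (p (s - z) * h z))) \<le> cmod (k (x - s)) * w s" for s
  proof -
    have "(LBINT z. cmod (k (x - s) * (p (s - z) * h z))) = cmod (k (x - s)) * (LBINT z. cmod (p (s - z) * h z))"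
      unfolding norm_mult[of "k (x - s)"] by simp
    then show ?thesis using mult_left_mono[OF w[of s], of "cmod (k (x - s))"] by simp
  qed
  note joint = fubini_integrable[OF fm fi kw fw]
  have inner: "(LBINT s. k (x - s) * (p (s - z) * h z)) = conv k p (x - z) * h z" for z
  proof -
    have "(LBINT s. k (x - s) * (p (s - z) * h z)) = (LBINT s. k (x - s) * p (s - z)) * h z"
      unfolding mult.assoc[symmetric] by simp
    also have "(LBINT s. k (x - s) * p (s - z)) = (LBINT s. (\<lambda>s. k (x - z - s) * p s) (s + - z))" by simp
    also have "\<dots> = conv k p (x - z)" unfolding conv_def by (rule integral_shift)
    finally show ?thesis .
  qed
  have "conv k (conv p h) x = (LBINT s. LBINT z. k (x - s) * (p (s - z) * h z))"
    unfolding conv_def by simp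
  also have "\<dots> = (LBINT z. LBINT s. k (x - s) * (p (s - z) * h z))"
    by (rule fubini_swap[OF fm fi kw fw, symmetric])
  also have "\<dots> = conv (conv k p) h x" unfolding inner conv_def[of "conv k p"] ..
  finally show "conv k (conv p h) x = conv (conv k p) h x" .
  show "integrable lborel (\<lambda>s. k (x - s) * conv p h s)"
    using lborel_pair.integrable_fst[OF joint] unfolding conv_def by simp
  show "integrable lborel (\<lambda>z. conv k p (x - z) * h z)"
    using lborel_pair.integrable_snd[OF joint] unfolding inner .
qed

section \<open>The whole-line operator with the given symbol\<close>

lemma conv_add_right:
  assumes "integrable lborel (\<lambda>s. k (x - s) * f s)" "integrable lborel (\<lambda>s. k (x - s) * g s)"
  shows "conv k (\<lambda>s. f s + g s) x = conv k f x + conv k g x"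
  unfolding conv_def ring_distribs using assms by simp

lemma conv_diff_right:
  assumes "integrable lborel (\<lambda>s. k (x - s) * f s)" "integrable lborel (\<lambda>s. k (x - s) * g s)"
  shows "conv k (\<lambda>s. f s - g s) x = conv k f x - conv k g x"
  unfolding conv_def ring_distribs using assms by simp

lemma conv_cmult_right: "conv k (\<lambda>s. c * f s) x = c * conv k f x"
  unfolding conv_def by (simp add: mult.left_commute)

lemma conv_shift_right: "conv k (\<lambda>s. f (s - y)) x = conv k f (x - y)"
proof -
  have "conv k (\<lambda>s. f (s - y)) x = (LBINT s. (\<lambda>s. k (x - y - s) * f s) (s + - y))" unfolding conv_def by simp
  also have "\<dots> = conv k f (x - y)" unfolding conv_def by (rule integral_shift)
  finally show ?thesis .
qed

text \<open>Boundedness would be too narrow a domain, because the half-line solutions grow linearly;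
  what is asked is just convergence of the convolution at every point.\<close>

definition admissible :: "(real \<Rightarrow> complex) \<Rightarrow> (real \<Rightarrow> complex) \<Rightarrow> bool" where
  "admissible k f \<longleftrightarrow> (\<forall>x. integrable lborel (\<lambda>s. k (x - s) * f s))"

definition sym_op :: "complex \<Rightarrow> (real \<Rightarrow> complex) \<Rightarrow> (real \<Rightarrow> complex) \<Rightarrow> real \<Rightarrow> complex" where
  "sym_op a k f x = a * f x + conv k f x"

lemma admissible_add: "admissible k f \<Longrightarrow> admissible k g \<Longrightarrow> admissible k (\<lambda>s. f s + g s)"
  unfolding admissible_def ring_distribs by simp

lemma admissible_diff: "admissible k f \<Longrightarrow> admissible k g \<Longrightarrow> admissible k (\<lambda>s. f s - g s)"
  unfolding admissible_def ring_distribs by simp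

lemma admissible_cmult: "admissible k f \<Longrightarrow> admissible k (\<lambda>s. c * f s)"
  unfolding admissible_def by (simp add: mult.left_commute)

lemma admissible_shift:
  assumes "admissible k f" shows "admissible k (\<lambda>s. f (s - y))"
  unfolding admissible_def
proof
  fix x
  show "integrable lborel (\<lambda>s. k (x - s) * f (s - y))"
    using assms integrable_shift_iff[of "\<lambda>s. k (x - y - s) * f s" "-y"] unfolding admissible_def by simp
qed

lemma sym_op_add: "admissible k f \<Longrightarrow> admissible k g \<Longrightarrow> sym_op a k (\<lambda>s. f s + g s) x = sym_op a k f x + sym_op a k g x"
  unfolding sym_op_def admissible_def by (simp add: conv_add_right algebra_simps)

lemma sym_op_diff: "admissible k f \<Longrightarrow> admissible k g \<Longrightarrow> sym_op a k (\<lambda>s. f s - g s) x = sym_op a k f x - sym_op a k g x"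
  unfolding sym_op_def admissible_def by (simp add: conv_diff_right algebra_simps)

lemma sym_op_cmult: "sym_op a k (\<lambda>s. c * f s) x = c * sym_op a k f x"
  unfolding sym_op_def by (simp add: conv_cmult_right algebra_simps)

lemma sym_op_shift: "sym_op a k (\<lambda>s. f (s - y)) x = sym_op a k f (x - y)"
  unfolding sym_op_def by (simp add: conv_shift_right)

text \<open>The composite density on the right becomes \<open>Sminus\<close> when \<open>p\<close>
  is \<open>pfun Up\<close>, and \<open>Splus\<close> when it is \<open>mfun Um\<close>. Thus
  applying \<sigma> after one inverse factor leaves the other Wiener-Hopf factor, whose density is
  one-sided.\<close>

lemma sym_op_factor:
  assumes m: "k \<in> borel_measurable borel" "p \<in> borel_measurable borel" "h \<in> borel_measurable borel"
    and h: "admissible k h"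
    and i: "\<And>s. integrable lborel (\<lambda>z. p (s - z) * h z)"
    and w: "\<And>s. (LBINT z. cmod (p (s - z) * h z)) \<le> w s"
    and kw: "\<And>x. integrable lborel (\<lambda>s. cmod (k (x - s)) * w s)"
  shows "sym_op a k (\<lambda>s. c * h s + conv p h s) x = a * c * h x + conv (\<lambda>u. a * p u + c * k u + conv k p u) h x"
    and "admissible k (\<lambda>s. c * h s + conv p h s)"
proof -
  have ad: "admissible k (conv p h)"
    unfolding admissible_def using conv_assoc_integrable[OF m i w kw] by blast
  show "admissible k (\<lambda>s. c * h s + conv p h s)" by (intro admissible_add admissible_cmult h ad)
  have i1: "integrable lborel (\<lambda>s. p (x - s) * h s)" by (rule i)
  have i2: "integrable lborel (\<lambda>s. k (x - s) * h s)" using h unfolding admissible_def by blast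
  have i3: "integrable lborel (\<lambda>s. conv k p (x - s) * h s)" by (rule conv_assoc_integrable'[OF m i w kw])
  have "conv (\<lambda>u. a * p u + c * k u + conv k p u) h x
     = (LBINT s. a * (p (x - s) * h s) + c * (k (x - s) * h s) + conv k p (x - s) * h s)"
    unfolding conv_def[of _ h] by (simp add: algebra_simps)
  also have "\<dots> = a * conv p h x + c * conv k h x + conv (conv k p) h x"
    unfolding conv_def[of _ h] using i1 i2 i3 by simp
  finally show "sym_op a k (\<lambda>s. c * h s + conv p h s) x = a * c * h x + conv (\<lambda>u. a * p u + c * k u + conv k p u) h x"
    unfolding sym_op_add[OF admissible_cmult[OF h] ad] sym_op_cmult
    unfolding sym_op_def conv_assoc[OF m i w kw] by (simp add: algebra_simps)
qed

text \<open>For the pair \<open>cp\<close>, \<open>Up\<close> this is \<open>t\<close> times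
  W(1/sigma_+) applied to 1; for \<open>cm\<close> and the reflected \<open>Um\<close> it is
  \<open>t\<close> times W of the reflected 1/sigma_- applied to 1. The extension by 0 allows the
  whole-line operator to act on it.\<close>

definition wh_one :: "complex \<Rightarrow> (real \<Rightarrow> complex) \<Rightarrow> real \<Rightarrow> complex" where
  "wh_one c U x = (if 0 < x then c + of_real x + (LBINT u. if u < x then U u else 0) else 0)"

context wh_time
begin

abbreviation "p \<equiv> pfun Up"
abbreviation "m \<equiv> mfun Um"

lemma reflected: "wh_time a cm cp s (\<lambda>x. k (- x)) (\<lambda>x. Um (- x)) (\<lambda>x. Up (- x)) C \<eta>"
proof
  show "0 < \<eta>" "s \<noteq> 0" by (fact eta s)+
  show "exp_bounded C \<eta> (\<lambda>x. k (- x))" "exp_bounded C \<eta> (\<lambda>x. Um (- x))" "exp_bounded C \<eta> (\<lambda>x. Up (- x))"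
    using exp_bounded_reflect k Um Up by blast+
  show "(LBINT x. k (- x)) = - a" using int_k integral_reflect[of k] by simp
  show "(LBINT x. of_real x * k (- x)) = 0"
  proof -
    have "(LBINT x. of_real x * k (- x)) = (LBINT x. (\<lambda>x. - (of_real x * k x)) (- x))" by simp
    also have "\<dots> = (LBINT x. - (of_real x * k x))" by (rule integral_reflect)
    finally show ?thesis using moment_k by simp
  qed
  have [measurable]: "Splus a k cm Um \<in> borel_measurable borel" "Sminus a k cp Up \<in> borel_measurable borel"
    using Sp(1) Sm(1) by (auto simp: exp_bounded_def)
  have [measurable]: "p \<in> borel_measurable borel" "m \<in> borel_measurable borel"
    using Up Um by (auto simp: exp_bounded_def)
  show "exp_bounded C \<eta> (Splus a (\<lambda>x. k (- x)) cp (\<lambda>x. Up (- x)))"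
    using exp_bounded_reflect[OF Sm(1)] by (simp add: Splus_reflect[abs_def])
  show "exp_bounded C \<eta> (Sminus a (\<lambda>x. k (- x)) cm (\<lambda>x. Um (- x)))"
    using exp_bounded_reflect[OF Sp(1)] by (simp add: Sminus_reflect[abs_def])
  show "AE x in lborel. x < 0 \<longrightarrow> Splus a (\<lambda>x. k (- x)) cp (\<lambda>x. Up (- x)) x = 0"
    using AE_reflect[OF _ Sm(2)] by (simp add: Splus_reflect)
  show "AE x in lborel. 0 < x \<longrightarrow> Sminus a (\<lambda>x. k (- x)) cm (\<lambda>x. Um (- x)) x = 0"
    using AE_reflect[OF _ Sp(2)] by (simp add: Sminus_reflect)
  show "(LBINT x. Splus a (\<lambda>x. k (- x)) cp (\<lambda>x. Up (- x)) x) = - a * cp"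
    using Sm(3) integral_reflect[of "Sminus a k cp Up"] by (simp add: Splus_reflect)
  show "(LBINT x. Sminus a (\<lambda>x. k (- x)) cm (\<lambda>x. Um (- x)) x) = - a * cm"
    using Sp(3) integral_reflect[of "Splus a k cm Um"] by (simp add: Sminus_reflect)
  show "AE x in lborel. a * cp * pfun (\<lambda>x. Um (- x)) x + cm * Splus a (\<lambda>x. k (- x)) cp (\<lambda>x. Up (- x)) x +
      conv (Splus a (\<lambda>x. k (- x)) cp (\<lambda>x. Up (- x))) (pfun (\<lambda>x. Um (- x))) x = 0"
    using AE_reflect[OF _ Sm(4)] by (simp add: Splus_reflect[abs_def] pfun_reflect[abs_def] conv_reflect)
  show "AE x in lborel. a * cm * mfun (\<lambda>x. Up (- x)) x + cp * Sminus a (\<lambda>x. k (- x)) cm (\<lambda>x. Um (- x)) x +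
      conv (Sminus a (\<lambda>x. k (- x)) cm (\<lambda>x. Um (- x))) (mfun (\<lambda>x. Up (- x))) x = 0"
    using AE_reflect[OF _ Sp(4)] by (simp add: Sminus_reflect[abs_def] mfun_reflect[abs_def] conv_reflect)
  show "a * cm * cp = s" using s by (simp add: mult_ac)
qed (use Up Um in auto)

lemma meas [measurable]: "k \<in> borel_measurable borel" "Up \<in> borel_measurable borel" "Um \<in> borel_measurable borel"
  using k Up Um by (auto simp: exp_bounded_def)

lemma C_nonneg: "0 \<le> C" by (rule exp_bounded_nonneg[OF k])

lemma int: "integrable lborel k" "integrable lborel Up" "integrable lborel Um"
  using exp_bounded_integrable[OF _ eta] k Up Um by auto

lemma bounds: "cmod (k x) \<le> C" "cmod (Up x) \<le> C" "cmod (Um x) \<le> C"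
  using exp_bounded_le[of C \<eta>] k Up Um eta by auto

lemma p_bound: "cmod (p x) \<le> 1 + C"
  using norm_triangle_ineq[of "if 0 < x then 1 else 0" "Up x"] bounds(2)[of x] C_nonneg by (auto simp: pfun_def split: if_splits)

lemma m_bound: "cmod (m x) \<le> 1 + C"
  using norm_triangle_ineq[of "if x < 0 then 1 else 0" "Um x"] bounds(3)[of x] C_nonneg by (auto simp: mfun_def split: if_splits)

lemma p_neg: "x < 0 \<Longrightarrow> p x = 0" by (simp add: pfun_def Up)
lemma m_pos: "0 < x \<Longrightarrow> m x = 0" by (simp add: mfun_def Um)

lemma k_moment_abs: "integrable lborel (\<lambda>s. cmod (k (x - s)) * \<bar>s\<bar>)"
proof -
  have "integrable lborel (\<lambda>u. of_real u * k u)"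
    using weighted_L1_moment[OF exp_bounded_weighted_L1[OF k eta]] eta by simp
  then have 1: "integrable lborel (\<lambda>u. \<bar>u\<bar> * cmod (k u))" by (auto dest: integrable_norm simp: norm_mult)
  have 2: "integrable lborel (\<lambda>u. \<bar>x\<bar> * cmod (k u))" using int(1) by simp
  have "integrable lborel (\<lambda>u. \<bar>x - u\<bar> * cmod (k u))"
  proof (rule integrable_dominated[OF Bochner_Integration.integrable_add[OF 1 2]])
    show "AE u in lborel. norm (\<bar>x - u\<bar> * cmod (k u)) \<le> norm (\<bar>u\<bar> * cmod (k u) + \<bar>x\<bar> * cmod (k u))"
    proof (intro AE_I2)
      fix u
      have "\<bar>x - u\<bar> * cmod (k u) \<le> (\<bar>u\<bar> + \<bar>x\<bar>) * cmod (k u)" by (intro mult_right_mono) auto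
      then show "norm (\<bar>x - u\<bar> * cmod (k u)) \<le> norm (\<bar>u\<bar> * cmod (k u) + \<bar>x\<bar> * cmod (k u))"
        by (simp add: abs_mult distrib_right)
    qed
  qed measurable
  then show ?thesis
    using integrable_sub_iff[of "\<lambda>u. \<bar>x - u\<bar> * cmod (k u)" x] by (simp add: mult.commute)
qed

lemma admissible_bounded:
  assumes "f \<in> borel_measurable borel" "\<And>x. cmod (f x) \<le> b"
  shows "admissible k f"
  unfolding admissible_def using integrable_conv_integrand[OF int(1) assms] by blast

text \<open>Both \<open>p\<close> and \<open>h\<close> live on the positive axis, so only
  \<open>z\<close> between 0 and \<open>s\<close> contributes and \<open>conv p h\<close> grows at
  most linearly; the first moment of \<open>k\<close> then controls the double integral.\<close>

lemma
  assumes hm: "h \<in> borel_measurable borel" and hb: "\<And>z. cmod (h z) \<le> b" and h0: "\<And>z. z \<le> 0 \<Longrightarrow> h z = 0"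
  shows factor_right: "sym_op a k (\<lambda>s. cp * h s + conv p h s) x = a * cp * h x + conv (Sminus a k cp Up) h x"
    and factor_right_admissible: "admissible k (\<lambda>s. cp * h s + conv p h s)"
proof -
  have b0: "0 \<le> b" using order_trans[OF norm_ge_zero hb] .
  have le: "cmod (p (s - z) * h z) \<le> (1 + C) * b * indicator {0..max 0 s} z" for s z
  proof (cases "0 \<le> z \<and> z \<le> s")
    case True
    have "cmod (p (s - z)) * cmod (h z) \<le> (1 + C) * b"
      using p_bound hb C_nonneg by (intro mult_mono) auto
    then show ?thesis using True by (simp add: norm_mult)
  next
    case False
    then have "p (s - z) = 0 \<or> h z = 0" using p_neg[of "s - z"] h0[of z] by force
    then show ?thesis using b0 C_nonneg by auto
  qed
  have ii: "integrable lborel (\<lambda>z::real. (1 + C) * b * indicator {0..max 0 s} z :: real)" for s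
    by (intro integrable_mult_right integrable_real_indicator) auto
  have i: "integrable lborel (\<lambda>z. p (s - z) * h z)" for s
  proof (rule integrable_dominated[OF ii[of s]])
    show "(\<lambda>z. p (s - z) * h z) \<in> borel_measurable lborel" using hm by measurable
    show "AE z in lborel. cmod (p (s - z) * h z) \<le> norm ((1 + C) * b * indicator {0..max 0 s} z :: real)"
      using le[of s] b0 C_nonneg by (auto simp: abs_mult)
  qed
  have w: "(LBINT z. cmod (p (s - z) * h z)) \<le> (1 + C) * b * \<bar>s\<bar>" for s
  proof -
    have "(LBINT z. cmod (p (s - z) * h z)) \<le> (LBINT z. (1 + C) * b * indicator {0..max 0 s} z)"
      by (rule integral_mono) (use i ii le in auto)
    also have "\<dots> = (1 + C) * b * max 0 s" by simp
    also have "\<dots> \<le> (1 + C) * b * \<bar>s\<bar>" using b0 C_nonneg by (intro mult_left_mono) auto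
    finally show ?thesis .
  qed
  have kw: "integrable lborel (\<lambda>s. cmod (k (x - s)) * ((1 + C) * b * \<bar>s\<bar>))" for x
    using integrable_mult_right[OF k_moment_abs[of x], of "(1 + C) * b"] by (simp add: mult_ac)
  have pm: "p \<in> borel_measurable borel" by measurable
  note f1 = sym_op_factor(1)[OF meas(1) pm hm admissible_bounded[OF hm hb] i w kw, of a cp x]
  note f2 = sym_op_factor(2)[OF meas(1) pm hm admissible_bounded[OF hm hb] i w kw, of cp]
  show "sym_op a k (\<lambda>s. cp * h s + conv p h s) x = a * cp * h x + conv (Sminus a k cp Up) h x"
    using f1 unfolding Sminus_def[abs_def] by simp
  show "admissible k (\<lambda>s. cp * h s + conv p h s)" by (rule f2)
qed

text \<open>Integrability of \<open>h\<close> keeps \<open>conv m h\<close> bounded although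
  \<open>m\<close> tends to 1 at minus infinity, so here a constant majorant serves.\<close>

lemma
  assumes hi: "integrable lborel h" and hb: "\<And>z. cmod (h z) \<le> b"
  shows factor_left: "sym_op a k (\<lambda>s. cm * h s + conv m h s) x = a * cm * h x + conv (Splus a k cm Um) h x"
    and factor_left_admissible: "admissible k (\<lambda>s. cm * h s + conv m h s)"
proof -
  have hm[measurable]: "h \<in> borel_measurable borel" using hi borel_measurable_integrable by force
  have ii: "integrable lborel (\<lambda>z. (1 + C) * cmod (h z))" using hi by simp
  have le: "cmod (m (s - z) * h z) \<le> (1 + C) * cmod (h z)" for s z
    using m_bound[of "s - z"] by (simp add: norm_mult mult_right_mono)
  have i: "integrable lborel (\<lambda>z. m (s - z) * h z)" for s
    by (rule integrable_dominated[OF ii]) (use le C_nonneg in \<open>auto simp: abs_mult\<close>)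
  have w: "(LBINT z. cmod (m (s - z) * h z)) \<le> (LBINT z. (1 + C) * cmod (h z))" for s
    by (rule integral_mono) (use i ii le in auto)
  have kw: "integrable lborel (\<lambda>s. cmod (k (x - s)) * (LBINT z. (1 + C) * cmod (h z)))" for x
    using int(1) integrable_sub_iff[of "\<lambda>s. cmod (k s)" x] by simp
  have mm: "m \<in> borel_measurable borel" by measurable
  note f1 = sym_op_factor(1)[OF meas(1) mm hm admissible_bounded[OF hm hb] i w kw, of a cm x]
  note f2 = sym_op_factor(2)[OF meas(1) mm hm admissible_bounded[OF hm hb] i w kw, of cm]
  show "sym_op a k (\<lambda>s. cm * h s + conv m h s) x = a * cm * h x + conv (Splus a k cm Um) h x"
    using f1 unfolding Splus_def[abs_def] by simp
  show "admissible k (\<lambda>s. cm * h s + conv m h s)" by (rule f2)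
qed

section \<open>Columns of the half-line inverse and of its correction at the right end\<close>

lemma Sm_meas [measurable]: "Sminus a k cp Up \<in> borel_measurable borel" using Sm(1) by (simp add: exp_bounded_def)
lemma Sp_meas [measurable]: "Splus a k cm Um \<in> borel_measurable borel" using Sp(1) by (simp add: exp_bounded_def)

lemma AE_sub:
  assumes "Measurable.pred borel P" "AE u::real in lborel. P u" shows "AE s in lborel. P (x - s)"
  using AE_borel_affine[of "-1" P x] assms by simp

lemma AE_shift:
  assumes "Measurable.pred borel P" "AE u::real in lborel. P u" shows "AE x in lborel. P (x - y)"
  using AE_borel_affine[of 1 P "-y"] assms by simp

text \<open>Up to the factor \<open>t\<close> and a point mass, \<open>m_cut y\<close> is column
  \<open>y\<close> of W(1/sigma_-) on the half-line.\<close>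

definition m_cut :: "real \<Rightarrow> real \<Rightarrow> complex" where
  "m_cut y z = (if 0 < z then m (z - y) else 0)"

text \<open>With \<open>z = \<alpha> + x\<close> this is the kernel of H(u_+) Q_\<alpha> in the
  variables \<open>x\<close> and \<open>y\<close>. Placing it beyond \<alpha> turns the product of
  two Hankel operators into a convolution.\<close>

definition Up_cut :: "real \<Rightarrow> real \<Rightarrow> real \<Rightarrow> complex" where
  "Up_cut \<alpha> y z = (if \<alpha> < z then Up (z - y) else 0)"

lemma m_cut_zero: "z \<le> 0 \<Longrightarrow> m_cut y z = 0"
  by (simp add: m_cut_def)

lemma m_cut_meas [measurable]: "m_cut y \<in> borel_measurable borel"
  unfolding m_cut_def[abs_def] by measurable

lemma Up_cut_meas [measurable]: "Up_cut \<alpha> y \<in> borel_measurable borel"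
  unfolding Up_cut_def[abs_def] by measurable

lemma m_cut_bound: "cmod (m_cut y z) \<le> 1 + C"
  using m_bound C_nonneg by (auto simp: m_cut_def)

lemma Up_cut_bound: "cmod (Up_cut \<alpha> y z) \<le> C"
  using bounds C_nonneg by (auto simp: Up_cut_def)

lemma Up_cut_integrable: "integrable lborel (Up_cut \<alpha> y)"
proof -
  have "integrable lborel (\<lambda>z. Up (z - y))" using integrable_shift_iff[of Up "-y"] int(2) by simp
  then show ?thesis unfolding Up_cut_def[abs_def] by (intro integrable_if) auto
qed

text \<open>The function is column \<open>y\<close> of W(1/sigma_+) W(1/sigma_-), scaled by
  \<open>s\<close> and without its point mass \<open>cp * cm\<close>. Applying \<sigma> leaves the
  minus factor, whose product with 1/sigma_- is a pure point mass; the term with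
  \<open>k (x - y)\<close> accounts for the omitted mass.\<close>

lemma column_left:
  "AE x in lborel. 0 < x \<longrightarrow>
     sym_op a k (\<lambda>z. cp * m_cut y z + conv p (m_cut y) z + cm * p (z - y)) x + cp * cm * k (x - y) = 0"
proof -
  have ad: "admissible k (\<lambda>z. cp * m_cut y z + conv p (m_cut y) z)"
    by (rule factor_right_admissible[OF m_cut_meas m_cut_bound m_cut_zero])
  have adp: "admissible k p" by (rule admissible_bounded[OF _ p_bound]) measurable
  have 1: "sym_op a k (\<lambda>z. cp * m_cut y z + conv p (m_cut y) z + cm * p (z - y)) x
     = a * cp * m_cut y x + conv (Sminus a k cp Up) (m_cut y) x + cm * sym_op a k p (x - y)" for x
    unfolding sym_op_add[OF ad admissible_cmult[OF admissible_shift[OF adp]]] sym_op_cmult sym_op_shift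
    using factor_right[OF m_cut_meas m_cut_bound m_cut_zero, of y x] by simp
  have "AE x in lborel. a * cp * m (x - y) + cm * Sminus a k cp Up (x - y) + conv (Sminus a k cp Up) m (x - y) = 0"
    by (rule AE_shift[OF _ Sm(4)]) measurable
  then show ?thesis
  proof eventually_elim
    case (elim x)
    show ?case
    proof
      assume x: "0 < x"
      \<comment> \<open>Cutting \<open>m\<close> at 0 is invisible from \<open>x > 0\<close>: for
        the omitted \<open>z \<le> 0\<close> the difference \<open>x - z\<close> is positive, where
        \<open>Sminus\<close> vanishes.\<close>
      have "conv (Sminus a k cp Up) (m_cut y) x = conv (Sminus a k cp Up) (\<lambda>z. m (z - y)) x"
        unfolding conv_def
      proof (rule bint_cong_AE)
        have "AE z in lborel. 0 < x - z \<longrightarrow> Sminus a k cp Up (x - z) = 0"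
          by (rule AE_sub[OF _ Sm(2)]) measurable
        then show "AE z in lborel. Sminus a k cp Up (x - z) * m_cut y z = Sminus a k cp Up (x - z) * m (z - y)"
          by eventually_elim (use x in \<open>auto simp: m_cut_def\<close>)
      qed measurable
      also have "\<dots> = conv (Sminus a k cp Up) m (x - y)" by (rule conv_shift_right)
      finally have 2: "conv (Sminus a k cp Up) (m_cut y) x = conv (Sminus a k cp Up) m (x - y)" .
      have 3: "cm * sym_op a k p (x - y) + cp * cm * k (x - y) = cm * Sminus a k cp Up (x - y)"
        unfolding sym_op_def Sminus_def by (simp add: algebra_simps)
      have "sym_op a k (\<lambda>z. cp * m_cut y z + conv p (m_cut y) z + cm * p (z - y)) x + cp * cm * k (x - y)
        = a * cp * m (x - y) + cm * Sminus a k cp Up (x - y) + conv (Sminus a k cp Up) m (x - y)"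
        unfolding 1 2 3[symmetric] using x by (simp add: m_cut_def)
      with elim show "sym_op a k (\<lambda>z. cp * m_cut y z + conv p (m_cut y) z + cm * p (z - y)) x + cp * cm * k (x - y) = 0" by simp
    qed
  qed
qed

lemma sym_op_const: "sym_op a k (\<lambda>_. c) x = 0"
  unfolding sym_op_def conv_def using integral_sub[of k x] int_k by simp

lemma admissible_const: "admissible k (\<lambda>_. c)"
  by (rule admissible_bounded[of _ "cmod c"]) auto

lemma admissible_id: "admissible k of_real"
  unfolding admissible_def
proof
  fix x
  show "integrable lborel (\<lambda>s. k (x - s) * of_real s)"
    by (rule integrable_dominated[OF k_moment_abs[of x]]) (auto simp: norm_mult abs_mult)
qed

text \<open>The vanishing first moment of \<open>k\<close> enters here. Together with
  \<open>sym_op_const\<close> it lets affine terms be added freely to solutions.\<close>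

lemma sym_op_id: "sym_op a k of_real x = 0"
proof -
  have i: "integrable lborel (\<lambda>u. of_real u * k u)"
    using weighted_L1_moment[OF exp_bounded_weighted_L1[OF k eta]] eta by simp
  have "conv k of_real x = (LBINT s. (\<lambda>u. k u * of_real (x - u)) (x - s))" unfolding conv_def by simp
  also have "\<dots> = (LBINT u. k u * of_real (x - u))" by (rule integral_sub)
  also have "\<dots> = (LBINT u. of_real x * k u - of_real u * k u)" by (simp add: algebra_simps)
  also have "\<dots> = of_real x * (LBINT u. k u) - (LBINT u. of_real u * k u)" using i int(1) by simp
  finally show ?thesis unfolding sym_op_def using int_k moment_k by simp
qed

text \<open>Applying \<sigma> after \<open>t / sigma_-\<close> leaves the plus factor, which
  propagates only to the right, and its argument starts at \<alpha>. The constant may be subtracted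
  because constants are annihilated; it is chosen so that below \<alpha> only the convolution with
  \<open>Um\<close> remains (\<open>conv_m_Up_cut\<close>).\<close>

lemma column_right:
  assumes "x < \<alpha>"
  shows "sym_op a k (\<lambda>z. cm * Up_cut \<alpha> y z + conv m (Up_cut \<alpha> y) z - (LBINT z. Up_cut \<alpha> y z)) x = 0"
proof -
  have "conv (Splus a k cm Um) (Up_cut \<alpha> y) x = (LBINT s::real. 0)"
    unfolding conv_def
  proof (rule bint_cong_AE)
    have "AE z in lborel. x - z < 0 \<longrightarrow> Splus a k cm Um (x - z) = 0"
      by (rule AE_sub[OF _ Sp(2)]) measurable
    then show "AE z in lborel. Splus a k cm Um (x - z) * Up_cut \<alpha> y z = 0"
      by eventually_elim (use assms in \<open>auto simp: Up_cut_def\<close>)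
  qed measurable
  then show ?thesis
    unfolding sym_op_diff[OF factor_left_admissible[OF Up_cut_integrable Up_cut_bound] admissible_const] sym_op_const
      factor_left[OF Up_cut_integrable Up_cut_bound]
    using assms by (simp add: Up_cut_def)
qed

text \<open>The step function of the half-line is fed into the inverse plus factor, the form to
  which \<open>factor_right\<close> applies.\<close>

lemma wh_one_eq:
  "wh_one cp Up x = cp * (if 0 < x then 1 else 0) + conv p (\<lambda>z. if 0 < z then 1 else 0) x"
proof (cases "0 < x")
  case True
  have i1: "integrable lborel (\<lambda>u. indicator {0<..<x} u *\<^sub>R (1::complex))"
    using True by (intro integrable_real_indicator[THEN integrable_scaleR_left]) auto
  have i2: "integrable lborel (\<lambda>u. if u < x then Up u else 0)" by (intro integrable_if int) auto
  have "conv p (\<lambda>z. if 0 < z then 1 else 0) x = (LBINT s. (\<lambda>u. if u < x then p u else 0) (x - s))"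
    unfolding conv_def by (intro bint_cong) auto
  also have "\<dots> = (LBINT u. if u < x then p u else 0)" by (rule integral_sub)
  also have "\<dots> = (LBINT u. indicator {0<..<x} u *\<^sub>R 1 + (if u < x then Up u else 0))"
    by (intro bint_cong) (auto simp: pfun_def indicator_def)
  also have "\<dots> = of_real x + (LBINT u. if u < x then Up u else 0)"
    unfolding bint_add[OF i1 i2] using True by (simp add: scaleR_conv_of_real)
  finally show ?thesis using True by (simp add: wh_one_def)
next
  case False
  have "(\<lambda>s. p (x - s) * (if 0 < s then 1 else 0)) = (\<lambda>s. 0)" using False p_neg by (auto simp: fun_eq_iff)
  then have "conv p (\<lambda>z. if 0 < z then 1 else 0) x = 0" unfolding conv_def by simp
  then show ?thesis using False by (simp add: wh_one_def)
qed

lemma wh_one_admissible: "admissible k (wh_one cp Up)"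
  unfolding wh_one_eq[abs_def] by (rule factor_right_admissible[of _ 1]) auto

text \<open>A homogeneous solution exists because sigma_- vanishes at 0: seen from
  \<open>x > 0\<close>, \<open>Sminus\<close> is integrated over its entire support, and its total
  mass \<open>- a * cp\<close> cancels the multiple of the identity.\<close>

lemma sym_op_wh_one:
  assumes "0 < x" shows "sym_op a k (wh_one cp Up) x = 0"
proof -
  have "conv (Sminus a k cp Up) (\<lambda>z. if 0 < z then 1 else 0) x = (LBINT s. Sminus a k cp Up (x - s))"
    unfolding conv_def
  proof (rule bint_cong_AE)
    have "AE z in lborel. 0 < x - z \<longrightarrow> Sminus a k cp Up (x - z) = 0"
      by (rule AE_sub[OF _ Sm(2)]) measurable
    then show "AE z in lborel. Sminus a k cp Up (x - z) * (if 0 < z then 1 else 0) = Sminus a k cp Up (x - z)"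
      by eventually_elim (use assms in auto)
  qed measurable
  also have "\<dots> = - a * cp" unfolding integral_sub by (rule Sm(3))
  finally have "conv (Sminus a k cp Up) (\<lambda>z. if 0 < z then 1 else 0) x = - a * cp" .
  then show ?thesis
    unfolding wh_one_eq[abs_def] using factor_right[of "\<lambda>z. if 0 < z then 1 else 0" 1 x] assms by simp
qed

end

text \<open>The rate is split: one half gives the decay in \<open>x\<close>, the other keeps the
  integral finite.\<close>

lemma exp_bounded_tail:
  assumes U: "exp_bounded C \<eta> U" and \<eta>: "0 < \<eta>" and x: "0 \<le> x"
  shows "(LBINT u. if x \<le> u then cmod (U u) else 0) \<le> C * (LBINT u. exp (- (\<eta>/2) * \<bar>u\<bar>)) * exp (- (\<eta>/2) * x)"
proof -
  have C0: "0 \<le> C" by (rule exp_bounded_nonneg[OF U])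
  have i: "integrable lborel (\<lambda>u. C * exp (- (\<eta>/2) * x) * exp (- (\<eta>/2) * \<bar>u\<bar>))"
    using integrable_exp_abs[of "\<eta>/2"] \<eta> by simp
  have "(LBINT u. if x \<le> u then cmod (U u) else 0) \<le> (LBINT u. C * exp (- (\<eta>/2) * x) * exp (- (\<eta>/2) * \<bar>u\<bar>))"
  proof (rule integral_mono'[OF i])
    fix u
    show "0 \<le> C * exp (- (\<eta>/2) * x) * exp (- (\<eta>/2) * \<bar>u\<bar>)" using C0 by simp
    show "(if x \<le> u then cmod (U u) else 0) \<le> C * exp (- (\<eta>/2) * x) * exp (- (\<eta>/2) * \<bar>u\<bar>)"
    proof (cases "x \<le> u")
      case True
      have "cmod (U u) \<le> C * exp (- \<eta> * \<bar>u\<bar>)" using U unfolding exp_bounded_def by blast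
      also have "\<dots> = C * (exp (- (\<eta>/2) * u) * exp (- (\<eta>/2) * \<bar>u\<bar>))"
        using True x by (simp add: exp_add[symmetric] algebra_simps)
      also have "\<dots> \<le> C * (exp (- (\<eta>/2) * x) * exp (- (\<eta>/2) * \<bar>u\<bar>))"
      proof (intro mult_left_mono[OF _ C0] mult_right_mono)
        show "exp (- (\<eta>/2) * u) \<le> exp (- (\<eta>/2) * x)" using mult_left_mono[OF True, of "\<eta>/2"] \<eta> by simp
      qed simp
      finally show ?thesis using True by (simp add: mult.assoc)
    next
      case False then show ?thesis using C0 by simp
    qed
  qed
  then show ?thesis by (simp add: mult_ac)
qed

lemma norm_integral_le:
  assumes "integrable lborel w" "\<And>x. cmod (f x) \<le> w x"
  shows "cmod (LBINT x. f x) \<le> (LBINT x. w x)"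
proof -
  have "cmod (LBINT x. f x) \<le> (LBINT x. cmod (f x))" by (rule integral_norm_bound)
  also have "\<dots> \<le> (LBINT x. w x)"
    using assms order_trans[OF norm_ge_zero assms(2)] by (intro integral_mono') auto
  finally show ?thesis .
qed

text \<open>Reflection of (0,\<alpha>) in its midpoint turns solutions adapted to the left end for
  the reflected kernel into solutions adapted to the right end for \<open>k\<close>.\<close>

lemma conv_flip_at: "conv k (\<lambda>z. f (\<alpha> - z)) x = conv (\<lambda>x. k (- x)) f (\<alpha> - x)"
proof -
  have "conv k (\<lambda>z. f (\<alpha> - z)) x = (LBINT z. (\<lambda>z. k (- (\<alpha> - x - z)) * f z) (\<alpha> - z))" unfolding conv_def by simp
  also have "\<dots> = conv (\<lambda>x. k (- x)) f (\<alpha> - x)" unfolding conv_def by (rule integral_sub)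
  finally show ?thesis .
qed

lemma sym_op_flip_at: "sym_op a k (\<lambda>z. f (\<alpha> - z)) x = sym_op a (\<lambda>x. k (- x)) f (\<alpha> - x)"
  unfolding sym_op_def conv_flip_at ..

lemma admissible_flip_at:
  assumes "admissible (\<lambda>x. k (- x)) f" shows "admissible k (\<lambda>z. f (\<alpha> - z))"
  unfolding admissible_def
proof
  fix x
  have "integrable lborel (\<lambda>z. k (- (\<alpha> - x - z)) * f z)" using assms unfolding admissible_def by blast
  then show "integrable lborel (\<lambda>z. k (x - z) * f (\<alpha> - z))"
    using integrable_sub_iff[of "\<lambda>z. k (- (\<alpha> - x - z)) * f z" \<alpha>] by simp
qed

lemma wh_one_measurable [measurable]:
  assumes [measurable]: "U \<in> borel_measurable borel"
  shows "wh_one c U \<in> borel_measurable borel"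
  unfolding wh_one_def[abs_def] by measurable

lemma wh_one_bound:
  assumes "integrable lborel U" shows "cmod (wh_one c U x) \<le> cmod c + \<bar>x\<bar> + (LBINT u. cmod (U u))"
proof (cases "0 < x")
  case True
  have "cmod (LBINT u. if u < x then U u else 0) \<le> (LBINT u. cmod (U u))"
    by (rule norm_integral_le) (use assms in auto)
  then show ?thesis
    using True norm_triangle_ineq[of "c + of_real x" "LBINT u. if u < x then U u else 0"] norm_triangle_ineq[of c "of_real x"]
    by (simp add: wh_one_def)
next
  case False
  have "0 \<le> (LBINT u. cmod (U u))" "0 \<le> cmod c" by simp_all
  then have "0 \<le> cmod c + \<bar>x\<bar> + (LBINT u. cmod (U u))" by linarith
  then show ?thesis using False by (simp add: wh_one_def)
qed

section \<open>The columns of the approximate inverse and their estimates\<close>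

context wh_time
begin

text \<open>On (0,\<alpha>) this is \<open>t\<close> times the first factor of the tensor product in
  the claim. The affine terms are fitted to the two homogeneous solutions: for \<open>x < 0\<close>
  they cancel the one from the right end, for \<open>x > \<alpha>\<close> they cancel the slope of
  the one from the left end, in both cases up to an exponentially small tail.\<close>

definition phi :: "real \<Rightarrow> real \<Rightarrow> complex" where
  "phi \<alpha> x = wh_one cp Up x + (of_real \<alpha> + cm + (LBINT u. Um u)) - of_real x - wh_one cm (\<lambda>u. Um (- u)) (\<alpha> - x)"

text \<open>On (0,\<alpha>) this is \<open>t\<close> times the second factor of the tensor product;
  it is also the value that the uncorrected column approaches beyond \<alpha>
  (\<open>col_above\<close>).\<close>

definition psi :: "real \<Rightarrow> real \<Rightarrow> complex" where
  "psi \<alpha> y = wh_one cm (\<lambda>u. Um (- u)) y + (LBINT z. Up_cut \<alpha> y z)"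

text \<open>The bracket is u_+(0) + u_-(0), because a transform at 0 is an integral; the link with
  the derivative of the quotient of the factors is made by
  \<open>sigma_quotient_derivative\<close>.\<close>

definition B_coeff :: "real \<Rightarrow> complex" where
  "B_coeff \<alpha> = of_real \<alpha> + (cp + cm + (LBINT u. Up u) + (LBINT u. Um u))"

text \<open>
  For fixed \<open>y\<close> this is, up to the factor \<open>s\<close> and the multiple \<open>cp * cm\<close> of a point mass at \<open>y\<close>,
  column \<open>y\<close> of the approximate inverse. It is defined on the whole line, where the operator with
  symbol \<open>\<sigma>\<close> maps it to zero on \<open>(0,\<alpha>)\<close>; the truncation error is governed by its values outside.
\<close>

definition col :: "real \<Rightarrow> real \<Rightarrow> real \<Rightarrow> complex" where
  "col \<alpha> x y = (cp * m_cut y x + conv p (m_cut y) x + cm * p (x - y))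
     - (cm * Up_cut \<alpha> y x + conv m (Up_cut \<alpha> y) x - (LBINT z. Up_cut \<alpha> y z))
     - psi \<alpha> y / B_coeff \<alpha> * phi \<alpha> x"

lemma phi_admissible: "admissible k (phi \<alpha>)"
proof -
  interpret R: wh_time a cm cp s "\<lambda>x. k (- x)" "\<lambda>x. Um (- x)" "\<lambda>x. Up (- x)" C \<eta> by (rule reflected)
  show ?thesis unfolding phi_def[abs_def]
    by (intro admissible_diff admissible_add wh_one_admissible admissible_const admissible_id admissible_flip_at R.wh_one_admissible)
qed

lemma sym_op_phi:
  assumes "0 < x" "x < \<alpha>" shows "sym_op a k (phi \<alpha>) x = 0"
proof -
  interpret R: wh_time a cm cp s "\<lambda>x. k (- x)" "\<lambda>x. Um (- x)" "\<lambda>x. Up (- x)" C \<eta> by (rule reflected)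
  have 1: "admissible k (\<lambda>x. wh_one cp Up x + (of_real \<alpha> + cm + (LBINT u. Um u)))"
    by (intro admissible_add wh_one_admissible admissible_const)
  show ?thesis unfolding phi_def[abs_def]
    unfolding sym_op_diff[OF admissible_diff[OF 1 admissible_id] admissible_flip_at[OF R.wh_one_admissible]]
      sym_op_diff[OF 1 admissible_id] sym_op_add[OF wh_one_admissible admissible_const] sym_op_const sym_op_id sym_op_flip_at
    using sym_op_wh_one[OF assms(1)] R.sym_op_wh_one[of "\<alpha> - x"] assms by simp
qed

lemma col_parts_admissible:
  "admissible k (\<lambda>x. cp * m_cut y x + conv p (m_cut y) x + cm * p (x - y))"
  "admissible k (\<lambda>x. cm * Up_cut \<alpha> y x + conv m (Up_cut \<alpha> y) x - (LBINT z. Up_cut \<alpha> y z))"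
proof -
  have adp: "admissible k p" by (rule admissible_bounded[OF _ p_bound]) measurable
  show "admissible k (\<lambda>x. cp * m_cut y x + conv p (m_cut y) x + cm * p (x - y))"
    by (rule admissible_add[OF factor_right_admissible[OF m_cut_meas m_cut_bound m_cut_zero] admissible_cmult[OF admissible_shift[OF adp]]])
  show "admissible k (\<lambda>x. cm * Up_cut \<alpha> y x + conv m (Up_cut \<alpha> y) x - (LBINT z. Up_cut \<alpha> y z))"
    by (rule admissible_diff[OF factor_left_admissible[OF Up_cut_integrable Up_cut_bound] admissible_const])
qed

lemma col_admissible: "admissible k (\<lambda>x. col \<alpha> x y)"
  unfolding col_def
  by (rule admissible_diff[OF admissible_diff[OF col_parts_admissible] admissible_cmult[OF phi_admissible]])

lemma col_equation:
  "AE x in lborel. 0 < x \<and> x < \<alpha> \<longrightarrow> sym_op a k (\<lambda>x. col \<alpha> x y) x + cp * cm * k (x - y) = 0"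
  using column_left[of y]
proof eventually_elim
  case (elim x)
  show ?case
  proof
    assume x: "0 < x \<and> x < \<alpha>"
    show "sym_op a k (\<lambda>x. col \<alpha> x y) x + cp * cm * k (x - y) = 0"
      unfolding col_def sym_op_diff[OF admissible_diff[OF col_parts_admissible] admissible_cmult[OF phi_admissible]]
        sym_op_diff[OF col_parts_admissible] sym_op_cmult
      using elim x column_right[of x \<alpha> y] sym_op_phi[of x \<alpha>] by simp
  qed
qed

text \<open>One number bounds the \<open>L^1\<close> norms of \<open>k\<close>, \<open>Up\<close>
  and \<open>Um\<close> and is also the factor in front of their exponential tails.\<close>

definition tail_const :: real where "tail_const = C * (LBINT u::real. exp (- (\<eta>/2) * \<bar>u\<bar>))"

lemma tail_const_nonneg: "0 \<le> tail_const" using C_nonneg by (simp add: tail_const_def)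

lemma norm_int_le_tail_const: "exp_bounded C \<eta> U \<Longrightarrow> (LBINT u. cmod (U u)) \<le> tail_const"
proof -
  assume U: "exp_bounded C \<eta> U"
  have "(LBINT u. cmod (U u)) \<le> (LBINT u. C * exp (- (\<eta>/2) * \<bar>u\<bar>))"
  proof (rule integral_mono')
    show "integrable lborel (\<lambda>u. C * exp (- (\<eta>/2) * \<bar>u\<bar>))" using integrable_exp_abs[of "\<eta>/2"] eta by simp
    show "cmod (U u) \<le> C * exp (- (\<eta>/2) * \<bar>u\<bar>)" for u
      using exp_bounded_mono[OF U order_refl, of "\<eta>/2"] eta unfolding exp_bounded_def by simp
  qed (use C_nonneg in simp)
  then show ?thesis by (simp add: tail_const_def)
qed

lemma Up_cut_norm_int: "(LBINT z. cmod (Up_cut \<alpha> y z)) \<le> tail_const"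
proof -
  have "(LBINT z. cmod (Up_cut \<alpha> y z)) \<le> (LBINT z. cmod (Up (z + - y)))"
  proof (rule integral_mono')
    show "integrable lborel (\<lambda>z. cmod (Up (z + - y)))" using integrable_shift_iff[of "\<lambda>z. cmod (Up z)" "-y"] int(2) by simp
  qed (auto simp: Up_cut_def)
  also have "\<dots> = (LBINT z. cmod (Up z))" by (rule integral_shift)
  also have "\<dots> \<le> tail_const" by (rule norm_int_le_tail_const[OF Up(1)])
  finally show ?thesis .
qed

lemma psi_bound:
  assumes "0 < y" "y < \<alpha>" shows "cmod (psi \<alpha> y) \<le> cmod cm + \<alpha> + 2 * tail_const"
proof -
  have "cmod (LBINT z. Up_cut \<alpha> y z) \<le> tail_const" using integral_norm_bound[of lborel "Up_cut \<alpha> y"] Up_cut_norm_int[of \<alpha> y] by linarith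
  moreover have "cmod (wh_one cm (\<lambda>u. Um (- u)) y) \<le> cmod cm + \<bar>y\<bar> + (LBINT u. cmod (Um (- u)))"
    by (rule wh_one_bound) (use int integrable_reflect_iff[of Um] in simp)
  moreover have "(LBINT u. cmod (Um (- u))) \<le> tail_const" by (rule norm_int_le_tail_const[OF exp_bounded_reflect[OF Um(1)]])
  ultimately show ?thesis
    using norm_triangle_ineq[of "wh_one cm (\<lambda>u. Um (- u)) y" "LBINT z. Up_cut \<alpha> y z"] assms unfolding psi_def by linarith
qed

lemma phi_bound:
  assumes "0 < x" "x < \<alpha>" shows "cmod (phi \<alpha> x) \<le> cmod cp + 2 * cmod cm + 4 * \<alpha> + 3 * tail_const"
proof -
  have 1: "cmod (wh_one cm (\<lambda>u. Um (- u)) (\<alpha> - x)) \<le> cmod cm + \<bar>\<alpha> - x\<bar> + (LBINT u. cmod (Um (- u)))"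
    by (rule wh_one_bound) (use int integrable_reflect_iff[of Um] in simp)
  have 2: "cmod (wh_one cp Up x) \<le> cmod cp + \<bar>x\<bar> + (LBINT u. cmod (Up u))" by (rule wh_one_bound[OF int(2)])
  have 3: "(LBINT u. cmod (Um (- u))) \<le> tail_const" "(LBINT u. cmod (Up u)) \<le> tail_const" "(LBINT u. cmod (Um u)) \<le> tail_const"
    by (intro norm_int_le_tail_const exp_bounded_reflect Up Um)+
  have 4: "cmod (LBINT u. Um u) \<le> tail_const" using integral_norm_bound[of lborel Um] 3 by linarith
  have 5: "cmod (of_real \<alpha> + cm + (LBINT u. Um u)) \<le> \<alpha> + cmod cm + tail_const"
    using norm_triangle_ineq[of "of_real \<alpha> + cm" "LBINT u. Um u"] norm_triangle_ineq[of "of_real \<alpha>" cm] 4 assms by simp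
  have 6: "cmod (phi \<alpha> x) \<le> cmod (wh_one cp Up x) + cmod (of_real \<alpha> + cm + (LBINT u. Um u)) + \<bar>x\<bar> + cmod (wh_one cm (\<lambda>u. Um (- u)) (\<alpha> - x))"
    unfolding phi_def
    using norm_triangle_ineq4[of "wh_one cp Up x + (of_real \<alpha> + cm + (LBINT u. Um u)) - of_real x" "wh_one cm (\<lambda>u. Um (- u)) (\<alpha> - x)"]
      norm_triangle_ineq4[of "wh_one cp Up x + (of_real \<alpha> + cm + (LBINT u. Um u))" "of_real x"]
      norm_triangle_ineq[of "wh_one cp Up x" "of_real \<alpha> + cm + (LBINT u. Um u)"] by simp
  show ?thesis using 1 2 3 5 6 assms by simp
qed

lemma B_coeff_lower:
  assumes "2 * cmod (cp + cm + (LBINT u. Up u) + (LBINT u. Um u)) \<le> \<alpha>" "0 < \<alpha>"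
  shows "\<alpha> / 2 \<le> cmod (B_coeff \<alpha>)" "B_coeff \<alpha> \<noteq> 0"
proof -
  define b where "b = cp + cm + (LBINT u. Up u) + (LBINT u. Um u)"
  have "\<alpha> = cmod (B_coeff \<alpha> - b)" using assms(2) by (simp add: B_coeff_def b_def)
  also have "\<dots> \<le> cmod (B_coeff \<alpha>) + cmod b" by (rule norm_triangle_ineq4)
  finally show 1: "\<alpha> / 2 \<le> cmod (B_coeff \<alpha>)" using assms(1) by (simp add: b_def)
  then show "B_coeff \<alpha> \<noteq> 0" using assms(2) by auto
qed

text \<open>The numerator grows at most linearly and the denominator at least like
  \<open>\<alpha> / 2\<close>, so the coefficient of the correction stays bounded as \<alpha>
  grows.\<close>

lemma psi_over_B_coeff:
  assumes big: "2 * cmod (cp + cm + (LBINT u. Up u) + (LBINT u. Um u)) \<le> \<alpha>" "1 \<le> \<alpha>"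
    and y: "0 < y" "y < \<alpha>"
  shows "cmod (psi \<alpha> y / B_coeff \<alpha>) \<le> 2 * (cmod cm + 1 + 2 * tail_const)"
proof -
  have \<alpha>0: "0 < \<alpha>" using big by simp
  note B_coeff = B_coeff_lower[OF big(1) \<alpha>0]
  define q where "q = cmod cm + 1 + 2 * tail_const"
  have q0: "0 \<le> q" using tail_const_nonneg by (simp add: q_def)
  have "cmod cm + \<alpha> + 2 * tail_const \<le> q * \<alpha>"
    using mult_left_mono[OF big(2), of "cmod cm + 2 * tail_const"] tail_const_nonneg by (simp add: q_def algebra_simps)
  then have "cmod (psi \<alpha> y) \<le> 2 * q * (\<alpha> / 2)" using psi_bound[OF y] by simp
  also have "\<dots> \<le> 2 * q * cmod (B_coeff \<alpha>)" using B_coeff(1) q0 by (intro mult_left_mono) auto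
  finally show ?thesis using B_coeff(2) by (simp add: norm_divide divide_le_eq q_def)
qed

text \<open>Beyond \<alpha> the left and right parts contain the same convolution of
  \<open>Up\<close> and \<open>m\<close>, except for \<open>z \<le> 0\<close>; there the argument of
  \<open>Up\<close> is at least \<open>x\<close>, so a tail remains. The constants add up to
  \<open>psi\<close>, which the multiple of \<open>phi\<close> removes up to another tail.\<close>

lemma col_above:
  assumes y: "0 < y" "y < \<alpha>" and x: "\<alpha> < x" and b: "B_coeff \<alpha> \<noteq> 0"
  shows "col \<alpha> x y = - (LBINT z. if z \<le> 0 then m (z - y) * Up (x - z) else 0)
     + psi \<alpha> y / B_coeff \<alpha> * (LBINT u. if x \<le> u then Up u else 0)"
proof -
  have x0: "0 < x" "y < x" using assms by auto
  have m_cut_i: "integrable lborel (m_cut y)"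
  proof (rule integrable_box(1)[OF m_cut_meas m_cut_bound])
    fix z assume "m_cut y z \<noteq> 0"
    then show "z \<in> {0<..<y + 1}" using m_pos[of "z - y"] by (force simp: m_cut_def split: if_splits)
  qed
  have iUp: "integrable lborel (\<lambda>z. Up (x - z))" using integrable_sub_iff[of Up x] int(2) by simp
  have iUpm: "integrable lborel (\<lambda>z. m (z - y) * Up (x - z))"
    by (rule integrable_bounded_mult(1)[OF iUp _ m_bound]) measurable
  have iUpmy: "integrable lborel (\<lambda>z. Up (x - z) * m_cut y z)"
    using integrable_bounded_mult(1)[OF iUp m_cut_meas m_cut_bound] by (simp add: mult.commute)
  have myint: "(LBINT z. m_cut y z) = wh_one cm (\<lambda>u. Um (- u)) y - cm"
  proof -
    have i1: "integrable lborel (\<lambda>z. indicator {0<..<y} z *\<^sub>R (1::complex))"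
      by (intro integrable_real_indicator[THEN integrable_scaleR_left]) (use y in auto)
    have i2: "integrable lborel (\<lambda>z. if 0 < z then Um (z - y) else 0)"
      using integrable_shift_iff[of Um "-y"] int(3) by (intro integrable_if) auto
    have "(LBINT z. m_cut y z) = (LBINT z. indicator {0<..<y} z *\<^sub>R 1 + (if 0 < z then Um (z - y) else 0))"
      by (intro bint_cong) (auto simp: m_cut_def mfun_def indicator_def)
    also have "\<dots> = of_real y + (LBINT z. if 0 < z then Um (z - y) else 0)"
      unfolding bint_add[OF i1 i2] using y by (simp add: scaleR_conv_of_real)
    also have "(LBINT z. if 0 < z then Um (z - y) else 0) = (LBINT z. (\<lambda>u. if u < y then Um (- u) else 0) (y - z))"
      by (intro bint_cong) auto
    also have "\<dots> = (LBINT u. if u < y then Um (- u) else 0)" by (rule integral_sub)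
    finally show ?thesis using y by (simp add: wh_one_def)
  qed
  have w: "cp * m_cut y x + conv p (m_cut y) x + cm * p (x - y) = wh_one cm (\<lambda>u. Um (- u)) y + cm * Up (x - y) + conv Up (m_cut y) x"
  proof -
    have "m_cut y x = 0" using x0 m_pos by (simp add: m_cut_def)
    moreover have "p (x - y) = 1 + Up (x - y)" using x0 by (simp add: pfun_def)
    moreover have "conv p (m_cut y) x = (LBINT z. m_cut y z) + conv Up (m_cut y) x"
    proof -
      have "conv p (m_cut y) x = (LBINT z. m_cut y z + Up (x - z) * m_cut y z)"
        unfolding conv_def
      proof (intro bint_cong refl)
        fix z
        have "z < x" if "m_cut y z \<noteq> 0" using that m_pos[of "z - y"] x0 by (force simp: m_cut_def split: if_splits)
        then show "p (x - z) * m_cut y z = m_cut y z + Up (x - z) * m_cut y z"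
          by (cases "m_cut y z = 0") (auto simp: pfun_def algebra_simps)
      qed
      also have "\<dots> = (LBINT z. m_cut y z) + conv Up (m_cut y) x"
        unfolding conv_def by (rule bint_add[OF m_cut_i iUpmy])
      finally show ?thesis .
    qed
    ultimately show ?thesis unfolding myint by (simp add: algebra_simps)
  qed
  \<comment> \<open>The substitution of \<open>x + y - z\<close> for \<open>z\<close> exchanges the
    two functions. Where \<open>m (z - y)\<close> is nonzero the cut at \<alpha> is automatic,
    because there \<open>x + y - z \<ge> x\<close>.\<close>
  have mq: "conv m (Up_cut \<alpha> y) x = (LBINT z. m (z - y) * Up (x - z))"
  proof -
    have "conv m (Up_cut \<alpha> y) x = (LBINT z. (\<lambda>z. m (z - y) * Up_cut \<alpha> y (x + y - z)) (x + y - z))" unfolding conv_def by simp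
    also have "\<dots> = (LBINT z. m (z - y) * Up_cut \<alpha> y (x + y - z))" by (rule integral_sub)
    also have "\<dots> = (LBINT z. m (z - y) * Up (x - z))"
    proof (intro bint_cong refl)
      fix z show "m (z - y) * Up_cut \<alpha> y (x + y - z) = m (z - y) * Up (x - z)"
        using m_pos[of "z - y"] x by (cases "y < z") (auto simp: Up_cut_def algebra_simps)
    qed
    finally show ?thesis .
  qed
  have diff: "conv Up (m_cut y) x - conv m (Up_cut \<alpha> y) x = - (LBINT z. if z \<le> 0 then m (z - y) * Up (x - z) else 0)"
  proof -
    have "conv Up (m_cut y) x - conv m (Up_cut \<alpha> y) x = (LBINT z. Up (x - z) * m_cut y z - m (z - y) * Up (x - z))"
      unfolding mq conv_def[of Up] by (rule bint_diff[OF iUpmy iUpm, symmetric])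
    also have "\<dots> = (LBINT z. - (if z \<le> 0 then m (z - y) * Up (x - z) else 0))"
      by (intro bint_cong) (auto simp: m_cut_def)
    finally show ?thesis by simp
  qed
  have ph: "phi \<alpha> x = B_coeff \<alpha> - (LBINT u. if x \<le> u then Up u else 0)"
  proof -
    have "(LBINT u. Up u) = (LBINT u. (if u < x then Up u else 0) + (if x \<le> u then Up u else 0))"
      by (intro bint_cong) auto
    also have "\<dots> = (LBINT u. if u < x then Up u else 0) + (LBINT u. if x \<le> u then Up u else 0)"
      by (intro bint_add integrable_if int) auto
    finally show ?thesis using x x0 unfolding phi_def B_coeff_def by (simp add: wh_one_def)
  qed
  have "Up_cut \<alpha> y x = Up (x - y)" using x by (simp add: Up_cut_def)
  then have "col \<alpha> x y = (wh_one cm (\<lambda>u. Um (- u)) y + (LBINT z. Up_cut \<alpha> y z)) + (conv Up (m_cut y) x - conv m (Up_cut \<alpha> y) x) - psi \<alpha> y / B_coeff \<alpha> * phi \<alpha> x"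
    unfolding col_def w by (simp add: algebra_simps)
  also have "\<dots> = psi \<alpha> y - (LBINT z. if z \<le> 0 then m (z - y) * Up (x - z) else 0) - psi \<alpha> y / B_coeff \<alpha> * phi \<alpha> x"
    unfolding diff psi_def by simp
  also have "psi \<alpha> y / B_coeff \<alpha> * phi \<alpha> x = psi \<alpha> y - psi \<alpha> y / B_coeff \<alpha> * (LBINT u. if x \<le> u then Up u else 0)"
    unfolding ph using b by (simp add: right_diff_distrib)
  finally show ?thesis by simp
qed

lemma conv_m_Up_cut:
  assumes "x < \<alpha>" shows "conv m (Up_cut \<alpha> y) x - (LBINT z. Up_cut \<alpha> y z) = conv Um (Up_cut \<alpha> y) x"
proof -
  have i: "integrable lborel (\<lambda>z. Um (x - z) * Up_cut \<alpha> y z)"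
    by (rule integrable_conv_integrand[OF int(3) Up_cut_meas Up_cut_bound])
  have "conv m (Up_cut \<alpha> y) x = (LBINT z. Up_cut \<alpha> y z + Um (x - z) * Up_cut \<alpha> y z)"
    unfolding conv_def using assms by (intro bint_cong) (auto simp: mfun_def Up_cut_def algebra_simps)
  also have "\<dots> = (LBINT z. Up_cut \<alpha> y z) + conv Um (Up_cut \<alpha> y) x"
    unfolding conv_def by (rule bint_add[OF Up_cut_integrable i])
  finally show ?thesis by simp
qed

text \<open>For \<open>x < 0\<close> the half-line part vanishes altogether, and both remaining
  terms involve \<open>Um\<close> only at distance at least \<alpha> from 0.\<close>

lemma col_below:
  assumes \<alpha>: "0 < \<alpha>" and y: "0 < y" and x: "x < 0"
  shows "col \<alpha> x y = - conv Um (Up_cut \<alpha> y) x - psi \<alpha> y / B_coeff \<alpha> * (LBINT u. if \<alpha> - x \<le> u then Um (- u) else 0)"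
proof -
  have "conv p (m_cut y) x = (LBINT z::real. 0)"
    unfolding conv_def
  proof (intro bint_cong refl)
    fix z show "p (x - z) * m_cut y z = 0" using p_neg[of "x - z"] x by (cases "0 < z") (auto simp: m_cut_def)
  qed
  moreover have "p (x - y) = 0" using p_neg x y by simp
  moreover have "m_cut y x = 0" "Up_cut \<alpha> y x = 0" using x \<alpha> by (auto simp: m_cut_def Up_cut_def)
  moreover have "phi \<alpha> x = (LBINT u. if \<alpha> - x \<le> u then Um (- u) else 0)"
  proof -
    have i: "integrable lborel (\<lambda>u. Um (- u))" using integrable_reflect_iff[of Um] int(3) by simp
    have "(LBINT u. Um u) = (LBINT u. Um (- u))" by (rule integral_reflect[symmetric])
    also have "\<dots> = (LBINT u. (if u < \<alpha> - x then Um (- u) else 0) + (if \<alpha> - x \<le> u then Um (- u) else 0))"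
      by (intro bint_cong) auto
    also have "\<dots> = (LBINT u. if u < \<alpha> - x then Um (- u) else 0) + (LBINT u. if \<alpha> - x \<le> u then Um (- u) else 0)"
      by (intro bint_add integrable_if i) auto
    finally show ?thesis using x \<alpha> unfolding phi_def by (simp add: wh_one_def)
  qed
  ultimately show ?thesis using conv_m_Up_cut[of x \<alpha> y] x \<alpha> unfolding col_def by (simp add: algebra_simps)
qed

lemma col_outside:
  assumes big: "2 * cmod (cp + cm + (LBINT u. Up u) + (LBINT u. Um u)) \<le> \<alpha>" "1 \<le> \<alpha>"
    and y: "0 < y" "y < \<alpha>" and x: "x < 0 \<or> \<alpha> < x"
  shows "cmod (col \<alpha> x y) \<le> ((1 + C) + 2 * (cmod cm + 1 + 2 * tail_const)) * tail_const * exp (- (\<eta>/2) * \<alpha>)"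
proof -
  have \<alpha>0: "0 < \<alpha>" using big by simp
  note B_coeff = B_coeff_lower[OF big(1) \<alpha>0]
  define Q where "Q = 2 * (cmod cm + 1 + 2 * tail_const)"
  define e where "e = exp (- (\<eta>/2) * \<alpha>)"
  have Q0: "0 \<le> Q" using tail_const_nonneg by (simp add: Q_def)
  note ratio = psi_over_B_coeff[OF big y, folded Q_def]
  have tail_le: "(LBINT u. if z \<le> u then cmod (U u) else 0) \<le> tail_const * e" if U: "exp_bounded C \<eta> U" and z: "\<alpha> \<le> z" for U z
  proof -
    have "(LBINT u. if z \<le> u then cmod (U u) else 0) \<le> tail_const * exp (- (\<eta>/2) * z)"
      using exp_bounded_tail[OF U eta, of z] z \<alpha>0 by (simp add: tail_const_def)
    also have "\<dots> \<le> tail_const * e" unfolding e_def using z eta tail_const_nonneg by (intro mult_left_mono) auto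
    finally show ?thesis .
  qed
  have cut_int: "integrable lborel (\<lambda>u. if z \<le> u then cmod (U u) else 0)" if "exp_bounded C \<eta> U" for U z
  proof -
    have Ui: "integrable lborel U" by (rule exp_bounded_integrable[OF that eta])
    have [measurable]: "U \<in> borel_measurable borel" using that by (simp add: exp_bounded_def)
    show ?thesis by (rule integrable_dominated[OF Ui]) auto
  qed
  have tail_norm: "cmod (LBINT u. if z \<le> u then U u else 0) \<le> tail_const * e" if U: "exp_bounded C \<eta> U" and z: "\<alpha> \<le> z" for U z
  proof -
    have "cmod (LBINT u. if z \<le> u then U u else 0) \<le> (LBINT u. if z \<le> u then cmod (U u) else 0)"
      by (rule norm_integral_le[OF cut_int[OF U]]) simp
    then show ?thesis using tail_le[OF U z] by simp
  qed
  have fin: "(1 + C) * (tail_const * e) + Q * (tail_const * e) = ((1 + C) + Q) * tail_const * e" by (simp add: algebra_simps)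
  show ?thesis
  proof (cases "\<alpha> < x")
    case True
    have i: "integrable lborel (\<lambda>z. (1 + C) * (if x \<le> x - z then cmod (Up (x - z)) else 0))"
      using integrable_sub_iff[of "\<lambda>u. if x \<le> u then cmod (Up u) else 0" x] cut_int[OF Up(1), of x] by simp
    have "cmod (LBINT z. if z \<le> 0 then m (z - y) * Up (x - z) else 0) \<le> (LBINT z. (1 + C) * (if x \<le> x - z then cmod (Up (x - z)) else 0))"
    proof (rule norm_integral_le[OF i])
      fix z
      show "cmod (if z \<le> 0 then m (z - y) * Up (x - z) else 0) \<le> (1 + C) * (if x \<le> x - z then cmod (Up (x - z)) else 0)"
        using m_bound[of "z - y"] by (auto simp: norm_mult intro!: mult_right_mono)
    qed
    also have "\<dots> = (1 + C) * (LBINT u. if x \<le> u then cmod (Up u) else 0)"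
      using integral_sub[of "\<lambda>u. if x \<le> u then cmod (Up u) else 0" x] by simp
    also have "\<dots> \<le> (1 + C) * (tail_const * e)" using tail_le[OF Up(1), of x] True C_nonneg by (intro mult_left_mono) auto
    finally have 1: "cmod (LBINT z. if z \<le> 0 then m (z - y) * Up (x - z) else 0) \<le> (1 + C) * (tail_const * e)" .
    have 2: "cmod (psi \<alpha> y / B_coeff \<alpha> * (LBINT u. if x \<le> u then Up u else 0)) \<le> Q * (tail_const * e)"
      unfolding norm_mult using True by (intro mult_mono ratio tail_norm Up Q0) auto
    have "cmod (col \<alpha> x y) \<le> (1 + C) * (tail_const * e) + Q * (tail_const * e)"
      unfolding col_above[OF y True B_coeff(2)] using 1 2
        norm_triangle_ineq[of "- (LBINT z. if z \<le> 0 then m (z - y) * Up (x - z) else 0)" "psi \<alpha> y / B_coeff \<alpha> * (LBINT u. if x \<le> u then Up u else 0)"]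
      by simp
    then have "cmod (col \<alpha> x y) \<le> ((1 + C) + Q) * tail_const * e" unfolding fin .
    then show ?thesis unfolding Q_def e_def .
  next
    case False
    with x have x: "x < 0" by simp
    have i0: "integrable lborel (\<lambda>u. if \<alpha> - x \<le> u then cmod (Um (- u)) else 0)" by (rule cut_int[OF exp_bounded_reflect[OF Um(1)]])
    have i: "integrable lborel (\<lambda>z. C * (if \<alpha> - x \<le> z + - x then cmod (Um (- (z + - x))) else 0))"
      using integrable_shift_iff[of "\<lambda>u. if \<alpha> - x \<le> u then cmod (Um (- u)) else 0" "-x"] i0 by simp
    have "cmod (conv Um (Up_cut \<alpha> y) x) \<le> (LBINT z. C * (if \<alpha> - x \<le> z + - x then cmod (Um (- (z + - x))) else 0))"
      unfolding conv_def
    proof (rule norm_integral_le[OF i])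
      fix z
      show "cmod (Um (x - z) * Up_cut \<alpha> y z) \<le> C * (if \<alpha> - x \<le> z + - x then cmod (Um (- (z + - x))) else 0)"
      proof (cases "\<alpha> < z")
        case True
        have "cmod (Um (x - z)) * cmod (Up_cut \<alpha> y z) \<le> cmod (Um (x - z)) * C" by (intro mult_left_mono Up_cut_bound) simp
        then show ?thesis using True by (simp add: norm_mult mult.commute)
      qed (use C_nonneg in \<open>simp add: Up_cut_def\<close>)
    qed
    also have "\<dots> = C * (LBINT u. if \<alpha> - x \<le> u then cmod (Um (- u)) else 0)"
      using integral_shift[of "\<lambda>u. if \<alpha> - x \<le> u then cmod (Um (- u)) else 0" "-x"] by simp
    also have "\<dots> \<le> C * (tail_const * e)" using tail_le[OF exp_bounded_reflect[OF Um(1)], of "\<alpha> - x"] x C_nonneg by (intro mult_left_mono) auto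
    also have "\<dots> \<le> (1 + C) * (tail_const * e)" using tail_const_nonneg by (intro mult_right_mono) (auto simp: e_def)
    finally have 1: "cmod (conv Um (Up_cut \<alpha> y) x) \<le> (1 + C) * (tail_const * e)" .
    have 2: "cmod (psi \<alpha> y / B_coeff \<alpha> * (LBINT u. if \<alpha> - x \<le> u then Um (- u) else 0)) \<le> Q * (tail_const * e)"
      unfolding norm_mult using x by (intro mult_mono ratio tail_norm[OF exp_bounded_reflect[OF Um(1)]] Q0) auto
    have "cmod (col \<alpha> x y) \<le> (1 + C) * (tail_const * e) + Q * (tail_const * e)"
      unfolding col_below[OF \<alpha>0 y(1) x] using 1 2
        norm_triangle_ineq4[of "- conv Um (Up_cut \<alpha> y) x" "psi \<alpha> y / B_coeff \<alpha> * (LBINT u. if \<alpha> - x \<le> u then Um (- u) else 0)"]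
      by simp
    then have "cmod (col \<alpha> x y) \<le> ((1 + C) + Q) * tail_const * e" unfolding fin .
    then show ?thesis unfolding Q_def e_def .
  qed
qed

text \<open>A bound linear in \<alpha> suffices, since in the Neumann correction it meets an
  exponentially small factor.\<close>

lemma col_inside:
  assumes big: "2 * cmod (cp + cm + (LBINT u. Up u) + (LBINT u. Um u)) \<le> \<alpha>" "1 \<le> \<alpha>"
    and y: "0 < y" "y < \<alpha>" and x: "0 < x" "x < \<alpha>"
  shows "cmod (col \<alpha> x y) \<le> (cmod cp * (1 + C) + (1 + C) * (1 + C) + cmod cm * (1 + C) + tail_const * C
      + 2 * (cmod cm + 1 + 2 * tail_const) * (cmod cp + 2 * cmod cm + 4 + 3 * tail_const)) * \<alpha>"
proof -
  have \<alpha>0: "0 < \<alpha>" using big by simp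
  note B_coeff = B_coeff_lower[OF big(1) \<alpha>0]
  define Q where "Q = 2 * (cmod cm + 1 + 2 * tail_const)"
  have Q0: "0 \<le> Q" using tail_const_nonneg by (simp add: Q_def)
  note ratio = psi_over_B_coeff[OF big y, folded Q_def]
  have mul: "c \<le> c * \<alpha>" if "0 \<le> c" for c using mult_left_mono[OF big(2) that] by simp
  have q0: "Up_cut \<alpha> y x = 0" using x by (simp add: Up_cut_def)
  have 1: "cmod (cp * m_cut y x) \<le> cmod cp * (1 + C) * \<alpha>"
    using mult_left_mono[OF m_cut_bound[of y x], of "cmod cp"] mul[of "cmod cp * (1 + C)"] C_nonneg by (simp add: norm_mult)
  have 2: "cmod (conv p (m_cut y) x) \<le> (1 + C) * (1 + C) * \<alpha>"
  proof -
    have ii: "integrable lborel (\<lambda>z::real. (1 + C) * (1 + C) * indicator {0..\<alpha>} z :: real)"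
      using \<alpha>0 by (intro integrable_mult_right integrable_real_indicator) auto
    have "cmod (conv p (m_cut y) x) \<le> (LBINT z. (1 + C) * (1 + C) * indicator {0..\<alpha>} z)"
      unfolding conv_def
    proof (rule norm_integral_le[OF ii])
      fix z
      show "cmod (p (x - z) * m_cut y z) \<le> (1 + C) * (1 + C) * indicator {0..\<alpha>} z"
      proof (cases "z \<in> {0..\<alpha>}")
        case True
        have "cmod (p (x - z)) * cmod (m_cut y z) \<le> (1 + C) * (1 + C)"
          using C_nonneg by (intro mult_mono p_bound m_cut_bound) auto
        then show ?thesis using True by (simp add: norm_mult)
      next
        case False
        then have "m_cut y z = 0" using m_pos[of "z - y"] y by (auto simp: m_cut_def)
        then show ?thesis using C_nonneg by simp
      qed
    qed
    then show ?thesis using \<alpha>0 by simp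
  qed
  have 3: "cmod (cm * p (x - y)) \<le> cmod cm * (1 + C) * \<alpha>"
    using mult_left_mono[OF p_bound[of "x - y"], of "cmod cm"] mul[of "cmod cm * (1 + C)"] C_nonneg by (simp add: norm_mult)
  have 4: "cmod (conv m (Up_cut \<alpha> y) x - (LBINT z. Up_cut \<alpha> y z)) \<le> tail_const * C * \<alpha>"
  proof -
    have i: "integrable lborel (\<lambda>z. C * cmod (Um (x - z)))"
      using integrable_sub_iff[of "\<lambda>z. C * cmod (Um z)" x] int(3) by simp
    have "cmod (conv Um (Up_cut \<alpha> y) x) \<le> (LBINT z. C * cmod (Um (x - z)))"
      unfolding conv_def
    proof (rule norm_integral_le[OF i])
      fix z show "cmod (Um (x - z) * Up_cut \<alpha> y z) \<le> C * cmod (Um (x - z))"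
        using mult_left_mono[OF Up_cut_bound[of \<alpha> y z], of "cmod (Um (x - z))"] by (simp add: norm_mult mult.commute)
    qed
    also have "\<dots> = C * (LBINT z. cmod (Um z))" using integral_sub[of "\<lambda>z. C * cmod (Um z)" x] by simp
    also have "\<dots> \<le> C * tail_const" by (intro mult_left_mono norm_int_le_tail_const Um C_nonneg)
    also have "\<dots> \<le> tail_const * C * \<alpha>" using mul[of "tail_const * C"] tail_const_nonneg C_nonneg by (simp add: mult.commute)
    finally show ?thesis unfolding conv_m_Up_cut[OF x(2)] .
  qed
  have 5: "cmod (psi \<alpha> y / B_coeff \<alpha> * phi \<alpha> x) \<le> Q * (cmod cp + 2 * cmod cm + 4 + 3 * tail_const) * \<alpha>"
  proof -
    have "cmod (phi \<alpha> x) \<le> (cmod cp + 2 * cmod cm + 4 + 3 * tail_const) * \<alpha>"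
      using phi_bound[OF x] mul[of "cmod cp + 2 * cmod cm + 3 * tail_const"] tail_const_nonneg by (simp add: algebra_simps)
    then have "cmod (psi \<alpha> y / B_coeff \<alpha>) * cmod (phi \<alpha> x) \<le> Q * ((cmod cp + 2 * cmod cm + 4 + 3 * tail_const) * \<alpha>)"
      by (intro mult_mono ratio Q0) auto
    then show ?thesis unfolding norm_mult by (simp only: mult.assoc)
  qed
  have "cmod (col \<alpha> x y) \<le> cmod (cp * m_cut y x) + cmod (conv p (m_cut y) x) + cmod (cm * p (x - y))
      + cmod (conv m (Up_cut \<alpha> y) x - (LBINT z. Up_cut \<alpha> y z)) + cmod (psi \<alpha> y / B_coeff \<alpha> * phi \<alpha> x)"
    unfolding col_def q0
    using norm_triangle_ineq4[of "cp * m_cut y x + conv p (m_cut y) x + cm * p (x - y) - (conv m (Up_cut \<alpha> y) x - (LBINT z. Up_cut \<alpha> y z))" "psi \<alpha> y / B_coeff \<alpha> * phi \<alpha> x"]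
      norm_triangle_ineq4[of "cp * m_cut y x + conv p (m_cut y) x + cm * p (x - y)" "conv m (Up_cut \<alpha> y) x - (LBINT z. Up_cut \<alpha> y z)"]
      norm_triangle_ineq[of "cp * m_cut y x + conv p (m_cut y) x" "cm * p (x - y)"]
      norm_triangle_ineq[of "cp * m_cut y x" "conv p (m_cut y) x"] by simp
  also have "\<dots> \<le> cmod cp * (1 + C) * \<alpha> + (1 + C) * (1 + C) * \<alpha> + cmod cm * (1 + C) * \<alpha> + tail_const * C * \<alpha> + Q * (cmod cp + 2 * cmod cm + 4 + 3 * tail_const) * \<alpha>"
    by (intro add_mono 1 2 3 4 5)
  also have "\<dots> = (cmod cp * (1 + C) + (1 + C) * (1 + C) + cmod cm * (1 + C) + tail_const * C
      + 2 * (cmod cm + 1 + 2 * tail_const) * (cmod cp + 2 * cmod cm + 4 + 3 * tail_const)) * \<alpha>"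
    unfolding Q_def by (simp only: distrib_right)
  finally show ?thesis .
qed

lemma col_measurable [measurable]: "(\<lambda>(x, y). col \<alpha> x y) \<in> borel_measurable (lborel \<Otimes>\<^sub>M lborel)"
proof -
  have [measurable]: "p \<in> borel_measurable borel" "m \<in> borel_measurable borel" by measurable
  have 1: "(\<lambda>q. m_cut (snd q) (fst q)) \<in> borel_measurable (lborel \<Otimes>\<^sub>M lborel)"
    "(\<lambda>q. Up_cut \<alpha> (snd q) (fst q)) \<in> borel_measurable (lborel \<Otimes>\<^sub>M lborel)"
    "(\<lambda>q. p (fst q - snd q)) \<in> borel_measurable (lborel \<Otimes>\<^sub>M lborel)"
    unfolding m_cut_def Up_cut_def by measurable
  have 2: "(\<lambda>q. conv p (m_cut (snd q)) (fst q)) \<in> borel_measurable (lborel \<Otimes>\<^sub>M lborel)"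
    "(\<lambda>q. conv m (Up_cut \<alpha> (snd q)) (fst q)) \<in> borel_measurable (lborel \<Otimes>\<^sub>M lborel)"
    unfolding conv_def m_cut_def Up_cut_def by measurable
  have 3: "(\<lambda>y. LBINT z. Up_cut \<alpha> y z) \<in> borel_measurable borel" unfolding Up_cut_def by measurable
  have 4[measurable]: "psi \<alpha> \<in> borel_measurable borel" "phi \<alpha> \<in> borel_measurable borel"
    using 3 unfolding psi_def[abs_def] phi_def[abs_def] by measurable
  have 5: "(\<lambda>q. LBINT z. Up_cut \<alpha> (snd q) z) \<in> borel_measurable (lborel \<Otimes>\<^sub>M lborel)"
    using measurable_compose[OF measurable_snd, of "\<lambda>y. LBINT z. Up_cut \<alpha> y z" lborel borel lborel] 3 by simp
  have 6: "(\<lambda>q. psi \<alpha> (snd q)) \<in> borel_measurable (lborel \<Otimes>\<^sub>M lborel)"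
    "(\<lambda>q. phi \<alpha> (fst q)) \<in> borel_measurable (lborel \<Otimes>\<^sub>M lborel)" by measurable
  show ?thesis
    unfolding col_def case_prod_unfold
    by (intro borel_measurable_diff borel_measurable_add borel_measurable_times borel_measurable_divide
        borel_measurable_const 1 2 5 6)
qed

section \<open>The approximate inverse and its error as integral kernels\<close>

definition W_kernel :: "real \<Rightarrow> real \<Rightarrow> real \<Rightarrow> complex" where
  "W_kernel \<alpha> x y = (if x \<in> {0<..<\<alpha>} \<and> y \<in> {0<..<\<alpha>} then k (x - y) else 0)"

definition R_kernel :: "real \<Rightarrow> real \<Rightarrow> real \<Rightarrow> complex" where
  "R_kernel \<alpha> x y = (if x \<in> {0<..<\<alpha>} \<and> y \<in> {0<..<\<alpha>} then col \<alpha> x y / s else 0)"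

text \<open>The error is what truncation discards from the whole-line equation: the convolution of
  \<open>k\<close> with the part of the column outside (0,\<alpha>). The sign comes from moving it
  to the other side.\<close>

definition E_kernel :: "real \<Rightarrow> real \<Rightarrow> real \<Rightarrow> complex" where
  "E_kernel \<alpha> x y = (if x \<in> {0<..<\<alpha>} \<and> y \<in> {0<..<\<alpha>}
     then - (LBINT z. k (x - z) * (if z \<in> {0<..<\<alpha>} then 0 else col \<alpha> z y)) / s else 0)"

lemma W_kernel_bounded_kernel: "bounded_kernel \<alpha> C (W_kernel \<alpha>)"
  unfolding bounded_kernel_def
proof (intro conjI allI impI)
  show "case_prod (W_kernel \<alpha>) \<in> borel_measurable (lborel \<Otimes>\<^sub>M lborel)" unfolding W_kernel_def by measurable
  show "cmod (W_kernel \<alpha> x y) \<le> C" for x y using bounds(1) C_nonneg by (simp add: W_kernel_def)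
qed (auto simp: W_kernel_def split: if_splits)

text \<open>The whole-line equation for a column is split at the ends of the interval: the inner
  part of the convolution is the composition of \<open>W_kernel\<close> with
  \<open>R_kernel\<close>, the outer part is the error. \<open>A\<close> makes
  \<open>B_coeff\<close> bounded below, and \<open>D\<close> covers both kernels.\<close>

lemma parametrix:
  "\<exists>D A. 0 \<le> D \<and> (\<forall>\<alpha>\<ge>A. 0 < \<alpha> \<and> bounded_kernel \<alpha> (D * \<alpha>) (R_kernel \<alpha>) \<and> bounded_kernel \<alpha> (D * exp (- (\<eta>/2) * \<alpha>)) (E_kernel \<alpha>) \<and>
     (\<forall>y. y \<in> {0<..<\<alpha>} \<longrightarrow> (AE x in lborel. x \<in> {0<..<\<alpha>} \<longrightarrow>
        a * R_kernel \<alpha> x y + cp * cm / s * W_kernel \<alpha> x y + kernel_comp (W_kernel \<alpha>) (R_kernel \<alpha>) x y = E_kernel \<alpha> x y)))"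
proof -
  define D1 where "D1 = cmod cp * (1 + C) + (1 + C) * (1 + C) + cmod cm * (1 + C) + tail_const * C
      + 2 * (cmod cm + 1 + 2 * tail_const) * (cmod cp + 2 * cmod cm + 4 + 3 * tail_const)"
  define D2 where "D2 = ((1 + C) + 2 * (cmod cm + 1 + 2 * tail_const)) * tail_const"
  define D where "D = max (D1 / cmod s) (tail_const * D2 / cmod s)"
  define A where "A = max 1 (2 * cmod (cp + cm + (LBINT u. Up u) + (LBINT u. Um u)))"
  have D2: "0 \<le> D2" unfolding D2_def using C_nonneg tail_const_nonneg by simp
  have D0: "0 \<le> D" unfolding D_def using D2 tail_const_nonneg by (simp add: le_max_iff_disj)
  have s0: "cmod s > 0" using s by simp
  have main: "0 < \<alpha> \<and> bounded_kernel \<alpha> (D * \<alpha>) (R_kernel \<alpha>) \<and> bounded_kernel \<alpha> (D * exp (- (\<eta>/2) * \<alpha>)) (E_kernel \<alpha>) \<and>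
     (\<forall>y. y \<in> {0<..<\<alpha>} \<longrightarrow> (AE x in lborel. x \<in> {0<..<\<alpha>} \<longrightarrow>
        a * R_kernel \<alpha> x y + cp * cm / s * W_kernel \<alpha> x y + kernel_comp (W_kernel \<alpha>) (R_kernel \<alpha>) x y = E_kernel \<alpha> x y))" if "A \<le> \<alpha>" for \<alpha>
  proof -
    have big: "2 * cmod (cp + cm + (LBINT u. Up u) + (LBINT u. Um u)) \<le> \<alpha>" "1 \<le> \<alpha>" using that unfolding A_def by auto
    have \<alpha>0: "0 < \<alpha>" using big by simp
    define colp where "colp = (\<lambda>(x, y). col \<alpha> x y)"
    have colpm[measurable]: "colp \<in> borel_measurable (lborel \<Otimes>\<^sub>M lborel)" unfolding colp_def by (rule col_measurable)
    have cp': "col \<alpha> x y = colp (x, y)" for x y by (simp add: colp_def)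
    have "bounded_kernel \<alpha> (D * \<alpha>) (R_kernel \<alpha>)"
      unfolding bounded_kernel_def
    proof (intro conjI allI impI)
      show "case_prod (R_kernel \<alpha>) \<in> borel_measurable (lborel \<Otimes>\<^sub>M lborel)" unfolding R_kernel_def cp' by measurable
      fix x y
      show "cmod (R_kernel \<alpha> x y) \<le> D * \<alpha>"
      proof (cases "x \<in> {0<..<\<alpha>} \<and> y \<in> {0<..<\<alpha>}")
        case True
        then have "cmod (col \<alpha> x y) \<le> D1 * \<alpha>" unfolding D1_def by (intro col_inside big) auto
        then have "cmod (col \<alpha> x y / s) \<le> D1 / cmod s * \<alpha>" using s0 by (simp add: norm_divide divide_right_mono)
        also have "\<dots> \<le> D * \<alpha>" using \<alpha>0 by (intro mult_right_mono) (auto simp: D_def)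
        finally show ?thesis using True by (simp add: R_kernel_def)
      next
        case False then show ?thesis using D0 \<alpha>0 by (auto simp: R_kernel_def)
      qed
    qed (auto simp: R_kernel_def split: if_splits)
    moreover have "bounded_kernel \<alpha> (D * exp (- (\<eta>/2) * \<alpha>)) (E_kernel \<alpha>)"
      unfolding bounded_kernel_def
    proof (intro conjI allI impI)
      show "case_prod (E_kernel \<alpha>) \<in> borel_measurable (lborel \<Otimes>\<^sub>M lborel)" unfolding E_kernel_def cp' by measurable
      fix x y
      show "cmod (E_kernel \<alpha> x y) \<le> D * exp (- (\<eta>/2) * \<alpha>)"
      proof (cases "x \<in> {0<..<\<alpha>} \<and> y \<in> {0<..<\<alpha>}")
        case True
        define e where "e = exp (- (\<eta>/2) * \<alpha>)"
        have i: "integrable lborel (\<lambda>z. cmod (k (x - z)) * (D2 * e))"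
          using integrable_sub_iff[of "\<lambda>z. cmod (k z) * (D2 * e)" x] int(1) by simp
        \<comment> \<open>The estimate \<open>col_outside\<close> does not cover the two end points,
          which form a null set.\<close>
        have "(LBINT z. k (x - z) * (if z \<in> {0<..<\<alpha>} then 0 else col \<alpha> z y))
            = (LBINT z. k (x - z) * (if z \<in> {0..\<alpha>} then 0 else col \<alpha> z y))"
        proof (rule bint_cong_AE)
          show "(\<lambda>z. k (x - z) * (if z \<in> {0<..<\<alpha>} then 0 else col \<alpha> z y)) \<in> borel_measurable lborel"
            "(\<lambda>z. k (x - z) * (if z \<in> {0..\<alpha>} then 0 else col \<alpha> z y)) \<in> borel_measurable lborel"
            unfolding cp' by measurable
          have "AE z in lborel. z \<noteq> 0" "AE z in lborel. z \<noteq> \<alpha>" by (rule AE_lborel_singleton)+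
          then show "AE z in lborel. k (x - z) * (if z \<in> {0<..<\<alpha>} then 0 else col \<alpha> z y) = k (x - z) * (if z \<in> {0..\<alpha>} then 0 else col \<alpha> z y)"
            by eventually_elim auto
        qed
        also have "cmod \<dots> \<le> (LBINT z. cmod (k (x - z)) * (D2 * e))"
        proof (rule norm_integral_le[OF i])
          fix z
          show "cmod (k (x - z) * (if z \<in> {0..\<alpha>} then 0 else col \<alpha> z y)) \<le> cmod (k (x - z)) * (D2 * e)"
          proof (cases "z \<in> {0..\<alpha>}")
            case False
            then have "cmod (col \<alpha> z y) \<le> D2 * e" unfolding D2_def e_def using True by (intro col_outside big) auto
            then have "cmod (k (x - z)) * cmod (col \<alpha> z y) \<le> cmod (k (x - z)) * (D2 * e)"
              by (rule mult_left_mono) simp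
            moreover have "(if z \<in> {0..\<alpha>} then 0 else col \<alpha> z y) = col \<alpha> z y" by (rule if_not_P[OF False])
            ultimately show ?thesis by (simp only: norm_mult)
          qed (use D2 in \<open>auto simp: e_def\<close>)
        qed
        also have "\<dots> = (LBINT z. cmod (k z)) * (D2 * e)"
          using integral_sub[of "\<lambda>z. cmod (k z) * (D2 * e)" x] by simp
        also have "\<dots> \<le> tail_const * (D2 * e)" using D2 by (intro mult_right_mono norm_int_le_tail_const k) (auto simp: e_def)
        finally have "cmod (LBINT z. k (x - z) * (if z \<in> {0<..<\<alpha>} then 0 else col \<alpha> z y)) / cmod s \<le> tail_const * (D2 * e) / cmod s"
          by (rule divide_right_mono) simp
        then have "cmod (E_kernel \<alpha> x y) \<le> tail_const * D2 / cmod s * e" using True by (simp add: E_kernel_def norm_divide)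
        also have "\<dots> \<le> D * e" by (intro mult_right_mono) (auto simp: D_def e_def)
        finally show ?thesis unfolding e_def .
      next
        case False then show ?thesis using D0 by (auto simp: E_kernel_def)
      qed
    qed (auto simp: E_kernel_def split: if_splits)
    moreover have "AE x in lborel. x \<in> {0<..<\<alpha>} \<longrightarrow>
        a * R_kernel \<alpha> x y + cp * cm / s * W_kernel \<alpha> x y + kernel_comp (W_kernel \<alpha>) (R_kernel \<alpha>) x y = E_kernel \<alpha> x y" if y: "y \<in> {0<..<\<alpha>}" for y
      using col_equation[of \<alpha> y]
    proof eventually_elim
      case (elim x)
      show ?case
      proof
        assume x: "x \<in> {0<..<\<alpha>}"
        have ad: "integrable lborel (\<lambda>z. k (x - z) * col \<alpha> z y)" using col_admissible unfolding admissible_def by blast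
        have i1: "integrable lborel (\<lambda>z. if z \<in> {0<..<\<alpha>} then k (x - z) * col \<alpha> z y else 0)"
          by (rule integrable_if[OF ad]) auto
        have i2: "integrable lborel (\<lambda>z. if z \<notin> {0<..<\<alpha>} then k (x - z) * col \<alpha> z y else 0)"
          by (rule integrable_if[OF ad]) auto
        have "conv k (\<lambda>z. col \<alpha> z y) x = (LBINT z. (if z \<in> {0<..<\<alpha>} then k (x - z) * col \<alpha> z y else 0) + (if z \<notin> {0<..<\<alpha>} then k (x - z) * col \<alpha> z y else 0))"
          unfolding conv_def by (intro bint_cong) auto
        also have "\<dots> = (LBINT z. if z \<in> {0<..<\<alpha>} then k (x - z) * col \<alpha> z y else 0) + (LBINT z. if z \<notin> {0<..<\<alpha>} then k (x - z) * col \<alpha> z y else 0)"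
          by (rule bint_add[OF i1 i2])
        also have "(LBINT z. if z \<in> {0<..<\<alpha>} then k (x - z) * col \<alpha> z y else 0) = (LBINT z. s * (W_kernel \<alpha> x z * R_kernel \<alpha> z y))"
          using x y s by (intro bint_cong) (auto simp: W_kernel_def R_kernel_def)
        also have "\<dots> = s * kernel_comp (W_kernel \<alpha>) (R_kernel \<alpha>) x y" unfolding kernel_comp_def by simp
        also have "(LBINT z. if z \<notin> {0<..<\<alpha>} then k (x - z) * col \<alpha> z y else 0) = (LBINT z. k (x - z) * (if z \<in> {0<..<\<alpha>} then 0 else col \<alpha> z y))"
          by (intro bint_cong) auto
        also have "\<dots> = - s * E_kernel \<alpha> x y" using x y s by (simp add: E_kernel_def)
        finally have cv: "conv k (\<lambda>z. col \<alpha> z y) x = s * kernel_comp (W_kernel \<alpha>) (R_kernel \<alpha>) x y - s * E_kernel \<alpha> x y" by simp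
        have "a * col \<alpha> x y + conv k (\<lambda>z. col \<alpha> z y) x + cp * cm * k (x - y) = 0"
          using elim x by (simp add: sym_op_def)
        then have "s * (a * R_kernel \<alpha> x y + cp * cm / s * W_kernel \<alpha> x y + kernel_comp (W_kernel \<alpha>) (R_kernel \<alpha>) x y - E_kernel \<alpha> x y) = 0"
          unfolding cv using x y s by (simp add: R_kernel_def W_kernel_def algebra_simps)
        then show "a * R_kernel \<alpha> x y + cp * cm / s * W_kernel \<alpha> x y + kernel_comp (W_kernel \<alpha>) (R_kernel \<alpha>) x y = E_kernel \<alpha> x y"
          using s by simp
      qed
    qed
    ultimately show ?thesis using \<alpha>0 by blast
  qed
  show ?thesis using D0 main by (intro exI[of _ D] exI[of _ A]) blast
qed

end

section \<open>The operators of the statement\<close>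

text \<open>\<open>symbol_repr\<close> is an arbitrary choice. Uniqueness of transforms fixes its
  constant and, almost everywhere, its density, so each operator may be computed with a preferred
  density.\<close>

lemma symbol_repr_unique:
  assumes V0: "integrable lborel V0" and v: "\<And>\<xi>. v \<xi> = c0 + fourier V0 \<xi>"
  obtains V where "symbol_repr v = (c0, V)" "integrable lborel V" "AE x in lborel. V x = V0 x"
proof -
  define P where "P = (\<lambda>(c, V). integrable lborel V \<and> (\<forall>\<xi>. v \<xi> = c + fourier V \<xi>))"
  have "P (c0, V0)" using V0 v by (simp add: P_def)
  then have "P (symbol_repr v)" unfolding symbol_repr_def P_def[symmetric] by (rule someI)
  obtain c V where cV: "symbol_repr v = (c, V)" by (cases "symbol_repr v")
  then have V: "integrable lborel V" "\<And>\<xi>. v \<xi> = c + fourier V \<xi>"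
    using \<open>P (symbol_repr v)\<close> by (auto simp: P_def)
  have i: "integrable lborel (\<lambda>x. V x + (-1) * V0 x)" using V(1) V0 by auto
  have "(c - c0) + fourier (\<lambda>x. V x + (-1) * V0 x) \<xi> = 0" for \<xi>
  proof -
    have E: "fourier (\<lambda>x. V x + (-1) * V0 x) \<xi> = fourier V \<xi> + (-1) * fourier V0 \<xi>"
      unfolding fourier_cmult[symmetric] by (rule fourier_add) (use V(1) V0 in auto)
    have "(c - c0) + fourier (\<lambda>x. V x + (-1) * V0 x) \<xi> = (c + fourier V \<xi>) - (c0 + fourier V0 \<xi>)"
      unfolding E by simp
    then show ?thesis unfolding V(2)[symmetric] v[symmetric] by simp
  qed
  then have "c - c0 = 0" "AE x in lborel. V x + (-1) * V0 x = 0" using fourier_unique[OF i, of "c - c0"] by blast+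
  then have "c = c0" "AE x in lborel. V x = V0 x" by (simp, elim eventually_mono, simp)
  with cV V(1) show thesis by (intro that) auto
qed

lemma AE_eq_affine:
  fixes V V0 :: "real \<Rightarrow> complex"
  assumes "AE x in lborel. V x = V0 x" "V \<in> borel_measurable borel" "V0 \<in> borel_measurable borel"
  shows "AE y in lborel. V (x - y) = V0 (x - y)" "AE y in lborel. V (x + y) = V0 (x + y)"
proof -
  note assms(2,3)[measurable]
  have P: "Measurable.pred borel (\<lambda>x. V x = V0 x)" by measurable
  show "AE y in lborel. V (x - y) = V0 (x - y)" using AE_borel_affine[OF _ P assms(1), of "-1" x] by simp
  show "AE y in lborel. V (x + y) = V0 (x + y)" using AE_borel_affine[OF _ P assms(1), of 1 x] by simp
qed

lemma set_integral_halfline: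
  "(LBINT y:{0<..}. F y * f y) = (LBINT y. F y * (if 0 < y then f y else (0::complex)))"
  unfolding set_lebesgue_integral_def
  by (intro bint_cong) (auto simp: indicator_def)

text \<open>The integral sees \<open>f\<close> only on the positive axis, so measurability is asked
  of the restriction; an intermediate function such as \<open>wh_minus t um g\<close> is controlled
  only there.\<close>

lemma wiener_hopf_eq:
  assumes V0: "integrable lborel V0" and v: "\<And>\<xi>. v \<xi> = c0 + fourier V0 \<xi>"
    and f: "(\<lambda>y. if 0 < y then f y else 0) \<in> borel_measurable borel"
  shows "wiener_hopf v f x = c0 * f x + conv V0 (\<lambda>y. if 0 < y then f y else 0) x"
proof -
  obtain V where V: "symbol_repr v = (c0, V)" "integrable lborel V" "AE x in lborel. V x = V0 x"
    using symbol_repr_unique[OF V0 v] by blast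
  have [measurable]: "V \<in> borel_measurable borel" "V0 \<in> borel_measurable borel"
    using V(2) V0 borel_measurable_integrable by force+
  note f[measurable]
  have "(LBINT y. V (x - y) * (if 0 < y then f y else 0)) = (LBINT y. V0 (x - y) * (if 0 < y then f y else 0))"
  proof (rule bint_cong_AE)
    show "AE y in lborel. V (x - y) * (if 0 < y then f y else 0) = V0 (x - y) * (if 0 < y then f y else 0)"
      using AE_eq_affine(1)[OF V(3), of x] by (auto elim!: eventually_mono)
  qed measurable
  then show ?thesis unfolding wiener_hopf_def V(1) conv_def by (simp add: set_integral_halfline)
qed

lemma hankel_eq:
  assumes V0: "integrable lborel V0" and v: "\<And>\<xi>. v \<xi> = c0 + fourier V0 \<xi>"
    and f: "(\<lambda>y. if 0 < y then f y else 0) \<in> borel_measurable borel"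
  shows "hankel v f x = (LBINT y. V0 (x + y) * (if 0 < y then f y else 0))"
proof -
  obtain V where V: "symbol_repr v = (c0, V)" "integrable lborel V" "AE x in lborel. V x = V0 x"
    using symbol_repr_unique[OF V0 v] by blast
  have [measurable]: "V \<in> borel_measurable borel" "V0 \<in> borel_measurable borel"
    using V(2) V0 borel_measurable_integrable by force+
  note f[measurable]
  have "(LBINT y. V (x + y) * (if 0 < y then f y else 0)) = (LBINT y. V0 (x + y) * (if 0 < y then f y else 0))"
  proof (rule bint_cong_AE)
    show "AE y in lborel. V (x + y) * (if 0 < y then f y else 0) = V0 (x + y) * (if 0 < y then f y else 0)"
      using AE_eq_affine(2)[OF V(3), of x] by (auto elim!: eventually_mono)
  qed measurable
  then show ?thesis unfolding hankel_def V(1) by (simp add: set_integral_halfline)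
qed

section \<open>Square-integrable functions on the interval and their extensions by zero\<close>

lemma P_cut_indicator: "P_cut \<alpha> f x = indicator {0<..<\<alpha>} x *\<^sub>R f x"
  by (simp add: P_cut_def indicator_def)

lemma L2_iff_cutL2: "f \<in> L2 \<alpha> \<longleftrightarrow> cutL2 \<alpha> (P_cut \<alpha> f)"
proof -
  have 1: "set_borel_measurable lborel {0<..<\<alpha>} f \<longleftrightarrow> P_cut \<alpha> f \<in> borel_measurable borel"
    unfolding set_borel_measurable_def P_cut_indicator[abs_def] by simp
  have "(\<lambda>x. indicator {0<..<\<alpha>} x *\<^sub>R (cmod (f x))\<^sup>2) = (\<lambda>x. (cmod (P_cut \<alpha> f x))\<^sup>2)"
    by (simp add: P_cut_def indicator_def fun_eq_iff)
  then have 2: "set_integrable lborel {0<..<\<alpha>} (\<lambda>x. (cmod (f x))\<^sup>2) \<longleftrightarrow> integrable lborel (\<lambda>x. (cmod (P_cut \<alpha> f x))\<^sup>2)"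
    unfolding set_integrable_def by simp
  show ?thesis unfolding L2_def cutL2_def using 1 2 by (auto simp: P_cut_def)
qed

lemma P_cut_cutL2: "cutL2 \<alpha> h \<Longrightarrow> P_cut \<alpha> h = h"
  unfolding cutL2_def P_cut_def by (auto simp: fun_eq_iff)

lemma set_integral_P_cut:
  "(LBINT y:{0<..<\<alpha>}. F y * f y) = (LBINT y. F y * P_cut \<alpha> f y)"
  unfolding set_lebesgue_integral_def
  by (intro bint_cong) (auto simp: indicator_def P_cut_def)

lemma L2_integral_norm: "(LBINT x:{0<..<\<alpha>}. (cmod (f x))\<^sup>2) = (LBINT x. (cmod (P_cut \<alpha> f x))\<^sup>2)"
  unfolding set_lebesgue_integral_def
  by (intro bint_cong) (auto simp: indicator_def P_cut_def)

lemma cutL2_lincomb: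
  assumes "cutL2 \<alpha> f" "cutL2 \<alpha> g"
  shows "cutL2 \<alpha> (\<lambda>x. c * f x + d * g x)"
  unfolding cutL2_def
proof (intro conjI allI impI)
  show m: "(\<lambda>x. c * f x + d * g x) \<in> borel_measurable borel" using assms by (auto simp: cutL2_def)
  have i: "integrable lborel (\<lambda>x. 2 * (cmod c)\<^sup>2 * (cmod (f x))\<^sup>2 + 2 * (cmod d)\<^sup>2 * (cmod (g x))\<^sup>2)"
    using assms by (auto simp: cutL2_def)
  show "integrable lborel (\<lambda>x. (cmod (c * f x + d * g x))\<^sup>2)"
  proof (rule integrable_dominated[OF i])
    show "AE x in lborel. norm ((cmod (c * f x + d * g x))\<^sup>2) \<le> norm (2 * (cmod c)\<^sup>2 * (cmod (f x))\<^sup>2 + 2 * (cmod d)\<^sup>2 * (cmod (g x))\<^sup>2)"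
    proof (intro AE_I2)
      fix x
      define u v where "u = cmod c * cmod (f x)" and "v = cmod d * cmod (g x)"
      have "cmod (c * f x + d * g x) \<le> u + v"
        using norm_triangle_ineq[of "c * f x" "d * g x"] by (simp add: u_def v_def norm_mult)
      then have "(cmod (c * f x + d * g x))\<^sup>2 \<le> (u + v)\<^sup>2" by (rule power_mono) simp
      also have "\<dots> \<le> 2 * u\<^sup>2 + 2 * v\<^sup>2"
        using zero_le_power2[of "u - v"] unfolding power2_diff power2_sum by linarith
      finally show "norm ((cmod (c * f x + d * g x))\<^sup>2) \<le> norm (2 * (cmod c)\<^sup>2 * (cmod (f x))\<^sup>2 + 2 * (cmod d)\<^sup>2 * (cmod (g x))\<^sup>2)"
        by (simp add: u_def v_def power_mult_distrib)
    qed
  qed (use m in auto)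
  fix x assume "c * f x + d * g x \<noteq> 0"
  then have "f x \<noteq> 0 \<or> g x \<noteq> 0" by auto
  then show "x \<in> {0<..<\<alpha>}" using assms unfolding cutL2_def by blast
qed

lemma L2_bounded_linear_kernel_op:
  assumes K: "bounded_kernel \<alpha> b K" and \<alpha>: "0 < \<alpha>"
    and T: "\<And>f. f \<in> L2 \<alpha> \<Longrightarrow> T f = kernel_op c K (P_cut \<alpha> f)"
  shows "L2_bounded_linear \<alpha> T"
  unfolding L2_bounded_linear_def
proof (intro conjI ballI allI exI)
  have cut: "cutL2 \<alpha> (T f)" if "f \<in> L2 \<alpha>" for f
    unfolding T[OF that] using that kernel_op_cutL2(1)[OF K _ \<alpha>] by (simp add: L2_iff_cutL2)
  fix f assume f: "f \<in> L2 \<alpha>"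
  show "T f \<in> L2 \<alpha>" unfolding L2_iff_cutL2 P_cut_cutL2[OF cut[OF f]] by (rule cut[OF f])
  show "(LBINT x:{0<..<\<alpha>}. (cmod (T f x))\<^sup>2) \<le> 2 * ((cmod c)\<^sup>2 + (b * \<alpha>)\<^sup>2) * (LBINT x:{0<..<\<alpha>}. (cmod (f x))\<^sup>2)"
    unfolding L2_integral_norm P_cut_cutL2[OF cut[OF f]] unfolding T[OF f]
    using kernel_op_cutL2(2)[OF K _ \<alpha>] f by (simp add: L2_iff_cutL2)
  fix g u v assume g: "g \<in> L2 \<alpha>"
  define F where "F = P_cut \<alpha> f"
  define G where "G = P_cut \<alpha> g"
  have FG: "cutL2 \<alpha> F" "cutL2 \<alpha> G" using f g by (simp_all add: F_def G_def L2_iff_cutL2)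
  have pc: "P_cut \<alpha> (\<lambda>x. u * f x + v * g x) = (\<lambda>x. u * F x + v * G x)"
    by (auto simp: F_def G_def P_cut_def)
  have h: "(\<lambda>x. u * f x + v * g x) \<in> L2 \<alpha>" unfolding L2_iff_cutL2 pc by (rule cutL2_lincomb[OF FG])
  have "T (\<lambda>x. u * f x + v * g x) x = u * T f x + v * T g x" for x
  proof -
    have i: "integrable lborel (\<lambda>y. K x y * F y)" "integrable lborel (\<lambda>y. K x y * G y)"
      using kernel_op_integrand_integrable[OF K] cutL2_imp_cutL1[OF FG(1)] cutL2_imp_cutL1[OF FG(2)] by (auto simp: cutL1_def)
    have "(LBINT y. K x y * (u * F y + v * G y)) = (LBINT y. u * (K x y * F y) + v * (K x y * G y))"
      by (simp add: algebra_simps)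
    also have "\<dots> = u * (LBINT y. K x y * F y) + v * (LBINT y. K x y * G y)" using i by simp
    finally show ?thesis unfolding T[OF h] T[OF f] T[OF g] pc unfolding kernel_op_def F_def[symmetric] G_def[symmetric]
      by (simp add: algebra_simps)
  qed
  then show "L2_eq \<alpha> (T (\<lambda>x. u * f x + v * g x)) (\<lambda>x. u * T f x + v * T g x)" by (simp add: L2_eq_def)
qed

lemma L2_inverse_kernel_op:
  assumes W: "bounded_kernel \<alpha> w W" and R: "bounded_kernel \<alpha> b K" and \<alpha>: "0 < \<alpha>"
    and T: "\<And>f. f \<in> L2 \<alpha> \<Longrightarrow> T f = kernel_op a W (P_cut \<alpha> f)"
    and S: "\<And>f. f \<in> L2 \<alpha> \<Longrightarrow> S f = kernel_op c K (P_cut \<alpha> f)"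
    and TS: "\<And>f. cutL2 \<alpha> f \<Longrightarrow> AE x in lborel. kernel_op a W (kernel_op c K f) x = f x"
    and ST: "\<And>f. cutL2 \<alpha> f \<Longrightarrow> AE x in lborel. kernel_op c K (kernel_op a W f) x = f x"
  shows "L2_inverse \<alpha> T S"
  unfolding L2_inverse_def
proof (intro conjI ballI)
  show bl: "L2_bounded_linear \<alpha> T" "L2_bounded_linear \<alpha> S"
    by (rule L2_bounded_linear_kernel_op[OF W \<alpha> T] L2_bounded_linear_kernel_op[OF R \<alpha> S], assumption)+
  fix f assume f: "f \<in> L2 \<alpha>"
  then have cf: "cutL2 \<alpha> (P_cut \<alpha> f)" by (simp add: L2_iff_cutL2)
  have "S f \<in> L2 \<alpha>" "T f \<in> L2 \<alpha>" using bl f unfolding L2_bounded_linear_def by blast+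
  then have 1: "T (S f) = kernel_op a W (kernel_op c K (P_cut \<alpha> f))" "S (T f) = kernel_op c K (kernel_op a W (P_cut \<alpha> f))"
    using T[of "S f"] S[of "T f"] P_cut_cutL2[OF kernel_op_cutL2(1)[OF R cf \<alpha>]] P_cut_cutL2[OF kernel_op_cutL2(1)[OF W cf \<alpha>]]
    by (simp_all add: S[OF f] T[OF f])
  show "L2_eq \<alpha> (T (S f)) f" unfolding L2_eq_def 1 using TS[OF cf] by eventually_elim (auto simp: P_cut_def)
  show "L2_eq \<alpha> (S (T f)) f" unfolding L2_eq_def 1 using ST[OF cf] by eventually_elim (auto simp: P_cut_def)
qed

lemma integral_gt_eq_ge:
  fixes f :: "real \<Rightarrow> complex"
  assumes [measurable]: "f \<in> borel_measurable borel"
  shows "(LBINT u. if c < u then f u else 0) = (LBINT u. if c \<le> u then f u else 0)"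
proof (rule bint_cong_AE)
  have "AE u in lborel. u \<noteq> c" by (rule AE_lborel_singleton)
  then show "AE u in lborel. (if c < u then f u else 0) = (if c \<le> u then f u else 0)" by eventually_elim auto
qed measurable

section \<open>The claimed expression in terms of kernels\<close>

context wh_time
begin

text \<open>On the interval the affine terms cancel the solution from the right end except for a
  tail of the reflected \<open>Um\<close> beyond \<open>\<alpha> - x\<close>, and this tail is the
  Hankel term applied to 1.\<close>

lemma phi_inside:
  assumes "x < \<alpha>"
  shows "phi \<alpha> x = wh_one cp Up x + (LBINT z. if \<alpha> < z then Um (x - z) else 0)"
proof -
  have i: "integrable lborel (\<lambda>u. Um (- u))" using integrable_reflect_iff[of Um] int(3) by simp
  have "(LBINT u. Um u) = (LBINT u. Um (- u))" by (rule integral_reflect[symmetric])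
  also have "\<dots> = (LBINT u. (if u < \<alpha> - x then Um (- u) else 0) + (if \<alpha> - x \<le> u then Um (- u) else 0))"
    by (intro bint_cong) auto
  also have "\<dots> = (LBINT u. if u < \<alpha> - x then Um (- u) else 0) + (LBINT u. if \<alpha> - x \<le> u then Um (- u) else 0)"
    by (intro bint_add integrable_if i) auto
  also have "(LBINT u. if \<alpha> - x \<le> u then Um (- u) else 0) = (LBINT u. if \<alpha> - x < u then Um (- u) else 0)"
    by (rule integral_gt_eq_ge[symmetric]) measurable
  also have "\<dots> = (LBINT z. (\<lambda>u. if \<alpha> - x < u then Um (- u) else 0) (z + - x))" by (rule integral_shift[symmetric])
  also have "\<dots> = (LBINT z. if \<alpha> < z then Um (x - z) else 0)" by (intro bint_cong) auto
  finally show ?thesis using assms unfolding phi_def by (simp add: wh_one_def)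
qed

text \<open>Up to the factor \<open>t\<close> and a multiple of the identity, the kernels of \<open>W(1/\<sigma>\<^sub>+)\<close> and \<open>W(1/\<sigma>\<^sub>-)\<close> on \<open>(0,\<alpha>)\<close>.\<close>

definition P_kernel :: "real \<Rightarrow> real \<Rightarrow> real \<Rightarrow> complex" where
  "P_kernel \<alpha> x y = (if x \<in> {0<..<\<alpha>} \<and> y \<in> {0<..<\<alpha>} then p (x - y) else 0)"

definition M_kernel :: "real \<Rightarrow> real \<Rightarrow> real \<Rightarrow> complex" where
  "M_kernel \<alpha> x y = (if x \<in> {0<..<\<alpha>} \<and> y \<in> {0<..<\<alpha>} then m (x - y) else 0)"

lemma P_kernel_bounded_kernel: "bounded_kernel \<alpha> (1 + C) (P_kernel \<alpha>)"
  unfolding bounded_kernel_def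
proof (intro conjI allI impI)
  have [measurable]: "p \<in> borel_measurable borel" by measurable
  show "case_prod (P_kernel \<alpha>) \<in> borel_measurable (lborel \<Otimes>\<^sub>M lborel)" unfolding P_kernel_def by measurable
  show "cmod (P_kernel \<alpha> x y) \<le> 1 + C" for x y using p_bound C_nonneg by (simp add: P_kernel_def)
qed (auto simp: P_kernel_def split: if_splits)

lemma M_kernel_bounded_kernel: "bounded_kernel \<alpha> (1 + C) (M_kernel \<alpha>)"
  unfolding bounded_kernel_def
proof (intro conjI allI impI)
  have [measurable]: "m \<in> borel_measurable borel" by measurable
  show "case_prod (M_kernel \<alpha>) \<in> borel_measurable (lborel \<Otimes>\<^sub>M lborel)" unfolding M_kernel_def by measurable
  show "cmod (M_kernel \<alpha> x y) \<le> 1 + C" for x y using m_bound C_nonneg by (simp add: M_kernel_def)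
qed (auto simp: M_kernel_def split: if_splits)

text \<open>Truncating the inner variable at \<alpha> changes nothing, because
  \<open>m (z - y)\<close> vanishes for \<open>z > y\<close>. The product on the half-line and the
  product on the interval therefore agree.\<close>

lemma kernel_comp_P_kernel_M_kernel:
  assumes "x \<in> {0<..<\<alpha>}" "y \<in> {0<..<\<alpha>}"
  shows "kernel_comp (P_kernel \<alpha>) (M_kernel \<alpha>) x y = conv p (m_cut y) x"
  unfolding kernel_comp_def conv_def
proof (intro bint_cong refl)
  fix z
  show "P_kernel \<alpha> x z * M_kernel \<alpha> z y = p (x - z) * m_cut y z"
    using assms m_pos[of "z - y"] unfolding P_kernel_def M_kernel_def m_cut_def by (cases "z < \<alpha>") auto
qed

text \<open>The claimed expression is exactly the operator built from \<open>R_kernel\<close>; no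
  error arises here. \<open>T1\<close> treats the Wiener-Hopf product, \<open>T2\<close> the Hankel
  product and \<open>T3\<close> the tensor product, and their kernels add up to the column
  \<open>col\<close>.\<close>

lemma paper_formula:
  fixes up um :: "real \<Rightarrow> complex"
  assumes up: "\<And>\<xi>. up \<xi> = cp + fourier Up \<xi>" and um: "\<And>\<xi>. um \<xi> = cm + fourier Um \<xi>"
    and t: "s = t\<^sup>2" and f: "cutL1 \<alpha> (P_cut \<alpha> f)" and x: "0 < x" "x < \<alpha>"
  shows "P_cut \<alpha> (wh_plus t up (wh_minus t um (P_cut \<alpha> f))) x
      - 1 / (t * t) * Q_rev \<alpha> (hankel (flip_arg um) (hankel up (Q_rev \<alpha> f))) x
      - inverse (B_coeff \<alpha>) *
          tensor \<alpha>
            (\<lambda>y. 1 / t * Q_rev \<alpha> (hankel (flip_arg um) (\<lambda>_. 1)) y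
                 + P_cut \<alpha> (wh_plus t up (\<lambda>_. 1)) y)
            (\<lambda>y. 1 / t * Q_rev \<alpha> (hankel up (\<lambda>_. 1)) y
                 + P_cut \<alpha> (wh_plus t (flip_arg um) (\<lambda>_. 1)) y)
            f x = kernel_op (cp * cm / s) (R_kernel \<alpha>) (P_cut \<alpha> f) x"
proof -
  define g where "g = P_cut \<alpha> f"
  have \<alpha>0: "0 < \<alpha>" using x by simp
  have t0: "t \<noteq> 0" using s t by auto
  have gc: "cutL1 \<alpha> g" using f by (simp add: g_def)
  have gi: "integrable lborel g" using gc by (simp add: cutL1_def)
  have gm[measurable]: "g \<in> borel_measurable borel" using gi borel_measurable_integrable by force
  have g0: "g y = 0" if "y \<notin> {0<..<\<alpha>}" for y using gc that unfolding cutL1_def by blast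
  have gpos: "(\<lambda>y. if 0 < y then g y else 0) = g" using g0 by (auto simp: fun_eq_iff)
  have pm[measurable]: "p \<in> borel_measurable borel" "m \<in> borel_measurable borel" by measurable
  have iUmr: "integrable lborel (\<lambda>x. Um (- x))" using integrable_reflect_iff[of Um] int(3) by simp
  have fum: "flip_arg um \<xi> = cm + fourier (\<lambda>x. Um (- x)) \<xi>" for \<xi>
    by (simp add: flip_arg_def um fourier_reflect)

  \<comment> \<open>The singular and regular parts of 1/sigma_- recombine into convolution with
    \<open>m\<close>.\<close>
  have h: "wh_minus t um g z = (cm * g z + conv m g z) / t" for z
  proof -
    have i1: "integrable lborel (\<lambda>y. if z < y then g y else 0)" by (intro integrable_if gi) auto
    have i2: "integrable lborel (\<lambda>y. Um (z - y) * g y)"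
      by (rule integrable_bounded_mult(1)[OF gi _ bounds(3)]) measurable
    have "(LBINT y:{z<..}. g y) = (LBINT y. if z < y then g y else 0)"
      unfolding set_lebesgue_integral_def by (intro bint_cong) (auto simp: indicator_def)
    moreover have "wiener_hopf um g z = cm * g z + conv Um g z"
      using wiener_hopf_eq[OF int(3) um, of g z] gm by (simp add: gpos)
    moreover have "(LBINT y. if z < y then g y else 0) + conv Um g z = conv m g z"
      unfolding conv_def
      by (subst bint_add[OF i1 i2, symmetric])
         (intro bint_cong, auto simp: mfun_def algebra_simps)
    ultimately show ?thesis unfolding wh_minus_def wh_sing_minus_def by (simp add: algebra_simps)
  qed
  define hc where "hc = kernel_op cm (M_kernel \<alpha>) g"
  have hcL: "cutL1 \<alpha> hc" unfolding hc_def by (rule kernel_op_cutL1[OF M_kernel_bounded_kernel gc])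
  have hci: "integrable lborel hc" using hcL by (simp add: cutL1_def)
  have hcm[measurable]: "hc \<in> borel_measurable borel" using hci borel_measurable_integrable by force
  \<comment> \<open>Since \<open>m\<close> acts only to the left, the support is not enlarged beyond
    \<alpha>, and the half-line function is again supported in (0,\<alpha>).\<close>
  have hcut: "(if 0 < z then wh_minus t um g z else 0) = hc z / t" for z
  proof (cases "z \<in> {0<..<\<alpha>}")
    case True
    have "conv m g z = (LBINT y. M_kernel \<alpha> z y * g y)"
      unfolding conv_def
    proof (intro bint_cong refl)
      fix y show "m (z - y) * g y = M_kernel \<alpha> z y * g y" using True g0[of y] by (auto simp: M_kernel_def)
    qed
    then show ?thesis using True unfolding h hc_def kernel_op_def by simp
  next
    case False
    have "hc z = 0" using hcL False unfolding cutL1_def by blast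
    moreover have "conv m g z = 0" if "0 < z"
    proof -
      have "(\<lambda>y. m (z - y) * g y) = (\<lambda>y. 0)"
      proof
        fix y show "m (z - y) * g y = 0"
          using that False g0[of y] m_pos[of "z - y"] by (cases "y < \<alpha>") auto
      qed
      then show ?thesis by (simp add: conv_def)
    qed
    ultimately show ?thesis using g0[OF False] unfolding h by auto
  qed
  have T1: "P_cut \<alpha> (wh_plus t up (wh_minus t um (P_cut \<alpha> f))) x
     = (cp * cm * g x + (LBINT y. (cp * M_kernel \<alpha> x y + cm * P_kernel \<alpha> x y + kernel_comp (P_kernel \<alpha>) (M_kernel \<alpha>) x y) * g y)) / s"
  proof -
    have i1: "integrable lborel (\<lambda>y. if y < x then hc y / t else 0)" by (rule integrable_if) (use hci in auto)
    have i2: "integrable lborel (\<lambda>y. Up (x - y) * (hc y / t))"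
      by (rule integrable_bounded_mult(1)[OF _ _ bounds(2)]) (use hci in auto)
    have "wh_sing_plus (wh_minus t um g) x = (LBINT y. if y < x then hc y / t else 0)"
      unfolding wh_sing_plus_def set_lebesgue_integral_def
    proof (intro bint_cong refl)
      fix y show "indicator {0<..<x} y *\<^sub>R wh_minus t um g y = (if y < x then hc y / t else 0)"
        using hcut[of y] by (auto simp: indicator_def split: if_splits)
    qed
    moreover have "wiener_hopf up (wh_minus t um g) x = cp * (hc x / t) + (LBINT y. Up (x - y) * (hc y / t))"
      using wiener_hopf_eq[OF int(2) up, of "wh_minus t um g" x] hcut[of x] x hcm by (simp add: hcut conv_def)
    moreover have "(LBINT y. if y < x then hc y / t else 0) + (LBINT y. Up (x - y) * (hc y / t)) = (LBINT y. P_kernel \<alpha> x y * hc y) / t"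
    proof -
      have "(LBINT y. if y < x then hc y / t else 0) + (LBINT y. Up (x - y) * (hc y / t)) = (LBINT y. P_kernel \<alpha> x y * hc y / t)"
      proof (subst bint_add[OF i1 i2, symmetric], intro bint_cong refl)
        fix y
        have "hc y = 0" if "y \<notin> {0<..<\<alpha>}" using hcL that unfolding cutL1_def by blast
        then show "(if y < x then hc y / t else 0) + Up (x - y) * (hc y / t) = P_kernel \<alpha> x y * hc y / t"
          using x by (cases "y \<in> {0<..<\<alpha>}") (auto simp: P_kernel_def pfun_def algebra_simps add_divide_distrib)
      qed
      then show ?thesis by simp
    qed
    ultimately have W: "wh_plus t up (wh_minus t um g) x = kernel_op cp (P_kernel \<alpha>) hc x / (t * t)"
      unfolding wh_plus_def kernel_op_def by (simp add: add_divide_distrib algebra_simps)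
    have A: "P_cut \<alpha> F x = F x" for F using x by (simp add: P_cut_def)
    show ?thesis unfolding A g_def[symmetric] W
      unfolding hc_def kernel_op_comp[OF P_kernel_bounded_kernel M_kernel_bounded_kernel gc] t power2_eq_square ..
  qed

  \<comment> \<open>Preparation for exchanging the two Hankel integrals: \<open>Up_cut\<close> has
    an \<open>L^1\<close> norm in \<open>z\<close> bounded uniformly in \<open>y\<close>, and
    \<open>Um\<close> is bounded.\<close>
  have m2: "(\<lambda>(y, z). Um (x - z) * (if \<alpha> < z then Up (z - y) else 0) * g y) \<in> borel_measurable (lborel \<Otimes>\<^sub>M lborel)"
    by measurable
  have iq: "integrable lborel (\<lambda>z. Um (x - z) * Up_cut \<alpha> y z)" for y
    by (rule integrable_conv_integrand[OF int(3) Up_cut_meas Up_cut_bound])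
  have i2: "integrable lborel (\<lambda>z. Um (x - z) * (if \<alpha> < z then Up (z - y) else 0) * g y)" for y
    using iq[of y] unfolding Up_cut_def by simp
  have w2: "(LBINT z. cmod (Um (x - z) * (if \<alpha> < z then Up (z - y) else 0) * g y)) \<le> C * tail_const * cmod (g y)" for y
  proof -
    have "(LBINT z. cmod (Um (x - z) * Up_cut \<alpha> y z)) \<le> C * (LBINT z. cmod (Up_cut \<alpha> y z))"
      by (rule integrable_bounded_mult(2)[OF Up_cut_integrable _ bounds(3)]) measurable
    also have "\<dots> \<le> C * tail_const" by (intro mult_left_mono Up_cut_norm_int C_nonneg)
    finally have "(LBINT z. cmod (Um (x - z) * Up_cut \<alpha> y z)) * cmod (g y) \<le> C * tail_const * cmod (g y)"
      by (rule mult_right_mono) simp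
    then show ?thesis unfolding Up_cut_def norm_mult[of _ "g y"] by simp
  qed
  have wi2: "integrable lborel (\<lambda>y. C * tail_const * cmod (g y))" using gi by simp
  have cq: "(LBINT z. Um (x - z) * (if \<alpha> < z then Up (z - y) else 0) * g y) = conv Um (Up_cut \<alpha> y) x * g y" for y
    unfolding conv_def Up_cut_def by simp
  have icq: "integrable lborel (\<lambda>y. conv Um (Up_cut \<alpha> y) x * g y)"
    using lborel_pair.integrable_fst[OF fubini_integrable[OF m2 i2 wi2 w2]] unfolding cq .
  have Qg: "Q_rev \<alpha> f y = g (\<alpha> - y)" for y by (simp add: Q_rev_def g_def P_cut_def)
  have G: "hankel up (Q_rev \<alpha> f) z = (LBINT y. Up (z + \<alpha> - y) * g y)" for z
  proof -
    have q0: "(\<lambda>y. if 0 < y then Q_rev \<alpha> f y else 0) = (\<lambda>y. g (\<alpha> - y))"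
      using g0 by (auto simp: fun_eq_iff Qg)
    have "hankel up (Q_rev \<alpha> f) z = (LBINT y. Up (z + y) * g (\<alpha> - y))"
      by (subst hankel_eq[OF int(2) up]) (simp_all add: q0 fun_cong[OF q0])
    also have "\<dots> = (LBINT y. (\<lambda>y. Up (z + \<alpha> - y) * g y) (\<alpha> - y))" by simp
    also have "\<dots> = (LBINT y. Up (z + \<alpha> - y) * g y)" by (rule integral_sub)
    finally show ?thesis .
  qed
  \<comment> \<open>After a shift by \<alpha> the two reversals disappear and the Hankel product has
    kernel \<open>conv Um (Up_cut \<alpha> y) x\<close>, to which the right part of
    \<open>col\<close> reduces inside the interval.\<close>
  have T2: "Q_rev \<alpha> (hankel (flip_arg um) (hankel up (Q_rev \<alpha> f))) x = (LBINT y. conv Um (Up_cut \<alpha> y) x * g y)"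
  proof -
    have "hankel (flip_arg um) (hankel up (Q_rev \<alpha> f)) (\<alpha> - x)
       = (LBINT z. Um (- (\<alpha> - x + z)) * (if 0 < z then LBINT y. Up (z + \<alpha> - y) * g y else 0))"
    proof -
      have fG: "hankel up (Q_rev \<alpha> f) = (\<lambda>z. LBINT y. Up (z + \<alpha> - y) * g y)" by (rule ext) (rule G)
      have "(\<lambda>z. if 0 < z then LBINT y. Up (z + \<alpha> - y) * g y else 0) \<in> borel_measurable borel" by measurable
      then show ?thesis unfolding fG by (rule hankel_eq[OF iUmr fum])
    qed
    also have "\<dots> = (LBINT z. (\<lambda>z. Um (x - z) * (if \<alpha> < z then LBINT y. Up (z - y) * g y else 0)) (z + \<alpha>))"
      by (intro bint_cong) (auto simp: algebra_simps)
    also have "\<dots> = (LBINT z. Um (x - z) * (if \<alpha> < z then LBINT y. Up (z - y) * g y else 0))" by (rule integral_shift)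
    also have "\<dots> = (LBINT z. LBINT y. Um (x - z) * (if \<alpha> < z then Up (z - y) else 0) * g y)"
      by (intro bint_cong) (auto simp: mult.assoc)
    also have "\<dots> = (LBINT y. LBINT z. Um (x - z) * (if \<alpha> < z then Up (z - y) else 0) * g y)"
      by (rule fubini_swap[OF m2 i2 wi2 w2])
    finally show ?thesis unfolding cq using x by (simp add: Q_rev_def)
  qed

  have V: "P_cut \<alpha> (wh_plus t v (\<lambda>_. 1)) y = wh_one c U y / t"
    if U: "integrable lborel U" and v: "\<And>\<xi>. v \<xi> = c + fourier U \<xi>" and y: "0 < y" "y < \<alpha>" for U c v y
  proof -
    have "wh_sing_plus (\<lambda>_. 1) y = of_real y"
      using y unfolding wh_sing_plus_def set_lebesgue_integral_def by (simp add: scaleR_conv_of_real)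
    moreover have "wiener_hopf v (\<lambda>_. 1) y = c + conv U (\<lambda>y. if 0 < y then 1 else 0) y"
      by (subst wiener_hopf_eq[OF U v]) simp_all
    moreover have "conv U (\<lambda>y. if 0 < y then 1 else 0) y = (LBINT u. if u < y then U u else 0)"
    proof -
      have "conv U (\<lambda>y. if 0 < y then 1 else 0) y = (LBINT z. (\<lambda>u. if u < y then U u else 0) (y - z))"
        unfolding conv_def by (intro bint_cong) auto
      also have "\<dots> = (LBINT u. if u < y then U u else 0)" by (rule integral_sub)
      finally show ?thesis .
    qed
    ultimately show ?thesis using y by (simp add: P_cut_def wh_plus_def wh_one_def algebra_simps)
  qed
  have HQ: "Q_rev \<alpha> (hankel v (\<lambda>_. 1)) y = (LBINT z. if \<alpha> < z then U (z - y) else 0)"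
    if U: "integrable lborel U" and v: "\<And>\<xi>. v \<xi> = c + fourier U \<xi>" and y: "0 < y" "y < \<alpha>" for U c v y
  proof -
    have "hankel v (\<lambda>_. 1) (\<alpha> - y) = (LBINT z. U (\<alpha> - y + z) * (if 0 < z then 1 else 0))"
      by (subst hankel_eq[OF U v]) simp_all
    also have "\<dots> = (LBINT z. (\<lambda>z. if \<alpha> < z then U (z - y) else 0) (z + \<alpha>))"
      by (intro bint_cong) (auto simp: algebra_simps)
    also have "\<dots> = (LBINT z. if \<alpha> < z then U (z - y) else 0)" by (rule integral_shift)
    finally show ?thesis using y by (simp add: Q_rev_def)
  qed
  have Ph: "1 / t * Q_rev \<alpha> (hankel (flip_arg um) (\<lambda>_. 1)) x + P_cut \<alpha> (wh_plus t up (\<lambda>_. 1)) x = phi \<alpha> x / t"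
    unfolding V[OF int(2) up x] HQ[OF iUmr fum x] phi_inside[OF x(2)] by (simp add: add_divide_distrib cong: if_cong)
  have Ps: "1 / t * Q_rev \<alpha> (hankel up (\<lambda>_. 1)) y + P_cut \<alpha> (wh_plus t (flip_arg um) (\<lambda>_. 1)) y = psi \<alpha> y / t"
    if "0 < y" "y < \<alpha>" for y
    unfolding V[OF iUmr fum that] HQ[OF int(2) up that] psi_def Up_cut_def by (simp add: add_divide_distrib)
  \<comment> \<open>Cutting \<open>psi\<close> to the interval makes it bounded, so that the pairing
    can be taken over the whole line.\<close>
  define psc where "psc y = (if 0 < y \<and> y < \<alpha> then psi \<alpha> y else 0)" for y
  have T3: "tensor \<alpha>
            (\<lambda>y. 1 / t * Q_rev \<alpha> (hankel (flip_arg um) (\<lambda>_. 1)) y + P_cut \<alpha> (wh_plus t up (\<lambda>_. 1)) y)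
            (\<lambda>y. 1 / t * Q_rev \<alpha> (hankel up (\<lambda>_. 1)) y + P_cut \<alpha> (wh_plus t (flip_arg um) (\<lambda>_. 1)) y)
            f x = phi \<alpha> x * (LBINT y. psc y * g y) / s"
  proof -
    have "(LBINT y:{0<..<\<alpha>}. (1 / t * Q_rev \<alpha> (hankel up (\<lambda>_. 1)) y + P_cut \<alpha> (wh_plus t (flip_arg um) (\<lambda>_. 1)) y) * f y)
      = (LBINT y. psc y * g y / t)"
      unfolding set_lebesgue_integral_def
    proof (intro bint_cong refl)
      fix y
      show "indicator {0<..<\<alpha>} y *\<^sub>R ((1 / t * Q_rev \<alpha> (hankel up (\<lambda>_. 1)) y + P_cut \<alpha> (wh_plus t (flip_arg um) (\<lambda>_. 1)) y) * f y) = psc y * g y / t"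
      proof (cases "0 < y \<and> y < \<alpha>")
        case True
        then show ?thesis using Ps[of y] by (simp add: psc_def g_def P_cut_def)
      next
        case False then show ?thesis by (auto simp: psc_def indicator_def)
      qed
    qed
    then show ?thesis unfolding tensor_def Ph t by (simp add: power2_eq_square)
  qed
  have psm: "psc \<in> borel_measurable borel"
  proof -
    have [measurable]: "(\<lambda>y. LBINT z. Up_cut \<alpha> y z) \<in> borel_measurable borel" unfolding Up_cut_def by measurable
    show ?thesis unfolding psc_def[abs_def] psi_def by measurable
  qed
  have psb: "cmod (psc y) \<le> cmod cm + \<alpha> + 2 * tail_const" for y
    using psi_bound[of y \<alpha>] tail_const_nonneg \<alpha>0 by (auto simp: psc_def)
  have ips: "integrable lborel (\<lambda>y. psc y * g y)" by (rule integrable_bounded_mult(1)[OF gi psm psb])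
  have ik1: "integrable lborel (\<lambda>y. (cp * M_kernel \<alpha> x y + cm * P_kernel \<alpha> x y + kernel_comp (P_kernel \<alpha>) (M_kernel \<alpha>) x y) * g y)"
    using kernel_op_integrand_integrable[OF M_kernel_bounded_kernel gi] kernel_op_integrand_integrable[OF P_kernel_bounded_kernel gi]
      kernel_op_integrand_integrable[OF kernel_comp_bounded_kernel[OF P_kernel_bounded_kernel M_kernel_bounded_kernel \<alpha>0] gi]
    by (simp add: distrib_right mult.assoc)
  have "(LBINT y. s * (R_kernel \<alpha> x y * g y)) = (LBINT y. (cp * M_kernel \<alpha> x y + cm * P_kernel \<alpha> x y + kernel_comp (P_kernel \<alpha>) (M_kernel \<alpha>) x y) * g y
      - conv Um (Up_cut \<alpha> y) x * g y - phi \<alpha> x / B_coeff \<alpha> * (psc y * g y))"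
  proof (intro bint_cong refl)
    fix y
    show "s * (R_kernel \<alpha> x y * g y) = (cp * M_kernel \<alpha> x y + cm * P_kernel \<alpha> x y + kernel_comp (P_kernel \<alpha>) (M_kernel \<alpha>) x y) * g y
      - conv Um (Up_cut \<alpha> y) x * g y - phi \<alpha> x / B_coeff \<alpha> * (psc y * g y)"
    proof (cases "y \<in> {0<..<\<alpha>}")
      case True
      have "Up_cut \<alpha> y x = 0" "m_cut y x = m (x - y)" using x by (auto simp: Up_cut_def m_cut_def)
      then have colE: "col \<alpha> x y = cp * M_kernel \<alpha> x y + cm * P_kernel \<alpha> x y + kernel_comp (P_kernel \<alpha>) (M_kernel \<alpha>) x y - conv Um (Up_cut \<alpha> y) x - phi \<alpha> x / B_coeff \<alpha> * psc y"
        using True x kernel_comp_P_kernel_M_kernel[of x \<alpha> y] conv_m_Up_cut[of x \<alpha> y]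
        unfolding col_def by (simp add: M_kernel_def P_kernel_def psc_def algebra_simps)
      have "s * (R_kernel \<alpha> x y * g y) = col \<alpha> x y * g y" using True x s by (simp add: R_kernel_def)
      then show ?thesis unfolding colE by (simp add: algebra_simps)
    next
      case False then show ?thesis using g0[of y] by simp
    qed
  qed
  also have "\<dots> = (LBINT y. (cp * M_kernel \<alpha> x y + cm * P_kernel \<alpha> x y + kernel_comp (P_kernel \<alpha>) (M_kernel \<alpha>) x y) * g y)
      - (LBINT y. conv Um (Up_cut \<alpha> y) x * g y) - phi \<alpha> x / B_coeff \<alpha> * (LBINT y. psc y * g y)"
    using ik1 icq ips by simp
  finally have R: "s * (LBINT y. R_kernel \<alpha> x y * g y) = \<dots>" by simp
  have "s * kernel_op (cp * cm / s) (R_kernel \<alpha>) g x = cp * cm * g x + s * (LBINT y. R_kernel \<alpha> x y * g y)"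
    unfolding kernel_op_def using s by (simp add: algebra_simps)
  then have "kernel_op (cp * cm / s) (R_kernel \<alpha>) g x = (cp * cm * g x + s * (LBINT y. R_kernel \<alpha> x y * g y)) / s"
    using s by (simp add: field_simps)
  then have fin: "kernel_op (cp * cm / s) (R_kernel \<alpha>) g x = (cp * cm * g x
      + ((LBINT y. (cp * M_kernel \<alpha> x y + cm * P_kernel \<alpha> x y + kernel_comp (P_kernel \<alpha>) (M_kernel \<alpha>) x y) * g y)
      - (LBINT y. conv Um (Up_cut \<alpha> y) x * g y) - phi \<alpha> x / B_coeff \<alpha> * (LBINT y. psc y * g y))) / s"
    unfolding R .
  have tt: "t * t = s" using t by (simp add: power2_eq_square)
  have alg: "(A + I1) / s - 1 / s * I2 - inverse b * (h * I3 / s) = (A + (I1 - I2 - h / b * I3)) / s" for A I1 I2 I3 h b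
    by (simp add: divide_inverse algebra_simps)
  show ?thesis unfolding T1 T2 T3 tt unfolding g_def[symmetric] fin by (rule alg)
qed

end

section \<open>The main theorem\<close>

lemma closure_upper: "closure {z. Im z > 0} = {z. Im z \<ge> 0}"
  using closure_halfspace_gt[of \<i> 0] by (simp add: inner_i)

lemma closure_lower: "closure {z. Im z < 0} = {z. Im z \<le> 0}"
  using closure_halfspace_lt[of \<i> 0] by (simp add: inner_i)

text \<open>The order estimate is only asymptotic; on the remaining compact interval continuity up
  to the real axis supplies the bound.\<close>

lemma wh_factor_bounded:
  assumes H: "range complex_of_real \<subseteq> closure H" and T: "wh_factor H T"
  obtains K where "\<And>x::real. cmod (of_real x * T (of_real x)) \<le> K"
proof -
  have c: "continuous_on (closure H) T" using T by (simp add: wh_factor_def)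
  have "(\<lambda>\<xi>::real. T (of_real \<xi>)) \<in> O[at_infinity](\<lambda>\<xi>. 1 / of_real \<xi>)"
    using T by (auto simp: wh_factor_def bigtheta_def)
  then obtain d where d: "\<forall>\<^sub>F x::real in at_infinity. cmod (T (of_real x)) \<le> d * cmod (1 / of_real x)"
    by (elim landau_o.bigE)
  then obtain b where b: "\<And>x::real. b \<le> norm x \<Longrightarrow> cmod (T (of_real x)) \<le> d * cmod (1 / of_real x)"
    by (auto simp: eventually_at_infinity)
  have "continuous_on {- \<bar>b\<bar>..\<bar>b\<bar>} (\<lambda>x::real. of_real x * T (of_real x))"
    by (intro continuous_intros continuous_on_compose2[OF c]) (use H in auto)
  then have "compact ((\<lambda>x::real. of_real x * T (of_real x)) ` {- \<bar>b\<bar>..\<bar>b\<bar>})"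
    by (rule compact_continuous_image) auto
  then obtain K1 where K1: "\<And>x. x \<in> {- \<bar>b\<bar>..\<bar>b\<bar>} \<Longrightarrow> cmod (of_real x * T (of_real x)) \<le> K1"
    using compact_imp_bounded bounded_iff by (metis (no_types, lifting) imageI)
  have "cmod (of_real x * T (of_real x)) \<le> max K1 \<bar>d\<bar>" for x :: real
  proof (cases "x \<in> {- \<bar>b\<bar>..\<bar>b\<bar>}")
    case True then show ?thesis using K1[OF True] by simp
  next
    case False
    then have "b \<le> norm x" "x \<noteq> 0" by auto
    then have "\<bar>x\<bar> * cmod (T (of_real x)) \<le> \<bar>x\<bar> * (d * (1 / \<bar>x\<bar>))"
      using b[of x] by (intro mult_left_mono) (auto simp: norm_divide)
    then show ?thesis using \<open>x \<noteq> 0\<close> by (simp add: norm_mult)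
  qed
  then show thesis by (rule that)
qed

text \<open>Caratheodory's form of differentiability: the factor \<open>r\<close> is the difference
  quotient, so its continuity at 0 is enough.\<close>

lemma has_vector_derivative_quotient:
  fixes f r :: "real \<Rightarrow> complex"
  assumes f: "\<And>x. f x = f 0 + of_real x * r x" and r: "isCont r 0"
  shows "(f has_vector_derivative r 0) (at 0)"
  unfolding has_vector_derivative_def has_derivative_iff_norm
proof
  show "bounded_linear (\<lambda>x. x *\<^sub>R r 0)" by (rule bounded_linear_scaleR_left)
  have "((\<lambda>y. cmod (r y - r 0)) \<longlongrightarrow> cmod (r 0 - r 0)) (at 0)"
    using r unfolding isCont_def by (intro tendsto_intros)
  then have "((\<lambda>y. cmod (r y - r 0)) \<longlongrightarrow> 0) (at 0)" by simp
  moreover have "\<forall>\<^sub>F y in at 0. cmod (r y - r 0) = norm (f y - f 0 - (y - 0) *\<^sub>R r 0) / norm (y - 0)"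
    unfolding eventually_at_filter
  proof (intro always_eventually allI impI)
    fix y :: real assume "y \<noteq> 0"
    have "f y - f 0 - (y - 0) *\<^sub>R r 0 = of_real y * (r y - r 0)"
      using f[of y] by (simp add: scaleR_conv_of_real algebra_simps)
    then show "cmod (r y - r 0) = norm (f y - f 0 - (y - 0) *\<^sub>R r 0) / norm (y - 0)"
      using \<open>y \<noteq> 0\<close> by (simp add: norm_mult)
  qed
  ultimately show "((\<lambda>y. norm (f y - f 0 - (y - 0) *\<^sub>R r 0) / norm (y - 0)) \<longlongrightarrow> 0) (at 0)"
    by (rule Lim_transform_eventually)
qed

text \<open>By \<open>T\<close> the quotient of the factors is \<open>- (1 + \<i> * \<xi> * um
  \<xi>) / (1 - \<i> * \<xi> * up \<xi>)\<close>, whose derivative at 0 can be read off. Multiplied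
  by \<open>\<i>\<close> it is u_+(0) + u_-(0), the constant part of \<open>B_coeff\<close>.\<close>

lemma sigma_quotient_derivative:
  assumes T: "\<And>\<xi>::real. \<tau>p (of_real \<xi>) * (1 - \<i> * of_real \<xi> * up \<xi>) = t" "\<And>\<xi>::real. \<tau>m (of_real \<xi>) * (1 + \<i> * of_real \<xi> * um \<xi>) = t"
    and t: "t \<noteq> 0" and c: "isCont up 0" "isCont um 0"
  shows "vector_derivative (sigma_quotient \<tau>p \<tau>m) (at 0) = - \<i> * (um 0 + up 0)"
proof -
  define r where "r \<xi> = - \<i> * (um \<xi> + up \<xi>) / (1 - \<i> * of_real \<xi> * up \<xi>)" for \<xi> :: real
  have "sigma_quotient \<tau>p \<tau>m \<xi> = -1 + of_real \<xi> * r \<xi>" for \<xi>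
  proof -
    define u v where "u = 1 - \<i> * of_real \<xi> * up \<xi>" and "v = 1 + \<i> * of_real \<xi> * um \<xi>"
    have nz: "u \<noteq> 0" "v \<noteq> 0" using T[of \<xi>] t by (auto simp: u_def v_def)
    have "\<tau>p (of_real \<xi>) = t / u" "\<tau>m (of_real \<xi>) = t / v" using T[of \<xi>] nz by (auto simp: u_def v_def field_simps)
    then have "sigma_quotient \<tau>p \<tau>m \<xi> = - v / u" using t nz by (simp add: sigma_quotient_def)
    also have "\<dots> = -1 + (u - v) / u" using nz by (simp add: field_simps)
    also have "u - v = of_real \<xi> * (- \<i> * (um \<xi> + up \<xi>))" by (simp add: u_def v_def algebra_simps)
    finally show ?thesis by (simp add: r_def u_def)
  qed
  moreover from this[of 0] have "sigma_quotient \<tau>p \<tau>m 0 = -1" by simp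
  ultimately have "sigma_quotient \<tau>p \<tau>m \<xi> = sigma_quotient \<tau>p \<tau>m 0 + of_real \<xi> * r \<xi>" for \<xi> by simp
  moreover have "isCont r 0" unfolding r_def using c by (intro continuous_intros) auto
  ultimately have "(sigma_quotient \<tau>p \<tau>m has_vector_derivative r 0) (at 0)" by (rule has_vector_derivative_quotient)
  then show ?thesis by (simp add: vector_derivative_at r_def)
qed

text \<open>\<open>2 * b\<close> is the rate of the error kernel and \<open>b\<close> the rate that
  survives; the spare factor absorbs the powers of \<alpha>. The first estimate is the smallness
  condition of the Neumann series, the second the size of the resulting correction.\<close>

lemma exp_decay_eventually:
  fixes c D b :: real
  assumes b: "b > 0"
  shows "\<forall>\<^sub>F \<alpha> in at_top. D * exp (- (2 * b) * \<alpha>) * \<alpha> \<le> 1 / 2"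
    "\<forall>\<^sub>F \<alpha> in at_top. (c + D * \<alpha> * \<alpha>) * (2 * (D * exp (- (2 * b) * \<alpha>))) \<le> exp (- b * \<alpha>)"
proof -
  have 1: "((\<lambda>\<alpha>. exp (- (2 * b) * \<alpha>) * \<alpha>) \<longlongrightarrow> 0) at_top" using b by real_asymp
  have 2: "((\<lambda>\<alpha>. exp (- b * \<alpha>)) \<longlongrightarrow> 0) at_top" using b by real_asymp
  have 3: "((\<lambda>\<alpha>. \<alpha> * \<alpha> * exp (- b * \<alpha>)) \<longlongrightarrow> 0) at_top" using b by real_asymp
  have "((\<lambda>\<alpha>. D * (exp (- (2 * b) * \<alpha>) * \<alpha>)) \<longlongrightarrow> D * 0) at_top" by (intro tendsto_intros 1)
  then have "\<forall>\<^sub>F \<alpha> in at_top. D * (exp (- (2 * b) * \<alpha>) * \<alpha>) < 1 / 2" by (rule order_tendstoD) simp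
  then show "\<forall>\<^sub>F \<alpha> in at_top. D * exp (- (2 * b) * \<alpha>) * \<alpha> \<le> 1 / 2"
    by eventually_elim (simp add: mult.assoc)
  have "((\<lambda>\<alpha>. 2 * c * D * exp (- b * \<alpha>) + 2 * D * D * (\<alpha> * \<alpha> * exp (- b * \<alpha>))) \<longlongrightarrow> 2 * c * D * 0 + 2 * D * D * 0) at_top"
    by (intro tendsto_intros 2 3)
  then have "\<forall>\<^sub>F \<alpha> in at_top. 2 * c * D * exp (- b * \<alpha>) + 2 * D * D * (\<alpha> * \<alpha> * exp (- b * \<alpha>)) < 1"
    by (rule order_tendstoD) simp
  then show "\<forall>\<^sub>F \<alpha> in at_top. (c + D * \<alpha> * \<alpha>) * (2 * (D * exp (- (2 * b) * \<alpha>))) \<le> exp (- b * \<alpha>)"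
  proof eventually_elim
    case (elim \<alpha>)
    have e: "exp (- (2 * b) * \<alpha>) = exp (- b * \<alpha>) * exp (- b * \<alpha>)" by (simp add: exp_add[symmetric])
    have "(c + D * \<alpha> * \<alpha>) * (2 * (D * exp (- (2 * b) * \<alpha>)))
       = (2 * c * D * exp (- b * \<alpha>) + 2 * D * D * (\<alpha> * \<alpha> * exp (- b * \<alpha>))) * exp (- b * \<alpha>)"
      unfolding e by (simp add: algebra_simps)
    also have "\<dots> \<le> 1 * exp (- b * \<alpha>)" using elim by (intro mult_right_mono) auto
    finally show ?case by simp
  qed
qed

section \<open>Invertibility for large \<alpha>\<close>

context wh_time
begin

lemma a_inverse: "a * (cp * cm / s) = 1"
  using s by (simp add: mult.assoc[symmetric])

lemma right_inverse_eventually: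
  "\<forall>\<^sub>F \<alpha> in at_top. \<exists>N. bounded_kernel \<alpha> (exp (- (\<eta>/4) * \<alpha>)) N \<and> (\<exists>b. bounded_kernel \<alpha> b (\<lambda>x y. R_kernel \<alpha> x y + N x y)) \<and>
     (\<forall>f. cutL2 \<alpha> f \<longrightarrow> (AE x in lborel. kernel_op a (W_kernel \<alpha>) (kernel_op (cp * cm / s) (\<lambda>x y. R_kernel \<alpha> x y + N x y) f) x = f x))"
proof -
  obtain D A where D0: "0 \<le> D" and DA: "\<And>\<alpha>. A \<le> \<alpha> \<Longrightarrow> 0 < \<alpha> \<and> bounded_kernel \<alpha> (D * \<alpha>) (R_kernel \<alpha>) \<and> bounded_kernel \<alpha> (D * exp (- (\<eta>/2) * \<alpha>)) (E_kernel \<alpha>) \<and>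
     (\<forall>y. y \<in> {0<..<\<alpha>} \<longrightarrow> (AE x in lborel. x \<in> {0<..<\<alpha>} \<longrightarrow>
        a * R_kernel \<alpha> x y + cp * cm / s * W_kernel \<alpha> x y + kernel_comp (W_kernel \<alpha>) (R_kernel \<alpha>) x y = E_kernel \<alpha> x y))"
    using parametrix by blast
  \<comment> \<open>The error kernel decays at rate \<open>\<eta>/2\<close>; half of this pays for
    the powers of \<alpha>.\<close>
  have "\<eta>/4 > 0" using eta by simp
  note ev = exp_decay_eventually(1)[OF this, of D] exp_decay_eventually(2)[OF this, of "cmod (cp * cm / s)" D]
  show ?thesis using ev eventually_ge_at_top[of A]
  proof eventually_elim
    case (elim \<alpha>)
    have \<alpha>0: "0 < \<alpha>" and R: "bounded_kernel \<alpha> (D * \<alpha>) (R_kernel \<alpha>)" and E: "bounded_kernel \<alpha> (D * exp (- (\<eta>/2) * \<alpha>)) (E_kernel \<alpha>)"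
      and id: "\<And>y. y \<in> {0<..<\<alpha>} \<Longrightarrow> AE x in lborel. x \<in> {0<..<\<alpha>} \<longrightarrow>
        a * R_kernel \<alpha> x y + cp * cm / s * W_kernel \<alpha> x y + kernel_comp (W_kernel \<alpha>) (R_kernel \<alpha>) x y = E_kernel \<alpha> x y"
      using DA[OF elim(3)] by blast+
    have small: "D * exp (- (\<eta>/2) * \<alpha>) * \<alpha> \<le> 1 / 2" using elim(1) by (simp add: mult_ac)
    obtain N where N: "bounded_kernel \<alpha> ((cmod (cp * cm / s) + D * \<alpha> * \<alpha>) * (2 * (D * exp (- (\<eta>/2) * \<alpha>)))) N"
      "\<And>f. cutL2 \<alpha> f \<Longrightarrow> AE x in lborel. kernel_op a (W_kernel \<alpha>) (kernel_op (cp * cm / s) (\<lambda>x y. R_kernel \<alpha> x y + N x y) f) x = f x"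
      using right_inverse_kernel[OF W_kernel_bounded_kernel R E \<alpha>0 small a_inverse id] by blast
    have "bounded_kernel \<alpha> (exp (- (\<eta>/4) * \<alpha>)) N"
      using N(1) elim(2) unfolding bounded_kernel_def by (auto simp: mult_ac intro: order_trans)
    moreover have "bounded_kernel \<alpha> (cmod 1 * (D * \<alpha>) + cmod 1 * ((cmod (cp * cm / s) + D * \<alpha> * \<alpha>) * (2 * (D * exp (- (\<eta>/2) * \<alpha>))))) (\<lambda>x y. R_kernel \<alpha> x y + N x y)"
      using bounded_kernel_lincomb[OF R N(1), of 1 1] by simp
    ultimately show ?case using N(2) by blast
  qed
qed

lemma inverse_eventually:
  "\<forall>\<^sub>F \<alpha> in at_top. \<exists>N. 0 < \<alpha> \<and> bounded_kernel \<alpha> (exp (- (\<eta>/4) * \<alpha>)) N \<and> (\<exists>b. bounded_kernel \<alpha> b (\<lambda>x y. R_kernel \<alpha> x y + N x y)) \<and>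
     (\<forall>f. cutL2 \<alpha> f \<longrightarrow> (AE x in lborel. kernel_op a (W_kernel \<alpha>) (kernel_op (cp * cm / s) (\<lambda>x y. R_kernel \<alpha> x y + N x y) f) x = f x)) \<and>
     (\<forall>f. cutL2 \<alpha> f \<longrightarrow> (AE x in lborel. kernel_op (cp * cm / s) (\<lambda>x y. R_kernel \<alpha> x y + N x y) (kernel_op a (W_kernel \<alpha>) f) x = f x))"
proof -
  interpret F: wh_time a cm cp s "\<lambda>x. k (- x)" "\<lambda>x. Um (- x)" "\<lambda>x. Up (- x)" C \<eta> by (rule reflected)
  \<comment> \<open>Changing the sign of \<open>x - y\<close> amounts to exchanging the variables,
    so the interpretation \<open>F\<close> speaks about the transposed kernel, as
    \<open>two_sided_inverse\<close> requires.\<close>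
  have flip: "F.W_kernel \<alpha> = (\<lambda>x y. W_kernel \<alpha> y x)" for \<alpha> by (auto simp: fun_eq_iff F.W_kernel_def W_kernel_def)
  show ?thesis using right_inverse_eventually F.right_inverse_eventually[unfolded flip] eventually_gt_at_top[of 0]
  proof eventually_elim
    case (elim \<alpha>)
    then obtain N b where N: "bounded_kernel \<alpha> (exp (- (\<eta>/4) * \<alpha>)) N" "bounded_kernel \<alpha> b (\<lambda>x y. R_kernel \<alpha> x y + N x y)"
      "\<And>f. cutL2 \<alpha> f \<Longrightarrow> AE x in lborel. kernel_op a (W_kernel \<alpha>) (kernel_op (cp * cm / s) (\<lambda>x y. R_kernel \<alpha> x y + N x y) f) x = f x"
      by blast
    from elim obtain N' b' where N': "bounded_kernel \<alpha> b' (\<lambda>x y. F.R_kernel \<alpha> x y + N' x y)"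
      "\<And>f. cutL2 \<alpha> f \<Longrightarrow> AE x in lborel. kernel_op a (\<lambda>x y. W_kernel \<alpha> y x) (kernel_op (cm * cp / s) (\<lambda>x y. F.R_kernel \<alpha> x y + N' x y) f) x = f x"
      by blast
    have "AE x in lborel. kernel_op (cp * cm / s) (\<lambda>x y. R_kernel \<alpha> x y + N x y) (kernel_op a (W_kernel \<alpha>) f) x = f x" if "cutL2 \<alpha> f" for f
      by (rule two_sided_inverse[OF W_kernel_bounded_kernel elim(3) N(2) N'(1) N(3) N'(2) that])
    with N elim(3) show ?case by blast
  qed
qed

end

theorem theorem2:
  fixes a :: complex and k \<sigma> \<tau> up um :: "real \<Rightarrow> complex" and \<delta> :: real
    and \<tau>p \<tau>m :: "complex \<Rightarrow> complex" and B :: "real \<Rightarrow> complex"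
  assumes "\<delta> > 0" and "integrable lborel (\<lambda>x. of_real (exp (\<delta> * \<bar>x\<bar>)) * k x)"
    and "\<And>\<xi>. \<sigma> \<xi> = a + fourier k \<xi>"
    and "\<And>\<xi>. \<sigma> \<xi> = of_real (\<xi>\<^sup>2) * \<tau> \<xi>"
    and "\<And>\<xi>. \<tau> \<xi> \<noteq> 0"
    and "has_total_arg_change \<tau> 0"
    and "\<And>\<xi>. \<tau> \<xi> = \<tau>m (of_real \<xi>) * \<tau>p (of_real \<xi>)"
    and "wh_factor {z. Im z > 0} \<tau>p" and "wh_factor {z. Im z < 0} \<tau>m"
    and "\<tau>m 0 = \<tau>p 0"
    and "\<And>\<xi>. \<xi> \<noteq> 0 \<Longrightarrow> \<tau>m 0 / sigma_minus \<tau>m \<xi> = 1 / (\<i> * of_real \<xi>) + um \<xi>"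
    and "\<And>\<xi>. \<xi> \<noteq> 0 \<Longrightarrow> \<tau>p 0 / sigma_plus \<tau>p \<xi> = 1 / (- \<i> * of_real \<xi>) + up \<xi>"
    and "const_plus_exp_decaying_on {..0} um"
    and "const_plus_exp_decaying_on {0..} up"
    and "\<And>\<alpha>. B \<alpha> = of_real \<alpha> + \<i> * vector_derivative (sigma_quotient \<tau>p \<tau>m) (at 0)"
  shows "\<exists>R. (\<forall>\<^sub>F \<alpha> in at_top. L2_inverse \<alpha> (wh_trunc \<alpha> \<sigma>) (R \<alpha>)) \<and>
    exp_equiv R (\<lambda>\<alpha> f x.
        P_cut \<alpha> (wh_plus (\<tau>p 0) up (wh_minus (\<tau>m 0) um (P_cut \<alpha> f))) x
      - 1 / (\<tau>m 0 * \<tau>p 0) * Q_rev \<alpha> (hankel (flip_arg um) (hankel up (Q_rev \<alpha> f))) x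
      - inverse (B \<alpha>) *
          tensor \<alpha>
            (\<lambda>y. 1 / \<tau>m 0 * Q_rev \<alpha> (hankel (flip_arg um) (\<lambda>_. 1)) y
                 + P_cut \<alpha> (wh_plus (\<tau>p 0) up (\<lambda>_. 1)) y)
            (\<lambda>y. 1 / \<tau>p 0 * Q_rev \<alpha> (hankel up (\<lambda>_. 1)) y
                 + P_cut \<alpha> (wh_plus (\<tau>m 0) (flip_arg um) (\<lambda>_. 1)) y)
            f x)"
proof -
  define t where "t = \<tau>p 0"
  have tm: "\<tau>m 0 = t" using assms(10) by (simp add: t_def)
  have Tp: "continuous_on {z. Im z \<ge> 0} \<tau>p" "\<tau>p holomorphic_on {z. Im z > 0}" "\<And>z. Im z \<ge> 0 \<Longrightarrow> \<tau>p z \<noteq> 0"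
    using assms(8) unfolding wh_factor_def closure_upper by auto
  have Tm: "continuous_on {z. Im z \<le> 0} \<tau>m" "\<tau>m holomorphic_on {z. Im z < 0}" "\<And>z. Im z \<le> 0 \<Longrightarrow> \<tau>m z \<noteq> 0"
    using assms(9) unfolding wh_factor_def closure_lower by auto
  have t0: "t \<noteq> 0" using Tp(3)[of 0] by (simp add: t_def)
  have kL: "weighted_L1 \<delta> k"
    unfolding weighted_L1_def
  proof
    have [measurable]: "(\<lambda>x. of_real (exp (\<delta> * \<bar>x\<bar>)) * k x) \<in> borel_measurable borel"
      using borel_measurable_integrable[OF assms(2)] by simp
    have "(\<lambda>x. of_real (exp (- (\<delta> * \<bar>x\<bar>))) * (of_real (exp (\<delta> * \<bar>x\<bar>)) * k x)) \<in> borel_measurable borel" by measurable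
    moreover have "of_real (exp (- (\<delta> * \<bar>x\<bar>))) * (of_real (exp (\<delta> * \<bar>x\<bar>)) * k x) = k x" for x
      by (simp add: mult.assoc[symmetric] exp_add[symmetric] del: of_real_exp flip: of_real_mult)
    ultimately show "k \<in> borel_measurable borel" by simp
    show "integrable lborel (\<lambda>x. exp (\<delta> * \<bar>x\<bar>) * cmod (k x))"
      using integrable_norm[OF assms(2)] by (simp add: norm_mult del: of_real_exp)
  qed
  obtain cm Um C1 \<eta>1 where Um: "Um \<in> borel_measurable borel" "\<eta>1 > 0" "\<And>x. cmod (Um x) \<le> C1 * exp (- \<eta>1 * \<bar>x\<bar>)"
      "\<And>x. x \<notin> {..0} \<Longrightarrow> Um x = 0" and um: "\<And>\<xi>. um \<xi> = cm + fourier Um \<xi>"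
    using assms(13) unfolding const_plus_exp_decaying_on_def exp_decaying_def by blast
  obtain cp Up C2 \<eta>2 where Up: "Up \<in> borel_measurable borel" "\<eta>2 > 0" "\<And>x. cmod (Up x) \<le> C2 * exp (- \<eta>2 * \<bar>x\<bar>)"
      "\<And>x. x \<notin> {0..} \<Longrightarrow> Up x = 0" and up: "\<And>\<xi>. up \<xi> = cp + fourier Up \<xi>"
    using assms(14) unfolding const_plus_exp_decaying_on_def exp_decaying_def by blast
  \<comment> \<open>A single rate for all decaying data; it must not exceed \<delta> so that the
    weight on \<open>k\<close> covers it.\<close>
  define \<eta> where "\<eta> = Min {\<eta>1, \<eta>2, \<delta>}"
  define C where "C = max C1 C2"
  have eta: "0 < \<eta>" "\<eta> \<le> \<eta>1" "\<eta> \<le> \<eta>2" "\<eta> \<le> \<delta>" using Um(2) Up(2) assms(1) by (auto simp: \<eta>_def)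
  have "exp_bounded C1 \<eta>1 Um" "exp_bounded C2 \<eta>2 Up" using Um Up unfolding exp_bounded_def by auto
  then have eUm: "exp_bounded C \<eta> Um" and eUp: "exp_bounded C \<eta> Up"
    using exp_bounded_mono[of C1 \<eta>1 Um C \<eta>] exp_bounded_mono[of C2 \<eta>2 Up C \<eta>] eta by (auto simp: C_def)
  have iUm: "integrable lborel Um" and iUp: "integrable lborel Up"
    using exp_bounded_integrable[OF eUm eta(1)] exp_bounded_integrable[OF eUp eta(1)] .
  obtain K1 where K1: "\<And>x::real. cmod (of_real x * \<tau>p (of_real x)) \<le> K1"
  proof (rule wh_factor_bounded[OF _ assms(8)])
    show "range complex_of_real \<subseteq> closure {z. Im z > 0}" unfolding closure_upper by auto
  qed blast
  obtain K2 where K2: "\<And>x::real. cmod (of_real x * \<tau>m (of_real x)) \<le> K2"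
  proof (rule wh_factor_bounded[OF _ assms(9)])
    show "range complex_of_real \<subseteq> closure {z. Im z < 0}" unfolding closure_lower by auto
  qed blast
  \<comment> \<open>At 0 this is the normalisation by \<open>t\<close>; elsewhere it is the defining
    relation of \<open>up\<close> cleared of denominators.\<close>
  have eqp: "\<tau>p (of_real \<xi>) * (1 - \<i> * of_real \<xi> * up \<xi>) = t" for \<xi> :: real
  proof (cases "\<xi> = 0")
    case True then show ?thesis by (simp add: t_def)
  next
    case False
    have nz: "\<tau>p (of_real \<xi>) \<noteq> 0" by (rule Tp(3)) simp
    have u: "up \<xi> = t / (- \<i> * of_real \<xi> * \<tau>p (of_real \<xi>)) - 1 / (- \<i> * of_real \<xi>)"
      using assms(12)[OF False] by (simp add: sigma_plus_def t_def)
    show ?thesis unfolding u using False nz by (simp add: field_simps)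
  qed
  have eqm: "\<tau>m (of_real \<xi>) * (1 + \<i> * of_real \<xi> * um \<xi>) = t" for \<xi> :: real
  proof (cases "\<xi> = 0")
    case True then show ?thesis by (simp add: tm)
  next
    case False
    have nz: "\<tau>m (of_real \<xi>) \<noteq> 0" by (rule Tm(3)) simp
    have u: "um \<xi> = t / (\<i> * of_real \<xi> * \<tau>m (of_real \<xi>)) - 1 / (\<i> * of_real \<xi>)"
      using assms(11)[OF False] by (simp add: sigma_minus_def tm)
    show ?thesis unfolding u using False nz by (simp add: field_simps)
  qed
  have "wh_fourier a cp cm t k Up Um \<tau>p \<tau>m \<delta> \<eta> C (max K1 K2)"
  proof
    show "a + fourier k \<xi> = (of_real \<xi>)\<^sup>2 * (\<tau>m (of_real \<xi>) * \<tau>p (of_real \<xi>))" for \<xi>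
      using assms(3)[of \<xi>] assms(4)[of \<xi>] assms(7)[of \<xi>] by simp
    show "cmod (of_real x * \<tau>p (of_real x)) \<le> max K1 K2" "cmod (of_real x * \<tau>m (of_real x)) \<le> max K1 K2" for x :: real
      using K1[of x] K2[of x] by auto
    show "\<tau>p (of_real \<xi>) * (1 - \<i> * of_real \<xi> * (cp + fourier Up \<xi>)) = t" for \<xi> :: real using eqp[of \<xi>] by (simp only: up)
    show "\<tau>m (of_real \<xi>) * (1 + \<i> * of_real \<xi> * (cm + fourier Um \<xi>)) = t" for \<xi> :: real using eqm[of \<xi>] by (simp only: um)
  qed (use eta kL Tp Tm t0 eUp eUm Up(4) Um(4) in auto)
  from wh_fourier.time_data[OF this] obtain k' C' \<eta>' where k': "AE x in lborel. k' x = k x"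
    and wt: "wh_time a cp cm (t\<^sup>2) k' Up Um C' \<eta>'" by blast
  interpret wh_time a cp cm "t\<^sup>2" k' Up Um C' \<eta>' by (rule wt)
  have km: "k \<in> borel_measurable borel" using kL by (simp add: weighted_L1_def)
  \<comment> \<open>Changing \<open>k\<close> on a null set leaves \<sigma> unchanged, so the
    truncated operator may be computed with the bounded kernel.\<close>
  have sigma: "\<sigma> \<xi> = a + fourier k' \<xi>" for \<xi>
    using assms(3)[of \<xi>] fourier_cong_AE[OF k' meas(1) km, of \<xi>] by simp

  have BB: "B = B_coeff"
  proof
    fix \<alpha>
    have "isCont up 0" "isCont um 0"
      unfolding up[abs_def] um[abs_def]
      using continuous_on_fourier[OF iUp, of UNIV] continuous_on_fourier[OF iUm, of UNIV]
      by (auto simp: continuous_on_eq_continuous_at intro!: continuous_intros)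
    from sigma_quotient_derivative[OF eqp eqm t0 this]
    have "B \<alpha> = of_real \<alpha> + (um 0 + up 0)" by (simp add: assms(15))
    then show "B \<alpha> = B_coeff \<alpha>" by (simp add: B_coeff_def up um fourier_0)
  qed

  have W: "wh_trunc \<alpha> \<sigma> f = kernel_op a (W_kernel \<alpha>) (P_cut \<alpha> f)" if "f \<in> L2 \<alpha>" for \<alpha> f
  proof
    fix x
    define g where "g = P_cut \<alpha> f"
    have gm: "g \<in> borel_measurable borel" using that by (simp add: L2_iff_cutL2 cutL2_def g_def)
    have g0: "g y = 0" if "y \<notin> {0<..<\<alpha>}" for y using that by (auto simp: g_def P_cut_def)
    have gpos: "(\<lambda>y. if 0 < y then g y else 0) = g" using g0 by (auto simp: fun_eq_iff)
    show "wh_trunc \<alpha> \<sigma> f x = kernel_op a (W_kernel \<alpha>) (P_cut \<alpha> f) x"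
    proof (cases "x \<in> {0<..<\<alpha>}")
      case True
      have "wiener_hopf \<sigma> g x = a * g x + conv k' g x"
        using wiener_hopf_eq[OF int(1) sigma, of g x] gm by (simp add: gpos)
      also have "conv k' g x = (LBINT y. W_kernel \<alpha> x y * g y)"
        unfolding conv_def using True g0 by (intro bint_cong) (auto simp: W_kernel_def)
      finally have "wiener_hopf \<sigma> g x = a * g x + (LBINT y. W_kernel \<alpha> x y * g y)" .
      moreover have "P_cut \<alpha> (wiener_hopf \<sigma> g) x = wiener_hopf \<sigma> g x" using True by (simp add: P_cut_def)
      ultimately show ?thesis unfolding wh_trunc_def kernel_op_def g_def[symmetric] by simp
    next
      case False
      have "(\<lambda>y. W_kernel \<alpha> x y * g y) = (\<lambda>y. 0)" using False by (auto simp: W_kernel_def)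
      then show ?thesis using False g0[OF False] unfolding wh_trunc_def kernel_op_def g_def[symmetric]
        by (auto simp: P_cut_def)
    qed
  qed

  define c where "c = cp * cm / t\<^sup>2"
  define good where "good \<alpha> N \<longleftrightarrow> 0 < \<alpha> \<and> bounded_kernel \<alpha> (exp (- (\<eta>'/4) * \<alpha>)) N \<and> (\<exists>b. bounded_kernel \<alpha> b (\<lambda>x y. R_kernel \<alpha> x y + N x y)) \<and>
     (\<forall>f. cutL2 \<alpha> f \<longrightarrow> (AE x in lborel. kernel_op a (W_kernel \<alpha>) (kernel_op c (\<lambda>x y. R_kernel \<alpha> x y + N x y) f) x = f x)) \<and>
     (\<forall>f. cutL2 \<alpha> f \<longrightarrow> (AE x in lborel. kernel_op c (\<lambda>x y. R_kernel \<alpha> x y + N x y) (kernel_op a (W_kernel \<alpha>) f) x = f x))" for \<alpha> N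
  \<comment> \<open>For each large \<alpha> some correction exists. Choosing one yields a single
    family \<open>R\<close>, because both conjuncts of the claim concern the same operators.\<close>
  define N_kernel where "N_kernel \<alpha> = (SOME N. good \<alpha> N)" for \<alpha>
  have good: "\<forall>\<^sub>F \<alpha> in at_top. good \<alpha> (N_kernel \<alpha>)"
    using inverse_eventually
  proof eventually_elim
    case (elim \<alpha>)
    then have "\<exists>N. good \<alpha> N" unfolding good_def c_def .
    then show ?case unfolding N_kernel_def by (rule someI_ex)
  qed
  define R where "R \<alpha> f = kernel_op c (\<lambda>x y. R_kernel \<alpha> x y + N_kernel \<alpha> x y) (P_cut \<alpha> f)" for \<alpha> f
  show ?thesis
  proof (intro exI[of _ R] conjI)
    show "\<forall>\<^sub>F \<alpha> in at_top. L2_inverse \<alpha> (wh_trunc \<alpha> \<sigma>) (R \<alpha>)"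
      using good
    proof eventually_elim
      case (elim \<alpha>)
      then obtain b where "0 < \<alpha>" "bounded_kernel \<alpha> b (\<lambda>x y. R_kernel \<alpha> x y + N_kernel \<alpha> x y)" unfolding good_def by blast
      then show ?case
        using elim by (intro L2_inverse_kernel_op[OF W_kernel_bounded_kernel _ _ W, where c = c]) (auto simp: good_def R_def)
    qed
    show "exp_equiv R (\<lambda>\<alpha> f x.
        P_cut \<alpha> (wh_plus (\<tau>p 0) up (wh_minus (\<tau>m 0) um (P_cut \<alpha> f))) x
      - 1 / (\<tau>m 0 * \<tau>p 0) * Q_rev \<alpha> (hankel (flip_arg um) (hankel up (Q_rev \<alpha> f))) x
      - inverse (B \<alpha>) *
          tensor \<alpha>
            (\<lambda>y. 1 / \<tau>m 0 * Q_rev \<alpha> (hankel (flip_arg um) (\<lambda>_. 1)) y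
                 + P_cut \<alpha> (wh_plus (\<tau>p 0) up (\<lambda>_. 1)) y)
            (\<lambda>y. 1 / \<tau>p 0 * Q_rev \<alpha> (hankel up (\<lambda>_. 1)) y
                 + P_cut \<alpha> (wh_plus (\<tau>m 0) (flip_arg um) (\<lambda>_. 1)) y)
            f x)"
      unfolding exp_equiv_def tm t_def[symmetric] BB
    \<comment> \<open>The two families differ exactly by the kernel \<open>N_kernel\<close>, whose
      bound provides the rate \<open>\<eta>'/4\<close> and the constant 1.\<close>
    proof (rule exI[of _ "\<eta>'/4"], rule conjI, use eta in simp, rule exI[of _ 1])
      show "\<forall>\<^sub>F \<alpha> in at_top. \<exists>K. case_prod K \<in> borel_measurable (lborel \<Otimes>\<^sub>M lborel) \<and>
        (\<forall>x\<in>{0<..<\<alpha>}. \<forall>y\<in>{0<..<\<alpha>}. cmod (K x y) \<le> 1 * exp (- (\<eta>'/4) * \<alpha>)) \<and>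
        (\<forall>f\<in>L2 \<alpha>. L2_eq \<alpha> (\<lambda>x. R \<alpha> f x -
           (P_cut \<alpha> (wh_plus t up (wh_minus t um (P_cut \<alpha> f))) x
            - 1 / (t * t) * Q_rev \<alpha> (hankel (flip_arg um) (hankel up (Q_rev \<alpha> f))) x
            - inverse (B_coeff \<alpha>) *
                tensor \<alpha>
                  (\<lambda>y. 1 / t * Q_rev \<alpha> (hankel (flip_arg um) (\<lambda>_. 1)) y
                       + P_cut \<alpha> (wh_plus t up (\<lambda>_. 1)) y)
                  (\<lambda>y. 1 / t * Q_rev \<alpha> (hankel up (\<lambda>_. 1)) y
                       + P_cut \<alpha> (wh_plus t (flip_arg um) (\<lambda>_. 1)) y)
                  f x))
           (\<lambda>x. LBINT y:{0<..<\<alpha>}. K x y * f y))"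
        using good
      proof eventually_elim
        case (elim \<alpha>)
        then obtain b where N: "bounded_kernel \<alpha> (exp (- (\<eta>'/4) * \<alpha>)) (N_kernel \<alpha>)" and S: "bounded_kernel \<alpha> b (\<lambda>x y. R_kernel \<alpha> x y + N_kernel \<alpha> x y)"
          unfolding good_def by blast
        have "L2_eq \<alpha> (\<lambda>x. R \<alpha> f x -
           (P_cut \<alpha> (wh_plus t up (wh_minus t um (P_cut \<alpha> f))) x
            - 1 / (t * t) * Q_rev \<alpha> (hankel (flip_arg um) (hankel up (Q_rev \<alpha> f))) x
            - inverse (B_coeff \<alpha>) *
                tensor \<alpha>
                  (\<lambda>y. 1 / t * Q_rev \<alpha> (hankel (flip_arg um) (\<lambda>_. 1)) y
                       + P_cut \<alpha> (wh_plus t up (\<lambda>_. 1)) y)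
                  (\<lambda>y. 1 / t * Q_rev \<alpha> (hankel up (\<lambda>_. 1)) y
                       + P_cut \<alpha> (wh_plus t (flip_arg um) (\<lambda>_. 1)) y)
                  f x))
           (\<lambda>x. LBINT y:{0<..<\<alpha>}. N_kernel \<alpha> x y * f y)" if f: "f \<in> L2 \<alpha>" for f
          unfolding L2_eq_def
        proof (intro AE_I2 impI)
          fix x assume "x \<in> {0<..<\<alpha>}"
          then have x: "0 < x" "x < \<alpha>" by auto
          have fc: "cutL1 \<alpha> (P_cut \<alpha> f)" using f by (simp add: L2_iff_cutL2 cutL2_imp_cutL1)
          then have fi: "integrable lborel (P_cut \<alpha> f)" by (simp add: cutL1_def)
          have iN: "integrable lborel (\<lambda>y. N_kernel \<alpha> x y * P_cut \<alpha> f y)" by (rule kernel_op_integrand_integrable[OF N fi])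
          have iS: "integrable lborel (\<lambda>y. (R_kernel \<alpha> x y + N_kernel \<alpha> x y) * P_cut \<alpha> f y)" by (rule kernel_op_integrand_integrable[OF S fi])
          have "(LBINT y. R_kernel \<alpha> x y * P_cut \<alpha> f y) = (LBINT y. (R_kernel \<alpha> x y + N_kernel \<alpha> x y) * P_cut \<alpha> f y - N_kernel \<alpha> x y * P_cut \<alpha> f y)"
            by (simp add: algebra_simps)
          also have "\<dots> = (LBINT y. (R_kernel \<alpha> x y + N_kernel \<alpha> x y) * P_cut \<alpha> f y) - (LBINT y. N_kernel \<alpha> x y * P_cut \<alpha> f y)"
            by (rule bint_diff[OF iS iN])
          finally have "R \<alpha> f x - kernel_op c (R_kernel \<alpha>) (P_cut \<alpha> f) x = (LBINT y:{0<..<\<alpha>}. N_kernel \<alpha> x y * f y)"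
            unfolding R_def kernel_op_def set_integral_P_cut by simp
          then show "R \<alpha> f x -
           (P_cut \<alpha> (wh_plus t up (wh_minus t um (P_cut \<alpha> f))) x
            - 1 / (t * t) * Q_rev \<alpha> (hankel (flip_arg um) (hankel up (Q_rev \<alpha> f))) x
            - inverse (B_coeff \<alpha>) *
                tensor \<alpha>
                  (\<lambda>y. 1 / t * Q_rev \<alpha> (hankel (flip_arg um) (\<lambda>_. 1)) y
                       + P_cut \<alpha> (wh_plus t up (\<lambda>_. 1)) y)
                  (\<lambda>y. 1 / t * Q_rev \<alpha> (hankel up (\<lambda>_. 1)) y
                       + P_cut \<alpha> (wh_plus t (flip_arg um) (\<lambda>_. 1)) y)
                  f x) = (LBINT y:{0<..<\<alpha>}. N_kernel \<alpha> x y * f y)"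
            unfolding paper_formula[OF up um refl fc x] c_def .
        qed
        moreover have "case_prod (N_kernel \<alpha>) \<in> borel_measurable (lborel \<Otimes>\<^sub>M lborel)"
          "\<forall>x\<in>{0<..<\<alpha>}. \<forall>y\<in>{0<..<\<alpha>}. cmod (N_kernel \<alpha> x y) \<le> 1 * exp (- (\<eta>'/4) * \<alpha>)"
          using N by (auto simp: bounded_kernel_def)
        ultimately show ?case by blast
      qed
    qed
  qed
qed

end
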